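(* For each of the following simple double theories $\mathbb{T}$, the models of $\mathbb{T}$ in $\mathbb{S}\mathrm{pan}$ are the objects of a double category whose arrows are lax natural transformations, proarrows are modules, and cells are modulations: (1) the theory of categories, the theory of functors, and the theory of transformations; (2) the theory of adjunctions, the theory of monads, and the theory of Frobenius monads.
   Context: Double categories are pseudo: strict in the direction of arrows, weak in the direction of proarrows. A double category $\mathbb{D}$ has underlying categories $\mathbb{D}_0$ (objects and arrows) and $\mathbb{D}_1$ (proarrows, written $m: x \nrightarrow y$, and cells). A cell $\alpha: m \to n$ from $m: x \nrightarrow y$ to $n: w \nrightarrow z$ over $(f,g)$ has source arrow $f: x\to w$ and target arrow $g: y \to z$; it is globular if $f,g$ are identities. Composition in $\mathbb{D}_0,\mathbb{D}_1$ is written $\cdot$ in diagrammatic order; external composition of proarrows and cells is written $\odot$ in diagrammatic order, with external identities $\mathrm{id}_x,\mathrm{id}_f$. Coherence isomorphisms for $\odot$ are suppressed in formulas. $\mathbb{S}\mathrm{pan}$ is the double category of sets, functions, spans, maps of spans. A simple double theory is a small strict double category $\mathbb{T}$; a model in $\mathbb{S}\mathrm{pan}$ is a lax double functor $\mathbb{T}\to\mathbb{S}\mathrm{pan}$. The theories are the strict double categories presented by the following generators and relations (all with only identity proarrows): - categories: the terminal double category; - functors: the walking arrow $\{0\to1\}$ with trivial proarrows and cells; - transformations: objects $x,y$, arrows $f,g:x\to y$, one cell $\mathrm{id}_x\to\mathrm{id}_y$ over $(f,g)$; - adjunctions: objects $x,y$, arrows $f:x\to y$, $g:y\to x$, cells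 $\eta:\mathrm{id}_x\to\mathrm{id}_x$ over $(1_x,f\cdot g)$ and $\varepsilon:\mathrm{id}_y\to\mathrm{id}_y$ over $(g\cdot f,1_y)$, with $(\eta\cdot\mathrm{id}_f)\odot(\mathrm{id}_f\cdot\varepsilon)=\mathrm{id}_f$ and $(\mathrm{id}_g\cdot\eta)\odot(\varepsilon\cdot\mathrm{id}_g)=\mathrm{id}_g$; - monads: an object $x$, an arrow $t:x\to x$, cells $\mu,\eta:\mathrm{id}_x\to\mathrm{id}_x$ over $(t\cdot t,t)$ and $(1_x,t)$, with $(\mu\cdot\mathrm{id}_t)\odot\mu=(\mathrm{id}_t\cdot\mu)\odot\mu$ and $(\eta\cdot\mathrm{id}_t)\odot\mu=\mathrm{id}_t=(\mathrm{id}_t\cdot\eta)\odot\mu$; - Frobenius monads: the theory of monads with further cells $\rho,\varepsilon:\mathrm{id}_x\to\mathrm{id}_x$ over $(1_x,t\cdot t)$ and $(t,1_x)$, with $(\rho\cdot\mathrm{id}_t)\odot(\mathrm{id}_t\cdot\mu)=(\mathrm{id}_t\cdot\rho)\odot(\mu\cdot\mathrm{id}_t)$ and $\rho\odot(\varepsilon\cdot\mathrm{id}_t)=\eta=\rho\odot(\mathrm{id}_t\cdot\varepsilon)$. Lax double functor $F:\mathbb{D}\to\mathbb{E}$: functors $F_0,F_1$ compatible with source and target, with globular laxators $F_{m,n}:Fm\odot Fn\to F(m\odot n)$ and unitors $F_x:\mathrm{id}_{Fx}\to F\mathrm{id}_x$, natural ($(F\alpha\odot F\beta)\cdot F_{m',n'}=F_{m,n}\cdot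 F(\alpha\odot\beta)$, $\mathrm{id}_{Ff}\cdot F_y=F_x\cdot F\mathrm{id}_f$), associative and unital. $F_{x,m}:F\mathrm{id}_x\odot Fm\to Fm$, $F_{m,y}:Fm\odot F\mathrm{id}_y\to Fm$ denote laxators at identity proarrows. Lax natural transformation $\alpha:F\Rightarrow G$ of lax functors $\mathbb{D}\to\mathbb{E}$: arrows $\alpha_x:Fx\to Gx$; cells $\alpha_m:Fm\to Gm$ over $(\alpha_x,\alpha_y)$ for $m:x\nrightarrow y$; for each arrow $f:x\to y$ a cell $\alpha_f:\mathrm{id}_{Fx}\to G\mathrm{id}_y$ over $(\alpha_x\cdot Gf,\ Ff\cdot\alpha_y)$; such that (1) for each cell $\gamma:m\to n$ over $(f,g)$, $m:x\nrightarrow y$, $n:w\nrightarrow z$: $(\alpha_f\odot(F\gamma\cdot\alpha_n))\cdot G_{w,n}=((\alpha_m\cdot G\gamma)\odot\alpha_g)\cdot G_{n,z}$; (2) $F_{m,n}\cdot\alpha_{m\odot n}=(\alpha_m\odot\alpha_n)\cdot G_{m,n}$ and $F_x\cdot\alpha_{\mathrm{id}_x}=\mathrm{id}_{\alpha_x}\cdot G_x$; (3) for $x\xrightarrow{f}y\xrightarrow{g}z$, $\alpha_{f\cdot g}=((\alpha_f\cdot G\mathrm{id}_g)\odot(\mathrm{id}_{Ff}\cdot\alpha_g))\cdot G_{z,z}$ and $\alpha_{1_x}=\mathrm{id}_{\alpha_x}\cdot G_x$. Composition: $(\alpha\beta)_x=\alpha_x\cdot\beta_x$, $(\alpha\beta)_m=\alpha_m\cdot\beta_m$,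 $(\alpha\beta)_f=((\mathrm{id}_{\alpha_x}\cdot\beta_f)\odot(\alpha_f\cdot\beta_{\mathrm{id}_y}))\cdot H_{y,y}$. Module: let $\mathbb{I}$ be the strict double category freely generated by one proarrow $i:0\nrightarrow 1$. A module $M:F\nrightarrow G$ between lax functors $F,G:\mathbb{D}\to\mathbb{E}$ is a lax functor $M:\mathbb{D}\times\mathbb{I}\to\mathbb{E}$ with $M(-,0)=F$, $M(-,1)=G$. Write $Mm=M(m,i):Fx\nrightarrow Gy$, $M\alpha=M(\alpha,1_i)$, $M^\ell_{m,n}:Fm\odot Mn\to M(m\odot n)$, $M^r_{m,n}:Mm\odot Gn\to M(m\odot n)$ for the resulting laxators. Modulation from $M:F\nrightarrow G$ to $N:H\nrightarrow K$ over lax transformations $\alpha:F\Rightarrow H$, $\beta:G\Rightarrow K$: for each $m:x\nrightarrow y$ a cell $\mu_m:Mm\to Nm$ over $(\alpha_x,\beta_y)$ such that $(\mu_m\odot\beta_n)\cdot N^r_{m,n}=M^r_{m,n}\cdot\mu_{m\odot n}$, $(\alpha_m\odot\mu_n)\cdot N^\ell_{m,n}=M^\ell_{m,n}\cdot\mu_{m\odot n}$, and for each cell $\gamma:m\to n$ over $(f,g)$, $m:x\nrightarrow y$, $n:w\nrightarrow z$, $(\alpha_f\odot(M\gamma\cdot\mu_n))\cdot N^\ell_{\mathrm{id}_w,n}=((\mu_m\cdot N\gamma)\odot\beta_g)\cdot N^r_{n,\mathrm{id}_z}$. The double category in question is the one representing the virtual double category whose objects are lax functors $\mathbb{T}\to\mathbb{S}\mathrm{pan}$,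 arrows lax transformations, proarrows modules and multicells multimodulations, where a multimodulation $\mu:(M_1,\dots,M_k)\to N$ over $(\alpha:F_0\Rightarrow G,\beta:F_k\Rightarrow H)$ consists of cells $\mu_{m_1,\dots,m_k}:M_1m_1\odot\cdots\odot M_km_k\to N(m_1\odot\cdots\odot m_k)$ over $(\alpha_{x_0},\beta_{x_k})$ (for $k=0$, cells $\mu_x:\mathrm{id}_{F_0x}\to N\mathrm{id}_x$) satisfying the evident generalizations of the equivariance and naturality axioms for modulations, including inner equivariance $(1\odot(M_i)^r_{m_i,m'}\odot1)\cdot\mu_{\dots,m_i\odot m',m_{i+1},\dots}=(1\odot(M_{i+1})^\ell_{m',m_{i+1}}\odot1)\cdot\mu_{\dots,m_i,m'\odot m_{i+1},\dots}$ and, for $k=0$, $(\mu_x\odot\beta_m)\cdot N^r_{\mathrm{id}_x,m}=(\alpha_m\odot\mu_y)\cdot N^\ell_{m,\mathrm{id}_y}$. *)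

theory Defs
  imports "HOL-Library.FuncSet"
begin

section \<open>Pseudo double categories\<close>

text \<open>
  All compositions are written in diagrammatic order. A cell \<open>c\<close> goes from the proarrow
  \<open>cdom c\<close> to the proarrow \<open>ccod c\<close> and lies over the pair of arrows \<open>(csrc c, ctgt c)\<close>.
  The operations are only meaningful on the carriers \<open>Ob\<close>, \<open>Ar\<close>, \<open>Pr\<close>, \<open>Ce\<close>.
\<close>

record ('o, 'a, 'p, 'c) dbl =
  Ob :: "'o set"
  Ar :: "'a set"
  Pr :: "'p set"
  Ce :: "'c set"
  adom :: "'a \<Rightarrow> 'o"
  acod :: "'a \<Rightarrow> 'o"
  aid :: "'o \<Rightarrow> 'a"
  acomp :: "'a \<Rightarrow> 'a \<Rightarrow> 'a"  (infixl "\<cdot>\<index>" 70)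
  psrc :: "'p \<Rightarrow> 'o"
  ptgt :: "'p \<Rightarrow> 'o"
  cdom :: "'c \<Rightarrow> 'p"
  ccod :: "'c \<Rightarrow> 'p"
  cid :: "'p \<Rightarrow> 'c"
  ccomp :: "'c \<Rightarrow> 'c \<Rightarrow> 'c"  (infixl "\<star>\<index>" 70)
  csrc :: "'c \<Rightarrow> 'a"
  ctgt :: "'c \<Rightarrow> 'a"
  pid :: "'o \<Rightarrow> 'p"
  pcomp :: "'p \<Rightarrow> 'p \<Rightarrow> 'p"  (infixr "\<odot>\<index>" 75)
  idcell :: "'a \<Rightarrow> 'c"
  hcomp :: "'c \<Rightarrow> 'c \<Rightarrow> 'c"  (infixr "\<otimes>\<index>" 75)
  assoc :: "'p \<Rightarrow> 'p \<Rightarrow> 'p \<Rightarrow> 'c"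
  lunit :: "'p \<Rightarrow> 'c"
  runit :: "'p \<Rightarrow> 'c"

definition category ::
  "'o set \<Rightarrow> 'a set \<Rightarrow> ('a \<Rightarrow> 'o) \<Rightarrow> ('a \<Rightarrow> 'o) \<Rightarrow> ('o \<Rightarrow> 'a) \<Rightarrow> ('a \<Rightarrow> 'a \<Rightarrow> 'a) \<Rightarrow> bool" where
  "category X A d c i k \<longleftrightarrow>
     (\<forall>f\<in>A. d f \<in> X \<and> c f \<in> X) \<and>
     (\<forall>x\<in>X. i x \<in> A \<and> d (i x) = x \<and> c (i x) = x) \<and>
     (\<forall>f\<in>A. \<forall>g\<in>A. c f = d g \<longrightarrow> k f g \<in> A \<and> d (k f g) = d f \<and> c (k f g) = c g) \<and>
     (\<forall>f\<in>A. k (i (d f)) f = f \<and> k f (i (c f)) = f) \<and>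
     (\<forall>f\<in>A. \<forall>g\<in>A. \<forall>h\<in>A. c f = d g \<and> c g = d h \<longrightarrow> k (k f g) h = k f (k g h))"

definition in_cell ::
  "('o,'a,'p,'c) dbl \<Rightarrow> 'c \<Rightarrow> 'p \<Rightarrow> 'p \<Rightarrow> 'a \<Rightarrow> 'a \<Rightarrow> bool" where
  "in_cell D c m n f g \<longleftrightarrow>
     c \<in> Ce D \<and> cdom D c = m \<and> ccod D c = n \<and> csrc D c = f \<and> ctgt D c = g"

definition globular :: "('o,'a,'p,'c) dbl \<Rightarrow> 'c \<Rightarrow> 'p \<Rightarrow> 'p \<Rightarrow> bool" where
  "globular D c m n \<longleftrightarrow> in_cell D c m n (aid D (psrc D m)) (aid D (ptgt D m))"

definition cell_inverse :: "('o,'a,'p,'c) dbl \<Rightarrow> 'c \<Rightarrow> 'c \<Rightarrow> bool" where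
  "cell_inverse D c d \<longleftrightarrow>
     d \<in> Ce D \<and> cdom D d = ccod D c \<and> ccod D d = cdom D c \<and>
     c \<star>\<^bsub>D\<^esub> d = cid D (cdom D c) \<and> d \<star>\<^bsub>D\<^esub> c = cid D (ccod D c)"

definition cinv :: "('o,'a,'p,'c) dbl \<Rightarrow> 'c \<Rightarrow> 'c" where
  "cinv D c = (THE d. cell_inverse D c d)"

locale double_category =
  fixes D :: "('o,'a,'p,'c) dbl"  (structure)
  assumes cat0: "category (Ob D) (Ar D) (adom D) (acod D) (aid D) (acomp D)"
    and cat1: "category (Pr D) (Ce D) (cdom D) (ccod D) (cid D) (ccomp D)"
    \<comment> \<open>source and target are functors\<close>
    and psrc_Ob: "m \<in> Pr D \<Longrightarrow> psrc D m \<in> Ob D"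
    and ptgt_Ob: "m \<in> Pr D \<Longrightarrow> ptgt D m \<in> Ob D"
    and csrc_Ar: "c \<in> Ce D \<Longrightarrow> csrc D c \<in> Ar D \<and>
          adom D (csrc D c) = psrc D (cdom D c) \<and> acod D (csrc D c) = psrc D (ccod D c)"
    and ctgt_Ar: "c \<in> Ce D \<Longrightarrow> ctgt D c \<in> Ar D \<and>
          adom D (ctgt D c) = ptgt D (cdom D c) \<and> acod D (ctgt D c) = ptgt D (ccod D c)"
    and cid_bd: "m \<in> Pr D \<Longrightarrow>
          csrc D (cid D m) = aid D (psrc D m) \<and> ctgt D (cid D m) = aid D (ptgt D m)"
    and ccomp_bd: "\<lbrakk>c \<in> Ce D; d \<in> Ce D; ccod D c = cdom D d\<rbrakk> \<Longrightarrow>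
          csrc D (c \<star> d) = csrc D c \<cdot> csrc D d \<and> ctgt D (c \<star> d) = ctgt D c \<cdot> ctgt D d"
    \<comment> \<open>external identities form a functor\<close>
    and pid_Pr: "x \<in> Ob D \<Longrightarrow> pid D x \<in> Pr D \<and> psrc D (pid D x) = x \<and> ptgt D (pid D x) = x"
    and idcell_in: "f \<in> Ar D \<Longrightarrow>
          in_cell D (idcell D f) (pid D (adom D f)) (pid D (acod D f)) f f"
    and idcell_aid: "x \<in> Ob D \<Longrightarrow> idcell D (aid D x) = cid D (pid D x)"
    and idcell_acomp: "\<lbrakk>f \<in> Ar D; g \<in> Ar D; acod D f = adom D g\<rbrakk> \<Longrightarrow>
          idcell D (f \<cdot> g) = idcell D f \<star> idcell D g"
    \<comment> \<open>external composition is a functor\<close>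
    and pcomp_Pr: "\<lbrakk>m \<in> Pr D; n \<in> Pr D; ptgt D m = psrc D n\<rbrakk> \<Longrightarrow>
          m \<odot> n \<in> Pr D \<and> psrc D (m \<odot> n) = psrc D m \<and> ptgt D (m \<odot> n) = ptgt D n"
    and hcomp_in: "\<lbrakk>c \<in> Ce D; d \<in> Ce D; ctgt D c = csrc D d\<rbrakk> \<Longrightarrow>
          in_cell D (c \<otimes> d) (cdom D c \<odot> cdom D d) (ccod D c \<odot> ccod D d) (csrc D c) (ctgt D d)"
    and hcomp_cid: "\<lbrakk>m \<in> Pr D; n \<in> Pr D; ptgt D m = psrc D n\<rbrakk> \<Longrightarrow>
          cid D m \<otimes> cid D n = cid D (m \<odot> n)"
    and interchange: "\<lbrakk>c \<in> Ce D; d \<in> Ce D; c' \<in> Ce D; d' \<in> Ce D;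
          ctgt D c = csrc D d; ctgt D c' = csrc D d'; ccod D c = cdom D c'; ccod D d = cdom D d'\<rbrakk> \<Longrightarrow>
          (c \<otimes> d) \<star> (c' \<otimes> d') = (c \<star> c') \<otimes> (d \<star> d')"
    \<comment> \<open>coherence isomorphisms\<close>
    and assoc_glob: "\<lbrakk>m \<in> Pr D; n \<in> Pr D; p \<in> Pr D; ptgt D m = psrc D n; ptgt D n = psrc D p\<rbrakk> \<Longrightarrow>
          globular D (assoc D m n p) ((m \<odot> n) \<odot> p) (m \<odot> n \<odot> p) \<and>
          (\<exists>d. cell_inverse D (assoc D m n p) d)"
    and lunit_glob: "m \<in> Pr D \<Longrightarrow>
          globular D (lunit D m) (pid D (psrc D m) \<odot> m) m \<and> (\<exists>d. cell_inverse D (lunit D m) d)"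
    and runit_glob: "m \<in> Pr D \<Longrightarrow>
          globular D (runit D m) (m \<odot> pid D (ptgt D m)) m \<and> (\<exists>d. cell_inverse D (runit D m) d)"
    and assoc_nat: "\<lbrakk>c \<in> Ce D; d \<in> Ce D; e \<in> Ce D; ctgt D c = csrc D d; ctgt D d = csrc D e\<rbrakk> \<Longrightarrow>
          ((c \<otimes> d) \<otimes> e) \<star> assoc D (ccod D c) (ccod D d) (ccod D e)
            = assoc D (cdom D c) (cdom D d) (cdom D e) \<star> (c \<otimes> d \<otimes> e)"
    and lunit_nat: "c \<in> Ce D \<Longrightarrow>
          (idcell D (csrc D c) \<otimes> c) \<star> lunit D (ccod D c) = lunit D (cdom D c) \<star> c"
    and runit_nat: "c \<in> Ce D \<Longrightarrow>
          (c \<otimes> idcell D (ctgt D c)) \<star> runit D (ccod D c) = runit D (cdom D c) \<star> c"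
    and pentagon: "\<lbrakk>m \<in> Pr D; n \<in> Pr D; p \<in> Pr D; q \<in> Pr D;
          ptgt D m = psrc D n; ptgt D n = psrc D p; ptgt D p = psrc D q\<rbrakk> \<Longrightarrow>
          (assoc D m n p \<otimes> cid D q) \<star> assoc D m (n \<odot> p) q \<star> (cid D m \<otimes> assoc D n p q)
            = assoc D (m \<odot> n) p q \<star> assoc D m n (p \<odot> q)"
    and triangle: "\<lbrakk>m \<in> Pr D; n \<in> Pr D; ptgt D m = psrc D n\<rbrakk> \<Longrightarrow>
          assoc D m (pid D (ptgt D m)) n \<star> (cid D m \<otimes> lunit D n) = runit D m \<otimes> cid D n"

definition prod_dbl ::
  "('o,'a,'p,'c) dbl \<Rightarrow> ('o2,'a2,'p2,'c2) dbl \<Rightarrow> ('o \<times> 'o2, 'a \<times> 'a2, 'p \<times> 'p2, 'c \<times> 'c2) dbl" where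
  "prod_dbl D E = \<lparr>
     Ob = Ob D \<times> Ob E, Ar = Ar D \<times> Ar E, Pr = Pr D \<times> Pr E, Ce = Ce D \<times> Ce E,
     adom = map_prod (adom D) (adom E), acod = map_prod (acod D) (acod E),
     aid = map_prod (aid D) (aid E),
     acomp = (\<lambda>(f, f') (g, g'). (f \<cdot>\<^bsub>D\<^esub> g, f' \<cdot>\<^bsub>E\<^esub> g')),
     psrc = map_prod (psrc D) (psrc E), ptgt = map_prod (ptgt D) (ptgt E),
     cdom = map_prod (cdom D) (cdom E), ccod = map_prod (ccod D) (ccod E),
     cid = map_prod (cid D) (cid E),
     ccomp = (\<lambda>(c, c') (d, d'). (c \<star>\<^bsub>D\<^esub> d, c' \<star>\<^bsub>E\<^esub> d')),
     csrc = map_prod (csrc D) (csrc E), ctgt = map_prod (ctgt D) (ctgt E),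
     pid = map_prod (pid D) (pid E),
     pcomp = (\<lambda>(m, m') (n, n'). (m \<odot>\<^bsub>D\<^esub> n, m' \<odot>\<^bsub>E\<^esub> n')),
     idcell = map_prod (idcell D) (idcell E),
     hcomp = (\<lambda>(c, c') (d, d'). (c \<otimes>\<^bsub>D\<^esub> d, c' \<otimes>\<^bsub>E\<^esub> d')),
     assoc = (\<lambda>(m, m') (n, n') (p, p'). (assoc D m n p, assoc E m' n' p')),
     lunit = map_prod (lunit D) (lunit E), runit = map_prod (runit D) (runit E) \<rparr>"

text \<open>
  The walking proarrow, freely generated by \<open>i = (False, True)\<close> from \<open>False\<close> to \<open>True\<close>.
  Its arrows are the identities, named by their object; its proarrows are the pairs
  \<open>(a, b)\<close> with \<open>a \<le> b\<close>, the diagonal ones being the identity proarrows; its cells are the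
  identities on proarrows.
\<close>

definition walking_proarrow :: "(bool, bool, bool \<times> bool, bool \<times> bool) dbl" where
  "walking_proarrow = \<lparr>
     Ob = UNIV, Ar = UNIV, Pr = {(a, b). a \<le> b}, Ce = {(a, b). a \<le> b},
     adom = (\<lambda>f. f), acod = (\<lambda>f. f), aid = (\<lambda>x. x), acomp = (\<lambda>f g. f),
     psrc = fst, ptgt = snd,
     cdom = (\<lambda>c. c), ccod = (\<lambda>c. c), cid = (\<lambda>m. m), ccomp = (\<lambda>c d. c),
     csrc = fst, ctgt = snd,
     pid = (\<lambda>x. (x, x)), pcomp = (\<lambda>m n. (fst m, snd n)),
     idcell = (\<lambda>f. (f, f)), hcomp = (\<lambda>c d. (fst c, snd d)),
     assoc = (\<lambda>m n p. (fst m, snd p)), lunit = (\<lambda>m. m), runit = (\<lambda>m. m) \<rparr>"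


section \<open>The double category of spans\<close>

text \<open>
  Sets are the \<open>small\<close> subsets of a type \<open>'u\<close>; an injection \<open>pair\<close> encodes ordered pairs, so
  that pullbacks can be chosen. The closure conditions hold for any universe of sets, and also
  for the collection of all subsets of any infinite type.
\<close>

definition set_universe :: "('u set \<Rightarrow> bool) \<Rightarrow> ('u \<Rightarrow> 'u \<Rightarrow> 'u) \<Rightarrow> bool" where
  "set_universe small pair \<longleftrightarrow>
     (\<forall>a b a' b'. pair a b = pair a' b' \<longrightarrow> a = a' \<and> b = b') \<and>
     (\<forall>A B. small A \<and> B \<subseteq> A \<longrightarrow> small B) \<and>
     (\<forall>A (f :: 'u \<Rightarrow> 'u). small A \<longrightarrow> small (f ` A)) \<and>
     (\<forall>A B. small A \<and> small B \<longrightarrow> small {pair a b | a b. a \<in> A \<and> b \<in> B})"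

definition unpair :: "('u \<Rightarrow> 'u \<Rightarrow> 'u) \<Rightarrow> 'u \<Rightarrow> 'u \<times> 'u" where
  "unpair pair z = (THE (a, b). z = pair a b)"

record 'u func =
  func_dom :: "'u set"
  func_cod :: "'u set"
  func_map :: "'u \<Rightarrow> 'u"

record 'u span =
  apex :: "'u set"
  lfoot :: "'u set"
  rfoot :: "'u set"
  lleg :: "'u \<Rightarrow> 'u"
  rleg :: "'u \<Rightarrow> 'u"

record 'u span_map =
  sm_dom :: "'u span"
  sm_cod :: "'u span"
  sm_left :: "'u func"
  sm_right :: "'u func"
  sm_map :: "'u \<Rightarrow> 'u"

definition funcs :: "('u set \<Rightarrow> bool) \<Rightarrow> 'u func set" where
  "funcs small = {f. small (func_dom f) \<and> small (func_cod f) \<and>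
     func_map f \<in> func_dom f \<rightarrow>\<^sub>E func_cod f}"

definition func_id :: "'u set \<Rightarrow> 'u func" where
  "func_id A = \<lparr>func_dom = A, func_cod = A, func_map = restrict (\<lambda>a. a) A\<rparr>"

definition func_comp :: "'u func \<Rightarrow> 'u func \<Rightarrow> 'u func" where
  "func_comp f g = \<lparr>func_dom = func_dom f, func_cod = func_cod g,
     func_map = restrict (\<lambda>a. func_map g (func_map f a)) (func_dom f)\<rparr>"

definition spans :: "('u set \<Rightarrow> bool) \<Rightarrow> 'u span set" where
  "spans small = {m. small (apex m) \<and> small (lfoot m) \<and> small (rfoot m) \<and>
     lleg m \<in> apex m \<rightarrow>\<^sub>E lfoot m \<and> rleg m \<in> apex m \<rightarrow>\<^sub>E rfoot m}"

definition span_id :: "'u set \<Rightarrow> 'u span" where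
  "span_id A = \<lparr>apex = A, lfoot = A, rfoot = A,
     lleg = restrict (\<lambda>a. a) A, rleg = restrict (\<lambda>a. a) A\<rparr>"

definition pullback :: "('u \<Rightarrow> 'u \<Rightarrow> 'u) \<Rightarrow> 'u span \<Rightarrow> 'u span \<Rightarrow> 'u set" where
  "pullback pair m n = {pair a b | a b. a \<in> apex m \<and> b \<in> apex n \<and> rleg m a = lleg n b}"

definition span_comp :: "('u \<Rightarrow> 'u \<Rightarrow> 'u) \<Rightarrow> 'u span \<Rightarrow> 'u span \<Rightarrow> 'u span" where
  "span_comp pair m n = \<lparr>apex = pullback pair m n, lfoot = lfoot m, rfoot = rfoot n,
     lleg = restrict (\<lambda>z. lleg m (fst (unpair pair z))) (pullback pair m n),
     rleg = restrict (\<lambda>z. rleg n (snd (unpair pair z))) (pullback pair m n)\<rparr>"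

definition span_maps :: "('u set \<Rightarrow> bool) \<Rightarrow> 'u span_map set" where
  "span_maps small = {c. sm_dom c \<in> spans small \<and> sm_cod c \<in> spans small \<and>
     sm_left c \<in> funcs small \<and> sm_right c \<in> funcs small \<and>
     func_dom (sm_left c) = lfoot (sm_dom c) \<and> func_cod (sm_left c) = lfoot (sm_cod c) \<and>
     func_dom (sm_right c) = rfoot (sm_dom c) \<and> func_cod (sm_right c) = rfoot (sm_cod c) \<and>
     sm_map c \<in> apex (sm_dom c) \<rightarrow>\<^sub>E apex (sm_cod c) \<and>
     (\<forall>a\<in>apex (sm_dom c).
        lleg (sm_cod c) (sm_map c a) = func_map (sm_left c) (lleg (sm_dom c) a) \<and>
        rleg (sm_cod c) (sm_map c a) = func_map (sm_right c) (rleg (sm_dom c) a))}"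

text \<open>Globular maps of spans, used for the identities and the coherence isomorphisms.\<close>

definition span_glob :: "'u span \<Rightarrow> 'u span \<Rightarrow> ('u \<Rightarrow> 'u) \<Rightarrow> 'u span_map" where
  "span_glob m n h = \<lparr>sm_dom = m, sm_cod = n, sm_left = func_id (lfoot m),
     sm_right = func_id (rfoot m), sm_map = restrict h (apex m)\<rparr>"

definition Span :: "('u set \<Rightarrow> bool) \<Rightarrow> ('u \<Rightarrow> 'u \<Rightarrow> 'u) \<Rightarrow>
    ('u set, 'u func, 'u span, 'u span_map) dbl" where
  "Span small pair = \<lparr>
     Ob = {A. small A}, Ar = funcs small, Pr = spans small, Ce = span_maps small,
     adom = func_dom, acod = func_cod, aid = func_id, acomp = func_comp,
     psrc = lfoot, ptgt = rfoot,
     cdom = sm_dom, ccod = sm_cod, cid = (\<lambda>m. span_glob m m (\<lambda>a. a)),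
     ccomp = (\<lambda>c d. \<lparr>sm_dom = sm_dom c, sm_cod = sm_cod d,
        sm_left = func_comp (sm_left c) (sm_left d),
        sm_right = func_comp (sm_right c) (sm_right d),
        sm_map = restrict (\<lambda>a. sm_map d (sm_map c a)) (apex (sm_dom c))\<rparr>),
     csrc = sm_left, ctgt = sm_right,
     pid = span_id, pcomp = span_comp pair,
     idcell = (\<lambda>f. \<lparr>sm_dom = span_id (func_dom f), sm_cod = span_id (func_cod f),
        sm_left = f, sm_right = f, sm_map = func_map f\<rparr>),
     hcomp = (\<lambda>c d. \<lparr>sm_dom = span_comp pair (sm_dom c) (sm_dom d),
        sm_cod = span_comp pair (sm_cod c) (sm_cod d),
        sm_left = sm_left c, sm_right = sm_right d,
        sm_map = restrict
          (\<lambda>z. let (a, b) = unpair pair z in pair (sm_map c a) (sm_map d b))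
          (pullback pair (sm_dom c) (sm_dom d))\<rparr>),
     assoc = (\<lambda>m n p. span_glob (span_comp pair (span_comp pair m n) p)
        (span_comp pair m (span_comp pair n p))
        (\<lambda>z. let (y, c) = unpair pair z; (a, b) = unpair pair y in pair a (pair b c))),
     lunit = (\<lambda>m. span_glob (span_comp pair (span_id (lfoot m)) m) m (\<lambda>z. snd (unpair pair z))),
     runit = (\<lambda>m. span_glob (span_comp pair m (span_id (rfoot m))) m (\<lambda>z. fst (unpair pair z))) \<rparr>"


section \<open>Lax functors, lax transformations, modules, modulations\<close>

text \<open>
  Throughout, the domain \<open>D\<close> of a lax functor is a strict double category, so that no
  coherence isomorphism of \<open>D\<close> is inserted; those of the codomain \<open>E\<close> are. Families of data are
  \<open>undefined\<close> outside of their index sets, so that equality of lax functors and transformations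
  is equality in HOL.
\<close>

record ('o,'a,'p,'c,'o2,'a2,'p2,'c2) lax =
  fOb :: "'o \<Rightarrow> 'o2"
  fAr :: "'a \<Rightarrow> 'a2"
  fPr :: "'p \<Rightarrow> 'p2"
  fCe :: "'c \<Rightarrow> 'c2"
  laxator :: "'p \<Rightarrow> 'p \<Rightarrow> 'c2"
  unitor :: "'o \<Rightarrow> 'c2"

definition lax_functor ::
  "('o,'a,'p,'c) dbl \<Rightarrow> ('o2,'a2,'p2,'c2) dbl \<Rightarrow> ('o,'a,'p,'c,'o2,'a2,'p2,'c2) lax \<Rightarrow> bool" where
  "lax_functor D E F \<longleftrightarrow>
     fOb F \<in> Ob D \<rightarrow>\<^sub>E Ob E \<and> fAr F \<in> Ar D \<rightarrow>\<^sub>E Ar E \<and>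
     fPr F \<in> Pr D \<rightarrow>\<^sub>E Pr E \<and> fCe F \<in> Ce D \<rightarrow>\<^sub>E Ce E \<and>
     (\<forall>f\<in>Ar D. adom E (fAr F f) = fOb F (adom D f) \<and> acod E (fAr F f) = fOb F (acod D f)) \<and>
     (\<forall>x\<in>Ob D. fAr F (aid D x) = aid E (fOb F x)) \<and>
     (\<forall>f\<in>Ar D. \<forall>g\<in>Ar D. acod D f = adom D g \<longrightarrow>
        fAr F (f \<cdot>\<^bsub>D\<^esub> g) = fAr F f \<cdot>\<^bsub>E\<^esub> fAr F g) \<and>
     (\<forall>m\<in>Pr D. psrc E (fPr F m) = fOb F (psrc D m) \<and> ptgt E (fPr F m) = fOb F (ptgt D m)) \<and>
     (\<forall>c\<in>Ce D. in_cell E (fCe F c) (fPr F (cdom D c)) (fPr F (ccod D c))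
        (fAr F (csrc D c)) (fAr F (ctgt D c))) \<and>
     (\<forall>m\<in>Pr D. fCe F (cid D m) = cid E (fPr F m)) \<and>
     (\<forall>c\<in>Ce D. \<forall>d\<in>Ce D. ccod D c = cdom D d \<longrightarrow>
        fCe F (c \<star>\<^bsub>D\<^esub> d) = fCe F c \<star>\<^bsub>E\<^esub> fCe F d) \<and>
     (\<forall>m n. if m \<in> Pr D \<and> n \<in> Pr D \<and> ptgt D m = psrc D n
        then globular E (laxator F m n) (fPr F m \<odot>\<^bsub>E\<^esub> fPr F n) (fPr F (m \<odot>\<^bsub>D\<^esub> n))
        else laxator F m n = undefined) \<and>
     (\<forall>x. if x \<in> Ob D
        then globular E (unitor F x) (pid E (fOb F x)) (fPr F (pid D x))
        else unitor F x = undefined) \<and>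
     (\<forall>c\<in>Ce D. \<forall>d\<in>Ce D. ctgt D c = csrc D d \<longrightarrow>
        (fCe F c \<otimes>\<^bsub>E\<^esub> fCe F d) \<star>\<^bsub>E\<^esub> laxator F (ccod D c) (ccod D d)
          = laxator F (cdom D c) (cdom D d) \<star>\<^bsub>E\<^esub> fCe F (c \<otimes>\<^bsub>D\<^esub> d)) \<and>
     (\<forall>f\<in>Ar D. idcell E (fAr F f) \<star>\<^bsub>E\<^esub> unitor F (acod D f)
        = unitor F (adom D f) \<star>\<^bsub>E\<^esub> fCe F (idcell D f)) \<and>
     (\<forall>m\<in>Pr D. \<forall>n\<in>Pr D. \<forall>p\<in>Pr D. ptgt D m = psrc D n \<and> ptgt D n = psrc D p \<longrightarrow>
        (laxator F m n \<otimes>\<^bsub>E\<^esub> cid E (fPr F p)) \<star>\<^bsub>E\<^esub> laxator F (m \<odot>\<^bsub>D\<^esub> n) p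
          = assoc E (fPr F m) (fPr F n) (fPr F p) \<star>\<^bsub>E\<^esub>
            (cid E (fPr F m) \<otimes>\<^bsub>E\<^esub> laxator F n p) \<star>\<^bsub>E\<^esub> laxator F m (n \<odot>\<^bsub>D\<^esub> p)) \<and>
     (\<forall>m\<in>Pr D.
        (unitor F (psrc D m) \<otimes>\<^bsub>E\<^esub> cid E (fPr F m)) \<star>\<^bsub>E\<^esub> laxator F (pid D (psrc D m)) m
          = lunit E (fPr F m) \<and>
        (cid E (fPr F m) \<otimes>\<^bsub>E\<^esub> unitor F (ptgt D m)) \<star>\<^bsub>E\<^esub> laxator F m (pid D (ptgt D m))
          = runit E (fPr F m))"

record ('o,'a,'p,'c,'o2,'a2,'p2,'c2) trans =
  tdom :: "('o,'a,'p,'c,'o2,'a2,'p2,'c2) lax"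
  tcod :: "('o,'a,'p,'c,'o2,'a2,'p2,'c2) lax"
  tOb :: "'o \<Rightarrow> 'a2"
  tPr :: "'p \<Rightarrow> 'c2"
  tAr :: "'a \<Rightarrow> 'c2"

text \<open>
  In the naturality axiom for a cell \<open>c\<close>, both sides are precomposed with an inverse unitor of
  \<open>E\<close>, to make them cells out of \<open>fPr F (cdom D c)\<close>.
\<close>

definition lax_trans ::
  "('o,'a,'p,'c) dbl \<Rightarrow> ('o2,'a2,'p2,'c2) dbl \<Rightarrow> ('o,'a,'p,'c,'o2,'a2,'p2,'c2) trans \<Rightarrow> bool" where
  "lax_trans D E \<alpha> \<longleftrightarrow> (let F = tdom \<alpha>; G = tcod \<alpha> in
     lax_functor D E F \<and> lax_functor D E G \<and>
     tOb \<alpha> \<in> Ob D \<rightarrow>\<^sub>E Ar E \<and> tPr \<alpha> \<in> Pr D \<rightarrow>\<^sub>E Ce E \<and> tAr \<alpha> \<in> Ar D \<rightarrow>\<^sub>E Ce E \<and>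
     (\<forall>x\<in>Ob D. adom E (tOb \<alpha> x) = fOb F x \<and> acod E (tOb \<alpha> x) = fOb G x) \<and>
     (\<forall>m\<in>Pr D. in_cell E (tPr \<alpha> m) (fPr F m) (fPr G m)
        (tOb \<alpha> (psrc D m)) (tOb \<alpha> (ptgt D m))) \<and>
     (\<forall>f\<in>Ar D. in_cell E (tAr \<alpha> f) (pid E (fOb F (adom D f))) (fPr G (pid D (acod D f)))
        (tOb \<alpha> (adom D f) \<cdot>\<^bsub>E\<^esub> fAr G f) (fAr F f \<cdot>\<^bsub>E\<^esub> tOb \<alpha> (acod D f))) \<and>
     (\<forall>c\<in>Ce D. let m = cdom D c; n = ccod D c; f = csrc D c; g = ctgt D c in
        cinv E (lunit E (fPr F m)) \<star>\<^bsub>E\<^esub>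
            (tAr \<alpha> f \<otimes>\<^bsub>E\<^esub> (fCe F c \<star>\<^bsub>E\<^esub> tPr \<alpha> n)) \<star>\<^bsub>E\<^esub> laxator G (pid D (psrc D n)) n
          = cinv E (runit E (fPr F m)) \<star>\<^bsub>E\<^esub>
            ((tPr \<alpha> m \<star>\<^bsub>E\<^esub> fCe G c) \<otimes>\<^bsub>E\<^esub> tAr \<alpha> g) \<star>\<^bsub>E\<^esub> laxator G n (pid D (ptgt D n))) \<and>
     (\<forall>m\<in>Pr D. \<forall>n\<in>Pr D. ptgt D m = psrc D n \<longrightarrow>
        laxator F m n \<star>\<^bsub>E\<^esub> tPr \<alpha> (m \<odot>\<^bsub>D\<^esub> n)
          = (tPr \<alpha> m \<otimes>\<^bsub>E\<^esub> tPr \<alpha> n) \<star>\<^bsub>E\<^esub> laxator G m n) \<and>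
     (\<forall>x\<in>Ob D. unitor F x \<star>\<^bsub>E\<^esub> tPr \<alpha> (pid D x) = idcell E (tOb \<alpha> x) \<star>\<^bsub>E\<^esub> unitor G x) \<and>
     (\<forall>f\<in>Ar D. \<forall>g\<in>Ar D. acod D f = adom D g \<longrightarrow>
        tAr \<alpha> (f \<cdot>\<^bsub>D\<^esub> g)
          = cinv E (lunit E (pid E (fOb F (adom D f)))) \<star>\<^bsub>E\<^esub>
            ((tAr \<alpha> f \<star>\<^bsub>E\<^esub> fCe G (idcell D g)) \<otimes>\<^bsub>E\<^esub> (idcell E (fAr F f) \<star>\<^bsub>E\<^esub> tAr \<alpha> g)) \<star>\<^bsub>E\<^esub>
            laxator G (pid D (acod D g)) (pid D (acod D g))) \<and>
     (\<forall>x\<in>Ob D. tAr \<alpha> (aid D x) = idcell E (tOb \<alpha> x) \<star>\<^bsub>E\<^esub> unitor G x))"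

definition trans_id ::
  "('o,'a,'p,'c) dbl \<Rightarrow> ('o2,'a2,'p2,'c2) dbl \<Rightarrow> ('o,'a,'p,'c,'o2,'a2,'p2,'c2) lax \<Rightarrow>
   ('o,'a,'p,'c,'o2,'a2,'p2,'c2) trans" where
  "trans_id D E F = \<lparr>tdom = F, tcod = F,
     tOb = restrict (\<lambda>x. aid E (fOb F x)) (Ob D),
     tPr = restrict (\<lambda>m. cid E (fPr F m)) (Pr D),
     tAr = restrict (\<lambda>f. unitor F (adom D f) \<star>\<^bsub>E\<^esub> fCe F (idcell D f)) (Ar D)\<rparr>"

definition trans_comp ::
  "('o,'a,'p,'c) dbl \<Rightarrow> ('o2,'a2,'p2,'c2) dbl \<Rightarrow> ('o,'a,'p,'c,'o2,'a2,'p2,'c2) trans \<Rightarrow>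
   ('o,'a,'p,'c,'o2,'a2,'p2,'c2) trans \<Rightarrow> ('o,'a,'p,'c,'o2,'a2,'p2,'c2) trans" where
  "trans_comp D E \<alpha> \<beta> = \<lparr>tdom = tdom \<alpha>, tcod = tcod \<beta>,
     tOb = restrict (\<lambda>x. tOb \<alpha> x \<cdot>\<^bsub>E\<^esub> tOb \<beta> x) (Ob D),
     tPr = restrict (\<lambda>m. tPr \<alpha> m \<star>\<^bsub>E\<^esub> tPr \<beta> m) (Pr D),
     tAr = restrict (\<lambda>f. let x = adom D f; y = acod D f in
       cinv E (lunit E (pid E (fOb (tdom \<alpha>) x))) \<star>\<^bsub>E\<^esub>
       ((idcell E (tOb \<alpha> x) \<star>\<^bsub>E\<^esub> tAr \<beta> f) \<otimes>\<^bsub>E\<^esub> (tAr \<alpha> f \<star>\<^bsub>E\<^esub> tPr \<beta> (pid D y))) \<star>\<^bsub>E\<^esub>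
       laxator (tcod \<beta>) (pid D y) (pid D y)) (Ar D)\<rparr>"

type_synonym ('o,'a,'p,'c,'o2,'a2,'p2,'c2) module =
  "('o \<times> bool, 'a \<times> bool, 'p \<times> bool \<times> bool, 'c \<times> bool \<times> bool, 'o2, 'a2, 'p2, 'c2) lax"

abbreviation is_module ::
  "('o,'a,'p,'c) dbl \<Rightarrow> ('o2,'a2,'p2,'c2) dbl \<Rightarrow> ('o,'a,'p,'c,'o2,'a2,'p2,'c2) module \<Rightarrow> bool" where
  "is_module D E M \<equiv> lax_functor (prod_dbl D walking_proarrow) E M"

text \<open>The lax functors \<open>M(-, 0)\<close> (for \<open>b = False\<close>) and \<open>M(-, 1)\<close> (for \<open>b = True\<close>).\<close>

definition mod_end ::
  "('o,'a,'p,'c) dbl \<Rightarrow> bool \<Rightarrow> ('o,'a,'p,'c,'o2,'a2,'p2,'c2) module \<Rightarrow>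
   ('o,'a,'p,'c,'o2,'a2,'p2,'c2) lax" where
  "mod_end D b M = \<lparr>
     fOb = restrict (\<lambda>x. fOb M (x, b)) (Ob D),
     fAr = restrict (\<lambda>f. fAr M (f, b)) (Ar D),
     fPr = restrict (\<lambda>m. fPr M (m, b, b)) (Pr D),
     fCe = restrict (\<lambda>c. fCe M (c, b, b)) (Ce D),
     laxator = (\<lambda>m n. if m \<in> Pr D \<and> n \<in> Pr D \<and> ptgt D m = psrc D n
       then laxator M (m, b, b) (n, b, b) else undefined),
     unitor = restrict (\<lambda>x. unitor M (x, b)) (Ob D)\<rparr>"

abbreviation mod_src where "mod_src D \<equiv> mod_end D False"
abbreviation mod_tgt where "mod_tgt D \<equiv> mod_end D True"

definition mod_Pr :: "('o,'a,'p,'c,'o2,'a2,'p2,'c2) module \<Rightarrow> 'p \<Rightarrow> 'p2" where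
  "mod_Pr M m = fPr M (m, False, True)"

definition mod_Ce :: "('o,'a,'p,'c,'o2,'a2,'p2,'c2) module \<Rightarrow> 'c \<Rightarrow> 'c2" where
  "mod_Ce M c = fCe M (c, False, True)"

definition act_l :: "('o,'a,'p,'c,'o2,'a2,'p2,'c2) module \<Rightarrow> 'p \<Rightarrow> 'p \<Rightarrow> 'c2" where
  "act_l M m n = laxator M (m, False, False) (n, False, True)"

definition act_r :: "('o,'a,'p,'c,'o2,'a2,'p2,'c2) module \<Rightarrow> 'p \<Rightarrow> 'p \<Rightarrow> 'c2" where
  "act_r M m n = laxator M (m, False, True) (n, True, True)"

record ('o,'a,'p,'c,'o2,'a2,'p2,'c2) modn =
  odom :: "('o,'a,'p,'c,'o2,'a2,'p2,'c2) module"
  ocod :: "('o,'a,'p,'c,'o2,'a2,'p2,'c2) module"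
  oleft :: "('o,'a,'p,'c,'o2,'a2,'p2,'c2) trans"
  oright :: "('o,'a,'p,'c,'o2,'a2,'p2,'c2) trans"
  ocell :: "'p \<Rightarrow> 'c2"

definition modulation ::
  "('o,'a,'p,'c) dbl \<Rightarrow> ('o2,'a2,'p2,'c2) dbl \<Rightarrow> ('o,'a,'p,'c,'o2,'a2,'p2,'c2) modn \<Rightarrow> bool" where
  "modulation D E \<mu> \<longleftrightarrow>
    (let M = odom \<mu>; N = ocod \<mu>; \<alpha> = oleft \<mu>; \<beta> = oright \<mu>; u = ocell \<mu> in
     is_module D E M \<and> is_module D E N \<and> lax_trans D E \<alpha> \<and> lax_trans D E \<beta> \<and>
     tdom \<alpha> = mod_src D M \<and> tcod \<alpha> = mod_src D N \<and>
     tdom \<beta> = mod_tgt D M \<and> tcod \<beta> = mod_tgt D N \<and>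
     u \<in> extensional (Pr D) \<and>
     (\<forall>m\<in>Pr D. in_cell E (u m) (mod_Pr M m) (mod_Pr N m)
        (tOb \<alpha> (psrc D m)) (tOb \<beta> (ptgt D m))) \<and>
     (\<forall>m\<in>Pr D. \<forall>n\<in>Pr D. ptgt D m = psrc D n \<longrightarrow>
        (u m \<otimes>\<^bsub>E\<^esub> tPr \<beta> n) \<star>\<^bsub>E\<^esub> act_r N m n = act_r M m n \<star>\<^bsub>E\<^esub> u (m \<odot>\<^bsub>D\<^esub> n) \<and>
        (tPr \<alpha> m \<otimes>\<^bsub>E\<^esub> u n) \<star>\<^bsub>E\<^esub> act_l N m n = act_l M m n \<star>\<^bsub>E\<^esub> u (m \<odot>\<^bsub>D\<^esub> n)) \<and>
     (\<forall>c\<in>Ce D. let m = cdom D c; n = ccod D c; f = csrc D c; g = ctgt D c in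
        cinv E (lunit E (mod_Pr M m)) \<star>\<^bsub>E\<^esub>
            (tAr \<alpha> f \<otimes>\<^bsub>E\<^esub> (mod_Ce M c \<star>\<^bsub>E\<^esub> u n)) \<star>\<^bsub>E\<^esub> act_l N (pid D (psrc D n)) n
          = cinv E (runit E (mod_Pr M m)) \<star>\<^bsub>E\<^esub>
            ((u m \<star>\<^bsub>E\<^esub> mod_Ce N c) \<otimes>\<^bsub>E\<^esub> tAr \<beta> g) \<star>\<^bsub>E\<^esub> act_r N n (pid D (ptgt D n))))"


section \<open>Multimodulations\<close>

text \<open>
  Iterated external composites, bracketed to the right. The extra object or arrow argument is
  the starting point of the path and only matters when the path is empty.
\<close>

fun is_path :: "('o,'a,'p,'c) dbl \<Rightarrow> 'o \<Rightarrow> 'p list \<Rightarrow> bool" where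
  "is_path D x [] \<longleftrightarrow> x \<in> Ob D"
| "is_path D x (m # ms) \<longleftrightarrow> m \<in> Pr D \<and> psrc D m = x \<and> is_path D (ptgt D m) ms"

fun path_end :: "('o,'a,'p,'c) dbl \<Rightarrow> 'o \<Rightarrow> 'p list \<Rightarrow> 'o" where
  "path_end D x [] = x"
| "path_end D x (m # ms) = path_end D (ptgt D m) ms"

fun pcomps :: "('o,'a,'p,'c) dbl \<Rightarrow> 'o \<Rightarrow> 'p list \<Rightarrow> 'p" where
  "pcomps D x [] = pid D x"
| "pcomps D x [m] = m"
| "pcomps D x (m # n # ns) = m \<odot>\<^bsub>D\<^esub> pcomps D (ptgt D m) (n # ns)"

fun is_cpath :: "('o,'a,'p,'c) dbl \<Rightarrow> 'a \<Rightarrow> 'c list \<Rightarrow> bool" where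
  "is_cpath D f [] \<longleftrightarrow> f \<in> Ar D"
| "is_cpath D f (c # cs) \<longleftrightarrow> c \<in> Ce D \<and> csrc D c = f \<and> is_cpath D (ctgt D c) cs"

fun cpath_end :: "('o,'a,'p,'c) dbl \<Rightarrow> 'a \<Rightarrow> 'c list \<Rightarrow> 'a" where
  "cpath_end D f [] = f"
| "cpath_end D f (c # cs) = cpath_end D (ctgt D c) cs"

fun hcomps :: "('o,'a,'p,'c) dbl \<Rightarrow> 'a \<Rightarrow> 'c list \<Rightarrow> 'c" where
  "hcomps D f [] = idcell D f"
| "hcomps D f [c] = c"
| "hcomps D f (c # d # ds) = c \<otimes>\<^bsub>D\<^esub> hcomps D (ctgt D c) (d # ds)"

text \<open>
  Coherence isomorphisms: \<open>join\<close> goes from the composite of the composites of two paths to the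
  composite of their concatenation, and \<open>flatten\<close> does the same for a list of paths.
\<close>

fun join :: "('o,'a,'p,'c) dbl \<Rightarrow> 'o \<Rightarrow> 'p list \<Rightarrow> 'p list \<Rightarrow> 'c" where
  "join D x [] ns = lunit D (pcomps D x ns)"
| "join D x [m] [] = runit D m"
| "join D x [m] (n # ns) = cid D (m \<odot>\<^bsub>D\<^esub> pcomps D (ptgt D m) (n # ns))"
| "join D x (m # m' # ms) ns =
     assoc D m (pcomps D (ptgt D m) (m' # ms))
       (pcomps D (path_end D (ptgt D m) (m' # ms)) ns) \<star>\<^bsub>D\<^esub>
     (cid D m \<otimes>\<^bsub>D\<^esub> join D (ptgt D m) (m' # ms) ns)"

fun flatten :: "('o,'a,'p,'c) dbl \<Rightarrow> 'o \<Rightarrow> 'p list list \<Rightarrow> 'c" where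
  "flatten D x [] = cid D (pid D x)"
| "flatten D x [ms] = cid D (pcomps D x ms)"
| "flatten D x (ms # ns # nss) =
     (cid D (pcomps D x ms) \<otimes>\<^bsub>D\<^esub> flatten D (path_end D x ms) (ns # nss)) \<star>\<^bsub>D\<^esub>
     join D x ms (concat (ns # nss))"

text \<open>
  Regard a cell \<open>c\<close> out of the composite of a path \<open>ms\<close> as a multicell \<open>(ms, c)\<close>. Then
  \<open>msubst D f [(ms1, c1), \<dots>, (msk, ck)] d\<close> is \<open>(c1 \<otimes> \<dots> \<otimes> ck) \<star> d\<close>, as a cell out of the
  composite of the concatenated path; \<open>f\<close> is the source of \<open>c1\<close>, and for \<open>k = 0\<close> the
  result is \<open>idcell f \<star> d\<close>.
\<close>

definition msubst :: "('o,'a,'p,'c) dbl \<Rightarrow> 'a \<Rightarrow> ('p list \<times> 'c) list \<Rightarrow> 'c \<Rightarrow> 'c" where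
  "msubst D f cs d =
     cinv D (flatten D (adom D f) (map fst cs)) \<star>\<^bsub>D\<^esub> hcomps D f (map snd cs) \<star>\<^bsub>D\<^esub> d"

definition units :: "('o,'a,'p,'c) dbl \<Rightarrow> 'p list \<Rightarrow> ('p list \<times> 'c) list" where
  "units D ms = map (\<lambda>m. ([m], cid D m)) ms"

text \<open>
  The component of a multimodulation \<open>(M\<^sub>1, \<dots>, M\<^sub>k) \<rightarrow> N\<close> at proarrows \<open>m\<^sub>1, \<dots>, m\<^sub>k\<close> starting at
  \<open>x\<close> is \<open>mcell \<mu> x [m\<^sub>1, \<dots>, m\<^sub>k]\<close>; for \<open>k = 0\<close>, the component at \<open>x\<close> is \<open>mcell \<mu> x []\<close>.
\<close>

record ('o,'a,'p,'c,'o2,'a2,'p2,'c2) mmodn =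
  mdom :: "('o,'a,'p,'c,'o2,'a2,'p2,'c2) module list"
  mcod :: "('o,'a,'p,'c,'o2,'a2,'p2,'c2) module"
  mleft :: "('o,'a,'p,'c,'o2,'a2,'p2,'c2) trans"
  mright :: "('o,'a,'p,'c,'o2,'a2,'p2,'c2) trans"
  mcell :: "'o \<Rightarrow> 'p list \<Rightarrow> 'c2"

fun mod_path :: "('o,'a,'p,'c) dbl \<Rightarrow> ('o2,'a2,'p2,'c2) dbl \<Rightarrow>
    ('o,'a,'p,'c,'o2,'a2,'p2,'c2) lax \<Rightarrow> ('o,'a,'p,'c,'o2,'a2,'p2,'c2) module list \<Rightarrow>
    ('o,'a,'p,'c,'o2,'a2,'p2,'c2) lax \<Rightarrow> bool" where
  "mod_path D E F [] G \<longleftrightarrow> F = G"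
| "mod_path D E F (M # Ms) G \<longleftrightarrow>
     is_module D E M \<and> mod_src D M = F \<and> mod_path D E (mod_tgt D M) Ms G"

definition mods_Pr :: "('o,'a,'p,'c,'o2,'a2,'p2,'c2) module list \<Rightarrow> 'p list \<Rightarrow> 'p2 list" where
  "mods_Pr Ms ms = map2 mod_Pr Ms ms"

text \<open>
  The conjuncts after the typing of the components are: outer left and right equivariance for
  \<open>k > 0\<close>, inner equivariance, equivariance for \<open>k = 0\<close>, and naturality (for all \<open>k\<close>).
\<close>

definition multimodulation ::
  "('o,'a,'p,'c) dbl \<Rightarrow> ('o2,'a2,'p2,'c2) dbl \<Rightarrow> ('o,'a,'p,'c,'o2,'a2,'p2,'c2) mmodn \<Rightarrow> bool" where
  "multimodulation D E \<mu> \<longleftrightarrow>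
    (let Ms = mdom \<mu>; N = mcod \<mu>; \<alpha> = mleft \<mu>; \<beta> = mright \<mu>; u = mcell \<mu>;
         F = tdom \<alpha>; G = tdom \<beta> in
     mod_path D E F Ms G \<and> is_module D E N \<and> lax_trans D E \<alpha> \<and> lax_trans D E \<beta> \<and>
     tcod \<alpha> = mod_src D N \<and> tcod \<beta> = mod_tgt D N \<and>
     (\<forall>x ms. if is_path D x ms \<and> length ms = length Ms
        then in_cell E (u x ms) (pcomps E (fOb F x) (mods_Pr Ms ms)) (mod_Pr N (pcomps D x ms))
               (tOb \<alpha> x) (tOb \<beta> (path_end D x ms))
        else u x ms = undefined) \<and>
     (\<forall>x m n ns M Ms'. Ms = M # Ms' \<and> is_path D x (m # n # ns) \<and> length ns = length Ms' \<longrightarrow>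
        msubst E (tOb \<alpha> x)
            [([fPr F m], tPr \<alpha> m), (mods_Pr Ms (n # ns), u (ptgt D m) (n # ns))]
            (act_l N m (pcomps D (ptgt D m) (n # ns)))
          = msubst E (aid E (fOb F x))
            (([fPr F m, mod_Pr M n], act_l M m n) # units E (mods_Pr Ms' ns))
            (u x ((m \<odot>\<^bsub>D\<^esub> n) # ns))) \<and>
     (\<forall>x ms m n M Ms'. Ms = Ms' @ [M] \<and> is_path D x (ms @ [m, n]) \<and> length ms = length Ms' \<longrightarrow>
        msubst E (tOb \<alpha> x)
            [(mods_Pr Ms (ms @ [m]), u x (ms @ [m])), ([fPr G n], tPr \<beta> n)]
            (act_r N (pcomps D x (ms @ [m])) n)
          = msubst E (aid E (fOb F x))
            (units E (mods_Pr Ms' ms) @ [([mod_Pr M m, fPr G n], act_r M m n)])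
            (u x (ms @ [m \<odot>\<^bsub>D\<^esub> n]))) \<and>
     (\<forall>x ms l m n ns Ms1 M M' Ms2.
        Ms = Ms1 @ [M, M'] @ Ms2 \<and> is_path D x (ms @ [l, m, n] @ ns) \<and>
        length ms = length Ms1 \<and> length ns = length Ms2 \<longrightarrow>
        msubst E (aid E (fOb F x))
            (units E (mods_Pr Ms1 ms) @
             [([mod_Pr M l, fPr (mod_tgt D M) m], act_r M l m), ([mod_Pr M' n], cid E (mod_Pr M' n))] @
             units E (mods_Pr Ms2 ns))
            (u x (ms @ [l \<odot>\<^bsub>D\<^esub> m, n] @ ns))
          = msubst E (aid E (fOb F x))
            (units E (mods_Pr Ms1 ms) @
             [([mod_Pr M l], cid E (mod_Pr M l)), ([fPr (mod_src D M') m, mod_Pr M' n], act_l M' m n)] @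
             units E (mods_Pr Ms2 ns))
            (u x (ms @ [l, m \<odot>\<^bsub>D\<^esub> n] @ ns))) \<and>
     (Ms = [] \<longrightarrow> (\<forall>m\<in>Pr D. let x = psrc D m; y = ptgt D m in
        msubst E (tOb \<alpha> x) [([], u x []), ([fPr G m], tPr \<beta> m)] (act_r N (pid D x) m)
          = msubst E (tOb \<alpha> x) [([fPr F m], tPr \<alpha> m), ([], u y [])] (act_l N m (pid D y)))) \<and>
     (\<forall>f cs. is_cpath D f cs \<and> length cs = length Ms \<longrightarrow>
        (let g = cpath_end D f cs; x = adom D f; w = acod D f; z = acod D g;
             ms = map (cdom D) cs; ns = map (ccod D) cs in
         msubst E (tOb \<alpha> x \<cdot>\<^bsub>E\<^esub> fAr (tcod \<alpha>) f)
             [([], tAr \<alpha> f),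
              (mods_Pr Ms ms, hcomps E (fAr F f) (map2 mod_Ce Ms cs) \<star>\<^bsub>E\<^esub> u w ns)]
             (act_l N (pid D w) (pcomps D w ns))
           = msubst E (tOb \<alpha> x \<cdot>\<^bsub>E\<^esub> fAr (tcod \<alpha>) f)
             [(mods_Pr Ms ms, u x ms \<star>\<^bsub>E\<^esub> mod_Ce N (hcomps D f cs)),
              ([], tAr \<beta> g)]
             (act_r N (pcomps D w ns) (pid D z)))))"


section \<open>Virtual double categories and representability\<close>

text \<open>
  The data of a virtual double category. The composite of a path of multicells
  \<open>\<phi>\<^sub>1, \<dots>, \<phi>\<^sub>n\<close>, whose first source is the arrow \<open>f\<close>, with a multicell \<open>\<psi>\<close> is
  \<open>vccomp f [\<phi>\<^sub>1, \<dots>, \<phi>\<^sub>n] \<psi>\<close>; the arrow \<open>f\<close> matters only when \<open>n = 0\<close>.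
\<close>

record ('o, 'a, 'p, 'c) vdbl =
  VOb :: "'o set"
  VAr :: "'a set"
  VPr :: "'p set"
  VCe :: "'c set"
  vadom :: "'a \<Rightarrow> 'o"
  vacod :: "'a \<Rightarrow> 'o"
  vaid :: "'o \<Rightarrow> 'a"
  vacomp :: "'a \<Rightarrow> 'a \<Rightarrow> 'a"
  vpsrc :: "'p \<Rightarrow> 'o"
  vptgt :: "'p \<Rightarrow> 'o"
  vcdom :: "'c \<Rightarrow> 'p list"
  vccod :: "'c \<Rightarrow> 'p"
  vcsrc :: "'c \<Rightarrow> 'a"
  vctgt :: "'c \<Rightarrow> 'a"
  vcid :: "'p \<Rightarrow> 'c"
  vccomp :: "'a \<Rightarrow> 'c list \<Rightarrow> 'c \<Rightarrow> 'c"

fun vpath :: "('o,'a,'p,'c) vdbl \<Rightarrow> 'o \<Rightarrow> 'p list \<Rightarrow> 'o \<Rightarrow> bool" where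
  "vpath V x [] y \<longleftrightarrow> x \<in> VOb V \<and> x = y"
| "vpath V x (m # ms) y \<longleftrightarrow> m \<in> VPr V \<and> vpsrc V m = x \<and> vpath V (vptgt V m) ms y"

definition opcartesian :: "('o,'a,'p,'c) vdbl \<Rightarrow> 'c \<Rightarrow> bool" where
  "opcartesian V \<phi> \<longleftrightarrow> \<phi> \<in> VCe V \<and>
    (let n = vccod V \<phi> in
     vcsrc V \<phi> = vaid V (vpsrc V n) \<and> vctgt V \<phi> = vaid V (vptgt V n) \<and>
     (\<forall>x y ks ls \<psi>.
        vpath V x ks (vpsrc V n) \<and> vpath V (vptgt V n) ls y \<and>
        \<psi> \<in> VCe V \<and> vcdom V \<psi> = ks @ vcdom V \<phi> @ ls \<and> vadom V (vcsrc V \<psi>) = x \<longrightarrow>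
        (\<exists>!\<chi>. \<chi> \<in> VCe V \<and> vcdom V \<chi> = ks @ [n] @ ls \<and> vccod V \<chi> = vccod V \<psi> \<and>
           vcsrc V \<chi> = vcsrc V \<psi> \<and> vctgt V \<chi> = vctgt V \<psi> \<and>
           vccomp V (vaid V x) (map (vcid V) ks @ [\<phi>] @ map (vcid V) ls) \<chi> = \<psi>)))"

text \<open>
  \<open>D\<close> represents \<open>V\<close>: they have the same objects, arrows and proarrows; the cells of \<open>D\<close>
  are, via the bijection \<open>J\<close>, the multicells of \<open>V\<close> with domain of length one; and there are
  opcartesian multicells \<open>t M N : (M, N) \<rightarrow> M \<odot> N\<close> and \<open>e F : () \<rightarrow> id\<^sub>F\<close> which
  determine the external composition of cells, the external identity cells and the coherence
  isomorphisms of \<open>D\<close>.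
\<close>

definition represents ::
  "('o,'a,'p,'d) dbl \<Rightarrow> ('o,'a,'p,'c) vdbl \<Rightarrow> ('d \<Rightarrow> 'c) \<Rightarrow> bool" where
  "represents D V J \<longleftrightarrow>
     Ob D = VOb V \<and> Ar D = VAr V \<and> Pr D = VPr V \<and>
     (\<forall>f\<in>Ar D. adom D f = vadom V f \<and> acod D f = vacod V f) \<and>
     (\<forall>x\<in>Ob D. aid D x = vaid V x) \<and>
     (\<forall>f\<in>Ar D. \<forall>g\<in>Ar D. acod D f = adom D g \<longrightarrow> f \<cdot>\<^bsub>D\<^esub> g = vacomp V f g) \<and>
     (\<forall>m\<in>Pr D. psrc D m = vpsrc V m \<and> ptgt D m = vptgt V m) \<and>
     bij_betw J (Ce D) {\<phi> \<in> VCe V. length (vcdom V \<phi>) = 1} \<and>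
     (\<forall>c\<in>Ce D. vcdom V (J c) = [cdom D c] \<and> vccod V (J c) = ccod D c \<and>
        vcsrc V (J c) = csrc D c \<and> vctgt V (J c) = ctgt D c) \<and>
     (\<forall>m\<in>Pr D. J (cid D m) = vcid V m) \<and>
     (\<forall>c\<in>Ce D. \<forall>d\<in>Ce D. ccod D c = cdom D d \<longrightarrow>
        J (c \<star>\<^bsub>D\<^esub> d) = vccomp V (csrc D c) [J c] (J d)) \<and>
     (\<exists>t e.
        (\<forall>m\<in>Pr D. \<forall>n\<in>Pr D. ptgt D m = psrc D n \<longrightarrow>
           opcartesian V (t m n) \<and> vcdom V (t m n) = [m, n] \<and> vccod V (t m n) = m \<odot>\<^bsub>D\<^esub> n) \<and>
        (\<forall>x\<in>Ob D.
           opcartesian V (e x) \<and> vcdom V (e x) = [] \<and> vccod V (e x) = pid D x) \<and>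
        (\<forall>c\<in>Ce D. \<forall>d\<in>Ce D. ctgt D c = csrc D d \<longrightarrow>
           vccomp V (aid D (psrc D (cdom D c))) [t (cdom D c) (cdom D d)] (J (c \<otimes>\<^bsub>D\<^esub> d))
             = vccomp V (csrc D c) [J c, J d] (t (ccod D c) (ccod D d))) \<and>
        (\<forall>f\<in>Ar D.
           vccomp V (aid D (adom D f)) [e (adom D f)] (J (idcell D f))
             = vccomp V f [] (e (acod D f))) \<and>
        (\<forall>m\<in>Pr D. \<forall>n\<in>Pr D. \<forall>p\<in>Pr D. ptgt D m = psrc D n \<and> ptgt D n = psrc D p \<longrightarrow>
           (let i = aid D (psrc D m) in
            vccomp V i [vccomp V i [t m n, vcid V p] (t (m \<odot>\<^bsub>D\<^esub> n) p)] (J (assoc D m n p))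
              = vccomp V i [vcid V m, t n p] (t m (n \<odot>\<^bsub>D\<^esub> p)))) \<and>
        (\<forall>m\<in>Pr D. let x = psrc D m; y = ptgt D m; i = aid D x in
            vccomp V i [vccomp V i [e x, vcid V m] (t (pid D x) m)] (J (lunit D m)) = vcid V m \<and>
            vccomp V i [vccomp V i [vcid V m, e y] (t m (pid D y))] (J (runit D m)) = vcid V m))"


section \<open>The virtual double category of lax functors\<close>

definition mmod_id ::
  "('o,'a,'p,'c) dbl \<Rightarrow> ('o2,'a2,'p2,'c2) dbl \<Rightarrow> ('o,'a,'p,'c,'o2,'a2,'p2,'c2) module \<Rightarrow>
   ('o,'a,'p,'c,'o2,'a2,'p2,'c2) mmodn" where
  "mmod_id D E M = \<lparr>mdom = [M], mcod = M,
     mleft = trans_id D E (mod_src D M), mright = trans_id D E (mod_tgt D M),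
     mcell = (\<lambda>x ms. if is_path D x ms \<and> length ms = 1
       then cid E (mod_Pr M (hd ms)) else undefined)\<rparr>"

text \<open>Cut a path into consecutive subpaths of given lengths, with their starting objects.\<close>

fun split_path :: "('o,'a,'p,'c) dbl \<Rightarrow> nat list \<Rightarrow> 'o \<Rightarrow> 'p list \<Rightarrow> ('o \<times> 'p list) list" where
  "split_path D [] x ms = []"
| "split_path D (k # ks) x ms =
     (x, take k ms) # split_path D ks (path_end D x (take k ms)) (drop k ms)"

definition mmod_comp ::
  "('o,'a,'p,'c) dbl \<Rightarrow> ('o2,'a2,'p2,'c2) dbl \<Rightarrow> ('o,'a,'p,'c,'o2,'a2,'p2,'c2) trans \<Rightarrow>
   ('o,'a,'p,'c,'o2,'a2,'p2,'c2) mmodn list \<Rightarrow> ('o,'a,'p,'c,'o2,'a2,'p2,'c2) mmodn \<Rightarrow>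
   ('o,'a,'p,'c,'o2,'a2,'p2,'c2) mmodn" where
  "mmod_comp D E \<alpha> \<phi>s \<psi> = \<lparr>mdom = concat (map mdom \<phi>s), mcod = mcod \<psi>,
     mleft = trans_comp D E \<alpha> (mleft \<psi>),
     mright = trans_comp D E (if \<phi>s = [] then \<alpha> else mright (last \<phi>s)) (mright \<psi>),
     mcell = (\<lambda>x ms.
       if is_path D x ms \<and> length ms = length (concat (map mdom \<phi>s))
       then let ps = split_path D (map (length \<circ> mdom) \<phi>s) x ms in
         msubst E (tOb \<alpha> x)
           (map2 (\<lambda>\<phi> (y, ns). (mods_Pr (mdom \<phi>) ns, mcell \<phi> y ns)) \<phi>s ps)
           (mcell \<psi> x (map (\<lambda>(y, ns). pcomps D y ns) ps))
       else undefined)\<rparr>"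

definition lax_vdbl ::
  "('o,'a,'p,'c) dbl \<Rightarrow> ('o2,'a2,'p2,'c2) dbl \<Rightarrow>
   (('o,'a,'p,'c,'o2,'a2,'p2,'c2) lax, ('o,'a,'p,'c,'o2,'a2,'p2,'c2) trans,
    ('o,'a,'p,'c,'o2,'a2,'p2,'c2) module, ('o,'a,'p,'c,'o2,'a2,'p2,'c2) mmodn) vdbl" where
  "lax_vdbl D E = \<lparr>
     VOb = {F. lax_functor D E F}, VAr = {\<alpha>. lax_trans D E \<alpha>},
     VPr = {M. is_module D E M}, VCe = {\<mu>. multimodulation D E \<mu>},
     vadom = tdom, vacod = tcod, vaid = trans_id D E, vacomp = trans_comp D E,
     vpsrc = mod_src D, vptgt = mod_tgt D,
     vcdom = mdom, vccod = mcod, vcsrc = mleft, vctgt = mright,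
     vcid = mmod_id D E, vccomp = mmod_comp D E \<rparr>"

definition unary ::
  "('o,'a,'p,'c) dbl \<Rightarrow> ('o,'a,'p,'c,'o2,'a2,'p2,'c2) modn \<Rightarrow>
   ('o,'a,'p,'c,'o2,'a2,'p2,'c2) mmodn" where
  "unary D \<mu> = \<lparr>mdom = [odom \<mu>], mcod = ocod \<mu>, mleft = oleft \<mu>, mright = oright \<mu>,
     mcell = (\<lambda>x ms. if is_path D x ms \<and> length ms = 1 then ocell \<mu> (hd ms) else undefined)\<rparr>"

definition double_category_of_models ::
  "('o,'a,'p,'c) dbl \<Rightarrow> ('o2,'a2,'p2,'c2) dbl \<Rightarrow>
   (('o,'a,'p,'c,'o2,'a2,'p2,'c2) lax, ('o,'a,'p,'c,'o2,'a2,'p2,'c2) trans,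
    ('o,'a,'p,'c,'o2,'a2,'p2,'c2) module, ('o,'a,'p,'c,'o2,'a2,'p2,'c2) modn) dbl \<Rightarrow> bool" where
  "double_category_of_models T E X \<longleftrightarrow>
     double_category X \<and>
     Ob X = {F. lax_functor T E F} \<and>
     Ar X = {\<alpha>. lax_trans T E \<alpha>} \<and>
     Pr X = {M. is_module T E M} \<and>
     Ce X = {\<mu>. modulation T E \<mu>} \<and>
     represents X (lax_vdbl T E) (unary T)"


section \<open>The double theories\<close>

text \<open>
  The double category with only identity proarrows and identity cells \<open>idcell f\<close>, on a partially
  ordered type regarded as a category. On \<^typ>\<open>unit\<close> it is the terminal double category;
  on \<^typ>\<open>bool\<close> it is the walking arrow.
\<close>

definition order_dbl :: "('o::order, 'o \<times> 'o, 'o, 'o \<times> 'o) dbl" where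
  "order_dbl = \<lparr>
     Ob = UNIV, Ar = {(x, y). x \<le> y}, Pr = UNIV, Ce = {(x, y). x \<le> y},
     adom = fst, acod = snd, aid = (\<lambda>x. (x, x)), acomp = (\<lambda>f g. (fst f, snd g)),
     psrc = (\<lambda>m. m), ptgt = (\<lambda>m. m),
     cdom = fst, ccod = snd, cid = (\<lambda>m. (m, m)), ccomp = (\<lambda>c d. (fst c, snd d)),
     csrc = (\<lambda>c. c), ctgt = (\<lambda>c. c),
     pid = (\<lambda>x. x), pcomp = (\<lambda>m n. m),
     idcell = (\<lambda>f. f), hcomp = (\<lambda>c d. c),
     assoc = (\<lambda>m n p. (m, m)), lunit = (\<lambda>m. (m, m)), runit = (\<lambda>m. (m, m)) \<rparr>"

definition theory_of_categories :: "(unit, unit \<times> unit, unit, unit \<times> unit) dbl" where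
  "theory_of_categories = order_dbl"

definition theory_of_functors :: "(bool, bool \<times> bool, bool, bool \<times> bool) dbl" where
  "theory_of_functors = order_dbl"

text \<open>
  Presentations of strict double categories with only identity proarrows. The objects are all
  elements of the type \<open>'o\<close>; the arrows are freely generated by \<open>'a\<close>, hence are paths
  \<open>(x, fs)\<close> with starting object \<open>x\<close>; a generating cell \<open>k\<close> goes from the identity on the start
  to the identity on the end of the parallel paths \<open>gsrc k\<close> and \<open>gtgt k\<close>, and lies over them.
\<close>

type_synonym ('o, 'a) gpath = "'o \<times> 'a list"

datatype ('o, 'a, 'k) cterm =
    Gen 'k
  | IdC "('o, 'a) gpath"
  | Vert "('o, 'a, 'k) cterm" "('o, 'a, 'k) cterm"  (infixl "\<cdot>\<cdot>" 70)
  | Ext "('o, 'a, 'k) cterm" "('o, 'a, 'k) cterm"  (infixl "\<odot>\<odot>" 65)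

record ('o, 'a, 'k) presentation =
  gdom :: "'a \<Rightarrow> 'o"
  gcod :: "'a \<Rightarrow> 'o"
  gsrc :: "'k \<Rightarrow> ('o, 'a) gpath"
  gtgt :: "'k \<Rightarrow> ('o, 'a) gpath"
  rels :: "(('o, 'a, 'k) cterm \<times> ('o, 'a, 'k) cterm) set"

fun gwf :: "('o, 'a, 'k) presentation \<Rightarrow> 'o \<Rightarrow> 'a list \<Rightarrow> bool" where
  "gwf P x [] \<longleftrightarrow> True"
| "gwf P x (f # fs) \<longleftrightarrow> gdom P f = x \<and> gwf P (gcod P f) fs"

fun gend :: "('o, 'a, 'k) presentation \<Rightarrow> ('o, 'a) gpath \<Rightarrow> 'o" where
  "gend P (x, []) = x"
| "gend P (x, f # fs) = gend P (gcod P f, fs)"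

definition gcomp :: "('o, 'a) gpath \<Rightarrow> ('o, 'a) gpath \<Rightarrow> ('o, 'a) gpath" where
  "gcomp p q = (fst p, snd p @ snd q)"

fun tsrc :: "('o, 'a, 'k) presentation \<Rightarrow> ('o, 'a, 'k) cterm \<Rightarrow> ('o, 'a) gpath" where
  "tsrc P (Gen k) = gsrc P k"
| "tsrc P (IdC p) = p"
| "tsrc P (s \<cdot>\<cdot> t) = gcomp (tsrc P s) (tsrc P t)"
| "tsrc P (s \<odot>\<odot> t) = tsrc P s"

fun ttgt :: "('o, 'a, 'k) presentation \<Rightarrow> ('o, 'a, 'k) cterm \<Rightarrow> ('o, 'a) gpath" where
  "ttgt P (Gen k) = gtgt P k"
| "ttgt P (IdC p) = p"
| "ttgt P (s \<cdot>\<cdot> t) = gcomp (ttgt P s) (ttgt P t)"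
| "ttgt P (s \<odot>\<odot> t) = ttgt P t"

fun twf :: "('o, 'a, 'k) presentation \<Rightarrow> ('o, 'a, 'k) cterm \<Rightarrow> bool" where
  "twf P (Gen k) \<longleftrightarrow> True"
| "twf P (IdC p) \<longleftrightarrow> gwf P (fst p) (snd p)"
| "twf P (s \<cdot>\<cdot> t) \<longleftrightarrow> twf P s \<and> twf P t \<and> gend P (tsrc P s) = fst (tsrc P t)"
| "twf P (s \<odot>\<odot> t) \<longleftrightarrow> twf P s \<and> twf P t \<and> ttgt P s = tsrc P t"

text \<open>
  The least congruence containing the relations and the laws of a strict double category; since
  only proarrows \<open>id\<^sub>x\<close> are present, identity cells on proarrows are the cells \<open>IdC (x, [])\<close>.
\<close>

inductive teq :: "('o, 'a, 'k) presentation \<Rightarrow> ('o, 'a, 'k) cterm \<Rightarrow> ('o, 'a, 'k) cterm \<Rightarrow> bool"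
  for P where
  "(s, t) \<in> rels P \<Longrightarrow> teq P s t"
| "twf P t \<Longrightarrow> teq P t t"
| "teq P s t \<Longrightarrow> teq P t s"
| "teq P s t \<Longrightarrow> teq P t u \<Longrightarrow> teq P s u"
| "teq P s s' \<Longrightarrow> teq P t t' \<Longrightarrow> twf P (s \<cdot>\<cdot> t) \<Longrightarrow> teq P (s \<cdot>\<cdot> t) (s' \<cdot>\<cdot> t')"
| "teq P s s' \<Longrightarrow> teq P t t' \<Longrightarrow> twf P (s \<odot>\<odot> t) \<Longrightarrow> teq P (s \<odot>\<odot> t) (s' \<odot>\<odot> t')"
| "twf P (s \<cdot>\<cdot> t \<cdot>\<cdot> u) \<Longrightarrow> teq P (s \<cdot>\<cdot> t \<cdot>\<cdot> u) (s \<cdot>\<cdot> (t \<cdot>\<cdot> u))"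
| "twf P t \<Longrightarrow> teq P (IdC (fst (tsrc P t), []) \<cdot>\<cdot> t) t"
| "twf P t \<Longrightarrow> teq P (t \<cdot>\<cdot> IdC (gend P (tsrc P t), [])) t"
| "twf P (s \<odot>\<odot> t \<odot>\<odot> u) \<Longrightarrow> teq P (s \<odot>\<odot> t \<odot>\<odot> u) (s \<odot>\<odot> (t \<odot>\<odot> u))"
| "twf P t \<Longrightarrow> teq P (IdC (tsrc P t) \<odot>\<odot> t) t"
| "twf P t \<Longrightarrow> teq P (t \<odot>\<odot> IdC (ttgt P t)) t"
| "twf P (IdC p \<cdot>\<cdot> IdC q) \<Longrightarrow> teq P (IdC p \<cdot>\<cdot> IdC q) (IdC (gcomp p q))"
| "twf P ((s \<odot>\<odot> t) \<cdot>\<cdot> (s' \<odot>\<odot> t')) \<Longrightarrow>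
     teq P ((s \<odot>\<odot> t) \<cdot>\<cdot> (s' \<odot>\<odot> t')) ((s \<cdot>\<cdot> s') \<odot>\<odot> (t \<cdot>\<cdot> t'))"

definition tclass :: "('o, 'a, 'k) presentation \<Rightarrow> ('o, 'a, 'k) cterm \<Rightarrow> ('o, 'a, 'k) cterm set" where
  "tclass P t = {s. teq P s t}"

definition trep :: "('o, 'a, 'k) cterm set \<Rightarrow> ('o, 'a, 'k) cterm" where
  "trep C = (SOME t. t \<in> C)"

definition presented ::
  "('o, 'a, 'k) presentation \<Rightarrow> ('o, ('o, 'a) gpath, 'o, ('o, 'a, 'k) cterm set) dbl" where
  "presented P = \<lparr>
     Ob = UNIV, Ar = {(x, fs). gwf P x fs}, Pr = UNIV, Ce = tclass P ` {t. twf P t},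
     adom = fst, acod = gend P, aid = (\<lambda>x. (x, [])), acomp = gcomp,
     psrc = (\<lambda>m. m), ptgt = (\<lambda>m. m),
     cdom = (\<lambda>C. fst (tsrc P (trep C))), ccod = (\<lambda>C. gend P (tsrc P (trep C))),
     cid = (\<lambda>m. tclass P (IdC (m, []))),
     ccomp = (\<lambda>C C'. tclass P (trep C \<cdot>\<cdot> trep C')),
     csrc = (\<lambda>C. tsrc P (trep C)), ctgt = (\<lambda>C. ttgt P (trep C)),
     pid = (\<lambda>x. x), pcomp = (\<lambda>m n. m),
     idcell = (\<lambda>p. tclass P (IdC p)),
     hcomp = (\<lambda>C C'. tclass P (trep C \<odot>\<odot> trep C')),
     assoc = (\<lambda>m n p. tclass P (IdC (m, []))),
     lunit = (\<lambda>m. tclass P (IdC (m, []))), runit = (\<lambda>m. tclass P (IdC (m, []))) \<rparr>"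

datatype two_ob = obX | obY
datatype trf_ar = trF | trG
datatype adj_ar = adF | adG
datatype adj_ce = adEta | adEps
datatype mnd_ce = mnMu | mnEta
datatype frob_ce = frMu | frEta | frRho | frEps

definition theory_of_transformations where
  "theory_of_transformations = presented \<lparr>
     gdom = (\<lambda>_ :: trf_ar. obX), gcod = (\<lambda>_. obY),
     gsrc = (\<lambda>_ :: unit. (obX, [trF])), gtgt = (\<lambda>_. (obX, [trG])),
     rels = {} \<rparr>"

definition theory_of_adjunctions where
  "theory_of_adjunctions = presented \<lparr>
     gdom = (\<lambda>a. case a of adF \<Rightarrow> obX | adG \<Rightarrow> obY),
     gcod = (\<lambda>a. case a of adF \<Rightarrow> obY | adG \<Rightarrow> obX),
     gsrc = (\<lambda>k. case k of adEta \<Rightarrow> (obX, []) | adEps \<Rightarrow> (obY, [adG, adF])),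
     gtgt = (\<lambda>k. case k of adEta \<Rightarrow> (obX, [adF, adG]) | adEps \<Rightarrow> (obY, [])),
     rels = (let f = IdC (obX, [adF]); g = IdC (obY, [adG]); \<eta> = Gen adEta; \<epsilon> = Gen adEps in
       {((\<eta> \<cdot>\<cdot> f) \<odot>\<odot> (f \<cdot>\<cdot> \<epsilon>), f),
        ((g \<cdot>\<cdot> \<eta>) \<odot>\<odot> (\<epsilon> \<cdot>\<cdot> g), g)}) \<rparr>"

text \<open>The generating object and arrow \<open>t\<close> of the next two theories are the elements of \<^typ>\<open>unit\<close>.\<close>

definition monad_rels ::
  "(unit, unit, 'k) cterm \<Rightarrow> (unit, unit, 'k) cterm \<Rightarrow>
   ((unit, unit, 'k) cterm \<times> (unit, unit, 'k) cterm) set" where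
  "monad_rels \<mu> \<eta> = (let t = IdC ((), [()]) in
     {((\<mu> \<cdot>\<cdot> t) \<odot>\<odot> \<mu>, (t \<cdot>\<cdot> \<mu>) \<odot>\<odot> \<mu>),
      ((\<eta> \<cdot>\<cdot> t) \<odot>\<odot> \<mu>, t),
      ((t \<cdot>\<cdot> \<eta>) \<odot>\<odot> \<mu>, t)})"

definition theory_of_monads where
  "theory_of_monads = presented \<lparr>
     gdom = (\<lambda>_ :: unit. ()), gcod = (\<lambda>_. ()),
     gsrc = (\<lambda>k. case k of mnMu \<Rightarrow> ((), [(), ()]) | mnEta \<Rightarrow> ((), [])),
     gtgt = (\<lambda>k. case k of mnMu \<Rightarrow> ((), [()]) | mnEta \<Rightarrow> ((), [()])),
     rels = monad_rels (Gen mnMu) (Gen mnEta) \<rparr>"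

definition theory_of_Frobenius_monads where
  "theory_of_Frobenius_monads = presented \<lparr>
     gdom = (\<lambda>_ :: unit. ()), gcod = (\<lambda>_. ()),
     gsrc = (\<lambda>k. case k of frMu \<Rightarrow> ((), [(), ()]) | frEta \<Rightarrow> ((), [])
       | frRho \<Rightarrow> ((), []) | frEps \<Rightarrow> ((), [()])),
     gtgt = (\<lambda>k. case k of frMu \<Rightarrow> ((), [()]) | frEta \<Rightarrow> ((), [()])
       | frRho \<Rightarrow> ((), [(), ()]) | frEps \<Rightarrow> ((), [])),
     rels = monad_rels (Gen frMu) (Gen frEta) \<union>
       (let t = IdC ((), [()]); \<mu> = Gen frMu; \<eta> = Gen frEta; \<rho> = Gen frRho; \<epsilon> = Gen frEps in
       {((\<rho> \<cdot>\<cdot> t) \<odot>\<odot> (t \<cdot>\<cdot> \<mu>), (t \<cdot>\<cdot> \<rho>) \<odot>\<odot> (\<mu> \<cdot>\<cdot> t)),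
        (\<rho> \<odot>\<odot> (\<epsilon> \<cdot>\<cdot> t), \<eta>),
        (\<rho> \<odot>\<odot> (t \<cdot>\<cdot> \<epsilon>), \<eta>)}) \<rparr>"

end

theory Submission
  imports Defs
begin

text \<open>
  All six theories have only identity proarrows, and the proof uses nothing else about them.
  A model, a transformation, a module or a (multi)modulation is then determined by its components
  at the objects of the theory, and each axiom can be checked on elements of spans. The composite
  of two modules is their tensor product: the coequalizer, at every object, of the two actions of
  the middle model on pairs of composable elements. A cell of the theory acts on a module as the
  action of its image composed with that of an identity cell, so the tensor product is again a
  module. The cell into the tensor product is opcartesian because inner equivariance of a
  multimodulation says that it is compatible with the coequalizer in two adjacent arguments; the
  cell into the identity module is opcartesian because an element of a model can be absorbed by
  the action on a neighbouring argument.
\<close>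

text \<open>Two obstacles shape the proof. Composition of spans is associative only up to
  isomorphism, and \<open>msubst\<close> inserts these isomorphisms and their inverses. They vanish
  once an element of a composite is recorded as the list of its components (\<open>chain\<close>,
  \<open>enc\<close>): \<open>flatten\<close> becomes \<open>concat\<close>, and an axiom about
  multicells compares two ways of cutting one list. The second obstacle is that naturality is
  demanded in every cell of the theory, while the cells of a presented theory are not known
  explicitly. For a cell \<open>c\<close> with target arrow \<open>g\<close>, the equation
  \<open>hcomp c (idcell g) = c\<close> writes the action of \<open>c\<close> on a module as an
  element of the left model, the value of \<open>c\<close> at a unit, acting on the result of
  \<open>idcell g\<close>. Naturality of the left transformation at that element reduces naturality
  in \<open>c\<close> to naturality in \<open>idcell g\<close>, so \<open>modn_laws\<close> and
  \<open>mm_laws\<close> state naturality for arrows only. The same equation dictates how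
  \<open>c\<close> acts on a tensor product: by \<open>c\<close> on one factor and by
  \<open>idcell g\<close> on the other, since applying \<open>c\<close> to both would break the
  match in the middle.\<close>

type_synonym ('o, 'a, 'c, 'u) s_lax =
  "('o, 'a, 'o, 'c, 'u set, 'u func, 'u span, 'u span_map) lax"
type_synonym ('o, 'a, 'c, 'u) s_mmodn =
  "('o, 'a, 'o, 'c, 'u set, 'u func, 'u span, 'u span_map) mmodn"
type_synonym ('o, 'a, 'c, 'u) s_modn =
  "('o, 'a, 'o, 'c, 'u set, 'u func, 'u span, 'u span_map) modn"
type_synonym ('o, 'a, 'c, 'u) s_module =
  "('o, 'a, 'o, 'c, 'u set, 'u func, 'u span, 'u span_map) module"
type_synonym ('o, 'a, 'c, 'u) s_trans =
  "('o, 'a, 'o, 'c, 'u set, 'u func, 'u span, 'u span_map) trans"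

abbreviation (input) "elt M x \<equiv> apex (mod_Pr M x)"
abbreviation (input) "lft M x \<equiv> lleg (mod_Pr M x)"
abbreviation (input) "rgt M x \<equiv> rleg (mod_Pr M x)"
abbreviation (input) "fel F x \<equiv> apex (fPr F x)"
abbreviation (input) "flt F x \<equiv> lleg (fPr F x)"
abbreviation (input) "frt F x \<equiv> rleg (fPr F x)"
abbreviation (input) "mce M c \<equiv> sm_map (mod_Ce M c)"
abbreviation (input) "tpr al x \<equiv> sm_map (tPr al x)"
abbreviation (input) "tar al f \<equiv> sm_map (tAr al f)"
abbreviation (input) "tob al x \<equiv> func_map (tOb al x)"
abbreviation (input) "fce F c \<equiv> sm_map (fCe F c)"
abbreviation (input) "far F f \<equiv> func_map (fAr F f)"
abbreviation (input) "uni F x \<equiv> sm_map (unitor F x)"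
abbreviation (input) "idO F x \<equiv> func_id (fOb F x)"
abbreviation (input) "spO F x \<equiv> span_id (fOb F x)"

section \<open>Maps of spans, computed on apexes\<close>

definition span_cell :: "'u span \<Rightarrow> 'u span \<Rightarrow> 'u func \<Rightarrow> 'u func \<Rightarrow> ('u \<Rightarrow> 'u) \<Rightarrow> 'u span_map" where
  "span_cell m n f g h = \<lparr>sm_dom = m, sm_cod = n, sm_left = f, sm_right = g,
     sm_map = restrict h (apex m)\<rparr>"

lemma span_cell_simps [simp]:
  "sm_dom (span_cell m n f g h) = m" "sm_cod (span_cell m n f g h) = n"
  "sm_left (span_cell m n f g h) = f" "sm_right (span_cell m n f g h) = g"
  "sm_map (span_cell m n f g h) = restrict h (apex m)"
  by (simp_all add: span_cell_def)

lemma span_glob_eq: "span_glob m n h = span_cell m n (func_id (lfoot m)) (func_id (rfoot m)) h"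
  by (simp add: span_glob_def span_cell_def)

lemma func_id_simps [simp]: "func_dom (func_id A) = A" "func_cod (func_id A) = A"
  "a \<in> A ==> func_map (func_id A) a = a"
  by (simp_all add: func_id_def)

lemma func_comp_simps [simp]: "func_dom (func_comp f g) = func_dom f"
  "func_cod (func_comp f g) = func_cod g"
  "a \<in> func_dom f ==> func_map (func_comp f g) a = func_map g (func_map f a)"
  by (simp_all add: func_comp_def)

lemma span_id_simps [simp]: "apex (span_id A) = A" "lfoot (span_id A) = A" "rfoot (span_id A) = A"
  "a \<in> A ==> lleg (span_id A) a = a" "a \<in> A ==> rleg (span_id A) a = a"
  by (simp_all add: span_id_def)

lemma funcs_map: "f \<in> funcs small ==> a \<in> func_dom f ==> func_map f a \<in> func_cod f"
  by (auto simp: funcs_def)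

lemma func_eqI:
  assumes "f \<in> funcs small" "g \<in> funcs small" "func_dom f = func_dom g" "func_cod f = func_cod g"
    "\<And>a. a \<in> func_dom f ==> func_map f a = func_map g a"
  shows "f = g"
proof -
  have "func_map f = func_map g"
    using assms by (intro extensionalityI[of _ "func_dom f"]) (auto simp: funcs_def PiE_def)
  then show ?thesis using assms(3,4) by simp
qed

lemma func_id_funcs: "small A ==> func_id A \<in> funcs small"
  by (auto simp: funcs_def func_id_def)

lemma func_comp_funcs:
  "f \<in> funcs small ==> g \<in> funcs small ==> func_cod f = func_dom g ==> func_comp f g \<in> funcs small"
  by (auto simp: funcs_def func_comp_def)

lemma func_comp_id_left: "f \<in> funcs small ==> func_dom f = A ==> func_comp (func_id A) f = f"
  by (rule func_eqI[of _ small]) (auto simp: func_id_def func_comp_def funcs_def)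

lemma func_comp_id_right: "f \<in> funcs small ==> func_cod f = A ==> func_comp f (func_id A) = f"
  by (rule func_eqI[of _ small]) (auto simp: func_id_def func_comp_def funcs_def)

lemma func_comp_assoc:
  assumes "f \<in> funcs small" "g \<in> funcs small" "func_cod f = func_dom g"
  shows "func_comp (func_comp f g) h = func_comp f (func_comp g h)"
  using assms by (auto simp: func_comp_def funcs_def fun_eq_iff)

lemma spans_legs: "m \<in> spans small ==> a \<in> apex m ==> lleg m a \<in> lfoot m \<and> rleg m a \<in> rfoot m"
  by (auto simp: spans_def)

lemma span_id_spans: "small A ==> span_id A \<in> spans small"
  by (auto simp: spans_def span_id_def)

text \<open>The part of \<open>in_cell\<close> that does not mention the map on apexes. A cell of
  spans is such a frame together with a compatible extensional function, and the two halves are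
  mostly established separately.\<close>

definition frame :: "('u set \<Rightarrow> bool) \<Rightarrow> 'u span \<Rightarrow> 'u span \<Rightarrow> 'u func \<Rightarrow> 'u func \<Rightarrow> bool" where
  "frame small m n f g \<longleftrightarrow> m \<in> spans small \<and> n \<in> spans small \<and> f \<in> funcs small \<and> g \<in> funcs small \<and>
     func_dom f = lfoot m \<and> func_cod f = lfoot n \<and> func_dom g = rfoot m \<and> func_cod g = rfoot n"

locale span_universe =
  fixes small :: "'u set \<Rightarrow> bool" and pair :: "'u \<Rightarrow> 'u \<Rightarrow> 'u"
  assumes universe: "set_universe small pair"
begin

abbreviation E :: "('u set, 'u func, 'u span, 'u span_map) dbl" where "E \<equiv> Span small pair"

lemma pair_inject [simp]: "pair a b = pair a' b' \<longleftrightarrow> a = a' \<and> b = b'"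
proof
  assume "pair a b = pair a' b'"
  then show "a = a' \<and> b = b'"
    using universe[unfolded set_universe_def, THEN conjunct1] by blast
qed simp

lemma unpair_pair [simp]: "unpair pair (pair a b) = (a, b)"
  by (simp add: unpair_def)

lemma small_subset: "small A ==> B \<subseteq> A ==> small B"
  using universe unfolding set_universe_def by blast

lemma pair_in_pullback [simp]:
  "pair a b \<in> pullback pair m n \<longleftrightarrow> a \<in> apex m \<and> b \<in> apex n \<and> rleg m a = lleg n b"
  by (auto simp: pullback_def)

lemma small_pullback: "m \<in> spans small ==> n \<in> spans small ==> small (pullback pair m n)"
proof -
  assume "m \<in> spans small" "n \<in> spans small"
  then have "small {pair a b | a b. a \<in> apex m \<and> b \<in> apex n}"
    using universe unfolding set_universe_def spans_def by blast
  then show ?thesis by (rule small_subset) (auto simp: pullback_def)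
qed

lemma span_comp_simps [simp]: "apex (span_comp pair m n) = pullback pair m n"
  "lfoot (span_comp pair m n) = lfoot m" "rfoot (span_comp pair m n) = rfoot n"
  "pair a b \<in> pullback pair m n ==> lleg (span_comp pair m n) (pair a b) = lleg m a"
  "pair a b \<in> pullback pair m n ==> rleg (span_comp pair m n) (pair a b) = rleg n b"
  by (simp_all add: span_comp_def)

lemma span_comp_spans:
  assumes "m \<in> spans small" "n \<in> spans small"
  shows "span_comp pair m n \<in> spans small"
  using assms small_pullback[OF assms]
  by (auto simp: spans_def span_comp_def) (auto simp: pullback_def)

lemma Span_simps [simp]:
  "Ob E = {A. small A}" "Ar E = funcs small" "Pr E = spans small" "Ce E = span_maps small"
  "adom E = func_dom" "acod E = func_cod" "aid E = func_id" "acomp E = func_comp"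
  "psrc E = lfoot" "ptgt E = rfoot" "cdom E = sm_dom" "ccod E = sm_cod"
  "csrc E = sm_left" "ctgt E = sm_right" "pid E = span_id" "pcomp E = span_comp pair"
  by (simp_all add: Span_def)

lemma in_cell_iff: "in_cell E c m n f g \<longleftrightarrow> frame small m n f g \<and>
    sm_dom c = m \<and> sm_cod c = n \<and> sm_left c = f \<and> sm_right c = g \<and> sm_map c \<in> extensional (apex m) \<and>
    (\<forall>a\<in>apex m. sm_map c a \<in> apex n \<and> lleg n (sm_map c a) = func_map f (lleg m a) \<and>
       rleg n (sm_map c a) = func_map g (rleg m a))"
  by (auto simp: in_cell_def frame_def span_maps_def PiE_def)

lemma in_cell_bd:
  "in_cell E c m n f g ==> sm_dom c = m \<and> sm_cod c = n \<and> sm_left c = f \<and> sm_right c = g \<and> c \<in> span_maps small"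
  by (simp add: in_cell_def)

lemma in_cell_frame: "in_cell E c m n f g ==> frame small m n f g"
  by (simp add: in_cell_iff)

lemma in_cell_self: "c \<in> span_maps small ==> in_cell E c (sm_dom c) (sm_cod c) (sm_left c) (sm_right c)"
  by (simp add: in_cell_def)

lemma in_cell_map:
  "in_cell E c m n f g ==> a \<in> apex m ==> sm_map c a \<in> apex n \<and>
     lleg n (sm_map c a) = func_map f (lleg m a) \<and> rleg n (sm_map c a) = func_map g (rleg m a)"
  by (simp add: in_cell_iff)

text \<open>The map of a cell is extensional on the apex of its domain, so agreement on elements is
  equality of records. This rule, or its form \<open>in_cell_eq_iff\<close>, turns equations between
  cells of spans into equations between elements.\<close>

lemma in_cell_eqI:
  assumes "in_cell E c m n f g" "in_cell E d m n f g" "\<And>a. a \<in> apex m ==> sm_map c a = sm_map d a"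
  shows "c = d"
proof -
  have "sm_map c = sm_map d"
    using assms by (intro extensionalityI[of _ "apex m"]) (auto simp: in_cell_iff)
  then show ?thesis using assms(1,2) by (simp add: in_cell_iff)
qed

lemma in_cell_span_cell:
  assumes "frame small m n f g"
    "\<And>a. a \<in> apex m ==> h a \<in> apex n \<and> lleg n (h a) = func_map f (lleg m a) \<and> rleg n (h a) = func_map g (rleg m a)"
  shows "in_cell E (span_cell m n f g h) m n f g"
  using assms by (simp add: in_cell_iff)

lemma ccomp_simps [simp]: "sm_dom (ccomp E c d) = sm_dom c" "sm_cod (ccomp E c d) = sm_cod d"
  "sm_left (ccomp E c d) = func_comp (sm_left c) (sm_left d)"
  "sm_right (ccomp E c d) = func_comp (sm_right c) (sm_right d)"
  "a \<in> apex (sm_dom c) ==> sm_map (ccomp E c d) a = sm_map d (sm_map c a)"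
  by (simp_all add: Span_def)

lemma hcomp_simps [simp]: "sm_dom (hcomp E c d) = span_comp pair (sm_dom c) (sm_dom d)"
  "sm_cod (hcomp E c d) = span_comp pair (sm_cod c) (sm_cod d)"
  "sm_left (hcomp E c d) = sm_left c" "sm_right (hcomp E c d) = sm_right d"
  "pair a b \<in> pullback pair (sm_dom c) (sm_dom d) ==>
     sm_map (hcomp E c d) (pair a b) = pair (sm_map c a) (sm_map d b)"
  by (simp_all add: Span_def)

lemma idcell_simps [simp]: "sm_dom (idcell E f) = span_id (func_dom f)"
  "sm_cod (idcell E f) = span_id (func_cod f)" "sm_left (idcell E f) = f" "sm_right (idcell E f) = f"
  "sm_map (idcell E f) = func_map f"
  by (simp_all add: Span_def)

lemma cid_simps [simp]: "sm_dom (cid E m) = m" "sm_cod (cid E m) = m"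
  "sm_left (cid E m) = func_id (lfoot m)" "sm_right (cid E m) = func_id (rfoot m)"
  "a \<in> apex m ==> sm_map (cid E m) a = a"
  by (simp_all add: Span_def span_glob_def)

lemma assoc_simps [simp]: "sm_dom (assoc E m n p) = span_comp pair (span_comp pair m n) p"
  "sm_cod (assoc E m n p) = span_comp pair m (span_comp pair n p)"
  "sm_left (assoc E m n p) = func_id (lfoot m)" "sm_right (assoc E m n p) = func_id (rfoot p)"
  "pair (pair a b) c \<in> pullback pair (span_comp pair m n) p ==>
     sm_map (assoc E m n p) (pair (pair a b) c) = pair a (pair b c)"
  by (simp_all add: Span_def span_glob_def del: pair_in_pullback)

lemma lunit_simps [simp]: "sm_dom (lunit E m) = span_comp pair (span_id (lfoot m)) m"
  "sm_cod (lunit E m) = m"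
  "sm_left (lunit E m) = func_id (lfoot m)" "sm_right (lunit E m) = func_id (rfoot m)"
  "pair a b \<in> pullback pair (span_id (lfoot m)) m ==> sm_map (lunit E m) (pair a b) = b"
  by (simp_all add: Span_def span_glob_def)

lemma runit_simps [simp]: "sm_dom (runit E m) = span_comp pair m (span_id (rfoot m))"
  "sm_cod (runit E m) = m"
  "sm_left (runit E m) = func_id (lfoot m)" "sm_right (runit E m) = func_id (rfoot m)"
  "pair a b \<in> pullback pair m (span_id (rfoot m)) ==> sm_map (runit E m) (pair a b) = a"
  by (simp_all add: Span_def span_glob_def)

lemma frameD:
  assumes "frame small m n f g"
  shows "m \<in> spans small" "n \<in> spans small" "f \<in> funcs small" "g \<in> funcs small"
    "func_dom f = lfoot m" "func_cod f = lfoot n" "func_dom g = rfoot m" "func_cod g = rfoot n"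
  using assms by (auto simp: frame_def)

lemma spans_feet: "m \<in> spans small ==> small (lfoot m) \<and> small (rfoot m)"
  by (simp add: spans_def)

lemma in_cell_ccomp:
  assumes "in_cell E c m n f g" "in_cell E d n p f' g'"
  shows "in_cell E (ccomp E c d) m p (func_comp f f') (func_comp g g')"
proof -
  have "sm_dom c = m"
    using assms(1) by (simp add: in_cell_iff)
  then have "sm_map (ccomp E c d) \<in> extensional (apex m)"
    by (simp add: Span_def)
  then show ?thesis
    using assms by (auto simp: in_cell_iff frame_def intro!: func_comp_funcs dest: spans_legs)
qed

lemma in_cell_hcomp:
  assumes "in_cell E c m n f g" "in_cell E d m' n' g h"
  shows "in_cell E (hcomp E c d) (span_comp pair m m') (span_comp pair n n') f h"
proof -
  have "sm_dom c = m" "sm_dom d = m'"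
    using assms by (simp_all add: in_cell_iff)
  then have "sm_map (hcomp E c d) \<in> extensional (pullback pair m m')"
    by (simp add: Span_def)
  moreover have "sm_map (hcomp E c d) z \<in> pullback pair n n' \<and>
      lleg (span_comp pair n n') (sm_map (hcomp E c d) z) = func_map f (lleg (span_comp pair m m') z) \<and>
      rleg (span_comp pair n n') (sm_map (hcomp E c d) z) = func_map h (rleg (span_comp pair m m') z)"
    if z: "z \<in> pullback pair m m'" for z
  proof -
    obtain a b where z: "z = pair a b" "a \<in> apex m" "b \<in> apex m'" "rleg m a = lleg m' b"
      using z by (auto simp: pullback_def)
    then show ?thesis
      using assms by (simp add: in_cell_iff)
  qed
  ultimately show ?thesis
    using assms by (auto simp: in_cell_iff frame_def intro!: span_comp_spans)
qed

lemma in_cell_idcell: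
  assumes "f \<in> funcs small"
  shows "in_cell E (idcell E f) (span_id (func_dom f)) (span_id (func_cod f)) f f"
  using assms funcs_map[OF assms] by (auto simp: in_cell_iff frame_def funcs_def PiE_def intro: span_id_spans)

lemma in_cell_span_glob:
  assumes "m \<in> spans small" "n \<in> spans small" "lfoot m = lfoot n" "rfoot m = rfoot n"
    "\<And>a. a \<in> apex m ==> h a \<in> apex n \<and> lleg n (h a) = lleg m a \<and> rleg n (h a) = rleg m a"
  shows "in_cell E (span_glob m n h) m n (func_id (lfoot m)) (func_id (rfoot m))"
  unfolding span_glob_eq
proof (rule in_cell_span_cell)
  show "frame small m n (func_id (lfoot m)) (func_id (rfoot m))"
    using assms(1-4) by (auto simp: frame_def spans_def intro: func_id_funcs)
qed (use assms spans_legs[OF assms(1)] in simp)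

lemma in_cell_cid: "m \<in> spans small ==> in_cell E (cid E m) m m (func_id (lfoot m)) (func_id (rfoot m))"
proof -
  assume "m \<in> spans small"
  then have "in_cell E (span_glob m m (\<lambda>a. a)) m m (func_id (lfoot m)) (func_id (rfoot m))"
    by (intro in_cell_span_glob) auto
  then show ?thesis by (simp add: Span_def)
qed

lemma in_cell_assoc:
  assumes "m \<in> spans small" "n \<in> spans small" "p \<in> spans small"
    "rfoot m = lfoot n" "rfoot n = lfoot p"
  shows "in_cell E (assoc E m n p) (span_comp pair (span_comp pair m n) p)
    (span_comp pair m (span_comp pair n p)) (func_id (lfoot m)) (func_id (rfoot p))"
proof -
  let ?d = "span_comp pair (span_comp pair m n) p"
  let ?h = "\<lambda>z. let (y, c) = unpair pair z; (a, b) = unpair pair y in pair a (pair b c)"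
  have "in_cell E (span_glob ?d (span_comp pair m (span_comp pair n p)) ?h) ?d
      (span_comp pair m (span_comp pair n p)) (func_id (lfoot ?d)) (func_id (rfoot ?d))"
  proof (rule in_cell_span_glob, goal_cases)
    case (5 z)
    then obtain a b c where "z = pair (pair a b) c" "pair a b \<in> pullback pair m n" "c \<in> apex p"
        "rleg n b = lleg p c"
      by (auto simp: pullback_def span_comp_def)
    then show ?case by simp
  qed (use assms in \<open>auto intro: span_comp_spans\<close>)
  then show ?thesis by (simp add: Span_def)
qed

lemma in_cell_lunit:
  assumes m: "m \<in> spans small"
  shows "in_cell E (lunit E m) (span_comp pair (span_id (lfoot m)) m) m (func_id (lfoot m)) (func_id (rfoot m))"
proof -
  let ?d = "span_comp pair (span_id (lfoot m)) m"
  have "in_cell E (span_glob ?d m (\<lambda>z. snd (unpair pair z))) ?d m (func_id (lfoot ?d)) (func_id (rfoot ?d))"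
  proof (rule in_cell_span_glob, goal_cases)
    case (5 z)
    then obtain a b where "z = pair a b" "a \<in> lfoot m" "b \<in> apex m" "lleg m b = a"
      by (auto simp: pullback_def)
    then show ?case by simp
  qed (use m spans_feet[OF m] in \<open>auto intro: span_comp_spans span_id_spans\<close>)
  then show ?thesis by (simp add: Span_def)
qed

lemma in_cell_runit:
  assumes m: "m \<in> spans small"
  shows "in_cell E (runit E m) (span_comp pair m (span_id (rfoot m))) m (func_id (lfoot m)) (func_id (rfoot m))"
proof -
  let ?d = "span_comp pair m (span_id (rfoot m))"
  have "in_cell E (span_glob ?d m (\<lambda>z. fst (unpair pair z))) ?d m (func_id (lfoot ?d)) (func_id (rfoot ?d))"
  proof (rule in_cell_span_glob, goal_cases)
    case (5 z)
    then obtain a b where "z = pair a b" "b \<in> rfoot m" "a \<in> apex m" "rleg m a = b"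
      by (auto simp: pullback_def)
    then show ?case using spans_legs[OF m] by simp
  qed (use m spans_feet[OF m] in \<open>auto intro: span_comp_spans span_id_spans\<close>)
  then show ?thesis by (simp add: Span_def)
qed

text \<open>\<open>cinv\<close> is a definite description, so nothing is known about it before
  uniqueness. A globular map that is bijective on apexes has its pointwise inverse as an inverse,
  and any other inverse has the same arrows and the same values.\<close>

lemma cinv_cell:
  assumes c: "in_cell E c m n (func_id (lfoot m)) (func_id (rfoot m))"
    and bij: "bij_betw (sm_map c) (apex m) (apex n)"
  shows "cell_inverse E c (cinv E c)"
    and "in_cell E (cinv E c) n m (func_id (lfoot m)) (func_id (rfoot m))"
    and "a \<in> apex m ==> sm_map (cinv E c) (sm_map c a) = a"
proof -
  have fr: "frame small m n (func_id (lfoot m)) (func_id (rfoot m))"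
    using in_cell_frame[OF c] .
  then have feet: "lfoot n = lfoot m" "rfoot n = rfoot m" and sp: "m \<in> spans small" "n \<in> spans small"
    by (auto simp: frame_def)
  let ?h = "the_inv_into (apex m) (sm_map c)"
  let ?d = "span_cell n m (func_id (lfoot m)) (func_id (rfoot m)) ?h"
  have inj: "inj_on (sm_map c) (apex m)" and im: "sm_map c ` apex m = apex n"
    using bij by (auto simp: bij_betw_def)
  have inv1: "?h (sm_map c a) = a" if "a \<in> apex m" for a
    using the_inv_into_f_f[OF inj that] .
  have d: "in_cell E ?d n m (func_id (lfoot m)) (func_id (rfoot m))"
  proof (rule in_cell_span_cell)
    show "frame small n m (func_id (lfoot m)) (func_id (rfoot m))"
      using fr feet by (simp add: frame_def)
    fix b assume "b \<in> apex n"
    then obtain a where a: "a \<in> apex m" "b = sm_map c a" using im by auto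
    then show "?h b \<in> apex m \<and> lleg m (?h b) = func_map (func_id (lfoot m)) (lleg n b) \<and>
        rleg m (?h b) = func_map (func_id (rfoot m)) (rleg n b)"
      using in_cell_map[OF c a(1)] spans_legs[OF sp(1) a(1)] inv1[OF a(1)] by simp
  qed
  have ids: "func_comp (func_id A) (func_id A) = func_id A" for A :: "'u set"
    by (auto simp: func_comp_def func_id_def)
  have cd: "ccomp E c ?d = cid E m"
    using in_cell_ccomp[OF c d] in_cell_cid[OF sp(1)] c
    by (intro in_cell_eqI[of _ m m "func_id (lfoot m)" "func_id (rfoot m)"])
      (auto simp: ids inv1 in_cell_iff)
  have dc: "ccomp E ?d c = cid E n"
  proof (rule in_cell_eqI[of _ n n "func_id (lfoot n)" "func_id (rfoot n)"])
    show "in_cell E (ccomp E ?d c) n n (func_id (lfoot n)) (func_id (rfoot n))"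
      using in_cell_ccomp[OF d c] by (simp add: ids feet)
    fix b assume "b \<in> apex n"
    then obtain a where "a \<in> apex m" "b = sm_map c a" using im by auto
    then show "sm_map (ccomp E ?d c) b = sm_map (cid E n) b"
      using inv1 \<open>b \<in> apex n\<close> by simp
  qed (rule in_cell_cid[OF sp(2)])
  have inv: "cell_inverse E c ?d"
    using in_cell_bd[OF c] in_cell_bd[OF d] cd dc by (simp add: cell_inverse_def)
  \<comment> \<open>\<open>cell_inverse\<close> does not fix the arrows of \<open>e\<close>. They
    are read off from the composite of \<open>e\<close> with \<open>c\<close>, which is an identity
    cell, because the arrows of \<open>c\<close> are themselves identities.\<close>
  have uniq: "e = ?d" if e: "cell_inverse E c e" for e
  proof -
    have e': "e \<in> span_maps small" "sm_dom e = n" "sm_cod e = m"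
        "ccomp E c e = cid E m" "ccomp E e c = cid E n"
      using e c by (auto simp: cell_inverse_def in_cell_iff)
    note ein = in_cell_self[OF e'(1), unfolded e'(2,3)]
    have "sm_left (ccomp E e c) = func_id (lfoot m)" "sm_right (ccomp E e c) = func_id (rfoot m)"
      using e'(5) feet by simp_all
    moreover have "sm_left (ccomp E e c) = sm_left e" "sm_right (ccomp E e c) = sm_right e"
      using c in_cell_frame[OF ein]
      by (auto simp: in_cell_iff frame_def intro!: func_comp_id_right)
    ultimately have "in_cell E e n m (func_id (lfoot m)) (func_id (rfoot m))"
      using ein by simp
    then show "e = ?d"
    proof (rule in_cell_eqI[OF _ d])
      fix b assume "b \<in> apex n"
      then obtain a where a: "a \<in> apex m" "b = sm_map c a" using im by auto
      have "sm_map (ccomp E c e) a = a" using e'(4) a by simp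
      then have "sm_map e b = a" using a c by (simp add: in_cell_iff)
      then show "sm_map e b = sm_map ?d b"
        using a inv1 \<open>b \<in> apex n\<close> by simp
    qed
  qed
  have eq: "cinv E c = ?d"
    unfolding cinv_def by (rule the_equality) (fact inv, rule uniq)
  show "cell_inverse E c (cinv E c)"
    "in_cell E (cinv E c) n m (func_id (lfoot m)) (func_id (rfoot m))"
    using inv d by (simp_all add: eq)
  show "sm_map (cinv E c) (sm_map c a) = a" if "a \<in> apex m"
    using inv1[OF that] in_cell_map[OF c that] by (simp add: eq)
qed

text \<open>The inverse inserts the left leg as first component. In this form the inverse unit
  constraints enter the naturality axioms: they make the component of a transformation at an arrow
  be evaluated at a leg.\<close>

lemma bij_lunit: "m \<in> spans small ==> bij_betw (sm_map (lunit E m)) (pullback pair (span_id (lfoot m)) m) (apex m)"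
  by (rule bij_betw_byWitness[where f' = "\<lambda>b. pair (lleg m b) b"])
    (auto simp: pullback_def dest: spans_legs)

lemma bij_runit: "m \<in> spans small ==> bij_betw (sm_map (runit E m)) (pullback pair m (span_id (rfoot m))) (apex m)"
  by (rule bij_betw_byWitness[where f' = "\<lambda>b. pair b (rleg m b)"])
    (auto simp: pullback_def dest: spans_legs)

lemma
  assumes m: "m \<in> spans small"
  shows in_cell_cinv_lunit: "in_cell E (cinv E (lunit E m)) m (span_comp pair (span_id (lfoot m)) m)
          (func_id (lfoot m)) (func_id (rfoot m))"
    and cinv_lunit: "b \<in> apex m ==> sm_map (cinv E (lunit E m)) b = pair (lleg m b) b"
  using cinv_cell[OF _ _, of "lunit E m" "span_comp pair (span_id (lfoot m)) m" m]
    in_cell_lunit[OF m] bij_lunit[OF m] spans_legs[OF m]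
   apply simp
  using cinv_cell(3)[of "lunit E m" "span_comp pair (span_id (lfoot m)) m" m "pair (lleg m b) b"]
    in_cell_lunit[OF m] bij_lunit[OF m] spans_legs[OF m]
  by simp

lemma
  assumes m: "m \<in> spans small"
  shows in_cell_cinv_runit: "in_cell E (cinv E (runit E m)) m (span_comp pair m (span_id (rfoot m)))
          (func_id (lfoot m)) (func_id (rfoot m))"
    and cinv_runit: "b \<in> apex m ==> sm_map (cinv E (runit E m)) b = pair b (rleg m b)"
  using cinv_cell[OF _ _, of "runit E m" "span_comp pair m (span_id (rfoot m))" m]
    in_cell_runit[OF m] bij_runit[OF m] spans_legs[OF m]
   apply simp
  using cinv_cell(3)[of "runit E m" "span_comp pair m (span_id (rfoot m))" m "pair b (rleg m b)"]
    in_cell_runit[OF m] bij_runit[OF m] spans_legs[OF m]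
  by simp

end

section \<open>Theories with only identity proarrows\<close>

text \<open>A proarrow is named by the object whose identity it is. Hence composable proarrows are
  equal, \<open>pcomp\<close> returns its first argument, and the domain and codomain of a cell are
  the common ends of its two parallel boundary arrows.\<close>

locale simple_theory =
  fixes T :: "('o, 'a, 'o, 'c) dbl"
  assumes carriers [simp]: "Ob T = UNIV" "Pr T = UNIV" "psrc T = (\<lambda>x. x)" "ptgt T = (\<lambda>x. x)"
      "pid T = (\<lambda>x. x)" "pcomp T = (\<lambda>x y. x)"
    and arrows: "category UNIV (Ar T) (adom T) (acod T) (aid T) (acomp T)"
    and cells: "category UNIV (Ce T) (cdom T) (ccod T) (cid T) (ccomp T)"
    and cell_boundary [simp]: "c \<in> Ce T ==> csrc T c \<in> Ar T" "c \<in> Ce T ==> ctgt T c \<in> Ar T"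
      "c \<in> Ce T ==> adom T (csrc T c) = cdom T c" "c \<in> Ce T ==> acod T (csrc T c) = ccod T c"
      "c \<in> Ce T ==> adom T (ctgt T c) = cdom T c" "c \<in> Ce T ==> acod T (ctgt T c) = ccod T c"
    and cid_boundary [simp]: "csrc T (cid T x) = aid T x" "ctgt T (cid T x) = aid T x"
    and ccomp_boundary [simp]:
      "c \<in> Ce T ==> d \<in> Ce T ==> ccod T c = cdom T d ==> csrc T (ccomp T c d) = acomp T (csrc T c) (csrc T d)"
      "c \<in> Ce T ==> d \<in> Ce T ==> ccod T c = cdom T d ==> ctgt T (ccomp T c d) = acomp T (ctgt T c) (ctgt T d)"
    and idcell_in_cell: "f \<in> Ar T ==> in_cell T (idcell T f) (adom T f) (acod T f) f f"
    and idcell_aid [simp]: "idcell T (aid T x) = cid T x"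
    and idcell_acomp: "f \<in> Ar T ==> g \<in> Ar T ==> acod T f = adom T g ==>
      idcell T (acomp T f g) = ccomp T (idcell T f) (idcell T g)"
    and hcomp_in_cell: "c \<in> Ce T ==> d \<in> Ce T ==> ctgt T c = csrc T d ==>
      in_cell T (hcomp T c d) (cdom T c) (ccod T c) (csrc T c) (ctgt T d)"
    and hcomp_units [simp]: "c \<in> Ce T ==> hcomp T (idcell T (csrc T c)) c = c"
      "c \<in> Ce T ==> hcomp T c (idcell T (ctgt T c)) = c"
begin

lemma ar [simp]:
  "aid T x \<in> Ar T" "adom T (aid T x) = x" "acod T (aid T x) = x"
  "f \<in> Ar T ==> g \<in> Ar T ==> acod T f = adom T g ==> acomp T f g \<in> Ar T"
  "f \<in> Ar T ==> g \<in> Ar T ==> acod T f = adom T g ==> adom T (acomp T f g) = adom T f"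
  "f \<in> Ar T ==> g \<in> Ar T ==> acod T f = adom T g ==> acod T (acomp T f g) = acod T g"
  "f \<in> Ar T ==> acomp T (aid T (adom T f)) f = f" "f \<in> Ar T ==> acomp T f (aid T (acod T f)) = f"
  using arrows by (auto simp: category_def)

lemma ce [simp]:
  "cid T x \<in> Ce T" "cdom T (cid T x) = x" "ccod T (cid T x) = x"
  "c \<in> Ce T ==> d \<in> Ce T ==> ccod T c = cdom T d ==> ccomp T c d \<in> Ce T"
  "c \<in> Ce T ==> d \<in> Ce T ==> ccod T c = cdom T d ==> cdom T (ccomp T c d) = cdom T c"
  "c \<in> Ce T ==> d \<in> Ce T ==> ccod T c = cdom T d ==> ccod T (ccomp T c d) = ccod T d"
  "c \<in> Ce T ==> ccomp T (cid T (cdom T c)) c = c" "c \<in> Ce T ==> ccomp T c (cid T (ccod T c)) = c"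
  using cells by (auto simp: category_def)

lemma idc [simp]:
  "f \<in> Ar T ==> idcell T f \<in> Ce T" "f \<in> Ar T ==> cdom T (idcell T f) = adom T f"
  "f \<in> Ar T ==> ccod T (idcell T f) = acod T f" "f \<in> Ar T ==> csrc T (idcell T f) = f"
  "f \<in> Ar T ==> ctgt T (idcell T f) = f"
  using idcell_in_cell[of f] by (auto simp: in_cell_def)

lemma hc [simp]:
  assumes "c \<in> Ce T" "d \<in> Ce T" "ctgt T c = csrc T d"
  shows "hcomp T c d \<in> Ce T" "cdom T (hcomp T c d) = cdom T c" "ccod T (hcomp T c d) = ccod T c"
    "csrc T (hcomp T c d) = csrc T c" "ctgt T (hcomp T c d) = ctgt T d"
  using hcomp_in_cell[OF assms] by (auto simp: in_cell_def)

text \<open>The shared middle arrow determines the ends of both cells, so an externally composable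
  pair lies over a single pair of objects.\<close>

lemma hcomp_dom:
  assumes "c \<in> Ce T" "d \<in> Ce T" "ctgt T c = csrc T d"
  shows "cdom T d = cdom T c" "ccod T d = ccod T c"
  using cell_boundary(3-6)[OF assms(1)] cell_boundary(3-6)[OF assms(2)] assms(3) by auto

end

lemma simple_theory_order: "simple_theory (order_dbl :: ('o::order, 'o \<times> 'o, 'o, 'o \<times> 'o) dbl)"
  by unfold_locales (auto simp: order_dbl_def category_def in_cell_def)

section \<open>Theories presented by generators and relations\<close>

lemma gcomp_nil: "gcomp (fst p, []) p = p" "gcomp p (x, []) = p"
  by (simp_all add: gcomp_def)

lemma fst_gcomp [simp]: "fst (gcomp p q) = fst p"
  by (simp add: gcomp_def)

lemma gcomp_assoc: "gcomp (gcomp p q) r = gcomp p (gcomp q r)"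
  by (simp add: gcomp_def)

lemma gend_append: "gend P (x, fs @ gs) = gend P (gend P (x, fs), gs)"
  by (induction fs arbitrary: x) auto

lemma gwf_append: "gwf P x (fs @ gs) \<longleftrightarrow> gwf P x fs \<and> gwf P (gend P (x, fs)) gs"
  by (induction fs arbitrary: x) auto

lemma gend_gcomp: "fst q = gend P p ==> gend P (gcomp p q) = gend P q"
  by (cases p; cases q) (simp add: gcomp_def gend_append)

lemma gwf_gcomp:
  "fst p = x ==> gwf P x (snd (gcomp p q)) \<longleftrightarrow> gwf P x (snd p) \<and> gwf P (gend P p) (snd q)"
  by (cases p) (auto simp: gcomp_def gwf_append)

locale wf_presentation =
  fixes P :: "('o, 'a, 'k) presentation"
  assumes gens: "gwf P (fst (gsrc P k)) (snd (gsrc P k))" "gwf P (fst (gsrc P k)) (snd (gtgt P k))"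
      "fst (gtgt P k) = fst (gsrc P k)" "gend P (gtgt P k) = gend P (gsrc P k)"
    and rels_wf: "(s, t) \<in> rels P ==> twf P s \<and> twf P t \<and> tsrc P s = tsrc P t \<and> ttgt P s = ttgt P t"
begin

lemma term_boundary:
  "twf P t ==> gwf P (fst (tsrc P t)) (snd (tsrc P t)) \<and> gwf P (fst (tsrc P t)) (snd (ttgt P t)) \<and>
    fst (ttgt P t) = fst (tsrc P t) \<and> gend P (ttgt P t) = gend P (tsrc P t)"
proof (induction t)
  case (Vert s t)
  then show ?case by (auto simp: gwf_gcomp gend_gcomp)
qed (auto simp: gens)

lemma term_paths:
  "twf P t ==> tsrc P t = (x, fs) ==> gwf P x fs" "twf P t ==> ttgt P t = (x, fs) ==> gwf P x fs"
  using term_boundary[of t] by auto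

text \<open>Every rule of the congruence preserves typing and both boundary paths. The boundary of a
  class is therefore that of any of its members, although \<open>presented\<close> defines it
  through the chosen representative \<open>trep\<close>.\<close>

lemma teq_wf: "teq P s t ==> twf P s \<and> twf P t \<and> tsrc P s = tsrc P t \<and> ttgt P s = ttgt P t"
proof (induction rule: teq.induct)
  case (13 p q)
  then show ?case by (simp add: gwf_gcomp gend_gcomp)
next
  case (14 s t s' t')
  \<comment> \<open>The factors of an external composite run between the same two objects, so the
    second factors can be composed as soon as the first ones can.\<close>
  then have "gend P (tsrc P t) = fst (tsrc P t')"
    using term_boundary[of s] term_boundary[of s'] by simp
  with 14 show ?case by simp
next
  case (8 t)
  then show ?case using gcomp_nil(1)[of "ttgt P t"] by (simp add: gcomp_nil term_boundary)
qed (auto simp: gcomp_nil gcomp_assoc rels_wf gwf_gcomp gend_gcomp term_boundary)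

lemma tclass_eq: "teq P s t ==> tclass P s = tclass P t"
  unfolding tclass_def using teq.intros(3,4) by blast

lemma teq_trep: "twf P t ==> teq P (trep (tclass P t)) t"
  unfolding trep_def tclass_def by (rule someI2[of _ t]) (auto intro: teq.intros(2))

lemma trep [simp]:
  assumes "twf P t"
  shows "twf P (trep (tclass P t))" "tsrc P (trep (tclass P t)) = tsrc P t"
    "ttgt P (trep (tclass P t)) = ttgt P t" "tclass P (trep (tclass P t)) = tclass P t"
  using teq_wf[OF teq_trep[OF assms]] tclass_eq[OF teq_trep[OF assms]] by auto

text \<open>The operations of \<open>presented\<close> act on chosen representatives. The congruence
  rules undo the choice, here and in \<open>tclass_Ext\<close>; after that the laws of a double
  category are literally rules of \<open>teq\<close>.\<close>

lemma tclass_Vert: "twf P (s \<cdot>\<cdot> t) ==> tclass P (trep (tclass P s) \<cdot>\<cdot> trep (tclass P t)) = tclass P (s \<cdot>\<cdot> t)"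
  by (rule tclass_eq, rule teq.intros(5)) (auto intro: teq_trep)

lemma tclass_Ext: "twf P (s \<odot>\<odot> t) ==> tclass P (trep (tclass P s) \<odot>\<odot> trep (tclass P t)) = tclass P (s \<odot>\<odot> t)"
  by (rule tclass_eq, rule teq.intros(6)) (auto intro: teq_trep)

lemma tclass_Vert_id: "twf P t ==> tclass P (IdC (fst (tsrc P t), []) \<cdot>\<cdot> t) = tclass P t"
  "twf P t ==> tclass P (t \<cdot>\<cdot> IdC (gend P (tsrc P t), [])) = tclass P t"
  by (rule tclass_eq, erule teq.intros(8)) (rule tclass_eq, erule teq.intros(9))

lemma tclass_Vert_assoc: "twf P (s \<cdot>\<cdot> t \<cdot>\<cdot> u) ==> tclass P (s \<cdot>\<cdot> t \<cdot>\<cdot> u) = tclass P (s \<cdot>\<cdot> (t \<cdot>\<cdot> u))"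
  by (rule tclass_eq, erule teq.intros(7))

lemma tclass_Ext_id: "twf P t ==> tclass P (IdC (tsrc P t) \<odot>\<odot> t) = tclass P t"
  "twf P t ==> tclass P (t \<odot>\<odot> IdC (ttgt P t)) = tclass P t"
  by (rule tclass_eq, erule teq.intros(11)) (rule tclass_eq, erule teq.intros(12))

lemma tclass_Ext_id':
  "twf P t ==> tclass P (trep (tclass P (IdC (tsrc P t))) \<odot>\<odot> trep (tclass P t)) = tclass P t"
  "twf P t ==> tclass P (trep (tclass P t) \<odot>\<odot> trep (tclass P (IdC (ttgt P t)))) = tclass P t"
  by (simp_all add: tclass_Ext tclass_Ext_id term_boundary)

lemma tclass_IdC_Vert: "twf P (IdC p \<cdot>\<cdot> IdC q) ==> tclass P (IdC p \<cdot>\<cdot> IdC q) = tclass P (IdC (gcomp p q))"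
  by (rule tclass_eq, erule teq.intros(13))

lemma simple_theory_presented: "simple_theory (presented P)"
proof
  let ?T = "presented P"
  show "category UNIV (Ar ?T) (adom ?T) (acod ?T) (aid ?T) (acomp ?T)"
    by (auto simp: category_def presented_def gcomp_def gwf_append gend_append split: prod.splits)
  have wf3: "twf P (s \<cdot>\<cdot> t \<cdot>\<cdot> u)" if "twf P s" "twf P t" "twf P u"
      "gend P (tsrc P s) = fst (tsrc P t)" "gend P (tsrc P t) = fst (tsrc P u)" for s t u
    using that by (simp add: gend_gcomp)
  show "category UNIV (Ce ?T) (cdom ?T) (ccod ?T) (cid ?T) (ccomp ?T)"
    unfolding category_def
  proof (intro conjI ballI impI; (elim conjE)?)
    fix C C' C'' assume "C \<in> Ce ?T" "C' \<in> Ce ?T" "C'' \<in> Ce ?T"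
      and *: "ccod ?T C = cdom ?T C'" "ccod ?T C' = cdom ?T C''"
    then obtain s t u where stu: "C = tclass P s" "C' = tclass P t" "C'' = tclass P u" "twf P s" "twf P t" "twf P u"
      by (auto simp: presented_def)
    then have ends: "gend P (tsrc P s) = fst (tsrc P t)" "gend P (tsrc P t) = fst (tsrc P u)"
      using * by (auto simp: presented_def)
    show "ccomp ?T (ccomp ?T C C') C'' = ccomp ?T C (ccomp ?T C' C'')"
      using stu ends wf3[OF stu(4-6) ends]
      by (simp add: presented_def tclass_Vert tclass_Vert_assoc)
  qed (auto simp: presented_def gend_gcomp tclass_Vert tclass_Vert_id term_boundary)
qed (auto simp: presented_def in_cell_def tclass_Ext tclass_Ext_id tclass_Ext_id' tclass_Vert tclass_IdC_Vert
      term_boundary gend_gcomp dest: term_paths)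

end

lemma simple_theory_transformations: "simple_theory theory_of_transformations"
  unfolding theory_of_transformations_def
  by (rule wf_presentation.simple_theory_presented, unfold_locales) auto

lemma simple_theory_adjunctions: "simple_theory theory_of_adjunctions"
  unfolding theory_of_adjunctions_def
  by (rule wf_presentation.simple_theory_presented, unfold_locales)
    (auto simp: Let_def gcomp_def split: adj_ce.splits)

lemma simple_theory_monads: "simple_theory theory_of_monads"
  unfolding theory_of_monads_def
  by (rule wf_presentation.simple_theory_presented, unfold_locales)
    (auto simp: Let_def gcomp_def monad_rels_def split: mnd_ce.splits)

lemma simple_theory_Frobenius_monads: "simple_theory theory_of_Frobenius_monads"
  unfolding theory_of_Frobenius_monads_def
  by (rule wf_presentation.simple_theory_presented, unfold_locales)
    (auto simp: Let_def gcomp_def monad_rels_def split: frob_ce.splits)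

section \<open>Paths of spans\<close>

text \<open>An element of an iterated composite of spans as the list of its components: adjacent
  legs match, and \<open>p\<close> and \<open>q\<close> are the outer legs. Over the empty path,
  whose composite is an identity span, the element is the point \<open>p = q\<close> itself, which
  is why the end points are kept as arguments.\<close>

fun chain :: "'u span list \<Rightarrow> 'u \<Rightarrow> 'u list \<Rightarrow> 'u \<Rightarrow> bool" where
  "chain [] p [] q \<longleftrightarrow> p = q"
| "chain (m # ms) p (e # es) q \<longleftrightarrow> e \<in> apex m \<and> lleg m e = p \<and> chain ms (rleg m e) es q"
| "chain _ _ _ _ \<longleftrightarrow> False"

lemma chain_Nil_iff: "chain [] p es q \<longleftrightarrow> es = [] \<and> p = q"
  by (cases es) auto

lemma chain_Cons_iff: "chain (m # ms) p es q \<longleftrightarrow>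
    (\<exists>e es'. es = e # es' \<and> e \<in> apex m \<and> lleg m e = p \<and> chain ms (rleg m e) es' q)"
  by (cases es) auto

lemma chain_length: "chain ms p es q ==> length es = length ms"
  by (induction ms p es q rule: chain.induct) auto

lemma chain_end: "chain ms p es q ==> chain ms p es q' ==> q = q'"
  by (induction ms p es q rule: chain.induct) auto

lemma chain_append: "chain ms p es q ==> chain (ms @ ns) p (es @ ds) r \<longleftrightarrow> chain ns q ds r"
  by (induction ms p es q rule: chain.induct) auto

lemma chain_split: "chain (ms @ ns) p zs r ==> \<exists>es ds q. zs = es @ ds \<and> chain ms p es q \<and> chain ns q ds r"
proof (induction ms arbitrary: p zs)
  case Nil
  then show ?case by (intro exI[of _ "[]"] exI[of _ zs]) auto
next
  case (Cons m ms)
  then obtain e zs' where e: "zs = e # zs'" "e \<in> apex m" "lleg m e = p" "chain (ms @ ns) (rleg m e) zs' r"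
    by (auto simp: chain_Cons_iff)
  with Cons.IH obtain es ds q where "zs' = es @ ds" "chain ms (rleg m e) es q" "chain ns q ds r"
    by blast
  with e show ?case by (intro exI[of _ "e # es"] exI[of _ ds] exI[of _ q]) auto
qed

context span_universe
begin

lemma legs [simp]:
  "m \<in> spans small ==> a \<in> apex m ==> lleg m a \<in> lfoot m"
  "m \<in> spans small ==> a \<in> apex m ==> rleg m a \<in> rfoot m"
  by (auto dest: spans_legs)

text \<open>The nested pair that a chain denotes, bracketed to the right as in
  \<open>pcomps\<close>. The starting point is the whole value for the empty list and is irrelevant
  otherwise (\<open>enc_start_irrelevant\<close>).\<close>

fun enc :: "'u \<Rightarrow> 'u list \<Rightarrow> 'u" where
  "enc p [] = p"
| "enc p [e] = e"
| "enc p (e # e' # es) = pair e (enc p (e' # es))"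

lemma is_path_append: "is_path E A (ms @ ns) ==> is_path E A ms \<and> is_path E (path_end E A ms) ns"
proof (induction ms arbitrary: A)
  case Nil
  then show ?case by (cases ns) (auto simp: spans_def)
qed auto

lemma is_path_appendI: "is_path E A ms ==> is_path E (path_end E A ms) ns ==> is_path E A (ms @ ns)"
  by (induction ms arbitrary: A) auto

lemma is_path_start: "is_path E A ms ==> small A"
  by (cases ms) (auto simp: spans_def)

lemma path_end_append: "path_end D A (ms @ ns) = path_end D (path_end D A ms) ns"
  by (induction ms arbitrary: A) auto

lemma is_path_end: "is_path E A ms ==> small (path_end E A ms)"
  by (induction ms arbitrary: A) auto

lemma pcomps_spans:
  "is_path E A ms ==> pcomps E A ms \<in> spans small \<and> lfoot (pcomps E A ms) = A \<and>
     rfoot (pcomps E A ms) = path_end E A ms"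
  by (induction ms arbitrary: A rule: induct_list012) (auto intro: span_id_spans span_comp_spans)

lemma enc_in_pcomps:
  "is_path E A ms ==> p \<in> A ==> chain ms p es q ==> enc p es \<in> apex (pcomps E A ms) \<and>
     lleg (pcomps E A ms) (enc p es) = p \<and> rleg (pcomps E A ms) (enc p es) = q"
proof (induction ms arbitrary: A p es rule: induct_list012)
  case (3 m n ns)
  then obtain e es' where es: "es = e # es'" "e \<in> apex m" "lleg m e = p" "chain (n # ns) (rleg m e) es' q"
    by (auto simp: chain_Cons_iff)
  then obtain e' es'' where es': "es' = e' # es''" by (auto simp: chain_Cons_iff)
  have "rleg m e \<in> rfoot m" using 3 es by auto
  then have IH: "enc (rleg m e) es' \<in> apex (pcomps E (rfoot m) (n # ns)) \<and>
      lleg (pcomps E (rfoot m) (n # ns)) (enc (rleg m e) es') = rleg m e \<and>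
      rleg (pcomps E (rfoot m) (n # ns)) (enc (rleg m e) es') = q"
    using 3 es by (intro "3.IH") auto
  moreover have "enc (rleg m e) (e' # es'') = enc p (e' # es'')"
    by (induction es'' arbitrary: e') auto
  ultimately show ?case using es es' by simp
qed (auto simp: chain_Nil_iff chain_Cons_iff)

lemma enc_start_irrelevant: "es \<noteq> [] ==> enc p es = enc p' es"
  by (induction es rule: induct_list012) auto

text \<open>Together with \<open>enc_in_pcomps\<close> and \<open>enc_inject\<close> this identifies
  the apex of a composite with the set of chains. Cells out of a composite can from here on be
  compared at the values \<open>enc p es\<close>.\<close>

lemma pcomps_cases:
  "is_path E A ms ==> z \<in> apex (pcomps E A ms) ==> \<exists>p es q. p \<in> A \<and> chain ms p es q \<and> z = enc p es"
proof (induction ms arbitrary: A z rule: induct_list012)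
  case 1
  then show ?case by (intro exI[of _ z] exI[of _ "[]"]) auto
next
  case (2 m)
  then show ?case by (intro exI[of _ "lleg m z"] exI[of _ "[z]"] exI[of _ "rleg m z"]) auto
next
  case (3 m n ns)
  then obtain e z' where z: "z = pair e z'" "e \<in> apex m" "z' \<in> apex (pcomps E (rfoot m) (n # ns))"
    "rleg m e = lleg (pcomps E (rfoot m) (n # ns)) z'"
    by (auto simp: pullback_def)
  obtain p es q where es: "p \<in> rfoot m" "chain (n # ns) p es q" "z' = enc p es"
    using "3.IH"(2)[OF _ z(3)] 3 by fastforce
  then have "rleg m e = p"
    using z enc_in_pcomps[OF _ es(1,2)] 3 by auto
  moreover obtain e' es' where "es = e' # es'" using es by (auto simp: chain_Cons_iff)
  ultimately show ?case
    using z es 3 by (intro exI[of _ "lleg m e"] exI[of _ "e # es"] exI[of _ q])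
      (auto dest: spans_legs intro: enc_start_irrelevant)
qed

lemma enc_inject:
  "chain ms p es q ==> chain ms p' es' q' ==> enc p es = enc p' es' ==> p = p' \<and> es = es'"
proof (induction ms arbitrary: p p' es es' rule: induct_list012)
  case (3 m n ns)
  from "3.prems"(1,2) obtain e ds e' ds' where es: "es = e # ds" "e \<in> apex m" "lleg m e = p" "chain (n # ns) (rleg m e) ds q"
      "es' = e' # ds'" "e' \<in> apex m" "lleg m e' = p'" "chain (n # ns) (rleg m e') ds' q'"
    by (auto simp: chain_Cons_iff)
  then have "ds \<noteq> []" "ds' \<noteq> []" by (auto simp: chain_Cons_iff)
  then have *: "enc p es = pair e (enc (rleg m e) ds)" "enc p' es' = pair e' (enc (rleg m e') ds')"
    unfolding es(1,5) by (auto simp: neq_Nil_conv intro: enc_start_irrelevant)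
  have e: "e = e'" "enc (rleg m e) ds = enc (rleg m e') ds'"
    using "3.prems"(3) unfolding * by auto
  then have "ds = ds'"
    using "3.IH"(2)[OF es(4,8)] by blast
  then show ?case using es(1,3,5,7) e by simp
next
  case (2 m)
  from "2.prems" show ?case by (auto simp: chain_Nil_iff chain_Cons_iff)
qed (simp add: chain_Nil_iff)

lemma hcomps_in_cell:
  "is_cpath E f cs ==> is_path E (func_dom f) (map sm_dom cs) \<and> is_path E (func_cod f) (map sm_cod cs) \<and>
     in_cell E (hcomps E f cs) (pcomps E (func_dom f) (map sm_dom cs))
       (pcomps E (func_cod f) (map sm_cod cs)) f (cpath_end E f cs)"
proof (induction cs arbitrary: f rule: induct_list012)
  case 1
  then show ?case by (auto simp: funcs_def intro: in_cell_idcell)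
next
  case (2 c)
  then show ?case using in_cell_frame[OF in_cell_self, of c] in_cell_self[of c]
    by (auto simp: frame_def spans_def)
next
  case (3 c d ds)
  then have "is_cpath E (sm_right c) (d # ds)" by simp
  note IH = "3.IH"(2)[OF this]
  have c: "c \<in> span_maps small" "sm_left c = f" using 3 by auto
  note fr = frameD[OF in_cell_frame[OF in_cell_self[OF c(1)]]]
  show ?case
    using IH fr c in_cell_hcomp[OF in_cell_self[OF c(1)]] by auto
qed

text \<open>\<open>hcomps\<close> and \<open>pcomps\<close> are bracketed alike, so an external
  composite acts on a list entry by entry. The starting point is moved along the first arrow, which
  is all that happens for the empty list.\<close>

lemma hcomps_elem:
  "is_cpath E f cs ==> p \<in> func_dom f ==> chain (map sm_dom cs) p es q ==>
     chain (map sm_cod cs) (func_map f p) (map2 sm_map cs es) (func_map (cpath_end E f cs) q) \<and>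
     sm_map (hcomps E f cs) (enc p es) = enc (func_map f p) (map2 sm_map cs es)"
proof (induction cs arbitrary: f p es rule: induct_list012)
  case 1
  then show ?case by (auto simp: chain_Nil_iff)
next
  case (2 c)
  then show ?case using in_cell_map[OF in_cell_self, of c] by (auto simp: chain_Nil_iff chain_Cons_iff)
next
  case (3 c d ds)
  then have r: "is_cpath E (sm_right c) (d # ds)" and c: "c \<in> span_maps small" "sm_left c = f" by auto
  note fr = frameD[OF in_cell_frame[OF in_cell_self[OF c(1)]]]
  obtain e es' where es: "es = e # es'" "e \<in> apex (sm_dom c)" "lleg (sm_dom c) e = p"
      "chain (map sm_dom (d # ds)) (rleg (sm_dom c) e) es' q"
    using 3 by (auto simp: chain_Cons_iff)
  obtain e' es'' where es': "es' = e' # es''" using es by (auto simp: chain_Cons_iff)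
  have re: "rleg (sm_dom c) e \<in> func_dom (sm_right c)" using es fr by auto
  note IH = "3.IH"(2)[OF r re es(4)]
  note ce = in_cell_map[OF in_cell_self[OF c(1)] es(2)]
  have path: "is_path E (func_dom (sm_right c)) (map sm_dom (d # ds))"
    using hcomps_in_cell[OF r] by simp
  have mem: "pair e (enc p es') \<in> pullback pair (sm_dom c) (pcomps E (func_dom (sm_right c)) (map sm_dom (d # ds)))"
    using enc_in_pcomps[OF path re es(4)] es(2) es' enc_start_irrelevant[of es' p "rleg (sm_dom c) e"] by simp
  have "sm_map (hcomps E f (c # d # ds)) (enc p es) = pair (sm_map c e) (sm_map (hcomps E (sm_right c) (d # ds)) (enc p es'))"
    using mem hcomps_in_cell[OF r] by (simp add: es(1) es' in_cell_iff del: pair_in_pullback)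
  also have "enc p es' = enc (rleg (sm_dom c) e) es'"
    using es' by (simp add: enc_start_irrelevant)
  finally show ?case
    using IH ce es(1-3) es' c fr by (auto intro: enc_start_irrelevant)
qed

lemma join_in_cell:
  "is_path E A ms ==> is_path E (path_end E A ms) ns ==>
   in_cell E (join E A ms ns) (span_comp pair (pcomps E A ms) (pcomps E (path_end E A ms) ns))
     (pcomps E A (ms @ ns)) (func_id A) (func_id (path_end E A (ms @ ns)))"
proof (induction ms arbitrary: A rule: induct_list012)
  case 1
  then show ?case using pcomps_spans[of A ns] in_cell_lunit[of "pcomps E A ns"] by simp
next
  case (2 m)
  then have m: "m \<in> spans small" "lfoot m = A" by auto
  show ?case
  proof (cases ns)
    case Nil
    then show ?thesis using m in_cell_runit[of m] by simp
  next
    case (Cons n ns')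
    then show ?thesis
      using m 2 pcomps_spans[of "rfoot m" ns] in_cell_cid[of "span_comp pair m (pcomps E (rfoot m) ns)"]
        span_comp_spans[of m "pcomps E (rfoot m) ns"] by simp
  qed
next
  case (3 m m' ms)
  let ?B = "path_end E (rfoot m) (m' # ms)"
  have m: "m \<in> spans small" "lfoot m = A" and path: "is_path E (rfoot m) (m' # ms)" "is_path E ?B ns"
    using 3 by auto
  note ps = pcomps_spans[OF path(1)] pcomps_spans[OF path(2)]
  have as: "in_cell E (assoc E m (pcomps E (rfoot m) (m' # ms)) (pcomps E ?B ns))
      (span_comp pair (span_comp pair m (pcomps E (rfoot m) (m' # ms))) (pcomps E ?B ns))
      (span_comp pair m (span_comp pair (pcomps E (rfoot m) (m' # ms)) (pcomps E ?B ns)))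
      (func_id A) (func_id (path_end E (rfoot m) (m' # ms @ ns)))"
    using in_cell_assoc[of m "pcomps E (rfoot m) (m' # ms)" "pcomps E ?B ns"] m ps
    by (simp add: path_end_append)
  have IH: "in_cell E (join E (rfoot m) (m' # ms) ns)
      (span_comp pair (pcomps E (rfoot m) (m' # ms)) (pcomps E ?B ns))
      (pcomps E (rfoot m) (m' # ms @ ns)) (func_id (rfoot m)) (func_id (path_end E (rfoot m) (m' # ms @ ns)))"
    using "3.IH"(2)[of "rfoot m"] path by simp
  have small: "small A" "small (path_end E (rfoot m) (m' # ms @ ns))"
    using m spans_feet[OF m(1)] is_path_end[OF path(2)] by (auto simp: path_end_append)
  have ids: "func_comp (func_id X) (func_id X) = func_id X" if "small X" for X
    using func_comp_id_left[OF func_id_funcs, of small X X] that by simp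
  show ?case
    using in_cell_ccomp[OF as in_cell_hcomp[OF in_cell_cid[OF m(1)] IH, unfolded m(2)],
        unfolded ids[OF small(1)] ids[OF small(2)]] by simp
qed

text \<open>On lists the coherence isomorphism \<open>join\<close> is concatenation. Associativity
  constraints re-bracket pairs that encode the same list, and unit constraints drop an end point
  that is already determined by a neighbour.\<close>

lemma join_elem:
  "is_path E A ms ==> is_path E (path_end E A ms) ns ==> p \<in> A ==> chain ms p es q ==> chain ns q ds r ==>
   sm_map (join E A ms ns) (pair (enc p es) (enc q ds)) = enc p (es @ ds)"
proof (induction ms arbitrary: A p es rule: induct_list012)
  case 1
  then show ?case using pcomps_spans[of A ns] enc_in_pcomps[of A ns p ds r] by (simp add: chain_Nil_iff)
next
  case (2 m)
  then have m: "m \<in> spans small" "lfoot m = A" by auto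
  have es: "es = [enc p es]" "enc p es \<in> apex m" "rleg m (enc p es) = q"
    using 2 by (auto simp: chain_Cons_iff chain_Nil_iff)
  have q: "q \<in> rfoot m" using es spans_legs[OF m(1)] by auto
  show ?case
  proof (cases ns)
    case Nil
    then show ?thesis using m q es 2 by (auto simp: chain_Nil_iff chain_Cons_iff)
  next
    case (Cons n ns')
    then obtain d ds' where ds: "ds = d # ds'" using 2 by (auto simp: chain_Cons_iff)
    have mem: "enc q ds \<in> apex (pcomps E (rfoot m) ns) \<and> lleg (pcomps E (rfoot m) ns) (enc q ds) = q"
      using enc_in_pcomps[of "rfoot m" ns q ds r] 2 q by auto
    have "sm_map (join E A [m] ns) (pair (enc p es) (enc q ds)) = pair (enc p es) (enc q ds)"
      using mem es(2,3) Cons by simp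
    also have "... = enc p ([enc p es] @ ds)"
      using ds enc_start_irrelevant[of ds q p] by simp
    also have "... = enc p (es @ ds)" using es(1) by simp
    finally show ?thesis .
  qed
next
  case (3 m m' ms)
  let ?B = "path_end E (rfoot m) (m' # ms)"
  let ?M = "pcomps E (rfoot m) (m' # ms)" and ?N = "pcomps E ?B ns"
  have m: "m \<in> spans small" "lfoot m = A" and path: "is_path E (rfoot m) (m' # ms)" "is_path E ?B ns"
    using 3 by auto
  obtain e es' where es: "es = e # es'" "e \<in> apex m" "lleg m e = p" "chain (m' # ms) (rleg m e) es' q"
    using 3 by (auto simp: chain_Cons_iff)
  obtain e' es'' where es': "es' = e' # es''" using es by (auto simp: chain_Cons_iff)
  let ?x = "enc (rleg m e) es'"
  have re: "rleg m e \<in> rfoot m" using es spans_legs[OF m(1)] by auto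
  note x = enc_in_pcomps[OF path(1) re es(4)]
  have "q \<in> ?B" using x spans_legs[of ?M small ?x] pcomps_spans[OF path(1)] by auto
  note y = enc_in_pcomps[OF path(2) this 3(7)]
  have enc: "enc p es = pair e ?x"
    using es es' enc_start_irrelevant[of es' p "rleg m e"] by simp
  have IH: "sm_map (join E (rfoot m) (m' # ms) ns) (pair ?x (enc q ds)) = enc (rleg m e) (es' @ ds)"
    using "3.IH"(2)[OF path re es(4) 3(7)] .
  have jd: "sm_dom (join E (rfoot m) (m' # ms) ns) = span_comp pair ?M ?N"
    using in_cell_bd[OF join_in_cell[OF path]] by simp
  have "sm_map (join E A (m # m' # ms) ns) (pair (enc p es) (enc q ds)) =
      sm_map (ccomp E (assoc E m ?M ?N) (hcomp E (cid E m) (join E (rfoot m) (m' # ms) ns)))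
        (pair (pair e ?x) (enc q ds))"
    by (simp only: join.simps enc Span_simps)
  also have "... = pair e (sm_map (join E (rfoot m) (m' # ms) ns) (pair ?x (enc q ds)))"
    using es x y jd by (simp del: join.simps pcomps.simps)
  also have "... = pair e (enc (rleg m e) (es' @ ds))"
    by (simp only: IH)
  also have "... = enc p (es @ ds)"
    using es es' by (auto intro: enc_start_irrelevant)
  finally show ?case .
qed

section \<open>Flattening a path of paths\<close>

fun comps :: "'u set \<Rightarrow> 'u span list list \<Rightarrow> 'u span list" where
  "comps A [] = []"
| "comps A (ms # mss) = pcomps E A ms # comps (path_end E A ms) mss"

text \<open>One element seen at two levels: \<open>ess\<close> cuts it into chains along the paths
  in \<open>mss\<close>, and \<open>zs\<close> lists the encodings of these pieces, which form a
  chain along the composites \<open>comps\<close>. This is the graph of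
  \<open>flatten\<close>.\<close>

fun mchain :: "'u span list list \<Rightarrow> 'u \<Rightarrow> 'u list list \<Rightarrow> 'u list \<Rightarrow> 'u \<Rightarrow> bool" where
  "mchain [] p [] [] q \<longleftrightarrow> p = q"
| "mchain (ms # mss) p (es # ess) (z # zs) q \<longleftrightarrow> z = enc p es \<and> (\<exists>r. chain ms p es r \<and> mchain mss r ess zs q)"
| "mchain _ _ _ _ _ \<longleftrightarrow> False"

lemma comps_path: "is_path E A (concat mss) ==> is_path E A (comps A mss) \<and>
    path_end E A (comps A mss) = path_end E A (concat mss)"
proof (induction mss arbitrary: A)
  case (Cons ms mss)
  then have "is_path E A ms" "is_path E (path_end E A ms) (concat mss)"
    using is_path_append[of A ms "concat mss"] by auto
  then show ?case using Cons.IH[of "path_end E A ms"] pcomps_spans[of A ms]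
    by (simp add: path_end_append)
qed auto

lemma mchain_chain:
  "is_path E A (concat mss) ==> p \<in> A ==> mchain mss p ess zs q ==>
    chain (comps A mss) p zs q \<and> chain (concat mss) p (concat ess) q"
proof (induction mss arbitrary: A p ess zs)
  case Nil
  then show ?case by (cases ess; cases zs) auto
next
  case (Cons ms mss)
  from Cons.prems(3) obtain es ess' zs' r where *: "ess = es # ess'" "zs = enc p es # zs'" "chain ms p es r"
      "mchain mss r ess' zs' q"
    by (cases ess; cases zs) auto
  have path: "is_path E A ms" "is_path E (path_end E A ms) (concat mss)"
    using is_path_append[of A ms "concat mss"] Cons.prems by auto
  note e = enc_in_pcomps[OF path(1) Cons.prems(2) *(3)]
  then have "r \<in> path_end E A ms"
    using spans_legs[of "pcomps E A ms" small] pcomps_spans[OF path(1)] by auto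
  from Cons.IH[OF path(2) this *(4)] show ?case
    using * e chain_append[OF *(3)] by auto
qed

lemma mchain_of_comps:
  "is_path E A (concat mss) ==> p \<in> A ==> chain (comps A mss) p zs q ==> \<exists>ess. mchain mss p ess zs q"
proof (induction mss arbitrary: A p zs)
  case Nil
  then show ?case by (intro exI[of _ "[]"]) (auto simp: chain_Nil_iff)
next
  case (Cons ms mss)
  have path: "is_path E A ms" "is_path E (path_end E A ms) (concat mss)"
    using is_path_append[of A ms "concat mss"] Cons.prems by auto
  obtain z zs' where z: "zs = z # zs'" "z \<in> apex (pcomps E A ms)" "lleg (pcomps E A ms) z = p"
      "chain (comps (path_end E A ms) mss) (rleg (pcomps E A ms) z) zs' q"
    using Cons.prems by (auto simp: chain_Cons_iff)
  obtain p' es r where es: "p' \<in> A" "chain ms p' es r" "z = enc p' es"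
    using pcomps_cases[OF path(1) z(2)] by auto
  then have "p' = p" "rleg (pcomps E A ms) z = r" using enc_in_pcomps[OF path(1) es(1,2)] z by auto
  moreover have "rleg (pcomps E A ms) z \<in> path_end E A ms"
    using spans_legs[of "pcomps E A ms" small] pcomps_spans[OF path(1)] z by auto
  ultimately obtain ess where "mchain mss r ess zs' q"
    using Cons.IH[OF path(2) _ z(4)] by auto
  then show ?case using es z \<open>p' = p\<close> by (intro exI[of _ "es # ess"]) auto
qed

lemma mchain_of_concat:
  "chain (concat mss) p es q ==> \<exists>ess zs. mchain mss p ess zs q \<and> concat ess = es"
proof (induction mss arbitrary: p es)
  case Nil
  then show ?case by (intro exI[of _ "[]"]) (auto simp: chain_Nil_iff)
next
  case (Cons ms mss)
  then have "chain (ms @ concat mss) p es q" by simp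
  from chain_split[OF this] obtain es1 ds r
    where *: "es = es1 @ ds" "chain ms p es1 r" "chain (concat mss) r ds q" by blast
  from Cons.IH[OF *(3)] obtain ess zs where "mchain mss r ess zs q" "concat ess = ds" by auto
  with * show ?case by (intro exI[of _ "es1 # ess"] exI[of _ "enc p es1 # zs"]) auto
qed

text \<open>The lengths of the pieces are prescribed by the paths in \<open>mss\<close>, so a list
  can be cut in only one way; this also holds with empty pieces, since their end points are
  determined by the neighbours.\<close>

lemma mchain_inject:
  "mchain mss p ess zs q ==> mchain mss p ess' zs' q' ==> concat ess = concat ess' ==> ess = ess' \<and> zs = zs'"
proof (induction mss arbitrary: p ess zs ess' zs')
  case Nil
  then show ?case by (cases ess; cases zs; cases ess'; cases zs') auto
next
  case (Cons ms mss)
  obtain es es1 zs1 r where *: "ess = es # es1" "zs = enc p es # zs1" "chain ms p es r" "mchain mss r es1 zs1 q"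
    using Cons.prems(1) by (cases ess; cases zs) auto
  obtain es' es1' zs1' r' where **: "ess' = es' # es1'" "zs' = enc p es' # zs1'" "chain ms p es' r'"
      "mchain mss r' es1' zs1' q'"
    using Cons.prems(2) by (cases ess'; cases zs') auto
  have "es = es'" "concat es1 = concat es1'"
    using Cons.prems(3) chain_length[OF *(3)] chain_length[OF **(3)] by (auto simp: * **)
  moreover have "r = r'" using chain_end[OF *(3)] **(3) \<open>es = es'\<close> by simp
  ultimately show ?case using Cons.IH[OF *(4)] * ** by auto
qed

lemma flatten_in_cell:
  "is_path E A (concat mss) ==> in_cell E (flatten E A mss) (pcomps E A (comps A mss))
     (pcomps E A (concat mss)) (func_id A) (func_id (path_end E A (concat mss)))"
proof (induction mss arbitrary: A rule: induct_list012)
  case 1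
  then show ?case using in_cell_cid[of "span_id A"] span_id_spans by auto
next
  case (2 ms)
  then show ?case using pcomps_spans[of A ms] in_cell_cid[of "pcomps E A ms"] by simp
next
  case (3 ms ns nss)
  let ?B = "path_end E A ms"
  have path: "is_path E A ms" "is_path E ?B (concat (ns # nss))"
    using is_path_append[of A ms "concat (ns # nss)"] 3 by auto
  have small: "small A" "small (path_end E A (ms @ concat (ns # nss)))"
    using is_path_start[OF path(1)] is_path_end[OF path(2)] by (auto simp: path_end_append)
  have ids: "func_comp (func_id X) (func_id X) = func_id X" if "small X" for X
    using func_comp_id_left[OF func_id_funcs, of small X X] that by simp
  have c: "in_cell E (cid E (pcomps E A ms)) (pcomps E A ms) (pcomps E A ms) (func_id A) (func_id ?B)"
    using in_cell_cid[of "pcomps E A ms"] pcomps_spans[OF path(1)] by simp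
  have d: "in_cell E (hcomp E (cid E (pcomps E A ms)) (flatten E ?B (ns # nss)))
      (pcomps E A (comps A (ms # ns # nss))) (span_comp pair (pcomps E A ms) (pcomps E ?B (concat (ns # nss))))
      (func_id A) (func_id (path_end E A (ms @ concat (ns # nss))))"
    using in_cell_hcomp[OF c "3.IH"(2)[OF path(2)]] pcomps_spans[OF path(1)]
    by (simp add: path_end_append)
  show ?case
    using in_cell_ccomp[OF d join_in_cell[OF path, unfolded path_end_append[symmetric]]]
      ids[OF small(1)] ids[OF small(2)] by (simp add: path_end_append)
qed

lemma flatten_elem:
  "is_path E A (concat mss) ==> p \<in> A ==> mchain mss p ess zs q ==>
    sm_map (flatten E A mss) (enc p zs) = enc p (concat ess)"
proof (induction mss arbitrary: A p ess zs rule: induct_list012)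
  case 1
  then show ?case by (cases ess; cases zs) auto
next
  case (2 ms)
  then obtain es where "ess = [es]" "zs = [enc p es]" "chain ms p es q"
    by (cases ess; cases zs; cases "tl ess"; cases "tl zs") auto
  then show ?case using 2 enc_in_pcomps[of A ms p es q] by simp
next
  case (3 ms ns nss)
  let ?B = "path_end E A ms" and ?mss = "ns # nss"
  have path: "is_path E A ms" "is_path E ?B (concat ?mss)"
    using is_path_append[of A ms "concat ?mss"] 3 by auto
  from "3.prems"(3) obtain es ess' zs' r where *: "ess = es # ess'" "zs = enc p es # zs'" "chain ms p es r"
      "mchain ?mss r ess' zs' q"
    by (cases ess; cases zs) auto
  note e = enc_in_pcomps[OF path(1) "3.prems"(2) *(3)]
  have r: "r \<in> ?B" using e spans_legs[of "pcomps E A ms" small] pcomps_spans[OF path(1)] by auto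
  note ch = mchain_chain[OF path(2) r *(4)]
  note d = enc_in_pcomps[OF conjunct1[OF comps_path[OF path(2)]] r conjunct1[OF ch]]
  have "zs' \<noteq> []" using *(4) by (cases ess'; cases zs') auto
  then have "enc p zs = pair (enc p es) (enc r zs')"
    using * enc_start_irrelevant[of zs' p r] by (auto simp: neq_Nil_conv)
  moreover have fd: "sm_dom (flatten E ?B ?mss) = pcomps E ?B (comps ?B ?mss)"
    using in_cell_bd[OF flatten_in_cell[OF path(2)]] by simp
  ultimately have "sm_map (flatten E A (ms # ?mss)) (enc p zs) =
      sm_map (join E A ms (concat ?mss)) (pair (enc p es) (sm_map (flatten E ?B ?mss) (enc r zs')))"
    using e d by (simp del: comps.simps(2) flatten.simps(2) concat.simps add: flatten.simps(3)[of _ _ ms ns])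
  also have "... = enc p (es @ concat ess')"
    using "3.IH"(2)[OF path(2) r *(4)] join_elem[OF path "3.prems"(2) *(3) conjunct2[OF ch]] by simp
  finally show ?case using * by simp
qed

text \<open>\<open>msubst\<close> contains \<open>cinv\<close> of \<open>flatten\<close>, which
  \<open>cinv_cell\<close> evaluates only for a bijection. Surjectivity cuts a chain into pieces;
  injectivity combines \<open>enc_inject\<close> with the uniqueness of the cutting.\<close>

lemma flatten_bij:
  assumes path: "is_path E A (concat mss)"
  shows "bij_betw (sm_map (flatten E A mss)) (apex (pcomps E A (comps A mss))) (apex (pcomps E A (concat mss)))"
  unfolding bij_betw_def
proof
  have *: "\<exists>p ess zs q. p \<in> A \<and> mchain mss p ess zs q \<and> z = enc p zs"
    if "z \<in> apex (pcomps E A (comps A mss))" for z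
    using pcomps_cases[OF conjunct1[OF comps_path[OF path]] that] mchain_of_comps[OF path] by metis
  show "inj_on (sm_map (flatten E A mss)) (apex (pcomps E A (comps A mss)))"
  proof (rule inj_onI)
    fix z z' assume z: "z \<in> apex (pcomps E A (comps A mss))" "z' \<in> apex (pcomps E A (comps A mss))"
      and eq: "sm_map (flatten E A mss) z = sm_map (flatten E A mss) z'"
    from *[OF z(1)] obtain p ess zs q where 1: "p \<in> A" "mchain mss p ess zs q" "z = enc p zs" by auto
    from *[OF z(2)] obtain p' ess' zs' q' where 2: "p' \<in> A" "mchain mss p' ess' zs' q'" "z' = enc p' zs'" by auto
    have "enc p (concat ess) = enc p' (concat ess')"
      using eq flatten_elem[OF path 1(1,2)] flatten_elem[OF path 2(1,2)] 1 2 by simp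
    then have "p = p' \<and> concat ess = concat ess'"
      using mchain_chain[OF path 1(1,2)] mchain_chain[OF path 2(1,2)] enc_inject by blast
    then show "z = z'" using mchain_inject 1 2 by blast
  qed
  show "sm_map (flatten E A mss) ` apex (pcomps E A (comps A mss)) = apex (pcomps E A (concat mss))"
  proof
    show "sm_map (flatten E A mss) ` apex (pcomps E A (comps A mss)) \<subseteq> apex (pcomps E A (concat mss))"
      using in_cell_map[OF flatten_in_cell[OF path]] by auto
    show "apex (pcomps E A (concat mss)) \<subseteq> sm_map (flatten E A mss) ` apex (pcomps E A (comps A mss))"
    proof
      fix y assume "y \<in> apex (pcomps E A (concat mss))"
      then obtain p es q where es: "p \<in> A" "chain (concat mss) p es q" "y = enc p es"
        using pcomps_cases[OF path] by blast
      then obtain ess zs where zs: "mchain mss p ess zs q" "concat ess = es"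
        using mchain_of_concat by blast
      show "y \<in> sm_map (flatten E A mss) ` apex (pcomps E A (comps A mss))"
      proof (rule image_eqI)
        show "y = sm_map (flatten E A mss) (enc p zs)"
          using es zs flatten_elem[OF path es(1) zs(1)] by simp
        show "enc p zs \<in> apex (pcomps E A (comps A mss))"
          using enc_in_pcomps[OF conjunct1[OF comps_path[OF path]] es(1)
              conjunct1[OF mchain_chain[OF path es(1) zs(1)]]] by simp
      qed
    qed
  qed
qed

section \<open>Substitution of multicells\<close>

fun mpath :: "'u func \<Rightarrow> ('u span list \<times> 'u span_map) list \<Rightarrow> bool" where
  "mpath f [] \<longleftrightarrow> f \<in> funcs small"
| "mpath f ((ms, c) # cs) \<longleftrightarrow> c \<in> span_maps small \<and> is_path E (func_dom f) ms \<and>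
     sm_dom c = pcomps E (func_dom f) ms \<and> sm_left c = f \<and> mpath (sm_right c) cs"

text \<open>Evaluation of a list of multicells along a chain from \<open>p\<close> to
  \<open>q\<close>: the pieces \<open>ess\<close> are fed to the multicells, and \<open>vs\<close>
  collects the values. It is a relation because the intermediate end points are found by following
  the legs.\<close>

fun meval :: "('u span list \<times> 'u span_map) list \<Rightarrow> 'u \<Rightarrow> 'u list list \<Rightarrow> 'u list \<Rightarrow> 'u \<Rightarrow> bool" where
  "meval [] p [] [] q \<longleftrightarrow> p = q"
| "meval ((ms, c) # cs) p (es # ess) (v # vs) q \<longleftrightarrow>
     v = sm_map c (enc p es) \<and> (\<exists>r. chain ms p es r \<and> meval cs r ess vs q)"
| "meval _ _ _ _ _ \<longleftrightarrow> False"

lemma mpath_start: "mpath f cs ==> f \<in> funcs small"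
proof (cases cs)
  case (Cons c cs')
  then show "mpath f cs ==> ?thesis"
    using frameD(3)[OF in_cell_frame[OF in_cell_self]] by (cases c) auto
qed auto

lemma mpath_props:
  "mpath f cs ==> is_cpath E f (map snd cs) \<and> is_path E (func_dom f) (concat (map fst cs)) \<and>
     comps (func_dom f) (map fst cs) = map sm_dom (map snd cs) \<and>
     path_end E (func_dom f) (concat (map fst cs)) = func_dom (cpath_end E f (map snd cs)) \<and>
     cpath_end E f (map snd cs) \<in> funcs small"
proof (induction cs arbitrary: f)
  case Nil
  then show ?case by (auto simp: funcs_def)
next
  case (Cons mc cs)
  obtain ms c where mc: "mc = (ms, c)" by force
  have c: "c \<in> span_maps small" "is_path E (func_dom f) ms" "sm_dom c = pcomps E (func_dom f) ms"
      "sm_left c = f" "mpath (sm_right c) cs"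
    using Cons.prems mc by auto
  have "path_end E (func_dom f) ms = func_dom (sm_right c)"
    using frameD(7)[OF in_cell_frame[OF in_cell_self[OF c(1)]]] c pcomps_spans[OF c(2)] by simp
  moreover have "is_path E (func_dom f) (ms @ ns)" if "is_path E (path_end E (func_dom f) ms) ns" for ns
    using is_path_appendI[OF c(2) that] .
  ultimately show ?case using Cons.IH[OF c(5)] c mc by (simp add: path_end_append)
qed

lemma meval_mchain:
  "meval cs p ess vs q ==> \<exists>zs. mchain (map fst cs) p ess zs q \<and> vs = map2 sm_map (map snd cs) zs"
proof (induction cs p ess vs q rule: meval.induct)
  case (2 ms c cs p es ess v vs q)
  then obtain r where r: "v = sm_map c (enc p es)" "chain ms p es r" "meval cs r ess vs q"
    by auto
  with 2(1)[OF this(3)] obtain zs where "chain ms p es r" "mchain (map fst cs) r ess zs q"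
    "vs = map2 sm_map (map snd cs) zs" "v = sm_map c (enc p es)"
    by auto
  then show ?case by (intro exI[of _ "enc p es # zs"]) auto
next
  case (1 p q)
  then show ?case by (intro exI[of _ "[]"]) auto
qed auto

lemma meval_split:
  "chain (concat (map fst cs)) p es q ==> \<exists>ess vs. meval cs p ess vs q \<and> es = concat ess"
proof (induction cs arbitrary: p es)
  case Nil
  then show ?case by (intro exI[of _ "[]"]) (auto simp: chain_Nil_iff)
next
  case (Cons mc cs)
  obtain ms c where mc: "mc = (ms, c)" by force
  obtain es1 ds r where *: "es = es1 @ ds" "chain ms p es1 r" "chain (concat (map fst cs)) r ds q"
    using Cons.prems mc chain_split[of ms "concat (map fst cs)" p es q] by force
  from Cons.IH[OF *(3)] obtain ess vs where "meval cs r ess vs q" "ds = concat ess" by auto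
  with * mc show ?case by (intro exI[of _ "es1 # ess"] exI[of _ "sm_map c (enc p es1) # vs"]) auto
qed

lemma msubst_in_cell:
  assumes cs: "mpath f cs"
    and d: "in_cell E d (pcomps E (func_cod f) (map sm_cod (map snd cs))) n g h"
  shows "in_cell E (msubst E f cs d) (pcomps E (func_dom f) (concat (map fst cs))) n
    (func_comp f g) (func_comp (cpath_end E f (map snd cs)) h)"
proof -
  let ?A = "func_dom f" and ?mss = "map fst cs" and ?e = "cpath_end E f (map snd cs)"
  note mp = mpath_props[OF cs]
  have path: "is_path E ?A (concat ?mss)" using mp by blast
  note ci = cinv_cell(2)[OF _ flatten_bij[OF path]]
  have "in_cell E (cinv E (flatten E ?A ?mss)) (pcomps E ?A (concat ?mss)) (pcomps E ?A (comps ?A ?mss))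
      (func_id ?A) (func_id (func_dom ?e))"
    using ci flatten_in_cell[OF path] pcomps_spans[OF conjunct1[OF comps_path[OF path]]] comps_path[OF path] mp
    by simp
  moreover have "in_cell E (hcomps E f (map snd cs)) (pcomps E ?A (comps ?A ?mss))
      (pcomps E (func_cod f) (map sm_cod (map snd cs))) f ?e"
    using hcomps_in_cell[of f "map snd cs"] mp by simp
  ultimately have "in_cell E (ccomp E (ccomp E (cinv E (flatten E ?A ?mss)) (hcomps E f (map snd cs))) d)
      (pcomps E ?A (concat ?mss)) n (func_comp (func_comp (func_id ?A) f) g)
      (func_comp (func_comp (func_id (func_dom ?e)) ?e) h)"
    using d by (intro in_cell_ccomp)
  moreover have "func_comp (func_id ?A) f = f" "func_comp (func_id (func_dom ?e)) ?e = ?e"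
    using mpath_start[OF cs] mp by (auto intro: func_comp_id_left)
  ultimately show ?thesis by (simp add: msubst_def)
qed

text \<open>The computation behind all axioms on multimodulations: in terms of lists, substitution
  evaluates each multicell on its piece and hands the list of values to \<open>d\<close>. The
  inverse of \<open>flatten\<close> only undoes the concatenation of the pieces.\<close>

lemma msubst_elem:
  assumes cs: "mpath f cs" and p: "p \<in> func_dom f" and ev: "meval cs p ess vs q"
  shows "sm_map (msubst E f cs d) (enc p (concat ess)) = sm_map d (enc (func_map f p) vs)"
    and "chain (map sm_cod (map snd cs)) (func_map f p) vs (func_map (cpath_end E f (map snd cs)) q)"
    and "chain (concat (map fst cs)) p (concat ess) q"
proof -
  let ?A = "func_dom f" and ?mss = "map fst cs"
  note mp = mpath_props[OF cs]
  have path: "is_path E ?A (concat ?mss)" using mp by blast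
  obtain zs where zs: "mchain ?mss p ess zs q" "vs = map2 sm_map (map snd cs) zs"
    using meval_mchain[OF ev] by blast
  note ch = mchain_chain[OF path p zs(1)]
  note cp = comps_path[OF path]
  note z = enc_in_pcomps[OF conjunct1[OF cp] p conjunct1[OF ch]]
  have glob: "in_cell E (flatten E ?A ?mss) (pcomps E ?A (comps ?A ?mss)) (pcomps E ?A (concat ?mss))
      (func_id (lfoot (pcomps E ?A (comps ?A ?mss)))) (func_id (rfoot (pcomps E ?A (comps ?A ?mss))))"
    using flatten_in_cell[OF path] pcomps_spans[OF conjunct1[OF cp]] cp by simp
  have inv: "sm_map (cinv E (flatten E ?A ?mss)) (enc p (concat ess)) = enc p zs"
    using cinv_cell(3)[OF glob flatten_bij[OF path] conjunct1[OF z]] flatten_elem[OF path p zs(1)] by simp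
  have dom: "sm_dom (cinv E (flatten E ?A ?mss)) = pcomps E ?A (concat ?mss)"
    using in_cell_bd[OF cinv_cell(2)[OF glob flatten_bij[OF path]]] by simp
  have cmp: "comps ?A ?mss = map sm_dom (map snd cs)" using mp by simp
  have cpth: "is_cpath E f (map snd cs)" using mp by simp
  note hc = hcomps_elem[OF cpth p, of zs q]
  have "chain (map sm_dom (map snd cs)) p zs q" using ch cmp by simp
  note hc = hc[OF this]
  show "chain (map sm_cod (map snd cs)) (func_map f p) vs (func_map (cpath_end E f (map snd cs)) q)"
    using hc zs(2) by simp
  show "chain (concat (map fst cs)) p (concat ess) q" using ch by simp
  have "enc p (concat ess) \<in> apex (pcomps E ?A (concat ?mss))"
    using enc_in_pcomps[OF path p conjunct2[OF ch]] by simp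
  then show "sm_map (msubst E f cs d) (enc p (concat ess)) = sm_map d (enc (func_map f p) vs)"
    using hc inv dom zs(2) unfolding msubst_def by simp
qed

lemma meval_units:
  "chain ms p es r ==> meval (units E ms @ cs) p (map (\<lambda>e. [e]) es @ ess) (es @ vs) q \<longleftrightarrow> meval cs r ess vs q"
proof (induction ms p es r rule: chain.induct)
  case (2 m ms p e es q)
  then show ?case by (auto simp: units_def)
qed (auto simp: units_def)

end

context span_universe
begin

lemma in_cell_eq_iff:
  assumes "in_cell E c m n f g" "in_cell E d m n f' g'" "f = f'" "g = g'"
  shows "c = d \<longleftrightarrow> (\<forall>a\<in>apex m. sm_map c a = sm_map d a)"
  using assms in_cell_eqI by blast

end

section \<open>Models and transformations\<close>

locale span_models = span_universe small pair + simple_theory T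
  for small :: "'u set \<Rightarrow> bool" and pair :: "'u \<Rightarrow> 'u \<Rightarrow> 'u" and T :: "('o, 'a, 'o, 'c) dbl"
begin

abbreviation (input) "tid \<equiv> trans_id T E"
abbreviation (input) "tcm \<equiv> trans_comp T E"
abbreviation (input) "ic \<equiv> idcell T"
abbreviation (input) "mpt \<equiv> mod_path T E"
abbreviation (input) "sr \<equiv> mod_src T"
abbreviation (input) "tg \<equiv> mod_tgt T"
abbreviation (input) "mcm \<equiv> mmod_comp T E"
abbreviation (input) "mmi \<equiv> mmod_id T E"
abbreviation (input) "mmx \<equiv> multimodulation T E"
abbreviation (input) "mux \<equiv> modulation T E"
abbreviation (input) "dA \<equiv> adom T"
abbreviation (input) "cA \<equiv> acod T"
abbreviation (input) "dC \<equiv> cdom T"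
abbreviation (input) "cC \<equiv> ccod T"
abbreviation (input) "sC \<equiv> csrc T"
abbreviation (input) "tC \<equiv> ctgt T"
abbreviation (input) "sc \<equiv> span_comp pair"

abbreviation "lx F \<equiv> lax_functor T E F"
abbreviation "tx al \<equiv> lax_trans T E al"
abbreviation "cmp F x a b \<equiv> sm_map (laxator F x x) (pair a b)"

context
  fixes F :: "('o, 'a, 'c, 'u) s_lax"
  assumes F: "lx F"
begin

lemma lx_ob [simp]: "small (fOb F x)"
  using F by (auto simp: lax_functor_def)

lemma lx_ar [simp]:
  "f \<in> Ar T ==> fAr F f \<in> funcs small" "f \<in> Ar T ==> func_dom (fAr F f) = fOb F (dA f)"
  "f \<in> Ar T ==> func_cod (fAr F f) = fOb F (cA f)"
  "f \<in> Ar T ==> cA f = y ==> p \<in> fOb F (dA f) ==> far F f p \<in> fOb F y"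
proof -
  show *: "f \<in> Ar T ==> fAr F f \<in> funcs small" "f \<in> Ar T ==> func_dom (fAr F f) = fOb F (dA f)"
    "f \<in> Ar T ==> func_cod (fAr F f) = fOb F (cA f)"
    using F by (auto simp: lax_functor_def)
  show "f \<in> Ar T ==> cA f = y ==> p \<in> fOb F (dA f) ==> far F f p \<in> fOb F y"
    using * funcs_map[of "fAr F f" small p] by auto
qed

lemma lx_ar_id: "fAr F (aid T x) = idO F x"
  using F by (auto simp: lax_functor_def)

lemma lx_ar_comp: "f \<in> Ar T ==> g \<in> Ar T ==> cA f = dA g ==>
    fAr F (acomp T f g) = func_comp (fAr F f) (fAr F g)"
  using F by (auto simp: lax_functor_def)

lemma lx_ar_map [simp]:
  "p \<in> fOb F x ==> far F (aid T x) p = p"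
  "f \<in> Ar T ==> g \<in> Ar T ==> cA f = dA g ==> p \<in> fOb F (dA f) ==>
     far F (acomp T f g) p = far F g (far F f p)"
  by (simp_all add: lx_ar_id lx_ar_comp)

lemma lx_pr [simp]: "fPr F x \<in> spans small" "lfoot (fPr F x) = fOb F x" "rfoot (fPr F x) = fOb F x"
  using F by (auto simp: lax_functor_def)

lemma lx_legs [simp]:
  "a \<in> fel F x ==> flt F x a \<in> fOb F x"
  "a \<in> fel F x ==> frt F x a \<in> fOb F x"
  using legs[of "fPr F x" a] by auto

lemma lx_ce: "c \<in> Ce T ==> in_cell E (fCe F c) (fPr F (dC c)) (fPr F (cC c))
    (fAr F (sC c)) (fAr F (tC c))"
  using F by (simp add: lax_functor_def)

lemma lx_ce_simps [simp]:
  assumes "c \<in> Ce T"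
  shows "sm_dom (fCe F c) = fPr F (dC c)" "sm_cod (fCe F c) = fPr F (cC c)"
    "sm_left (fCe F c) = fAr F (sC c)" "sm_right (fCe F c) = fAr F (tC c)"
    "cC c = y ==> a \<in> fel F (dC c) ==> fce F c a \<in> fel F y"
    "cC c = y ==> a \<in> fel F (dC c) ==> flt F y (fce F c a) =
       far F (sC c) (flt F (dC c) a)"
    "cC c = y ==> a \<in> fel F (dC c) ==> frt F y (fce F c a) =
       far F (tC c) (frt F (dC c) a)"
  using in_cell_bd[OF lx_ce[OF assms]] in_cell_map[OF lx_ce[OF assms], of a] by auto

lemma lx_ce_map [simp]:
  "a \<in> fel F x ==> fce F (cid T x) a = a"
  "c \<in> Ce T ==> d \<in> Ce T ==> cC c = dC d ==> a \<in> fel F (dC c) ==>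
     fce F (ccomp T c d) a = fce F d (fce F c a)"
proof -
  show "a \<in> fel F x ==> fce F (cid T x) a = a"
    using F by (simp add: lax_functor_def)
  assume c: "c \<in> Ce T" "d \<in> Ce T" "cC c = dC d" and a: "a \<in> fel F (dC c)"
  have "fCe F (ccomp T c d) = ccomp E (fCe F c) (fCe F d)"
    using F c by (simp add: lax_functor_def)
  then show "fce F (ccomp T c d) a = fce F d (fce F c a)"
    using c a by simp
qed

lemma lx_laxator: "in_cell E (laxator F x x) (sc (fPr F x) (fPr F x)) (fPr F x)
    (idO F x) (idO F x)"
proof -
  have "\<forall>m n. if m \<in> Pr T \<and> n \<in> Pr T \<and> ptgt T m = psrc T n
      then globular E (laxator F m n) (pcomp E (fPr F m) (fPr F n)) (fPr F (pcomp T m n))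
      else laxator F m n = undefined"
    using F unfolding lax_functor_def by (elim conjE)
  from this[THEN spec, THEN spec, of x x] show ?thesis
    by (simp add: globular_def)
qed

lemma lx_unitor: "in_cell E (unitor F x) (spO F x) (fPr F x)
    (idO F x) (idO F x)"
  using F by (simp add: lax_functor_def globular_def)

lemma lx_undefined: "x \<noteq> y ==> laxator F x y = undefined" "f \<notin> Ar T ==> fAr F f = undefined"
    "c \<notin> Ce T ==> fCe F c = undefined"
  using F by (auto simp: lax_functor_def PiE_iff extensional_def)

lemma lx_lax_simps [simp]: "sm_dom (laxator F x x) = sc (fPr F x) (fPr F x)"
  "sm_cod (laxator F x x) = fPr F x"
  "sm_left (laxator F x x) = idO F x" "sm_right (laxator F x x) = idO F x"
  "sm_dom (unitor F x) = spO F x" "sm_cod (unitor F x) = fPr F x"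
  "sm_left (unitor F x) = idO F x" "sm_right (unitor F x) = idO F x"
  using in_cell_bd[OF lx_laxator] in_cell_bd[OF lx_unitor] by simp_all

lemma lx_cmp [simp]:
  assumes "a \<in> fel F x" "b \<in> fel F x" "frt F x a = flt F x b"
  shows "cmp F x a b \<in> fel F x" "flt F x (cmp F x a b) = flt F x a"
    "frt F x (cmp F x a b) = frt F x b"
  using in_cell_map[OF lx_laxator, of "pair a b"] assms by simp_all

lemma lx_one [simp]:
  assumes "p \<in> fOb F x"
  shows "uni F x p \<in> fel F x" "flt F x (uni F x p) = p"
    "frt F x (uni F x p) = p"
  using in_cell_map[OF lx_unitor, of p] assms by simp_all

lemma lx_assoc [simp]:
  assumes "a \<in> fel F x" "b \<in> fel F x" "c \<in> fel F x"
    "frt F x a = flt F x b" "frt F x b = flt F x c"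
  shows "cmp F x (cmp F x a b) c = cmp F x a (cmp F x b c)"
proof -
  have "ccomp E (hcomp E (laxator F x x) (cid E (fPr F x))) (laxator F x x) =
      ccomp E (ccomp E (assoc E (fPr F x) (fPr F x) (fPr F x))
        (hcomp E (cid E (fPr F x)) (laxator F x x))) (laxator F x x)"
    using F by (simp add: lax_functor_def)
  from arg_cong[OF this, of "\<lambda>d. sm_map d (pair (pair a b) c)"] show ?thesis
    using assms by simp
qed

lemma lx_units [simp]:
  assumes "a \<in> fel F x"
  shows "p = flt F x a ==> cmp F x (uni F x p) a = a"
    "q = frt F x a ==> cmp F x a (uni F x q) = a"
proof -
  have "ccomp E (hcomp E (unitor F x) (cid E (fPr F x))) (laxator F x x) = lunit E (fPr F x) \<and>
    ccomp E (hcomp E (cid E (fPr F x)) (unitor F x)) (laxator F x x) = runit E (fPr F x)"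
    using F by (simp add: lax_functor_def)
  then have "sm_map (ccomp E (hcomp E (unitor F x) (cid E (fPr F x))) (laxator F x x)) (pair (flt F x a) a)
      = sm_map (lunit E (fPr F x)) (pair (flt F x a) a)"
    "sm_map (ccomp E (hcomp E (cid E (fPr F x)) (unitor F x)) (laxator F x x)) (pair a (frt F x a))
      = sm_map (runit E (fPr F x)) (pair a (frt F x a))"
    by simp_all
  then show "p = flt F x a ==> cmp F x (uni F x p) a = a"
    "q = frt F x a ==> cmp F x a (uni F x q) = a"
    using assms by simp_all
qed

lemma lx_hcomp:
  assumes "c \<in> Ce T" "d \<in> Ce T" "tC c = sC d"
    "a \<in> fel F (dC c)" "b \<in> fel F (dC c)"
    "frt F (dC c) a = flt F (dC c) b"
  shows "fce F (hcomp T c d) (cmp F (dC c) a b) =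
    cmp F (cC c) (fce F c a) (fce F d b)"
proof -
  note cd = hcomp_dom[OF assms(1-3)]
  have "ccomp E (hcomp E (fCe F c) (fCe F d)) (laxator F (cC c) (cC d)) =
      ccomp E (laxator F (dC c) (dC d)) (fCe F (hcomp T c d))"
    using F assms(1-3) by (simp add: lax_functor_def)
  from arg_cong[OF this, of "\<lambda>d. sm_map d (pair a b)"] show ?thesis
    using assms cd by simp
qed

text \<open>An identity cell is its own external composite with itself, by the unit law. Naturality
  of the laxator at this pair makes its image a homomorphism for composition of elements.\<close>

lemma lx_idcell [simp]:
  assumes f: "f \<in> Ar T"
  shows "dA f = x ==> p \<in> fOb F x ==> fce F (ic f) (uni F x p) =
      uni F (cA f) (far F f p)"
    "dA f = x ==> a \<in> fel F x ==> b \<in> fel F x ==> frt F x a = flt F x b ==>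
      fce F (ic f) (cmp F x a b) =
        cmp F (cA f) (fce F (ic f) a) (fce F (ic f) b)"
    "g \<in> Ar T ==> cA f = dA g ==> a \<in> fel F (dA f) ==>
      fce F (ic (acomp T f g)) a = fce F (ic g) (fce F (ic f) a)"
proof -
  have "ccomp E (idcell E (fAr F f)) (unitor F (cA f)) = ccomp E (unitor F (dA f)) (fCe F (ic f))"
    using F f by (simp add: lax_functor_def)
  from arg_cong[OF this, of "\<lambda>d. sm_map d p"]
  show "dA f = x ==> p \<in> fOb F x ==> fce F (ic f) (uni F x p) =
      uni F (cA f) (far F f p)"
    using f by auto
  show "dA f = x ==> a \<in> fel F x ==> b \<in> fel F x ==> frt F x a = flt F x b ==>
      fce F (ic f) (cmp F x a b) =
        cmp F (cA f) (fce F (ic f) a) (fce F (ic f) b)"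
    using lx_hcomp[of "ic f" "ic f" a b] f hcomp_units(1)[of "ic f"] by auto
  show "g \<in> Ar T ==> cA f = dA g ==> a \<in> fel F (dA f) ==>
      fce F (ic (acomp T f g)) a = fce F (ic g) (fce F (ic f) a)"
    using f by (simp add: idcell_acomp)
qed

end

text \<open>The typing half of \<open>lax_trans\<close>. It suffices for reading the remaining
  axioms on elements and for comparing transformations, so for \<open>trans_id\<close> and
  \<open>trans_comp\<close> it is proved first and the axioms are then checked on elements.\<close>

definition trans_typed ::
  "('o, 'a, 'c, 'u) s_trans \<Rightarrow> bool" where
  "trans_typed al \<longleftrightarrow> (let F = tdom al; G = tcod al in lx F \<and> lx G \<and>
     (\<forall>x. tOb al x \<in> funcs small \<and> func_dom (tOb al x) = fOb F x \<and> func_cod (tOb al x) = fOb G x) \<and>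
     (\<forall>x. in_cell E (tPr al x) (fPr F x) (fPr G x) (tOb al x) (tOb al x)) \<and>
     tAr al \<in> extensional (Ar T) \<and>
     (\<forall>f\<in>Ar T. in_cell E (tAr al f) (spO F (dA f)) (fPr G (cA f))
        (func_comp (tOb al (dA f)) (fAr G f)) (func_comp (fAr F f) (tOb al (cA f)))))"

context
  fixes al :: "('o, 'a, 'c, 'u) s_trans" and F G
  assumes typed: "trans_typed al" and FG: "tdom al = F" "tcod al = G"
begin

lemma tt_lax [simp]: "lx F" "lx G"
  using typed FG by (auto simp: trans_typed_def)

lemma tt_ob [simp]: "tOb al x \<in> funcs small" "func_dom (tOb al x) = fOb F x" "func_cod (tOb al x) = fOb G x"
  "p \<in> fOb F x ==> tob al x p \<in> fOb G x"
proof -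
  show *: "tOb al x \<in> funcs small" "func_dom (tOb al x) = fOb F x" "func_cod (tOb al x) = fOb G x"
    using typed FG by (simp_all add: trans_typed_def)
  show "p \<in> fOb F x ==> tob al x p \<in> fOb G x"
    using funcs_map[of "tOb al x" small p] * by simp
qed

lemma tt_pr_cell: "in_cell E (tPr al x) (fPr F x) (fPr G x) (tOb al x) (tOb al x)"
  using typed FG by (simp add: trans_typed_def)

lemma tt_pr [simp]:
  "sm_dom (tPr al x) = fPr F x" "sm_cod (tPr al x) = fPr G x"
  "sm_left (tPr al x) = tOb al x" "sm_right (tPr al x) = tOb al x"
  "a \<in> fel F x ==> tpr al x a \<in> fel G x"
  "a \<in> fel F x ==> flt G x (tpr al x a) = tob al x (flt F x a)"
  "a \<in> fel F x ==> frt G x (tpr al x a) = tob al x (frt F x a)"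
  using in_cell_bd[OF tt_pr_cell] in_cell_map[OF tt_pr_cell, of a] by simp_all

lemma tt_ar_cell: "f \<in> Ar T ==> in_cell E (tAr al f) (spO F (dA f)) (fPr G (cA f))
        (func_comp (tOb al (dA f)) (fAr G f)) (func_comp (fAr F f) (tOb al (cA f)))"
  using typed FG by (simp add: trans_typed_def)

lemma tt_ar [simp]:
  assumes "f \<in> Ar T"
  shows "sm_dom (tAr al f) = spO F (dA f)" "sm_cod (tAr al f) = fPr G (cA f)"
    "sm_left (tAr al f) = func_comp (tOb al (dA f)) (fAr G f)"
    "sm_right (tAr al f) = func_comp (fAr F f) (tOb al (cA f))"
    "cA f = y ==> p \<in> fOb F (dA f) ==> tar al f p \<in> fel G y"
    "cA f = y ==> p \<in> fOb F (dA f) ==> flt G y (tar al f p) =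
       far G f (tob al (dA f) p)"
    "cA f = y ==> p \<in> fOb F (dA f) ==> frt G y (tar al f p) =
       tob al (cA f) (far F f p)"
  using in_cell_bd[OF tt_ar_cell[OF assms]] in_cell_map[OF tt_ar_cell[OF assms], of p] assms by auto

text \<open>The inverse unit constraints send \<open>a\<close> to the pairs of \<open>a\<close> with
  its left leg and with its right leg. Hence the components of the transformation at the source and
  target arrows of \<open>c\<close> are evaluated at these legs.\<close>

lemma tt_nat_iff:
  assumes c: "c \<in> Ce T"
  shows "ccomp E (ccomp E (cinv E (lunit E (fPr F (dC c))))
           (hcomp E (tAr al (sC c)) (ccomp E (fCe F c) (tPr al (cC c))))) (laxator G (cC c) (cC c))
       = ccomp E (ccomp E (cinv E (runit E (fPr F (dC c))))
           (hcomp E (ccomp E (tPr al (dC c)) (fCe G c)) (tAr al (tC c)))) (laxator G (cC c) (cC c))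
     \<longleftrightarrow> (\<forall>a\<in>fel F (dC c).
          cmp G (cC c) (tar al (sC c) (flt F (dC c) a))
            (tpr al (cC c) (fce F c a)) =
          cmp G (cC c) (fce G c (tpr al (dC c) a))
            (tar al (tC c) (frt F (dC c) a)))" (is "?L = ?R \<longleftrightarrow> ?P")
proof -
  let ?m = "dC c" and ?n = "cC c" and ?f = "sC c" and ?g = "tC c"
  have fc: "in_cell E (ccomp E (fCe F c) (tPr al ?n)) (fPr F ?m) (fPr G ?n)
      (func_comp (fAr F ?f) (tOb al ?n)) (func_comp (fAr F ?g) (tOb al ?n))"
    by (rule in_cell_ccomp[OF lx_ce tt_pr_cell]) (simp_all add: c)
  have cf: "in_cell E (ccomp E (tPr al ?m) (fCe G c)) (fPr F ?m) (fPr G ?n)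
      (func_comp (tOb al ?m) (fAr G ?f)) (func_comp (tOb al ?m) (fAr G ?g))"
    by (rule in_cell_ccomp[OF tt_pr_cell lx_ce]) (simp_all add: c)
  have ta: "in_cell E (tAr al ?f) (spO F ?m) (fPr G ?n)
      (func_comp (tOb al ?m) (fAr G ?f)) (func_comp (fAr F ?f) (tOb al ?n))"
    "in_cell E (tAr al ?g) (spO F ?m) (fPr G ?n)
      (func_comp (tOb al ?m) (fAr G ?g)) (func_comp (fAr F ?g) (tOb al ?n))"
    using tt_ar_cell[of ?f] tt_ar_cell[of ?g] c by simp_all
  have lu: "in_cell E (cinv E (lunit E (fPr F ?m))) (fPr F ?m) (sc (spO F ?m) (fPr F ?m))
      (idO F ?m) (idO F ?m)"
    "in_cell E (cinv E (runit E (fPr F ?m))) (fPr F ?m) (sc (fPr F ?m) (spO F ?m))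
      (idO F ?m) (idO F ?m)"
    using in_cell_cinv_lunit[of "fPr F ?m"] in_cell_cinv_runit[of "fPr F ?m"] by simp_all
  note L = in_cell_ccomp[OF in_cell_ccomp[OF lu(1) in_cell_hcomp[OF ta(1) fc]] lx_laxator[OF tt_lax(2)]]
  note R = in_cell_ccomp[OF in_cell_ccomp[OF lu(2) in_cell_hcomp[OF cf ta(2)]] lx_laxator[OF tt_lax(2)]]
  have sl: "sm_dom (cinv E (lunit E (fPr F ?m))) = fPr F ?m" "sm_dom (cinv E (runit E (fPr F ?m))) = fPr F ?m"
    using in_cell_bd[OF in_cell_cinv_lunit[of "fPr F ?m"]] in_cell_bd[OF in_cell_cinv_runit[of "fPr F ?m"]] by auto
  show ?thesis
    unfolding in_cell_eq_iff[OF L R refl refl]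
    by (intro ball_cong refl) (simp add: sl c cinv_lunit cinv_runit)
qed

lemma tt_cmp_iff:
  "ccomp E (laxator F x x) (tPr al x) = ccomp E (hcomp E (tPr al x) (tPr al x)) (laxator G x x) \<longleftrightarrow>
    (\<forall>a b. a \<in> fel F x \<and> b \<in> fel F x \<and> frt F x a = flt F x b -->
       tpr al x (cmp F x a b) = cmp G x (tpr al x a) (tpr al x b))"
proof -
  have L: "in_cell E (ccomp E (laxator F x x) (tPr al x)) (sc (fPr F x) (fPr F x)) (fPr G x)
      (func_comp (idO F x) (tOb al x)) (func_comp (idO F x) (tOb al x))"
    by (rule in_cell_ccomp[OF lx_laxator tt_pr_cell]) simp
  have R: "in_cell E (ccomp E (hcomp E (tPr al x) (tPr al x)) (laxator G x x))
      (sc (fPr F x) (fPr F x)) (fPr G x)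
      (func_comp (tOb al x) (idO G x)) (func_comp (tOb al x) (idO G x))"
    by (rule in_cell_ccomp[OF in_cell_hcomp[OF tt_pr_cell tt_pr_cell] lx_laxator]) simp
  have eq: "func_comp (idO F x) (tOb al x) = func_comp (tOb al x) (idO G x)"
    by (simp add: func_comp_id_left[of _ small] func_comp_id_right[of _ small])
  show ?thesis
    unfolding in_cell_eq_iff[OF L R eq eq] by (auto simp: pullback_def)
qed

lemma tt_one_iff:
  "ccomp E (unitor F x) (tPr al x) = ccomp E (idcell E (tOb al x)) (unitor G x) \<longleftrightarrow>
    (\<forall>p\<in>fOb F x. tpr al x (uni F x p) = uni G x (tob al x p))"
proof -
  have L: "in_cell E (ccomp E (unitor F x) (tPr al x)) (spO F x) (fPr G x)
      (func_comp (idO F x) (tOb al x)) (func_comp (idO F x) (tOb al x))"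
    by (rule in_cell_ccomp[OF lx_unitor tt_pr_cell]) simp
  have R: "in_cell E (ccomp E (idcell E (tOb al x)) (unitor G x)) (spO F x) (fPr G x)
      (func_comp (tOb al x) (idO G x)) (func_comp (tOb al x) (idO G x))"
    using in_cell_ccomp[OF _ lx_unitor[OF tt_lax(2)], of "idcell E (tOb al x)"] in_cell_idcell[of "tOb al x"] by simp
  have eq: "func_comp (idO F x) (tOb al x) = func_comp (tOb al x) (idO G x)"
    by (simp add: func_comp_id_left[of _ small] func_comp_id_right[of _ small])
  show ?thesis
    unfolding in_cell_eq_iff[OF L R eq eq] by simp
qed

lemma tt_ar_id_iff:
  "tAr al (aid T x) = ccomp E (idcell E (tOb al x)) (unitor G x) \<longleftrightarrow>
    (\<forall>p\<in>fOb F x. tar al (aid T x) p = uni G x (tob al x p))"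
proof -
  have L: "in_cell E (tAr al (aid T x)) (spO F x) (fPr G x)
      (func_comp (tOb al x) (idO G x)) (func_comp (idO F x) (tOb al x))"
    using tt_ar_cell[of "aid T x"] by (simp add: lx_ar_id)
  have R: "in_cell E (ccomp E (idcell E (tOb al x)) (unitor G x)) (spO F x) (fPr G x)
      (func_comp (tOb al x) (idO G x)) (func_comp (tOb al x) (idO G x))"
    using in_cell_ccomp[OF _ lx_unitor[OF tt_lax(2)], of "idcell E (tOb al x)"] in_cell_idcell[of "tOb al x"] by simp
  have eq: "func_comp (idO F x) (tOb al x) = func_comp (tOb al x) (idO G x)"
    by (simp add: func_comp_id_left[of _ small] func_comp_id_right[of _ small])
  show ?thesis
    unfolding in_cell_eq_iff[OF L R refl eq] by simp
qed

lemma tt_ar_comp_iff: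
  assumes f: "f \<in> Ar T" "g \<in> Ar T" "cA f = dA g"
  shows "tAr al (acomp T f g) = ccomp E (ccomp E (cinv E (lunit E (spO F (dA f))))
        (hcomp E (ccomp E (tAr al f) (fCe G (ic g))) (ccomp E (idcell E (fAr F f)) (tAr al g))))
        (laxator G (cA g) (cA g)) \<longleftrightarrow>
      (\<forall>p\<in>fOb F (dA f). tar al (acomp T f g) p =
         cmp G (cA g) (fce G (ic g) (tar al f p))
           (tar al g (far F f p)))"
    (is "_ = ?R \<longleftrightarrow> _")
proof -
  let ?x = "dA f" and ?y = "dA g" and ?z = "cA g"
  have a: "in_cell E (ccomp E (tAr al f) (fCe G (ic g))) (spO F ?x) (fPr G ?z)
      (func_comp (func_comp (tOb al ?x) (fAr G f)) (fAr G g))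
      (func_comp (func_comp (fAr F f) (tOb al ?y)) (fAr G g))"
    using in_cell_ccomp[OF tt_ar_cell[OF f(1)], of "fCe G (ic g)"] lx_ce[OF tt_lax(2), of "ic g"] f by simp
  have b: "in_cell E (ccomp E (idcell E (fAr F f)) (tAr al g)) (spO F ?x) (fPr G ?z)
      (func_comp (fAr F f) (func_comp (tOb al ?y) (fAr G g)))
      (func_comp (fAr F f) (func_comp (fAr F g) (tOb al ?z)))"
    using in_cell_ccomp[OF _ tt_ar_cell[of g], of "idcell E (fAr F f)"] in_cell_idcell[of "fAr F f"] f by simp
  have ab: "func_comp (func_comp (fAr F f) (tOb al ?y)) (fAr G g) = func_comp (fAr F f) (func_comp (tOb al ?y) (fAr G g))"
    by (rule func_comp_assoc[of _ small]) (use f in auto)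
  have sid: "spO F ?x \<in> spans small" by (simp add: span_id_spans)
  have R: "in_cell E ?R (spO F ?x) (fPr G ?z)
      (func_comp (func_comp (idO F ?x) (func_comp (func_comp (tOb al ?x) (fAr G f)) (fAr G g))) (idO G ?z))
      (func_comp (func_comp (idO F ?x) (func_comp (fAr F f) (func_comp (fAr F g) (tOb al ?z)))) (idO G ?z))"
    using in_cell_ccomp[OF in_cell_ccomp[OF _ in_cell_hcomp[OF a[unfolded ab] b]] lx_laxator[OF tt_lax(2)]]
      in_cell_cinv_lunit[OF sid] by simp
  have L: "in_cell E (tAr al (acomp T f g)) (spO F ?x) (fPr G ?z)
      (func_comp (tOb al ?x) (func_comp (fAr G f) (fAr G g)))
      (func_comp (func_comp (fAr F f) (fAr F g)) (tOb al ?z))"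
    using tt_ar_cell[of "acomp T f g"] f by (simp add: lx_ar_comp)
  have e1: "func_comp (tOb al ?x) (func_comp (fAr G f) (fAr G g)) =
      func_comp (func_comp (idO F ?x) (func_comp (func_comp (tOb al ?x) (fAr G f)) (fAr G g))) (idO G ?z)"
    and e2: "func_comp (func_comp (fAr F f) (fAr F g)) (tOb al ?z) =
      func_comp (func_comp (idO F ?x) (func_comp (fAr F f) (func_comp (fAr F g) (tOb al ?z)))) (idO G ?z)"
    using f by (simp_all add: func_comp_id_left[of _ small] func_comp_id_right[of _ small] func_comp_funcs func_comp_assoc[of _ small])
  have sl: "sm_dom (cinv E (lunit E (spO F ?x))) = spO F ?x"
    using in_cell_bd[OF in_cell_cinv_lunit[OF sid]] by simp
  show ?thesis
    unfolding in_cell_eq_iff[OF L R e1 e2] using f by (simp add: sl cinv_lunit sid)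
qed

text \<open>Modulo typing, a lax transformation is a homomorphism of the category-like structures on
  elements, together with a family of elements indexed by arrows and points that satisfies a
  naturality square and two cocycle equations.\<close>

lemma lax_trans_iff:
  "tx al \<longleftrightarrow>
    (\<forall>c\<in>Ce T. \<forall>a\<in>fel F (dC c).
          cmp G (cC c) (tar al (sC c) (flt F (dC c) a))
            (tpr al (cC c) (fce F c a)) =
          cmp G (cC c) (fce G c (tpr al (dC c) a))
            (tar al (tC c) (frt F (dC c) a))) \<and>
    (\<forall>x a b. a \<in> fel F x \<and> b \<in> fel F x \<and> frt F x a = flt F x b -->
       tpr al x (cmp F x a b) = cmp G x (tpr al x a) (tpr al x b)) \<and>
    (\<forall>x. \<forall>p\<in>fOb F x. tpr al x (uni F x p) = uni G x (tob al x p)) \<and>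
    (\<forall>f\<in>Ar T. \<forall>g\<in>Ar T. cA f = dA g --> (\<forall>p\<in>fOb F (dA f). tar al (acomp T f g) p =
         cmp G (cA g) (fce G (ic g) (tar al f p))
           (tar al g (far F f p)))) \<and>
    (\<forall>x. \<forall>p\<in>fOb F x. tar al (aid T x) p = uni G x (tob al x p))"
    (is "_ \<longleftrightarrow> ?nat \<and> ?cmp \<and> ?one \<and> ?comp \<and> ?id")
proof -
  \<comment> \<open>The facts are stated as equations with \<open>True\<close> so that rewriting
    erases the typing conjuncts from the unfolded definition and leaves exactly the five
    equations.\<close>
  have typing: "lx F = True" "lx G = True" "(tOb al \<in> UNIV \<rightarrow>\<^sub>E funcs small) = True"
      "(tPr al \<in> UNIV \<rightarrow>\<^sub>E span_maps small) = True" "(tAr al \<in> Ar T \<rightarrow>\<^sub>E span_maps small) = True"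
      "(\<forall>x\<in>UNIV. func_dom (tOb al x) = fOb F x \<and> func_cod (tOb al x) = fOb G x) = True"
      "(\<forall>m\<in>UNIV. in_cell E (tPr al m) (fPr F m) (fPr G m) (tOb al m) (tOb al m)) = True"
      "(\<forall>f\<in>Ar T. in_cell E (tAr al f) (spO F (dA f)) (fPr G (cA f))
        (func_comp (tOb al (dA f)) (fAr G f)) (func_comp (fAr F f) (tOb al (cA f)))) = True"
    using typed in_cell_bd[OF tt_pr_cell] in_cell_bd[OF tt_ar_cell] tt_pr_cell tt_ar_cell
    by (auto simp: trans_typed_def PiE_iff Let_def)
  have nat: "?nat \<longleftrightarrow> (\<forall>c\<in>Ce T. ccomp E (ccomp E (cinv E (lunit E (fPr F (dC c))))
           (hcomp E (tAr al (sC c)) (ccomp E (fCe F c) (tPr al (cC c))))) (laxator G (cC c) (cC c))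
       = ccomp E (ccomp E (cinv E (runit E (fPr F (dC c))))
           (hcomp E (ccomp E (tPr al (dC c)) (fCe G c)) (tAr al (tC c)))) (laxator G (cC c) (cC c)))"
    by (intro ball_cong refl tt_nat_iff[symmetric])
  have comp: "?comp \<longleftrightarrow> (\<forall>f\<in>Ar T. \<forall>g\<in>Ar T. cA f = dA g -->
      tAr al (acomp T f g) = ccomp E (ccomp E (cinv E (lunit E (spO F (dA f))))
        (hcomp E (ccomp E (tAr al f) (fCe G (ic g))) (ccomp E (idcell E (fAr F f)) (tAr al g))))
        (laxator G (cA g) (cA g)))"
    by (intro ball_cong refl imp_cong tt_ar_comp_iff[symmetric])
  have cmp: "?cmp \<longleftrightarrow> (\<forall>x\<in>UNIV. \<forall>y\<in>UNIV. x = y -->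
      ccomp E (laxator F x y) (tPr al x) = ccomp E (hcomp E (tPr al x) (tPr al y)) (laxator G x y))"
    using tt_cmp_iff by blast
  have one: "?one \<longleftrightarrow> (\<forall>x\<in>UNIV. ccomp E (unitor F x) (tPr al x) = ccomp E (idcell E (tOb al x)) (unitor G x))"
    by (simp add: tt_one_iff)
  have id: "?id \<longleftrightarrow> (\<forall>x\<in>UNIV. tAr al (aid T x) = ccomp E (idcell E (tOb al x)) (unitor G x))"
    by (simp add: tt_ar_id_iff)
  show ?thesis
    unfolding nat comp cmp one id
    by (simp only: lax_trans_def Let_def FG carriers Span_simps typing simp_thms)
qed

end

declare tt_lax [simp del] tt_ob [simp del] tt_pr [simp del] tt_ar [simp del]

lemma trans_typed: "tx al ==> trans_typed al"
  unfolding lax_trans_def trans_typed_def Let_def by (auto simp: PiE_iff)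

text \<open>Where the codomain occurs in a conclusion as \<open>G\<close>, the equation naming it
  stays a premise. The rules then also apply when \<open>tcod al\<close> is known under another
  name, for instance as the domain of a composable transformation.\<close>

lemmas tx_simps [simp] = tt_lax[OF trans_typed refl refl] tt_ob(1-3)[OF trans_typed refl refl]
  tt_pr(1-4)[OF trans_typed refl refl] tt_ar(1-4)[OF trans_typed refl refl]
  tt_ob(4)[OF trans_typed refl] tt_pr(5-7)[OF trans_typed refl] tt_ar(5-7)[OF trans_typed refl]

context
  fixes al :: "('o, 'a, 'c, 'u) s_trans" and F G
  assumes tx: "tx al" and FG: "tdom al = F" "tcod al = G"
begin

lemma tx_nat:
  "c \<in> Ce T ==> a \<in> fel F (dC c) ==>
    cmp G (cC c) (tar al (sC c) (flt F (dC c) a))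
      (tpr al (cC c) (fce F c a)) =
    cmp G (cC c) (fce G c (tpr al (dC c) a))
      (tar al (tC c) (frt F (dC c) a))"
  using lax_trans_iff[OF trans_typed[OF tx] FG] tx by blast

lemma tx_map':
  "a \<in> fel F x ==> b \<in> fel F x ==> frt F x a = flt F x b ==>
     tpr al x (cmp F x a b) = cmp G x (tpr al x a) (tpr al x b)"
  "p \<in> fOb F x ==> tpr al x (uni F x p) = uni G x (tob al x p)"
  "f \<in> Ar T ==> g \<in> Ar T ==> cA f = dA g ==> p \<in> fOb F (dA f) ==>
     tar al (acomp T f g) p = cmp G (cA g)
       (fce G (ic g) (tar al f p)) (tar al g (far F f p))"
  "p \<in> fOb F x ==> tar al (aid T x) p = uni G x (tob al x p)"
  using lax_trans_iff[OF trans_typed[OF tx] FG] tx by blast+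

lemma tx_nat_arrow:
  "f \<in> Ar T ==> a \<in> fel F (dA f) ==>
    cmp G (cA f) (tar al f (flt F (dA f) a))
      (tpr al (cA f) (fce F (ic f) a)) =
    cmp G (cA f) (fce G (ic f) (tpr al (dA f) a))
      (tar al f (frt F (dA f) a))"
  using tx_nat[of "ic f" a] by simp

end

lemmas tx_map [simp] = tx_map'[OF _ _ refl]

lemma trans_eqI:
  assumes "trans_typed al" "trans_typed be" "tdom al = tdom be" "tcod al = tcod be"
    "\<And>x p. p \<in> fOb (tdom al) x ==> tob al x p = tob be x p"
    "\<And>x a. a \<in> fel (tdom al) x ==> tpr al x a = tpr be x a"
    "\<And>f p. f \<in> Ar T ==> p \<in> fOb (tdom al) (dA f) ==> tar al f p = tar be f p"
  shows "al = be"
proof -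
  note a = assms(1) refl refl and b = assms(2) assms(3)[symmetric] assms(4)[symmetric]
  have ob: "tOb al x = tOb be x" for x
    by (rule func_eqI[of _ small]) (use assms(5) in \<open>simp_all add: tt_ob[OF a] tt_ob[OF b]\<close>)
  have "tPr al x = tPr be x" for x
    by (rule in_cell_eqI[OF tt_pr_cell[OF a] tt_pr_cell[OF b, folded ob]]) (rule assms(6))
  moreover have "tAr al = tAr be"
  proof (rule extensionalityI[of _ "Ar T"])
    fix f assume "f \<in> Ar T"
    then show "tAr al f = tAr be f"
      by (intro in_cell_eqI[OF tt_ar_cell[OF a] tt_ar_cell[OF b, folded ob]]) (auto intro: assms(7))
  qed (use assms(1,2) in \<open>simp_all add: trans_typed_def Let_def\<close>)
  ultimately show ?thesis using ob assms(3,4)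
    by (cases al; cases be) (auto simp: fun_eq_iff)
qed

context
  fixes F :: "('o, 'a, 'c, 'u) s_lax"
  assumes F: "lx F"
begin

lemma trans_id_typed: "trans_typed (tid F)"
proof -
  have "in_cell E (ccomp E (unitor F (dA f)) (fCe F (ic f))) (spO F (dA f))
      (fPr F (cA f)) (func_comp (idO F (dA f)) (fAr F f))
      (func_comp (fAr F f) (idO F (cA f)))" if f: "f \<in> Ar T" for f
    using in_cell_ccomp[OF lx_unitor[OF F] lx_ce[OF F], of "ic f"] f F
    by (simp add: func_comp_id_left[of _ small] func_comp_id_right[of _ small])
  then show ?thesis
    using F by (simp add: trans_typed_def trans_id_def Let_def func_id_funcs)
      (metis in_cell_cid lx_pr)
qed

lemma trans_id_simps [simp]:
  "tdom (tid F) = F" "tcod (tid F) = F"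
  "p \<in> fOb F x ==> tob (tid F) x p = p"
  "a \<in> fel F x ==> tpr (tid F) x a = a"
  "f \<in> Ar T ==> p \<in> fOb F (dA f) ==>
     tar (tid F) f p = uni F (cA f) (far F f p)"
  using F by (simp_all add: trans_id_def)

lemma trans_id_tx [simp]: "tx (tid F)"
  unfolding lax_trans_iff[OF trans_id_typed trans_id_simps(1,2)]
  using F by (simp add: lx_units)

end

context
  fixes al be :: "('o, 'a, 'c, 'u) s_trans"
  assumes al: "tx al" and be: "tx be" and albe: "tcod al = tdom be"
begin

lemma trans_comp_boundary [simp]: "tdom (tcm al be) = tdom al" "tcod (tcm al be) = tcod be"
  by (simp_all add: trans_comp_def)

lemma cinv_lunit_id:
  assumes "small A"
  shows "in_cell E (cinv E (lunit E (span_id A))) (span_id A) (sc (span_id A) (span_id A)) (func_id A) (func_id A)"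
    and "sm_dom (cinv E (lunit E (span_id A))) = span_id A"
    and "p \<in> A ==> sm_map (cinv E (lunit E (span_id A))) p = pair p p"
  using in_cell_cinv_lunit[of "span_id A"] in_cell_bd[OF in_cell_cinv_lunit[of "span_id A"]]
    cinv_lunit[of "span_id A" p] span_id_spans[of small A] assms by simp_all

lemma trans_comp_typed: "trans_typed (tcm al be)"
proof -
  let ?F = "tdom al" and ?G = "tdom be" and ?H = "tcod be"
  note a = trans_typed[OF al] refl albe and b = trans_typed[OF be] refl refl
  have ar: "in_cell E (ccomp E (ccomp E (cinv E (lunit E (spO ?F (dA f))))
        (hcomp E (ccomp E (idcell E (tOb al (dA f))) (tAr be f)) (ccomp E (tAr al f) (tPr be (cA f)))))
        (laxator ?H (cA f) (cA f)))
      (spO ?F (dA f)) (fPr ?H (cA f))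
      (func_comp (func_comp (tOb al (dA f)) (tOb be (dA f))) (fAr ?H f))
      (func_comp (fAr ?F f) (func_comp (tOb al (cA f)) (tOb be (cA f))))" if f: "f \<in> Ar T" for f
  proof -
    let ?x = "dA f" and ?y = "cA f"
    have 1: "in_cell E (ccomp E (idcell E (tOb al ?x)) (tAr be f)) (spO ?F ?x) (fPr ?H ?y)
        (func_comp (tOb al ?x) (func_comp (tOb be ?x) (fAr ?H f)))
        (func_comp (tOb al ?x) (func_comp (fAr ?G f) (tOb be ?y)))"
      using in_cell_ccomp[OF _ tt_ar_cell[OF b f], of "idcell E (tOb al ?x)"] in_cell_idcell[of "tOb al ?x"] al albe
      by simp
    have 2: "in_cell E (ccomp E (tAr al f) (tPr be ?y)) (spO ?F ?x) (fPr ?H ?y)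
        (func_comp (func_comp (tOb al ?x) (fAr ?G f)) (tOb be ?y))
        (func_comp (func_comp (fAr ?F f) (tOb al ?y)) (tOb be ?y))"
      using in_cell_ccomp[OF tt_ar_cell[OF a f] tt_pr_cell[OF b]] .
    have 3: "func_comp (tOb al ?x) (func_comp (fAr ?G f) (tOb be ?y)) = func_comp (func_comp (tOb al ?x) (fAr ?G f)) (tOb be ?y)"
      by (rule func_comp_assoc[of _ small, symmetric]) (use al be albe f in simp_all)
    have 4: "func_comp (func_comp (tOb al ?x) (tOb be ?x)) (fAr ?H f) =
        func_comp (func_comp (idO ?F ?x) (func_comp (tOb al ?x) (func_comp (tOb be ?x) (fAr ?H f)))) (idO ?H ?y)"
      "func_comp (fAr ?F f) (func_comp (tOb al ?y) (tOb be ?y)) =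
        func_comp (func_comp (idO ?F ?x) (func_comp (func_comp (fAr ?F f) (tOb al ?y)) (tOb be ?y))) (idO ?H ?y)"
      using al be albe f by (simp_all add: func_comp_id_left[of _ small] func_comp_id_right[of _ small]
          func_comp_funcs func_comp_assoc[of _ small])
    show ?thesis
      unfolding 4 using al be
      by (intro in_cell_ccomp[OF in_cell_ccomp[OF _ in_cell_hcomp[OF 1[unfolded 3] 2]] lx_laxator] cinv_lunit_id) simp_all
  qed
  have "in_cell E (ccomp E (tPr al x) (tPr be x)) (fPr ?F x) (fPr ?H x)
      (func_comp (tOb al x) (tOb be x)) (func_comp (tOb al x) (tOb be x))" for x
    using in_cell_ccomp[OF tt_pr_cell[OF a] tt_pr_cell[OF b]] .
  with ar show ?thesis
    using al be albe by (simp add: trans_typed_def Let_def) (simp add: trans_comp_def Let_def func_comp_funcs)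
qed

lemma trans_comp_map [simp]:
  "p \<in> fOb (tdom al) x ==> tob (tcm al be) x p = tob be x (tob al x p)"
  "a \<in> fel (tdom al) x ==> tpr (tcm al be) x a = tpr be x (tpr al x a)"
  "f \<in> Ar T ==> p \<in> fOb (tdom al) (dA f) ==> tar (tcm al be) f p =
     cmp (tcod be) (cA f) (tar be f (tob al (dA f) p))
       (tpr be (cA f) (tar al f p))"
proof -
  show "p \<in> fOb (tdom al) x ==> tob (tcm al be) x p = tob be x (tob al x p)"
    "a \<in> fel (tdom al) x ==> tpr (tcm al be) x a = tpr be x (tpr al x a)"
    using al be albe by (simp_all add: trans_comp_def)
  have *: "tob al (dA f) p \<in> fOb (tdom be) (dA f)" if "p \<in> fOb (tdom al) (dA f)"
    using tt_ob(4)[OF trans_typed[OF al] refl albe that] .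
  show "f \<in> Ar T ==> p \<in> fOb (tdom al) (dA f) ==> tar (tcm al be) f p =
     cmp (tcod be) (cA f) (tar be f (tob al (dA f) p))
       (tpr be (cA f) (tar al f p))"
    using al be albe * by (simp add: trans_comp_def Let_def cinv_lunit_id)
qed

lemma trans_comp_tx [simp]: "tx (tcm al be)"
  unfolding lax_trans_iff[OF trans_comp_typed trans_comp_boundary]
proof (intro conjI ballI allI impI, goal_cases)
  let ?F = "tdom al" and ?G = "tdom be" and ?H = "tcod be"
  note [simp] = al be albe
  {
    case (1 c a)
    let ?x = "dC c" and ?y = "cC c" and ?f = "sC c" and ?g = "tC c"
    let ?p = "flt ?F ?x a" and ?q = "frt ?F ?x a"
    let ?X = "tar be ?f (tob al ?x ?p)"
    let ?Y = "tar al ?f ?p" and ?Z = "tpr al ?y (fce ?F c a)"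
    let ?U = "fce ?G c (tpr al ?x a)" and ?V = "tar al ?g ?q"
    let ?b = "tpr be ?y"
    \<comment> \<open>Pasting of two squares: \<open>be\<close> maps the naturality square of
      \<open>al\<close> at \<open>a\<close>, and the square of \<open>be\<close> at the image of
      \<open>a\<close> is attached to it. Associativity regroups the three factors in
      between.\<close>
    have "cmp ?H ?y (cmp ?H ?y ?X (?b ?Y)) (?b ?Z) = cmp ?H ?y ?X (?b (cmp ?G ?y ?Y ?Z))"
      using 1 by simp
    also have "cmp ?G ?y ?Y ?Z = cmp ?G ?y ?U ?V"
      using 1 by (intro tx_nat[OF al refl albe])
    also have "cmp ?H ?y ?X (?b (cmp ?G ?y ?U ?V)) = cmp ?H ?y (cmp ?H ?y ?X (?b ?U)) (?b ?V)"
      using 1 by simp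
    also have "cmp ?H ?y ?X (?b ?U) = cmp ?H ?y (fce ?H c (tpr be ?x (tpr al ?x a)))
        (tar be ?g (tob al ?x ?q))"
      using tx_nat[OF be refl refl, of c "tpr al ?x a"] 1 by simp
    finally show ?case using 1 by simp
  next
    case (4 f g p)
    let ?z = "cA g" and ?y = "dA g" and ?x = "dA f"
    let ?A = "fce ?H (ic g) (tar be f (tob al ?x p))"
    let ?B = "tar be g (far ?G f (tob al ?x p))"
    let ?af = "tar al f p" and ?ag = "tar al g (far ?F f p)"
    \<comment> \<open>Expanding the left side gives four factors, two from \<open>be\<close>
      followed by two from \<open>al\<close>. In the required order they alternate, and naturality
      of \<open>be\<close> along \<open>g\<close> exchanges the two middle ones.\<close>
    have "tar (tcm al be) (acomp T f g) p =
        cmp ?H ?z (cmp ?H ?z ?A ?B) (tpr be ?z (cmp ?G ?z (fce ?G (ic g) ?af) ?ag))"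
      using 4 by simp
    also have "... = cmp ?H ?z ?A (cmp ?H ?z (cmp ?H ?z ?B (tpr be ?z (fce ?G (ic g) ?af))) (tpr be ?z ?ag))"
      using 4 by simp
    also have "cmp ?H ?z ?B (tpr be ?z (fce ?G (ic g) ?af)) =
      cmp ?H ?z (fce ?H (ic g) (tpr be ?y ?af)) (tar be g (tob al ?y (far ?F f p)))"
      using tx_nat_arrow[OF be refl refl 4(2), of ?af] 4 by simp
    finally show ?case using 4 by simp
  }
qed (use al be albe in simp_all)

end

lemma trans_comp_id:
  assumes "tx al"
  shows "tcm (tid (tdom al)) al = al" "tcm al (tid (tcod al)) = al"
  by (rule trans_eqI; use assms in \<open>simp add: trans_typed\<close>)+

lemma trans_comp_assoc:
  assumes "tx al" "tx be" "tx ga" "tcod al = tdom be" "tcod be = tdom ga"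
  shows "tcm (tcm al be) ga = tcm al (tcm be ga)"
  by (rule trans_eqI; use assms in \<open>simp add: trans_typed\<close>)

end

section \<open>Modules as pairs of commuting actions\<close>

lemma ball_walking_proarrow [simp]:
  "(\<forall>m\<in>A \<times> {(a, b). a \<le> (b::bool)}. P m) \<longleftrightarrow>
    (\<forall>x\<in>A. P (x, False, False) \<and> P (x, False, True) \<and> P (x, True, True))"
  by (auto simp: le_bool_def) (metis (full_types))+

lemma ball_times_bool [simp]: "(\<forall>m\<in>A \<times> (UNIV :: bool set). P m) \<longleftrightarrow> (\<forall>x\<in>A. P (x, False) \<and> P (x, True))"
  by (auto, metis (full_types))

lemma prod_walking_simps [simp]:
  fixes T :: "('o, 'a, 'p, 'c) dbl"
  defines "W \<equiv> prod_dbl T walking_proarrow"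
  shows "Ob W = Ob T \<times> UNIV" "Ar W = Ar T \<times> UNIV" "Pr W = Pr T \<times> {(a, b). a \<le> b}"
    "Ce W = Ce T \<times> {(a, b). a \<le> b}"
    "adom W (f, s) = (adom T f, s)" "acod W (f, s) = (acod T f, s)" "aid W (x, s) = (aid T x, s)"
    "acomp W (f, s) (g, t) = (acomp T f g, s)"
    "psrc W (m, ab) = (psrc T m, fst ab)" "ptgt W (m, ab) = (ptgt T m, snd ab)"
    "cdom W (c, ab) = (cdom T c, ab)" "ccod W (c, ab) = (ccod T c, ab)" "cid W (m, ab) = (cid T m, ab)"
    "ccomp W (c, ab) (d, ab') = (ccomp T c d, ab)"
    "csrc W (c, ab) = (csrc T c, fst ab)" "ctgt W (c, ab) = (ctgt T c, snd ab)"
    "pid W (x, s) = (pid T x, s, s)" "pcomp W (m, ab) (n, cd) = (pcomp T m n, fst ab, snd cd)"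
    "idcell W (f, s) = (idcell T f, s, s)" "hcomp W (c, ab) (d, cd) = (hcomp T c d, fst ab, snd cd)"
  by (simp_all add: W_def prod_dbl_def walking_proarrow_def)

lemma mod_end_simps [simp]:
  "x \<in> Ob D ==> fOb (mod_end D b M) x = fOb M (x, b)"
  "f \<in> Ar D ==> fAr (mod_end D b M) f = fAr M (f, b)"
  "m \<in> Pr D ==> fPr (mod_end D b M) m = fPr M (m, b, b)"
  "c \<in> Ce D ==> fCe (mod_end D b M) c = fCe M (c, b, b)"
  "m \<in> Pr D ==> n \<in> Pr D ==> ptgt D m = psrc D n ==> laxator (mod_end D b M) m n = laxator M (m, b, b) (n, b, b)"
  "x \<in> Ob D ==> unitor (mod_end D b M) x = unitor M (x, b)"
  by (simp_all add: mod_end_def)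

context span_models
begin

abbreviation "mx M \<equiv> is_module T E M"

lemma mod_end_lx:
  assumes M: "mx M"
  shows "lx (mod_end T b M)"
proof -
  have "(\<forall>m n. if m \<in> Pr T \<and> n \<in> Pr T \<and> ptgt T m = psrc T n
      then globular E (laxator (mod_end T b M) m n)
        (pcomp E (fPr (mod_end T b M) m) (fPr (mod_end T b M) n)) (fPr (mod_end T b M) (pcomp T m n))
      else laxator (mod_end T b M) m n = undefined)"
  proof (intro allI, goal_cases)
    case (1 m n)
    have "\<forall>m n. if m \<in> Pr (prod_dbl T walking_proarrow) \<and> n \<in> Pr (prod_dbl T walking_proarrow) \<and>
        ptgt (prod_dbl T walking_proarrow) m = psrc (prod_dbl T walking_proarrow) n
      then globular E (laxator M m n) (pcomp E (fPr M m) (fPr M n)) (fPr M (pcomp (prod_dbl T walking_proarrow) m n))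
      else laxator M m n = undefined"
      using M unfolding lax_functor_def by (elim conjE)
    from this[THEN spec, THEN spec, of "(m, b, b)" "(n, b, b)"] show ?case
      by (auto simp: mod_end_def split: if_splits)
  qed
  moreover have "(\<forall>x. if x \<in> Ob T then globular E (unitor (mod_end T b M) x) (pid E (fOb (mod_end T b M) x))
      (fPr (mod_end T b M) (pid T x)) else unitor (mod_end T b M) x = undefined)"
    using M unfolding lax_functor_def by simp
  moreover have "fOb (mod_end T b M) \<in> Ob T \<rightarrow>\<^sub>E Ob E" "fAr (mod_end T b M) \<in> Ar T \<rightarrow>\<^sub>E Ar E"
     "fPr (mod_end T b M) \<in> Pr T \<rightarrow>\<^sub>E Pr E" "fCe (mod_end T b M) \<in> Ce T \<rightarrow>\<^sub>E Ce E"
    using M unfolding lax_functor_def by (auto simp: PiE_iff mod_end_def)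
  moreover have "\<forall>c\<in>Ce T. \<forall>d\<in>Ce T. tC c = sC d -->
      ccomp E (hcomp E (fCe (mod_end T b M) c) (fCe (mod_end T b M) d)) (laxator (mod_end T b M) (cC c) (cC d))
        = ccomp E (laxator (mod_end T b M) (dC c) (dC d)) (fCe (mod_end T b M) (hcomp T c d))"
  proof (intro ballI impI)
    fix c d assume cd: "c \<in> Ce T" "d \<in> Ce T" "tC c = sC d"
    let ?W = "prod_dbl T walking_proarrow"
    have "\<forall>c\<in>Ce ?W. \<forall>d\<in>Ce ?W. ctgt ?W c = csrc ?W d -->
      ccomp E (hcomp E (fCe M c) (fCe M d)) (laxator M (ccod ?W c) (ccod ?W d))
        = ccomp E (laxator M (cdom ?W c) (cdom ?W d)) (fCe M (hcomp ?W c d))"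
      using M unfolding lax_functor_def by (elim conjE)
    from this[THEN bspec, THEN bspec, of "(c, b, b)" "(d, b, b)"] cd hcomp_dom[OF cd]
    show "ccomp E (hcomp E (fCe (mod_end T b M) c) (fCe (mod_end T b M) d)) (laxator (mod_end T b M) (cC c) (cC d))
        = ccomp E (laxator (mod_end T b M) (dC c) (dC d)) (fCe (mod_end T b M) (hcomp T c d))"
      by simp
  qed
  ultimately show ?thesis
    using M unfolding lax_functor_def by (cases b; simp)
qed

abbreviation "la M x a m \<equiv> sm_map (act_l M x x) (pair a m)"
abbreviation "ra M x m b \<equiv> sm_map (act_r M x x) (pair m b)"

context
  fixes M :: "('o, 'a, 'c, 'u) s_module" and F G
  assumes M: "mx M" and FG: "sr M = F" "tg M = G"
begin

lemma md_lx: "lx F" "lx G"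
  using mod_end_lx[OF M] FG by auto

lemma md_ends:
  "fOb M (x, False) = fOb F x" "fOb M (x, True) = fOb G x"
  "f \<in> Ar T ==> fAr M (f, False) = fAr F f" "f \<in> Ar T ==> fAr M (f, True) = fAr G f"
  "fPr M (x, False, False) = fPr F x" "fPr M (x, True, True) = fPr G x"
  "c \<in> Ce T ==> fCe M (c, False, False) = fCe F c" "c \<in> Ce T ==> fCe M (c, True, True) = fCe G c"
  "laxator M (x, False, False) (x, False, False) = laxator F x x"
  "laxator M (x, True, True) (x, True, True) = laxator G x x"
  "unitor M (x, False) = unitor F x" "unitor M (x, True) = unitor G x"
  unfolding FG[symmetric] by simp_all

lemma md_pr: "mod_Pr M x \<in> spans small" "lfoot (mod_Pr M x) = fOb F x" "rfoot (mod_Pr M x) = fOb G x"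
  using M by (simp_all add: lax_functor_def PiE_iff md_ends mod_Pr_def)

lemma md_ce: "c \<in> Ce T ==> in_cell E (mod_Ce M c) (mod_Pr M (dC c)) (mod_Pr M (cC c))
    (fAr F (sC c)) (fAr G (tC c))"
proof -
  assume c: "c \<in> Ce T"
  have "\<forall>c\<in>Ce (prod_dbl T walking_proarrow). in_cell E (fCe M c) (fPr M (cdom (prod_dbl T walking_proarrow) c))
      (fPr M (ccod (prod_dbl T walking_proarrow) c)) (fAr M (csrc (prod_dbl T walking_proarrow) c))
      (fAr M (ctgt (prod_dbl T walking_proarrow) c))"
    using M unfolding lax_functor_def by (elim conjE)
  from bspec[OF this, of "(c, False, True)"] show ?thesis
    using c by (simp add: mod_Pr_def mod_Ce_def md_ends)
qed

lemma md_act: "in_cell E (act_l M x x) (sc (fPr F x) (mod_Pr M x)) (mod_Pr M x)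
      (idO F x) (idO G x)"
    "in_cell E (act_r M x x) (sc (mod_Pr M x) (fPr G x)) (mod_Pr M x)
      (idO F x) (idO G x)"
proof -
  have *: "\<forall>m n. if m \<in> Pr (prod_dbl T walking_proarrow) \<and> n \<in> Pr (prod_dbl T walking_proarrow) \<and>
        ptgt (prod_dbl T walking_proarrow) m = psrc (prod_dbl T walking_proarrow) n
      then globular E (laxator M m n) (pcomp E (fPr M m) (fPr M n)) (fPr M (pcomp (prod_dbl T walking_proarrow) m n))
      else laxator M m n = undefined"
    using M unfolding lax_functor_def by (elim conjE)
  from *[THEN spec, THEN spec, of "(x, False, False)" "(x, False, True)"]
    *[THEN spec, THEN spec, of "(x, False, True)" "(x, True, True)"]
  show "in_cell E (act_l M x x) (sc (fPr F x) (mod_Pr M x)) (mod_Pr M x)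
      (idO F x) (idO G x)"
    "in_cell E (act_r M x x) (sc (mod_Pr M x) (fPr G x)) (mod_Pr M x)
      (idO F x) (idO G x)"
    using md_pr lx_pr[OF md_lx(1)] lx_pr[OF md_lx(2)]
    by (simp_all add: globular_def md_ends mod_Pr_def act_l_def act_r_def)
qed

lemma md_legs:
  "m \<in> elt M x ==> lft M x m \<in> fOb F x"
  "m \<in> elt M x ==> rgt M x m \<in> fOb G x"
  using legs[of "mod_Pr M x" m] md_pr[of x] by auto

lemma md_ce_simps:
  assumes "c \<in> Ce T"
  shows "sm_dom (mod_Ce M c) = mod_Pr M (dC c)" "sm_cod (mod_Ce M c) = mod_Pr M (cC c)"
    "sm_left (mod_Ce M c) = fAr F (sC c)" "sm_right (mod_Ce M c) = fAr G (tC c)"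
    "cC c = y ==> m \<in> elt M (dC c) ==> mce M c m \<in> elt M y"
    "cC c = y ==> m \<in> elt M (dC c) ==> lft M y (mce M c m) =
       far F (sC c) (lft M (dC c) m)"
    "cC c = y ==> m \<in> elt M (dC c) ==> rgt M y (mce M c m) =
       far G (tC c) (rgt M (dC c) m)"
  using in_cell_bd[OF md_ce[OF assms]] in_cell_map[OF md_ce[OF assms], of m] by auto

lemma md_ce_map:
  "m \<in> elt M x ==> mce M (cid T x) m = m"
  "c \<in> Ce T ==> d \<in> Ce T ==> cC c = dC d ==> m \<in> elt M (dC c) ==>
     mce M (ccomp T c d) m = mce M d (mce M c m)"
proof -
  show "m \<in> elt M x ==> mce M (cid T x) m = m"
    using M by (simp add: lax_functor_def mod_Pr_def mod_Ce_def)
  assume c: "c \<in> Ce T" "d \<in> Ce T" "cC c = dC d" and m: "m \<in> elt M (dC c)"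
  have "mod_Ce M (ccomp T c d) = ccomp E (mod_Ce M c) (mod_Ce M d)"
    using M c by (simp add: lax_functor_def mod_Ce_def)
  then show "mce M (ccomp T c d) m = mce M d (mce M c m)"
    using c m by (simp add: md_ce_simps)
qed

lemma md_act_simps:
  "sm_dom (act_l M x x) = sc (fPr F x) (mod_Pr M x)" "sm_cod (act_l M x x) = mod_Pr M x"
  "sm_left (act_l M x x) = idO F x" "sm_right (act_l M x x) = idO G x"
  "sm_dom (act_r M x x) = sc (mod_Pr M x) (fPr G x)" "sm_cod (act_r M x x) = mod_Pr M x"
  "sm_left (act_r M x x) = idO F x" "sm_right (act_r M x x) = idO G x"
  using in_cell_bd[OF md_act(1)] in_cell_bd[OF md_act(2)] by simp_all

lemma md_la:
  assumes "a \<in> fel F x" "m \<in> elt M x" "frt F x a = lft M x m"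
  shows "la M x a m \<in> elt M x" "lft M x (la M x a m) = flt F x a"
    "rgt M x (la M x a m) = rgt M x m"
  using in_cell_map[OF md_act(1), of "pair a m" x] assms lx_legs[OF md_lx(1)] md_legs by simp_all

lemma md_ra:
  assumes "m \<in> elt M x" "b \<in> fel G x" "rgt M x m = flt G x b"
  shows "ra M x m b \<in> elt M x" "lft M x (ra M x m b) = lft M x m"
    "rgt M x (ra M x m b) = frt G x b"
  using in_cell_map[OF md_act(2), of "pair m b" x] assms lx_legs[OF md_lx(2)] md_legs by simp_all

text \<open>These are the associativity axiom of the lax functor at the three places where the
  generating proarrow \<open>i\<close> can stand in a composable triple. The middle one says that
  the two actions commute.\<close>

lemma md_assoc:
  shows "a \<in> fel F x ==> b \<in> fel F x ==> m \<in> elt M x ==>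
      frt F x a = flt F x b ==> frt F x b = lft M x m ==>
      la M x (cmp F x a b) m = la M x a (la M x b m)"
    "a \<in> fel F x ==> m \<in> elt M x ==> c \<in> fel G x ==>
      frt F x a = lft M x m ==> rgt M x m = flt G x c ==>
      ra M x (la M x a m) c = la M x a (ra M x m c)"
    "m \<in> elt M x ==> c \<in> fel G x ==> d \<in> fel G x ==>
      rgt M x m = flt G x c ==> frt G x c = flt G x d ==>
      ra M x (ra M x m c) d = ra M x m (cmp G x c d)"
proof -
  have *: "ccomp E (hcomp E (laxator F x x) (cid E (mod_Pr M x))) (act_l M x x) =
      ccomp E (ccomp E (assoc E (fPr F x) (fPr F x) (mod_Pr M x))
        (hcomp E (cid E (fPr F x)) (act_l M x x))) (act_l M x x)"
    "ccomp E (hcomp E (act_l M x x) (cid E (fPr G x))) (act_r M x x) =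
      ccomp E (ccomp E (assoc E (fPr F x) (mod_Pr M x) (fPr G x))
        (hcomp E (cid E (fPr F x)) (act_r M x x))) (act_l M x x)"
    "ccomp E (hcomp E (act_r M x x) (cid E (fPr G x))) (act_r M x x) =
      ccomp E (ccomp E (assoc E (mod_Pr M x) (fPr G x) (fPr G x))
        (hcomp E (cid E (mod_Pr M x)) (laxator G x x))) (act_r M x x)"
  proof -
    let ?W = "prod_dbl T walking_proarrow"
    have "\<forall>m\<in>Pr ?W. \<forall>n\<in>Pr ?W. \<forall>p\<in>Pr ?W. ptgt ?W m = psrc ?W n \<and> ptgt ?W n = psrc ?W p -->
        ccomp E (hcomp E (laxator M m n) (cid E (fPr M p))) (laxator M (pcomp ?W m n) p)
          = ccomp E (ccomp E (assoc E (fPr M m) (fPr M n) (fPr M p))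
            (hcomp E (cid E (fPr M m)) (laxator M n p))) (laxator M m (pcomp ?W n p))"
      using M unfolding lax_functor_def by (elim conjE)
    note A = this[THEN bspec, THEN bspec, THEN bspec]
    show "ccomp E (hcomp E (laxator F x x) (cid E (mod_Pr M x))) (act_l M x x) =
      ccomp E (ccomp E (assoc E (fPr F x) (fPr F x) (mod_Pr M x))
        (hcomp E (cid E (fPr F x)) (act_l M x x))) (act_l M x x)"
      using A[of "(x, False, False)" "(x, False, False)" "(x, False, True)"]
      by (simp add: md_ends mod_Pr_def act_l_def)
    show "ccomp E (hcomp E (act_l M x x) (cid E (fPr G x))) (act_r M x x) =
      ccomp E (ccomp E (assoc E (fPr F x) (mod_Pr M x) (fPr G x))
        (hcomp E (cid E (fPr F x)) (act_r M x x))) (act_l M x x)"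
      using A[of "(x, False, False)" "(x, False, True)" "(x, True, True)"]
      by (simp add: md_ends mod_Pr_def act_l_def act_r_def)
    show "ccomp E (hcomp E (act_r M x x) (cid E (fPr G x))) (act_r M x x) =
      ccomp E (ccomp E (assoc E (mod_Pr M x) (fPr G x) (fPr G x))
        (hcomp E (cid E (mod_Pr M x)) (laxator G x x))) (act_r M x x)"
      using A[of "(x, False, True)" "(x, True, True)" "(x, True, True)"]
      by (simp add: md_ends mod_Pr_def act_r_def)
  qed
  from arg_cong[OF *(1), of "\<lambda>d. sm_map d (pair (pair a b) m)"]
  show "a \<in> fel F x ==> b \<in> fel F x ==> m \<in> elt M x ==>
      frt F x a = flt F x b ==> frt F x b = lft M x m ==>
      la M x (cmp F x a b) m = la M x a (la M x b m)"
    using md_lx by (simp add: md_act_simps md_la)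
  from arg_cong[OF *(2), of "\<lambda>d. sm_map d (pair (pair a m) c)"]
  show "a \<in> fel F x ==> m \<in> elt M x ==> c \<in> fel G x ==>
      frt F x a = lft M x m ==> rgt M x m = flt G x c ==>
      ra M x (la M x a m) c = la M x a (ra M x m c)"
    using md_lx by (simp add: md_act_simps md_la md_ra)
  from arg_cong[OF *(3), of "\<lambda>e. sm_map e (pair (pair m c) d)"]
  show "m \<in> elt M x ==> c \<in> fel G x ==> d \<in> fel G x ==>
      rgt M x m = flt G x c ==> frt G x c = flt G x d ==>
      ra M x (ra M x m c) d = ra M x m (cmp G x c d)"
    using md_lx by (simp add: md_act_simps md_ra)
qed

lemma md_units:
  assumes "m \<in> elt M x"
  shows "p = lft M x m ==> la M x (uni F x p) m = m"
    "q = rgt M x m ==> ra M x m (uni G x q) = m"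
proof -
  have *: "ccomp E (hcomp E (unitor F x) (cid E (mod_Pr M x))) (act_l M x x) = lunit E (mod_Pr M x)"
    "ccomp E (hcomp E (cid E (mod_Pr M x)) (unitor G x)) (act_r M x x) = runit E (mod_Pr M x)"
  proof -
    let ?W = "prod_dbl T walking_proarrow"
    have "\<forall>m\<in>Pr ?W.
        ccomp E (hcomp E (unitor M (psrc ?W m)) (cid E (fPr M m))) (laxator M (pid ?W (psrc ?W m)) m) = lunit E (fPr M m) \<and>
        ccomp E (hcomp E (cid E (fPr M m)) (unitor M (ptgt ?W m))) (laxator M m (pid ?W (ptgt ?W m))) = runit E (fPr M m)"
      using M unfolding lax_functor_def by (elim conjE)
    from this[THEN bspec, of "(x, False, True)"]
    show "ccomp E (hcomp E (unitor F x) (cid E (mod_Pr M x))) (act_l M x x) = lunit E (mod_Pr M x)"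
      "ccomp E (hcomp E (cid E (mod_Pr M x)) (unitor G x)) (act_r M x x) = runit E (mod_Pr M x)"
      by (simp_all add: md_ends mod_Pr_def act_l_def act_r_def)
  qed
  from arg_cong[OF *(1), of "\<lambda>d. sm_map d (pair (lft M x m) m)"]
    arg_cong[OF *(2), of "\<lambda>d. sm_map d (pair m (rgt M x m))"]
  show "p = lft M x m ==> la M x (uni F x p) m = m"
    "q = rgt M x m ==> ra M x m (uni G x q) = m"
    using assms md_lx by (simp_all add: md_legs md_pr)
qed

lemma md_hcomp:
  assumes "c \<in> Ce T" "d \<in> Ce T" "tC c = sC d"
  shows "a \<in> fel F (dC c) ==> m \<in> elt M (dC c) ==>
      frt F (dC c) a = lft M (dC c) m ==>
      mce M (hcomp T c d) (la M (dC c) a m) =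
        la M (cC c) (fce F c a) (mce M d m)"
    "m \<in> elt M (dC c) ==> b \<in> fel G (dC c) ==>
      rgt M (dC c) m = flt G (dC c) b ==>
      mce M (hcomp T c d) (ra M (dC c) m b) =
        ra M (cC c) (mce M c m) (fce G d b)"
proof -
  note cd = hcomp_dom[OF assms]
  have *: "ccomp E (hcomp E (fCe F c) (mod_Ce M d)) (act_l M (cC c) (cC d)) =
      ccomp E (act_l M (dC c) (dC d)) (mod_Ce M (hcomp T c d))"
    "ccomp E (hcomp E (mod_Ce M c) (fCe G d)) (act_r M (cC c) (cC d)) =
      ccomp E (act_r M (dC c) (dC d)) (mod_Ce M (hcomp T c d))"
  proof -
    let ?W = "prod_dbl T walking_proarrow"
    have "\<forall>c\<in>Ce ?W. \<forall>d\<in>Ce ?W. ctgt ?W c = csrc ?W d -->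
      ccomp E (hcomp E (fCe M c) (fCe M d)) (laxator M (ccod ?W c) (ccod ?W d))
        = ccomp E (laxator M (cdom ?W c) (cdom ?W d)) (fCe M (hcomp ?W c d))"
      using M unfolding lax_functor_def by (elim conjE)
    note N = this[THEN bspec, THEN bspec]
    show "ccomp E (hcomp E (fCe F c) (mod_Ce M d)) (act_l M (cC c) (cC d)) =
      ccomp E (act_l M (dC c) (dC d)) (mod_Ce M (hcomp T c d))"
      using N[of "(c, False, False)" "(d, False, True)"] assms
      by (simp add: md_ends mod_Ce_def act_l_def)
    show "ccomp E (hcomp E (mod_Ce M c) (fCe G d)) (act_r M (cC c) (cC d)) =
      ccomp E (act_r M (dC c) (dC d)) (mod_Ce M (hcomp T c d))"
      using N[of "(c, False, True)" "(d, True, True)"] assms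
      by (simp add: md_ends mod_Ce_def act_r_def)
  qed
  from arg_cong[OF *(1), of "\<lambda>e. sm_map e (pair a m)"]
  show "a \<in> fel F (dC c) ==> m \<in> elt M (dC c) ==>
      frt F (dC c) a = lft M (dC c) m ==>
      mce M (hcomp T c d) (la M (dC c) a m) =
        la M (cC c) (fce F c a) (mce M d m)"
    using assms cd md_lx by (simp add: md_ce_simps md_act_simps)
  from arg_cong[OF *(2), of "\<lambda>e. sm_map e (pair m b)"]
  show "m \<in> elt M (dC c) ==> b \<in> fel G (dC c) ==>
      rgt M (dC c) m = flt G (dC c) b ==>
      mce M (hcomp T c d) (ra M (dC c) m b) =
        ra M (cC c) (mce M c m) (fce G d b)"
    using assms cd md_lx by (simp add: md_ce_simps md_act_simps)
qed

lemma md_idcell: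
  assumes f: "f \<in> Ar T" "dA f = x"
  shows "a \<in> fel F x ==> m \<in> elt M x ==> frt F x a = lft M x m ==>
      mce M (ic f) (la M x a m) =
        la M (cA f) (fce F (ic f) a) (mce M (ic f) m)"
    "m \<in> elt M x ==> b \<in> fel G x ==> rgt M x m = flt G x b ==>
      mce M (ic f) (ra M x m b) =
        ra M (cA f) (mce M (ic f) m) (fce G (ic f) b)"
    "g \<in> Ar T ==> cA f = dA g ==> m \<in> elt M x ==>
      mce M (ic (acomp T f g)) m = mce M (ic g) (mce M (ic f) m)"
  using md_hcomp[of "ic f" "ic f"] f hcomp_units(1)[of "ic f"]
  by (auto simp: idcell_acomp md_ce_map)

text \<open>By the unit law of external composition, \<open>c\<close> equals
  \<open>hcomp c (idcell g)\<close> with \<open>g\<close> its target arrow. Applying naturality of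
  the left action to this pair, at a unit element and \<open>m\<close>, splits the action of
  \<open>c\<close>. The second equation is the mirror image, with the source arrow.\<close>

lemma md_whisker:
  assumes c: "c \<in> Ce T" and m: "m \<in> elt M (dC c)"
  shows "mce M c m = la M (cC c)
      (fce F c (uni F (dC c) (lft M (dC c) m)))
      (mce M (ic (tC c)) m)"
    "mce M c m = ra M (cC c) (mce M (ic (sC c)) m)
      (fce G c (uni G (dC c) (rgt M (dC c) m)))"
proof -
  show "mce M c m = la M (cC c)
      (fce F c (uni F (dC c) (lft M (dC c) m)))
      (mce M (ic (tC c)) m)"
    using md_hcomp(1)[of c "ic (tC c)" "uni F (dC c) (lft M (dC c) m)" m]
      assms md_lx by (simp add: md_legs md_units)
  show "mce M c m = ra M (cC c) (mce M (ic (sC c)) m)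
      (fce G c (uni G (dC c) (rgt M (dC c) m)))"
    using md_hcomp(2)[of "ic (sC c)" c m "uni G (dC c) (rgt M (dC c) m)"]
      assms md_lx by (simp add: md_legs md_units)
qed

end

declare mod_end_simps [simp del]

lemmas mx_simps [simp] = md_lx[OF _ refl refl] md_pr[OF _ refl refl] md_ce_simps(1-4)[OF _ refl refl]
  md_act_simps[OF _ refl refl] md_ce_map[OF _ refl refl]
  md_legs(1)[OF _ _ refl] md_legs(2)[OF _ refl] md_ce_simps(5-7)[OF _ refl refl]
  md_la[OF _ refl refl] md_ra[OF _ refl refl] md_assoc(1)[OF _ _ refl] md_assoc(2,3)[OF _ refl refl]
  md_units(1)[OF _ _ refl] md_units(2)[OF _ refl] md_idcell[OF _ refl refl]

text \<open>Assembles a lax functor on the product with the walking proarrow from its two ends and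
  the data over \<open>i\<close>. The branches with value \<open>undefined\<close> keep all families
  extensional; thereby \<open>mod_end\<close> returns \<open>F\<close> and \<open>G\<close> on the
  nose.\<close>

definition mk_module ::
  "('o, 'a, 'c, 'u) s_lax \<Rightarrow>
   ('o, 'a, 'c, 'u) s_lax \<Rightarrow>
   ('o \<Rightarrow> 'u span) \<Rightarrow> ('c \<Rightarrow> 'u span_map) \<Rightarrow> ('o \<Rightarrow> 'u span_map) \<Rightarrow> ('o \<Rightarrow> 'u span_map) \<Rightarrow>
   ('o, 'a, 'c, 'u) s_module" where
  "mk_module F G P C L R = \<lparr>
     fOb = (\<lambda>(x, b). fOb (if b then G else F) x),
     fAr = (\<lambda>(f, b). fAr (if b then G else F) f),
     fPr = (\<lambda>(x, a, b). if a = b then fPr (if a then G else F) x else if a then undefined else P x),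
     fCe = (\<lambda>(c, a, b). if a = b then fCe (if a then G else F) c
        else if a \<or> c \<notin> Ce T then undefined else C c),
     laxator = (\<lambda>(x, a, b) (y, c, d). if x \<noteq> y \<or> b \<noteq> c \<or> \<not> a \<le> b \<or> \<not> c \<le> d then undefined
        else if a = d then laxator (if a then G else F) x x else if b then R x else L x),
     unitor = (\<lambda>(x, b). unitor (if b then G else F) x)\<rparr>"

lemma mk_module_simps [simp]:
  "fOb (mk_module F G P C L R) (x, b) = fOb (if b then G else F) x"
  "fAr (mk_module F G P C L R) (f, b) = fAr (if b then G else F) f"
  "fPr (mk_module F G P C L R) (x, False, False) = fPr F x"
  "fPr (mk_module F G P C L R) (x, True, True) = fPr G x"
  "fPr (mk_module F G P C L R) (x, False, True) = P x"
  "fCe (mk_module F G P C L R) (c, False, False) = fCe F c"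
  "fCe (mk_module F G P C L R) (c, True, True) = fCe G c"
  "c \<in> Ce T ==> fCe (mk_module F G P C L R) (c, False, True) = C c"
  "laxator (mk_module F G P C L R) (x, False, False) (x, False, False) = laxator F x x"
  "laxator (mk_module F G P C L R) (x, True, True) (x, True, True) = laxator G x x"
  "laxator (mk_module F G P C L R) (x, False, False) (x, False, True) = L x"
  "laxator (mk_module F G P C L R) (x, False, True) (x, True, True) = R x"
  "unitor (mk_module F G P C L R) (x, b) = unitor (if b then G else F) x"
  "mod_Pr (mk_module F G P C L R) x = P x" "c \<in> Ce T ==> mod_Ce (mk_module F G P C L R) c = C c"
  "act_l (mk_module F G P C L R) x x = L x" "act_r (mk_module F G P C L R) x x = R x"
  by (simp_all add: mk_module_def mod_Pr_def mod_Ce_def act_l_def act_r_def)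

lemma mod_end_mk_module [simp]:
  assumes "lx F" "lx G"
  shows "mod_end T b (mk_module F G P C L R) = (if b then G else F)"
proof -
  note u = lx_undefined[OF assms(1)] lx_undefined[OF assms(2)]
  show ?thesis
    by (rule lax.equality) (auto simp: mod_end_def mk_module_def fun_eq_iff restrict_def u)
qed

text \<open>The hypotheses are the instances of the lax functor axioms that involve
  \<open>i\<close>, read on elements; every other instance is one for \<open>F\<close> or for
  \<open>G\<close>. So to construct a module it is enough to give spans, actions of cells, and two
  actions of the models with these equations.\<close>

lemma mk_module_mx:
  assumes F: "lx F" and G: "lx G"
    and P: "\<And>x. P x \<in> spans small \<and> lfoot (P x) = fOb F x \<and> rfoot (P x) = fOb G x"
    and C: "\<And>c. c \<in> Ce T ==> in_cell E (C c) (P (dC c)) (P (cC c)) (fAr F (sC c)) (fAr G (tC c))"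
    and L: "\<And>x. in_cell E (L x) (sc (fPr F x) (P x)) (P x) (idO F x) (idO G x)"
    and R: "\<And>x. in_cell E (R x) (sc (P x) (fPr G x)) (P x) (idO F x) (idO G x)"
    and C_cid: "\<And>x m. m \<in> apex (P x) ==> sm_map (C (cid T x)) m = m"
    and C_ccomp: "\<And>c d m. c \<in> Ce T ==> d \<in> Ce T ==> cC c = dC d ==> m \<in> apex (P (dC c)) ==>
      sm_map (C (ccomp T c d)) m = sm_map (C d) (sm_map (C c) m)"
    and L_nat: "\<And>c d a m. c \<in> Ce T ==> d \<in> Ce T ==> tC c = sC d ==>
      a \<in> fel F (dC c) ==> m \<in> apex (P (dC c)) ==> frt F (dC c) a = lleg (P (dC c)) m ==>
      sm_map (C (hcomp T c d)) (sm_map (L (dC c)) (pair a m)) =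
        sm_map (L (cC c)) (pair (fce F c a) (sm_map (C d) m))"
    and R_nat: "\<And>c d m b. c \<in> Ce T ==> d \<in> Ce T ==> tC c = sC d ==>
      m \<in> apex (P (dC c)) ==> b \<in> fel G (dC c) ==> rleg (P (dC c)) m = flt G (dC c) b ==>
      sm_map (C (hcomp T c d)) (sm_map (R (dC c)) (pair m b)) =
        sm_map (R (cC c)) (pair (sm_map (C c) m) (fce G d b))"
    and LL: "\<And>x a b m. a \<in> fel F x ==> b \<in> fel F x ==> m \<in> apex (P x) ==>
      frt F x a = flt F x b ==> frt F x b = lleg (P x) m ==>
      sm_map (L x) (pair (cmp F x a b) m) = sm_map (L x) (pair a (sm_map (L x) (pair b m)))"
    and LR: "\<And>x a m c. a \<in> fel F x ==> m \<in> apex (P x) ==> c \<in> fel G x ==>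
      frt F x a = lleg (P x) m ==> rleg (P x) m = flt G x c ==>
      sm_map (R x) (pair (sm_map (L x) (pair a m)) c) = sm_map (L x) (pair a (sm_map (R x) (pair m c)))"
    and RR: "\<And>x m c d. m \<in> apex (P x) ==> c \<in> fel G x ==> d \<in> fel G x ==>
      rleg (P x) m = flt G x c ==> frt G x c = flt G x d ==>
      sm_map (R x) (pair (sm_map (R x) (pair m c)) d) = sm_map (R x) (pair m (cmp G x c d))"
    and L_unit: "\<And>x m. m \<in> apex (P x) ==> sm_map (L x) (pair (uni F x (lleg (P x) m)) m) = m"
    and R_unit: "\<And>x m. m \<in> apex (P x) ==> sm_map (R x) (pair m (uni G x (rleg (P x) m))) = m"
  shows "mx (mk_module F G P C L R)"
proof -
  let ?M = "mk_module F G P C L R" and ?W = "prod_dbl T walking_proarrow"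
  note [simp] = F G P
  have Lb: "sm_dom (L x) = sc (fPr F x) (P x)" "sm_cod (L x) = P x"
     "sm_left (L x) = idO F x" "sm_right (L x) = idO G x"
     "sm_dom (R x) = sc (P x) (fPr G x)" "sm_cod (R x) = P x"
     "sm_left (R x) = idO F x" "sm_right (R x) = idO G x" for x
    using in_cell_bd[OF L] in_cell_bd[OF R] by simp_all
  have Lm: "a \<in> fel F x ==> m \<in> apex (P x) ==> frt F x a = lleg (P x) m ==>
      sm_map (L x) (pair a m) \<in> apex (P x) \<and> lleg (P x) (sm_map (L x) (pair a m)) = flt F x a \<and>
      rleg (P x) (sm_map (L x) (pair a m)) = rleg (P x) m" for a m x
    using in_cell_map[OF L, of "pair a m" x] legs(2)[of "P x" m] by simp
  have Rm: "m \<in> apex (P x) ==> b \<in> fel G x ==> rleg (P x) m = flt G x b ==>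
      sm_map (R x) (pair m b) \<in> apex (P x) \<and> lleg (P x) (sm_map (R x) (pair m b)) = lleg (P x) m \<and>
      rleg (P x) (sm_map (R x) (pair m b)) = frt G x b" for b m x
    using in_cell_map[OF R, of "pair m b" x] legs(1)[of "P x" m] by simp
  have Cb: "sm_dom (C c) = P (dC c)" "sm_cod (C c) = P (cC c)"
      "sm_left (C c) = fAr F (sC c)" "sm_right (C c) = fAr G (tC c)" "C c \<in> span_maps small" if "c \<in> Ce T" for c
    using in_cell_bd[OF C[OF that]] by simp_all
  have legP: "m \<in> apex (P x) ==> lleg (P x) m \<in> fOb F x" "m \<in> apex (P x) ==> rleg (P x) m \<in> fOb G x" for m x
    using legs[of "P x" m] by simp_all
  have ids: "func_comp (idO H x) (idO H x) = idO H x" if "lx H" for H x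
    using that func_comp_id_left[OF func_id_funcs, of small "fOb H x" "fOb H x"] by simp
  have arid: "func_comp (fAr H f) (idO H (cA f)) = fAr H f"
    "func_comp (idO H (dA f)) (fAr H f) = fAr H f" if "lx H" "f \<in> Ar T" for H f
    using that by (auto intro!: func_comp_id_left[of _ small] func_comp_id_right[of _ small])
  have cidP: "in_cell E (cid E (P x)) (P x) (P x) (idO F x) (idO G x)"
    "in_cell E (cid E (fPr F x)) (fPr F x) (fPr F x) (idO F x) (idO F x)"
    "in_cell E (cid E (fPr G x)) (fPr G x) (fPr G x) (idO G x) (idO G x)" for x
    using in_cell_cid[of "P x"] in_cell_cid[of "fPr F x"] in_cell_cid[of "fPr G x"] by simp_all
  have cid: "C (cid T x) = cid E (P x)" for x
  proof (rule in_cell_eqI[OF _ cidP(1)])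
    show "in_cell E (C (cid T x)) (P x) (P x) (idO F x) (idO G x)"
      using C[of "cid T x"] by (simp add: lx_ar_id)
  qed (simp add: C_cid)
  have ccomp: "C (ccomp T c d) = ccomp E (C c) (C d)" if c: "c \<in> Ce T" "d \<in> Ce T" "cC c = dC d" for c d
  proof (rule in_cell_eqI)
    show "in_cell E (C (ccomp T c d)) (P (dC c)) (P (cC d)) (func_comp (fAr F (sC c)) (fAr F (sC d)))
      (func_comp (fAr G (tC c)) (fAr G (tC d)))"
      using C[of "ccomp T c d"] c by (simp add: lx_ar_comp)
    show "in_cell E (ccomp E (C c) (C d)) (P (dC c)) (P (cC d)) (func_comp (fAr F (sC c)) (fAr F (sC d)))
      (func_comp (fAr G (tC c)) (fAr G (tC d)))"
      using in_cell_ccomp[OF C[OF c(1), unfolded c(3)] C[OF c(2)]] .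
  qed (simp add: C_ccomp c Cb)
  have nat: "ccomp E (hcomp E (fCe F c) (C d)) (L (cC d)) = ccomp E (L (dC d)) (C (hcomp T c d))"
    "ccomp E (hcomp E (C c) (fCe G d)) (R (cC d)) = ccomp E (R (dC d)) (C (hcomp T c d))"
    if c: "c \<in> Ce T" "d \<in> Ce T" "tC c = sC d" for c d
  proof -
    note cd = hcomp_dom[OF c]
    have l: "in_cell E (ccomp E (hcomp E (fCe F c) (C d)) (L (cC d))) (sc (fPr F (dC d)) (P (dC d)))
        (P (cC d)) (fAr F (sC c)) (fAr G (tC d))"
      using in_cell_ccomp[OF in_cell_hcomp[OF lx_ce[OF F c(1)] C[OF c(2), folded c(3)], folded cd(2)] L]
        arid(1)[OF F, of "sC c"] arid(1)[OF G, of "tC d"] c cd by simp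
    have r: "in_cell E (ccomp E (hcomp E (C c) (fCe G d)) (R (cC d))) (sc (P (dC d)) (fPr G (dC d)))
        (P (cC d)) (fAr F (sC c)) (fAr G (tC d))"
      using in_cell_ccomp[OF in_cell_hcomp[OF C[OF c(1)] lx_ce[OF G c(2), folded c(3)], folded cd(2)] R]
        arid(1)[OF F, of "sC c"] arid(1)[OF G, of "tC d"] c cd by simp
    have ch: "in_cell E (C (hcomp T c d)) (P (dC d)) (P (cC d)) (fAr F (sC c)) (fAr G (tC d))"
      using C[of "hcomp T c d"] c cd by simp
    show "ccomp E (hcomp E (fCe F c) (C d)) (L (cC d)) = ccomp E (L (dC d)) (C (hcomp T c d))"
    proof (rule in_cell_eqI[OF l])
      show "in_cell E (ccomp E (L (dC d)) (C (hcomp T c d))) (sc (fPr F (dC d)) (P (dC d)))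
        (P (cC d)) (fAr F (sC c)) (fAr G (tC d))"
        using in_cell_ccomp[OF L ch] arid(2)[OF F, of "sC c"] arid(2)[OF G, of "tC d"] c cd by simp
      fix z assume "z \<in> apex (sc (fPr F (dC d)) (P (dC d)))"
      then obtain a m where z: "z = pair a m" "a \<in> fel F (dC d)" "m \<in> apex (P (dC d))"
        "frt F (dC d) a = lleg (P (dC d)) m" by (auto simp: pullback_def)
      show "sm_map (ccomp E (hcomp E (fCe F c) (C d)) (L (cC d))) z = sm_map (ccomp E (L (dC d)) (C (hcomp T c d))) z"
        using z c cd L_nat[OF c, of a m] by (simp add: Cb Lb)
    qed
    show "ccomp E (hcomp E (C c) (fCe G d)) (R (cC d)) = ccomp E (R (dC d)) (C (hcomp T c d))"
    proof (rule in_cell_eqI[OF r])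
      show "in_cell E (ccomp E (R (dC d)) (C (hcomp T c d))) (sc (P (dC d)) (fPr G (dC d)))
        (P (cC d)) (fAr F (sC c)) (fAr G (tC d))"
        using in_cell_ccomp[OF R ch] arid(2)[OF F, of "sC c"] arid(2)[OF G, of "tC d"] c cd by simp
      fix z assume "z \<in> apex (sc (P (dC d)) (fPr G (dC d)))"
      then obtain m b where z: "z = pair m b" "m \<in> apex (P (dC d))" "b \<in> fel G (dC d)"
        "rleg (P (dC d)) m = flt G (dC d) b" by (auto simp: pullback_def)
      show "sm_map (ccomp E (hcomp E (C c) (fCe G d)) (R (cC d))) z = sm_map (ccomp E (R (dC d)) (C (hcomp T c d))) z"
        using z c cd R_nat[OF c, of m b] by (simp add: Cb Lb)
    qed
  qed
  have as: "ccomp E (hcomp E (laxator F x x) (cid E (P x))) (L x) =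
      ccomp E (ccomp E (assoc E (fPr F x) (fPr F x) (P x)) (hcomp E (cid E (fPr F x)) (L x))) (L x)"
    "ccomp E (hcomp E (L x) (cid E (fPr G x))) (R x) =
      ccomp E (ccomp E (assoc E (fPr F x) (P x) (fPr G x)) (hcomp E (cid E (fPr F x)) (R x))) (L x)"
    "ccomp E (hcomp E (R x) (cid E (fPr G x))) (R x) =
      ccomp E (ccomp E (assoc E (P x) (fPr G x) (fPr G x)) (hcomp E (cid E (P x)) (laxator G x x))) (R x)" for x
  proof -
    have a: "in_cell E (assoc E (fPr F x) (fPr F x) (P x)) (sc (sc (fPr F x) (fPr F x)) (P x))
        (sc (fPr F x) (sc (fPr F x) (P x))) (idO F x) (idO G x)"
      "in_cell E (assoc E (fPr F x) (P x) (fPr G x)) (sc (sc (fPr F x) (P x)) (fPr G x))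
        (sc (fPr F x) (sc (P x) (fPr G x))) (idO F x) (idO G x)"
      "in_cell E (assoc E (P x) (fPr G x) (fPr G x)) (sc (sc (P x) (fPr G x)) (fPr G x))
        (sc (P x) (sc (fPr G x) (fPr G x))) (idO F x) (idO G x)"
      using in_cell_assoc[of "fPr F x" "fPr F x" "P x"] in_cell_assoc[of "fPr F x" "P x" "fPr G x"]
        in_cell_assoc[of "P x" "fPr G x" "fPr G x"] by simp_all
    note idx = ids[OF F, of x] ids[OF G, of x]
    show "ccomp E (hcomp E (laxator F x x) (cid E (P x))) (L x) =
      ccomp E (ccomp E (assoc E (fPr F x) (fPr F x) (P x)) (hcomp E (cid E (fPr F x)) (L x))) (L x)"
      by (rule in_cell_eqI[OF in_cell_ccomp[OF in_cell_hcomp[OF lx_laxator[OF F, of x] cidP(1)[of x]] L[of x], unfolded idx]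
          in_cell_ccomp[OF in_cell_ccomp[OF a(1) in_cell_hcomp[OF cidP(2)[of x] L[of x]]] L[of x], unfolded idx]])
        (auto simp: pullback_def LL Lb Lm)
    show "ccomp E (hcomp E (L x) (cid E (fPr G x))) (R x) =
      ccomp E (ccomp E (assoc E (fPr F x) (P x) (fPr G x)) (hcomp E (cid E (fPr F x)) (R x))) (L x)"
      by (rule in_cell_eqI[OF in_cell_ccomp[OF in_cell_hcomp[OF L[of x] cidP(3)[of x]] R[of x], unfolded idx]
          in_cell_ccomp[OF in_cell_ccomp[OF a(2) in_cell_hcomp[OF cidP(2)[of x] R[of x]]] L[of x], unfolded idx]])
        (auto simp: pullback_def LR Lb Lm Rm)
    show "ccomp E (hcomp E (R x) (cid E (fPr G x))) (R x) =
      ccomp E (ccomp E (assoc E (P x) (fPr G x) (fPr G x)) (hcomp E (cid E (P x)) (laxator G x x))) (R x)"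
      by (rule in_cell_eqI[OF in_cell_ccomp[OF in_cell_hcomp[OF R[of x] cidP(3)[of x]] R[of x], unfolded idx]
          in_cell_ccomp[OF in_cell_ccomp[OF a(3) in_cell_hcomp[OF cidP(1)[of x] lx_laxator[OF G, of x]]] R[of x], unfolded idx]])
        (auto simp: pullback_def RR Lb Rm)
  qed
  have un: "ccomp E (hcomp E (unitor F x) (cid E (P x))) (L x) = lunit E (P x)"
    "ccomp E (hcomp E (cid E (P x)) (unitor G x)) (R x) = runit E (P x)" for x
  proof -
    note idx = ids[OF F, of x] ids[OF G, of x]
    have lu: "in_cell E (lunit E (P x)) (sc (spO F x) (P x)) (P x) (idO F x) (idO G x)"
      "in_cell E (runit E (P x)) (sc (P x) (spO G x)) (P x) (idO F x) (idO G x)"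
      using in_cell_lunit[of "P x"] in_cell_runit[of "P x"] by simp_all
    show "ccomp E (hcomp E (unitor F x) (cid E (P x))) (L x) = lunit E (P x)"
      by (rule in_cell_eqI[OF in_cell_ccomp[OF in_cell_hcomp[OF lx_unitor[OF F, of x] cidP(1)[of x]] L[of x], unfolded idx] lu(1)])
        (auto simp: pullback_def Lb L_unit legP)
    show "ccomp E (hcomp E (cid E (P x)) (unitor G x)) (R x) = runit E (P x)"
      by (rule in_cell_eqI[OF in_cell_ccomp[OF in_cell_hcomp[OF cidP(1)[of x] lx_unitor[OF G, of x]] R[of x], unfolded idx] lu(2)])
        (auto simp: pullback_def Lb R_unit legP)
  qed
  have lax: "\<forall>m n. if m \<in> Pr ?W \<and> n \<in> Pr ?W \<and> ptgt ?W m = psrc ?W n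
      then globular E (laxator ?M m n) (pcomp E (fPr ?M m) (fPr ?M n)) (fPr ?M (pcomp ?W m n))
      else laxator ?M m n = undefined"
  proof (intro allI)
    fix m n :: "'o \<times> bool \<times> bool"
    obtain x a b y c d where mn: "m = (x, a, b)" "n = (y, c, d)" by (cases m; cases n) auto
    show "if m \<in> Pr ?W \<and> n \<in> Pr ?W \<and> ptgt ?W m = psrc ?W n
      then globular E (laxator ?M m n) (pcomp E (fPr ?M m) (fPr ?M n)) (fPr ?M (pcomp ?W m n))
      else laxator ?M m n = undefined"
    proof (cases "x = y \<and> b = c \<and> a \<le> b \<and> c \<le> d")
      case True
      then show ?thesis unfolding mn using lx_laxator[OF F, of x] lx_laxator[OF G, of x] L[of x] R[of x]
        by (cases a; cases b; cases d) (auto simp: globular_def)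
    next
      case False
      then have "laxator ?M m n = undefined" by (auto simp: mn mk_module_def)
      with False show ?thesis unfolding mn by auto
    qed
  qed
  have ext: "fOb ?M \<in> Ob ?W \<rightarrow>\<^sub>E Ob E" "fAr ?M \<in> Ar ?W \<rightarrow>\<^sub>E Ar E" "fPr ?M \<in> Pr ?W \<rightarrow>\<^sub>E Pr E" "fCe ?M \<in> Ce ?W \<rightarrow>\<^sub>E Ce E"
    using lx_undefined(2,3)[OF F] lx_undefined(2,3)[OF G] in_cell_bd[OF lx_ce[OF F]] in_cell_bd[OF lx_ce[OF G]]
    by (auto simp: PiE_iff extensional_def mk_module_def Cb)
  have ceb: "\<forall>c\<in>Ce ?W. in_cell E (fCe ?M c) (fPr ?M (cdom ?W c)) (fPr ?M (ccod ?W c)) (fAr ?M (csrc ?W c)) (fAr ?M (ctgt ?W c))"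
    by (simp add: C lx_ce)
  have natL: "\<forall>c\<in>Ce T. \<forall>d\<in>Ce T. tC c = sC d -->
      ccomp E (hcomp E (fCe H c) (fCe H d)) (laxator H (cC c) (cC d)) =
        ccomp E (laxator H (dC c) (dC d)) (fCe H (hcomp T c d))" if "lx H" for H
    using that unfolding lax_functor_def by (elim conjE)
  have natW: "\<forall>c\<in>Ce ?W. \<forall>d\<in>Ce ?W. ctgt ?W c = csrc ?W d -->
      ccomp E (hcomp E (fCe ?M c) (fCe ?M d)) (laxator ?M (ccod ?W c) (ccod ?W d))
        = ccomp E (laxator ?M (cdom ?W c) (cdom ?W d)) (fCe ?M (hcomp ?W c d))"
  proof (intro ballI impI)
    fix c d :: "'c \<times> bool \<times> bool" assume "c \<in> Ce ?W" "d \<in> Ce ?W" "ctgt ?W c = csrc ?W d"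
    moreover obtain c0 a b d0 a' b' where cd: "c = (c0, a, b)" "d = (d0, a', b')" by (cases c; cases d) auto
    ultimately have *: "c0 \<in> Ce T" "d0 \<in> Ce T" "tC c0 = sC d0" "b = a'" "a \<le> b" "a' \<le> b'" by auto
    note dom = hcomp_dom[OF *(1-3)]
    have mem: "hcomp T c0 d0 \<in> Ce T" using hc(1)[OF *(1-3)] .
    have L: "ccomp E (hcomp E (fCe F c0) (fCe F d0)) (laxator F (cC c0) (cC c0)) =
        ccomp E (laxator F (dC c0) (dC c0)) (fCe F (hcomp T c0 d0))"
      "ccomp E (hcomp E (fCe G c0) (fCe G d0)) (laxator G (cC c0) (cC c0)) =
        ccomp E (laxator G (dC c0) (dC c0)) (fCe G (hcomp T c0 d0))"
      using natL[OF F, THEN bspec, THEN bspec, THEN mp, OF *(1-3)]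
        natL[OF G, THEN bspec, THEN bspec, THEN mp, OF *(1-3)] unfolding dom .
    consider "a = False" "a' = False" "b' = False" | "a = False" "a' = False" "b' = True"
      | "a = False" "a' = True" "b' = True" | "a = True" "a' = True" "b' = True"
      using * by auto
    then show "ccomp E (hcomp E (fCe ?M c) (fCe ?M d)) (laxator ?M (ccod ?W c) (ccod ?W d))
        = ccomp E (laxator ?M (cdom ?W c) (cdom ?W d)) (fCe ?M (hcomp ?W c d))"
      unfolding cd *(4) prod_walking_simps dom fst_conv snd_conv
      using nat[OF *(1-3), unfolded dom] L
      by cases (simp_all only: mk_module_simps(6-12) mk_module_simps(8)[OF *(1)] mk_module_simps(8)[OF *(2)]
          mk_module_simps(8)[OF mem])
  qed
  note FG = F[unfolded lax_functor_def] G[unfolded lax_functor_def]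
  show ?thesis
    unfolding lax_functor_def
    apply (intro conjI)
    using ext apply simp_all[4]
    subgoal unfolding prod_walking_simps(1-4) carriers ball_walking_proarrow ball_times_bool by simp
    subgoal using FG unfolding prod_walking_simps(1-4) carriers ball_walking_proarrow ball_times_bool by simp
    subgoal using FG unfolding prod_walking_simps(1-4) carriers ball_walking_proarrow ball_times_bool by simp
    subgoal unfolding prod_walking_simps(1-4) carriers ball_walking_proarrow ball_times_bool by simp
    subgoal by (rule ceb)
    subgoal using FG unfolding prod_walking_simps(1-4) carriers ball_walking_proarrow ball_times_bool by (simp add: cid)
    subgoal using FG unfolding prod_walking_simps(1-4) carriers ball_walking_proarrow ball_times_bool by (simp add: ccomp)
    subgoal by (rule lax)
    subgoal using lx_unitor[OF F] lx_unitor[OF G] by (simp add: globular_def split: if_splits)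
    subgoal by (rule natW)
    subgoal using FG unfolding prod_walking_simps(1-4) carriers ball_walking_proarrow ball_times_bool by simp
    subgoal using FG unfolding prod_walking_simps(1-4) carriers ball_walking_proarrow ball_times_bool by (simp add: as)
    subgoal using FG unfolding prod_walking_simps(1-4) carriers ball_walking_proarrow ball_times_bool by (simp add: un)
    done
qed

lemma ball_pullback: "(\<forall>z\<in>pullback pair m n. P z) \<longleftrightarrow>
    (\<forall>a b. a \<in> apex m \<and> b \<in> apex n \<and> rleg m a = lleg n b --> P (pair a b))"
  by (auto simp: pullback_def)

section \<open>Modulations and tensor products\<close>

abbreviation "om mu x \<equiv> sm_map (ocell mu x)"

definition modn_typed ::
  "('o, 'a, 'c, 'u) s_modn \<Rightarrow> bool" where
  "modn_typed mu \<longleftrightarrow> mx (odom mu) \<and> mx (ocod mu) \<and> tx (oleft mu) \<and> tx (oright mu) \<and>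
     tdom (oleft mu) = sr (odom mu) \<and> tcod (oleft mu) = sr (ocod mu) \<and>
     tdom (oright mu) = tg (odom mu) \<and> tcod (oright mu) = tg (ocod mu) \<and>
     (\<forall>x. in_cell E (ocell mu x) (mod_Pr (odom mu) x) (mod_Pr (ocod mu) x) (tOb (oleft mu) x) (tOb (oright mu) x))"

text \<open>The third clause ranges over arrows, that is, over identity cells only. For modules over
  a simple theory this already yields naturality in all cells, by
  \<open>mt_nat_cell\<close>.\<close>

definition modn_laws where
  "modn_laws M N al be g \<longleftrightarrow>
     (\<forall>x m b. m \<in> elt M x \<and> b \<in> fel (tg M) x \<and>
        rgt M x m = flt (tg M) x b -->
        g x (ra M x m b) = ra N x (g x m) (tpr be x b)) \<and>
     (\<forall>x a m. a \<in> fel (sr M) x \<and> m \<in> elt M x \<and>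
        frt (sr M) x a = lft M x m -->
        g x (la M x a m) = la N x (tpr al x a) (g x m)) \<and>
     (\<forall>f\<in>Ar T. \<forall>m\<in>elt M (dA f).
        la N (cA f) (tar al f (lft M (dA f) m))
          (g (cA f) (mce M (ic f) m)) =
        ra N (cA f) (mce N (ic f) (g (dA f) m))
          (tar be f (rgt M (dA f) m)))"

context
  fixes mu :: "('o, 'a, 'c, 'u) s_modn" and M N al be
  assumes typed: "modn_typed mu" and fields: "odom mu = M" "ocod mu = N" "oleft mu = al" "oright mu = be"
begin

lemma mt_facts: "mx M" "mx N" "tx al" "tx be" "tdom al = sr M" "tcod al = sr N"
    "tdom be = tg M" "tcod be = tg N"
  using typed fields by (simp_all add: modn_typed_def)

lemma mt_cell: "in_cell E (ocell mu x) (mod_Pr M x) (mod_Pr N x) (tOb al x) (tOb be x)"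
  using typed fields by (simp add: modn_typed_def)

lemma mt_map:
  "sm_dom (ocell mu x) = mod_Pr M x" "sm_cod (ocell mu x) = mod_Pr N x"
  "sm_left (ocell mu x) = tOb al x" "sm_right (ocell mu x) = tOb be x"
  "m \<in> elt M x ==> om mu x m \<in> elt N x"
  "m \<in> elt M x ==> lft N x (om mu x m) = tob al x (lft M x m)"
  "m \<in> elt M x ==> rgt N x (om mu x m) = tob be x (rgt M x m)"
  using in_cell_bd[OF mt_cell] in_cell_map[OF mt_cell, of m] by simp_all

lemma mt_act_iff:
  "ccomp E (hcomp E (ocell mu x) (tPr be x)) (act_r N x x) = ccomp E (act_r M x x) (ocell mu x) \<longleftrightarrow>
    (\<forall>m b. m \<in> elt M x \<and> b \<in> fel (tg M) x \<and>
        rgt M x m = flt (tg M) x b -->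
        om mu x (ra M x m b) = ra N x (om mu x m) (tpr be x b))" (is ?R)
  "ccomp E (hcomp E (tPr al x) (ocell mu x)) (act_l N x x) = ccomp E (act_l M x x) (ocell mu x) \<longleftrightarrow>
    (\<forall>a m. a \<in> fel (sr M) x \<and> m \<in> elt M x \<and>
        frt (sr M) x a = lft M x m -->
        om mu x (la M x a m) = la N x (tpr al x a) (om mu x m))" (is ?L)
proof -
  note [simp] = mt_facts mt_map
  have b: "in_cell E (tPr be x) (fPr (tg M) x) (fPr (tg N) x) (tOb be x) (tOb be x)"
    "in_cell E (tPr al x) (fPr (sr M) x) (fPr (sr N) x) (tOb al x) (tOb al x)"
    using tt_pr_cell[OF trans_typed[OF mt_facts(4)] mt_facts(7,8)]
      tt_pr_cell[OF trans_typed[OF mt_facts(3)] mt_facts(5,6)] .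
  note l = in_cell_ccomp[OF in_cell_hcomp[OF mt_cell b(1)] md_act(2)[OF mt_facts(2) refl refl]]
  note r = in_cell_ccomp[OF md_act(2)[OF mt_facts(1) refl refl] mt_cell]
  have e: "func_comp (tOb al x) (idO (sr N) x) = func_comp (idO (sr M) x) (tOb al x)"
    "func_comp (tOb be x) (idO (tg N) x) = func_comp (idO (tg M) x) (tOb be x)"
    by (simp_all add: func_comp_id_left[of _ small] func_comp_id_right[of _ small])
  show ?R
    unfolding in_cell_eq_iff[OF l r e] by (auto simp: ball_pullback)
  note l' = in_cell_ccomp[OF in_cell_hcomp[OF b(2) mt_cell] md_act(1)[OF mt_facts(2) refl refl]]
  note r' = in_cell_ccomp[OF md_act(1)[OF mt_facts(1) refl refl] mt_cell]
  show ?L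
    unfolding in_cell_eq_iff[OF l' r' e] by (auto simp: ball_pullback)
qed

lemma mt_nat_iff:
  assumes c: "c \<in> Ce T"
  shows "ccomp E (ccomp E (cinv E (lunit E (mod_Pr M (dC c))))
           (hcomp E (tAr al (sC c)) (ccomp E (mod_Ce M c) (ocell mu (cC c))))) (act_l N (cC c) (cC c))
       = ccomp E (ccomp E (cinv E (runit E (mod_Pr M (dC c))))
           (hcomp E (ccomp E (ocell mu (dC c)) (mod_Ce N c)) (tAr be (tC c)))) (act_r N (cC c) (cC c))
     \<longleftrightarrow> (\<forall>m\<in>elt M (dC c).
          la N (cC c) (tar al (sC c) (lft M (dC c) m))
            (om mu (cC c) (mce M c m)) =
          ra N (cC c) (mce N c (om mu (dC c) m))
            (tar be (tC c) (rgt M (dC c) m)))"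
proof -
  note [simp] = mt_facts mt_map
  let ?m = "dC c" and ?n = "cC c" and ?f = "sC c" and ?g = "tC c"
  note mc = md_ce[OF mt_facts(1) refl refl c] md_ce[OF mt_facts(2) refl refl c]
  have fc: "in_cell E (ccomp E (mod_Ce M c) (ocell mu ?n)) (mod_Pr M ?m) (mod_Pr N ?n)
      (func_comp (fAr (sr M) ?f) (tOb al ?n)) (func_comp (fAr (tg M) ?g) (tOb be ?n))"
    by (rule in_cell_ccomp[OF mc(1) mt_cell])
  have cf: "in_cell E (ccomp E (ocell mu ?m) (mod_Ce N c)) (mod_Pr M ?m) (mod_Pr N ?n)
      (func_comp (tOb al ?m) (fAr (sr N) ?f)) (func_comp (tOb be ?m) (fAr (tg N) ?g))"
    by (rule in_cell_ccomp[OF mt_cell mc(2)])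
  have ta: "in_cell E (tAr al ?f) (spO (sr M) ?m) (fPr (sr N) ?n)
      (func_comp (tOb al ?m) (fAr (sr N) ?f)) (func_comp (fAr (sr M) ?f) (tOb al ?n))"
    "in_cell E (tAr be ?g) (spO (tg M) ?m) (fPr (tg N) ?n)
      (func_comp (tOb be ?m) (fAr (tg N) ?g)) (func_comp (fAr (tg M) ?g) (tOb be ?n))"
    using tt_ar_cell[OF trans_typed[OF mt_facts(3)] mt_facts(5,6), of ?f]
      tt_ar_cell[OF trans_typed[OF mt_facts(4)] mt_facts(7,8), of ?g] c by simp_all
  have lu: "in_cell E (cinv E (lunit E (mod_Pr M ?m))) (mod_Pr M ?m) (sc (spO (sr M) ?m) (mod_Pr M ?m))
      (idO (sr M) ?m) (idO (tg M) ?m)"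
    "in_cell E (cinv E (runit E (mod_Pr M ?m))) (mod_Pr M ?m) (sc (mod_Pr M ?m) (spO (tg M) ?m))
      (idO (sr M) ?m) (idO (tg M) ?m)"
    using in_cell_cinv_lunit[of "mod_Pr M ?m"] in_cell_cinv_runit[of "mod_Pr M ?m"] by simp_all
  note L = in_cell_ccomp[OF in_cell_ccomp[OF lu(1) in_cell_hcomp[OF ta(1) fc]] md_act(1)[OF mt_facts(2) refl refl]]
  note R = in_cell_ccomp[OF in_cell_ccomp[OF lu(2) in_cell_hcomp[OF cf ta(2)]] md_act(2)[OF mt_facts(2) refl refl]]
  have sl: "sm_dom (cinv E (lunit E (mod_Pr M ?m))) = mod_Pr M ?m" "sm_dom (cinv E (runit E (mod_Pr M ?m))) = mod_Pr M ?m"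
    using in_cell_bd[OF lu(1)] in_cell_bd[OF lu(2)] by auto
  show ?thesis
    unfolding in_cell_eq_iff[OF L R refl refl]
    by (intro ball_cong refl) (simp add: sl c cinv_lunit cinv_runit)
qed

text \<open>\<open>md_whisker\<close> writes the action of \<open>c\<close>, on both modules, as an
  element of the left model acting on the result of the identity cell of the target arrow.
  Equivariance carries that element through the modulation, naturality of \<open>al\<close>
  exchanges it with the component of \<open>al\<close>, and what remains is the law for the target
  arrow.\<close>

lemma mt_nat_cell:
  assumes laws: "modn_laws M N al be (om mu)" and c: "c \<in> Ce T" and m: "m \<in> elt M (dC c)"
  shows "la N (cC c) (tar al (sC c) (lft M (dC c) m))
            (om mu (cC c) (mce M c m)) =
          ra N (cC c) (mce N c (om mu (dC c) m))
            (tar be (tC c) (rgt M (dC c) m))"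
proof -
  note [simp] = mt_facts mt_map c m
  let ?x = "dC c" and ?y = "cC c" and ?f = "sC c" and ?g = "tC c"
  let ?F = "sr M" and ?H = "sr N"
  let ?p = "lft M ?x m" and ?one = "\<lambda>F. uni F ?x"
  let ?Mg = "mce M (ic ?g) m"
  have law_l: "om mu ?y (la M ?y a n) = la N ?y (tpr al ?y a) (om mu ?y n)"
    if "a \<in> fel ?F ?y" "n \<in> elt M ?y" "frt ?F ?y a = lft M ?y n" for a n
    using laws that by (simp add: modn_laws_def)
  have law_n: "la N ?y (tar al ?g ?p) (om mu ?y ?Mg) =
      ra N ?y (mce N (ic ?g) (om mu ?x m)) (tar be ?g (rgt M ?x m))"
    using laws c m cell_boundary[OF c] unfolding modn_laws_def by metis
  \<comment> \<open>Naturality of \<open>al\<close> at the unit over \<open>?p\<close>. It exchanges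
    the component of \<open>al\<close> at the source arrow of \<open>c\<close> for the component at
    the target arrow.\<close>
  have nat: "cmp ?H ?y (tar al ?f ?p) (tpr al ?y (fce ?F c (?one ?F ?p))) =
      cmp ?H ?y (fce ?H c (?one ?H (tob al ?x ?p))) (tar al ?g ?p)"
    using tx_nat[OF mt_facts(3,5,6) c, of "?one ?F ?p"] by simp
  have "la N ?y (tar al ?f ?p) (om mu ?y (mce M c m)) =
      la N ?y (tar al ?f ?p) (la N ?y (tpr al ?y (fce ?F c (?one ?F ?p))) (om mu ?y ?Mg))"
    using law_l[of "fce ?F c (?one ?F ?p)" ?Mg] md_whisker(1)[OF mt_facts(1) refl refl c m] by simp
  also have "... = la N ?y (cmp ?H ?y (tar al ?f ?p) (tpr al ?y (fce ?F c (?one ?F ?p)))) (om mu ?y ?Mg)"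
    by simp
  also have "... = la N ?y (fce ?H c (?one ?H (tob al ?x ?p))) (la N ?y (tar al ?g ?p) (om mu ?y ?Mg))"
    unfolding nat by simp
  also have "... = ra N ?y (la N ?y (fce ?H c (?one ?H (tob al ?x ?p))) (mce N (ic ?g) (om mu ?x m)))
      (tar be ?g (rgt M ?x m))"
    unfolding law_n by simp
  also have "la N ?y (fce ?H c (?one ?H (tob al ?x ?p))) (mce N (ic ?g) (om mu ?x m)) =
      mce N c (om mu ?x m)"
    using md_whisker(1)[OF mt_facts(2) refl refl c, of "om mu ?x m"] by simp
  finally show ?thesis .
qed

lemma modulation_typed_iff: "mux mu \<longleftrightarrow> modn_laws M N al be (om mu)"
proof -
  have a: "(\<forall>m\<in>UNIV. \<forall>n\<in>UNIV. m = n -->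
        ccomp E (hcomp E (ocell mu m) (tPr be n)) (act_r N m n) = ccomp E (act_r M m n) (ocell mu m) \<and>
        ccomp E (hcomp E (tPr al m) (ocell mu n)) (act_l N m n) = ccomp E (act_l M m n) (ocell mu m)) \<longleftrightarrow>
     (\<forall>x m b. m \<in> elt M x \<and> b \<in> fel (tg M) x \<and>
        rgt M x m = flt (tg M) x b -->
        om mu x (ra M x m b) = ra N x (om mu x m) (tpr be x b)) \<and>
     (\<forall>x a m. a \<in> fel (sr M) x \<and> m \<in> elt M x \<and>
        frt (sr M) x a = lft M x m -->
        om mu x (la M x a m) = la N x (tpr al x a) (om mu x m))"
    unfolding mt_act_iff[symmetric] by blast
  have n: "(\<forall>c\<in>Ce T. ccomp E (ccomp E (cinv E (lunit E (mod_Pr M (dC c))))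
           (hcomp E (tAr al (sC c)) (ccomp E (mod_Ce M c) (ocell mu (cC c))))) (act_l N (cC c) (cC c))
       = ccomp E (ccomp E (cinv E (runit E (mod_Pr M (dC c))))
           (hcomp E (ccomp E (ocell mu (dC c)) (mod_Ce N c)) (tAr be (tC c)))) (act_r N (cC c) (cC c))) \<longleftrightarrow>
     (\<forall>c\<in>Ce T. \<forall>m\<in>elt M (dC c).
          la N (cC c) (tar al (sC c) (lft M (dC c) m))
            (om mu (cC c) (mce M c m)) =
          ra N (cC c) (mce N c (om mu (dC c) m))
            (tar be (tC c) (rgt M (dC c) m)))" (is "_ \<longleftrightarrow> ?N")
    by (intro ball_cong refl mt_nat_iff)
  have "mux mu \<longleftrightarrow>
     (\<forall>x m b. m \<in> elt M x \<and> b \<in> fel (tg M) x \<and>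
        rgt M x m = flt (tg M) x b -->
        om mu x (ra M x m b) = ra N x (om mu x m) (tpr be x b)) \<and>
     (\<forall>x a m. a \<in> fel (sr M) x \<and> m \<in> elt M x \<and>
        frt (sr M) x a = lft M x m -->
        om mu x (la M x a m) = la N x (tpr al x a) (om mu x m)) \<and> ?N" (is "_ \<longleftrightarrow> ?A \<and> ?B \<and> ?N")
    unfolding modulation_def Let_def fields carriers n a using mt_facts mt_cell by auto
  moreover have "?A \<and> ?B \<and> ?N \<longleftrightarrow> modn_laws M N al be (om mu)"
  proof
    assume *: "?A \<and> ?B \<and> ?N"
    then show "modn_laws M N al be (om mu)"
      unfolding modn_laws_def
    proof (intro conjI ballI)
      fix f m assume "f \<in> Ar T" "m \<in> elt M (dA f)"
      moreover from this have "ic f \<in> Ce T" "m \<in> elt M (dC (ic f))" by simp_all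
      ultimately show "la N (cA f) (tar al f (lft M (dA f) m))
          (om mu (cA f) (mce M (ic f) m)) =
        ra N (cA f) (mce N (ic f) (om mu (dA f) m))
          (tar be f (rgt M (dA f) m))"
        using *[THEN conjunct2, THEN conjunct2, THEN bspec, THEN bspec, of "ic f" m] by simp
    qed blast+
  next
    assume *: "modn_laws M N al be (om mu)"
    show "?A \<and> ?B \<and> ?N"
      using mt_nat_cell[OF *] * unfolding modn_laws_def by blast
  qed
  ultimately show ?thesis by blast
qed

end

lemma modulation_typed: "mux mu ==> modn_typed mu"
  unfolding modulation_def modn_typed_def Let_def by simp

lemma modulation_iff:
  "mux mu \<longleftrightarrow> modn_typed mu \<and> modn_laws (odom mu) (ocod mu) (oleft mu) (oright mu) (om mu)"
  using modulation_typed modulation_typed_iff[OF _ refl refl refl refl] by blast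

lemmas mu_simps [simp] = mt_facts[OF modulation_typed refl refl refl refl]
  mt_map(1-4)[OF modulation_typed refl refl refl refl]
lemmas mu_map [simp] = mt_map(5-7)[OF modulation_typed refl _ refl refl]

context
  fixes mu :: "('o, 'a, 'c, 'u) s_modn" and M
  assumes mu: "mux mu" and M: "odom mu = M"
begin

lemma mu_laws:
  "m \<in> elt M x ==> b \<in> fel (tg M) x ==>
     rgt M x m = flt (tg M) x b ==>
     om mu x (ra M x m b) = ra (ocod mu) x (om mu x m) (tpr (oright mu) x b)"
  "a \<in> fel (sr M) x ==> m \<in> elt M x ==>
     frt (sr M) x a = lft M x m ==>
     om mu x (la M x a m) = la (ocod mu) x (tpr (oleft mu) x a) (om mu x m)"
  "f \<in> Ar T ==> m \<in> elt M (dA f) ==>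
     la (ocod mu) (cA f) (tar (oleft mu) f (lft M (dA f) m))
          (om mu (cA f) (mce M (ic f) m)) =
     ra (ocod mu) (cA f) (mce (ocod mu) (ic f) (om mu (dA f) m))
          (tar (oright mu) f (rgt M (dA f) m))"
proof -
  have "modn_laws M (ocod mu) (oleft mu) (oright mu) (om mu)"
    using mu M by (simp add: modulation_iff)
  then show "m \<in> elt M x ==> b \<in> fel (tg M) x ==>
     rgt M x m = flt (tg M) x b ==>
     om mu x (ra M x m b) = ra (ocod mu) x (om mu x m) (tpr (oright mu) x b)"
  "a \<in> fel (sr M) x ==> m \<in> elt M x ==>
     frt (sr M) x a = lft M x m ==>
     om mu x (la M x a m) = la (ocod mu) x (tpr (oleft mu) x a) (om mu x m)"
  "f \<in> Ar T ==> m \<in> elt M (dA f) ==>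
     la (ocod mu) (cA f) (tar (oleft mu) f (lft M (dA f) m))
          (om mu (cA f) (mce M (ic f) m)) =
     ra (ocod mu) (cA f) (mce (ocod mu) (ic f) (om mu (dA f) m))
          (tar (oright mu) f (rgt M (dA f) m))"
    unfolding modn_laws_def by blast+
qed

end

lemmas mu_law_simps [simp] = mu_laws(1,2)

lemma modn_eqI:
  assumes "modn_typed mu" "modn_typed nu" "odom mu = odom nu" "ocod mu = ocod nu" "oleft mu = oleft nu" "oright mu = oright nu"
    "\<And>x m. m \<in> elt (odom mu) x ==> om mu x m = om nu x m"
  shows "mu = nu"
proof -
  have "ocell mu x = ocell nu x" for x
    by (rule in_cell_eqI[OF mt_cell[OF assms(1) refl refl refl refl]
          mt_cell[OF assms(2) assms(3-6)[symmetric]]]) (rule assms(7))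
  then show ?thesis using assms(3-6) by (cases mu; cases nu) (auto simp: fun_eq_iff)
qed

definition mk_modn where
  "mk_modn M N al be g = \<lparr>odom = M, ocod = N, oleft = al, oright = be,
     ocell = (\<lambda>x. span_cell (mod_Pr M x) (mod_Pr N x) (tOb al x) (tOb be x) (g x))\<rparr>"

lemma mk_modn_simps [simp]: "odom (mk_modn M N al be g) = M" "ocod (mk_modn M N al be g) = N"
  "oleft (mk_modn M N al be g) = al" "oright (mk_modn M N al be g) = be"
  "m \<in> elt M x ==> om (mk_modn M N al be g) x m = g x m"
  by (simp_all add: mk_modn_def)

lemma mk_modn_typed:
  assumes "mx M" "mx N" "tx al" "tx be" "tdom al = sr M" "tcod al = sr N"
    "tdom be = tg M" "tcod be = tg N"
    and "\<And>x m. m \<in> elt M x ==> g x m \<in> elt N x \<and>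
      lft N x (g x m) = tob al x (lft M x m) \<and>
      rgt N x (g x m) = tob be x (rgt M x m)"
  shows "modn_typed (mk_modn M N al be g)"
proof -
  have "in_cell E (span_cell (mod_Pr M x) (mod_Pr N x) (tOb al x) (tOb be x) (g x)) (mod_Pr M x) (mod_Pr N x) (tOb al x) (tOb be x)" for x
    by (rule in_cell_span_cell) (use assms in \<open>simp_all add: frame_def\<close>)
  then show ?thesis
    using assms(1-8) by (simp add: modn_typed_def) (simp add: mk_modn_def)
qed

lemma mk_modn_modulation:
  assumes "mx M" "mx N" "tx al" "tx be" "tdom al = sr M" "tcod al = sr N"
    "tdom be = tg M" "tcod be = tg N"
    and "\<And>x m. m \<in> elt M x ==> g x m \<in> elt N x \<and>
      lft N x (g x m) = tob al x (lft M x m) \<and>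
      rgt N x (g x m) = tob be x (rgt M x m)"
    and "\<And>x m b. m \<in> elt M x ==> b \<in> fel (tg M) x ==>
        rgt M x m = flt (tg M) x b ==>
        g x (ra M x m b) = ra N x (g x m) (tpr be x b)"
    and "\<And>x a m. a \<in> fel (sr M) x ==> m \<in> elt M x ==>
        frt (sr M) x a = lft M x m ==>
        g x (la M x a m) = la N x (tpr al x a) (g x m)"
    and "\<And>f m. f \<in> Ar T ==> m \<in> elt M (dA f) ==>
        la N (cA f) (tar al f (lft M (dA f) m))
          (g (cA f) (mce M (ic f) m)) =
        ra N (cA f) (mce N (ic f) (g (dA f) m))
          (tar be f (rgt M (dA f) m))"
  shows "mux (mk_modn M N al be g)"
proof -
  have "modn_laws M N al be (om (mk_modn M N al be g))"
    using assms by (simp add: modn_laws_def)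
  moreover have "modn_typed (mk_modn M N al be g)"
    using assms by (intro mk_modn_typed)
  ultimately show ?thesis by (simp add: modulation_iff)
qed

definition tens_compat where
  "tens_compat M N x m n \<longleftrightarrow> m \<in> elt M x \<and> n \<in> elt N x \<and>
     rgt M x m = lft N x n"

definition tens_step where
  "tens_step M N x = {(pair (ra M x m b) n, pair m (la N x b n)) | m b n.
     m \<in> elt M x \<and> b \<in> fel (tg M) x \<and> n \<in> elt N x \<and>
     rgt M x m = flt (tg M) x b \<and>
     frt (tg M) x b = lft N x n}"

text \<open>The class of \<^term>\<open>pair m n\<close> in the coequalizer is represented by a chosen element, so that
  the coequalizer is a subset of the pullback and hence small.\<close>

definition tens where
  "tens M N x m n = (SOME z. (pair m n, z) \<in> (tens_step M N x \<union> (tens_step M N x)\<inverse>)\<^sup>*)"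

definition tens_set where
  "tens_set M N x = {tens M N x m n | m n. tens_compat M N x m n}"

text \<open>The map out of the coequalizer induced by \<open>g\<close>, evaluated at an arbitrary
  preimage of \<open>z\<close>. It is meaningful where \<open>g\<close> is \<open>balanced\<close>,
  and then \<open>tens_lift_tens\<close> computes it.\<close>

definition tens_lift where
  "tens_lift M N x g z = (let p = SOME p. tens_compat M N x (fst p) (snd p) \<and> z = tens M N x (fst p) (snd p)
     in g (fst p) (snd p))"

text \<open>Compatibility with the coequalizer is demanded only between pairs with outer legs
  \<open>p\<close> and \<open>q\<close>. The functions to be lifted, such as the action of a fixed
  \<open>a\<close> on the left factor, are well behaved only on pairs whose outer leg matches
  \<open>a\<close>.\<close>

definition balanced where
  "balanced M N x p q g \<longleftrightarrow> (\<forall>m b n. lft M x m = p \<and> rgt N x n = q \<and> m \<in> elt M x \<and> b \<in> fel (tg M) x \<and> n \<in> elt N x \<and>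
     rgt M x m = flt (tg M) x b \<and>
     frt (tg M) x b = lft N x n --> g (ra M x m b) n = g m (la N x b n))"

context
  fixes M N :: "('o, 'a, 'c, 'u) s_module"
  assumes M: "mx M" and N: "mx N" and MN: "tg M = sr N"
begin

lemma tens_rel_sym: "(y, z) \<in> (tens_step M N x \<union> (tens_step M N x)\<inverse>)\<^sup>* ==>
    (z, y) \<in> (tens_step M N x \<union> (tens_step M N x)\<inverse>)\<^sup>*"
  by (meson sym_Un_converse sym_rtrancl symD)

lemma tens_eq_iff: "tens M N x m n = tens M N x m' n' \<longleftrightarrow>
    (pair m n, pair m' n') \<in> (tens_step M N x \<union> (tens_step M N x)\<inverse>)\<^sup>*" (is "_ \<longleftrightarrow> _ \<in> ?R\<^sup>*")
proof
  have *: "(pair m n, tens M N x m n) \<in> ?R\<^sup>*" for m n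
    unfolding tens_def by (rule someI[of _ "pair m n"]) simp
  show "tens M N x m n = tens M N x m' n' ==> (pair m n, pair m' n') \<in> ?R\<^sup>*"
    using rtrancl_trans[OF *[of m n], of "pair m' n'"] tens_rel_sym[OF *[of m' n']] by simp
  assume r: "(pair m n, pair m' n') \<in> ?R\<^sup>*"
  have "(pair m n, z) \<in> ?R\<^sup>* \<longleftrightarrow> (pair m' n', z) \<in> ?R\<^sup>*" for z
    using rtrancl_trans[OF r] rtrancl_trans[OF tens_rel_sym[OF r]] by blast
  then show "tens M N x m n = tens M N x m' n'" by (simp add: tens_def)
qed

text \<open>Moving an element of the middle model across changes neither outer leg, so a sequence of
  moves stays among the pairs on which \<open>g\<close> is assumed to be balanced.\<close>

lemma tens_rel_invariant:
  assumes "(pair m n, z) \<in> (tens_step M N x \<union> (tens_step M N x)\<inverse>)\<^sup>*" "tens_compat M N x m n" "balanced M N x (lft M x m) (rgt N x n) g"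
  shows "\<exists>m' n'. z = pair m' n' \<and> tens_compat M N x m' n' \<and> lft M x m' = lft M x m \<and>
    rgt N x n' = rgt N x n \<and> g m' n' = g m n"
  using assms(1)
proof (induction rule: rtrancl_induct)
  case base
  then show ?case using assms(2) by auto
next
  case (step y z)
  then obtain m' n' where y: "y = pair m' n'" "tens_compat M N x m' n'" "g m' n' = g m n"
    "lft M x m' = lft M x m" "rgt N x n' = rgt N x n" by auto
  from step(2) consider "(y, z) \<in> tens_step M N x" | "(z, y) \<in> tens_step M N x" by auto
  then show ?case
  proof cases
    case 1
    then obtain m1 b where *: "m' = ra M x m1 b" "z = pair m1 (la N x b n')" "m1 \<in> elt M x"
        "b \<in> fel (tg M) x" "n' \<in> elt N x"
        "rgt M x m1 = flt (tg M) x b" "frt (tg M) x b = lft N x n'"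
      by (auto simp: tens_step_def y)
    moreover from this have "lft M x m1 = lft M x m" using y M by simp
    ultimately have "g (ra M x m1 b) n' = g m1 (la N x b n')" using assms(3) y(5) unfolding balanced_def by blast
    then show ?thesis using * y M N MN by (auto simp: tens_compat_def)
  next
    case 2
    then obtain b n1 where *: "n' = la N x b n1" "z = pair (ra M x m' b) n1" "m' \<in> elt M x"
        "b \<in> fel (tg M) x" "n1 \<in> elt N x"
        "rgt M x m' = flt (tg M) x b" "frt (tg M) x b = lft N x n1"
      by (auto simp: tens_step_def y)
    moreover from this have "rgt N x n1 = rgt N x n" using y N MN by simp
    ultimately have "g (ra M x m' b) n1 = g m' (la N x b n1)" using assms(3) y(4) unfolding balanced_def by blast
    then show ?thesis using * y M N MN by (auto simp: tens_compat_def)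
  qed
qed

lemma tens_lift_tens:
  assumes "balanced M N x (lft M x m) (rgt N x n) g" "m \<in> elt M x" "n \<in> elt N x" "rgt M x m = lft N x n"
  shows "tens_lift M N x g (tens M N x m n) = g m n"
proof -
  define p where "p = (SOME p. tens_compat M N x (fst p) (snd p) \<and> tens M N x m n = tens M N x (fst p) (snd p))"
  have c: "tens_compat M N x m n" using assms by (simp add: tens_compat_def)
  then have "\<exists>p. tens_compat M N x (fst p) (snd p) \<and> tens M N x m n = tens M N x (fst p) (snd p)"
    by (intro exI[of _ "(m, n)"]) simp
  from someI_ex[OF this] have "tens_compat M N x (fst p) (snd p) \<and> tens M N x m n = tens M N x (fst p) (snd p)"
    unfolding p_def .
  then have "g (fst p) (snd p) = g m n"
    using tens_rel_invariant[OF _ c assms(1)] tens_eq_iff by force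
  then show ?thesis by (simp add: tens_lift_def p_def[symmetric])
qed

lemma tens_balance:
  assumes "m \<in> elt M x" "b \<in> fel (tg M) x" "n \<in> elt N x"
     "rgt M x m = flt (tg M) x b" "frt (tg M) x b = lft N x n"
  shows "tens M N x (ra M x m b) n = tens M N x m (la N x b n)"
  unfolding tens_eq_iff using assms by (intro r_into_rtrancl) (auto simp: tens_step_def)

lemma tens_set_small: "small (tens_set M N x)"
proof (rule small_subset[OF small_pullback])
  show "mod_Pr M x \<in> spans small" "mod_Pr N x \<in> spans small" using M N by simp_all
  show "tens_set M N x \<subseteq> pullback pair (mod_Pr M x) (mod_Pr N x)"
  proof
    fix z assume "z \<in> tens_set M N x"
    then obtain m n where z: "z = tens M N x m n" "tens_compat M N x m n" by (auto simp: tens_set_def)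
    have "(pair m n, z) \<in> (tens_step M N x \<union> (tens_step M N x)\<inverse>)\<^sup>*"
      unfolding z tens_def by (rule someI[of _ "pair m n"]) simp
    \<comment> \<open>A constant function is balanced, so the invariant applies without any
      assumption and yields just that the chosen representative is a compatible pair.\<close>
    from tens_rel_invariant[OF this z(2), of "\<lambda>_ _. ()"] show "z \<in> pullback pair (mod_Pr M x) (mod_Pr N x)"
      by (auto simp: balanced_def tens_compat_def)
  qed
qed

end

definition tens_span where
  "tens_span M N x = \<lparr>apex = tens_set M N x, lfoot = fOb (sr M) x, rfoot = fOb (tg N) x,
     lleg = restrict (tens_lift M N x (\<lambda>m n. lft M x m)) (tens_set M N x),
     rleg = restrict (tens_lift M N x (\<lambda>m n. rgt N x n)) (tens_set M N x)\<rparr>"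

text \<open>A cell \<open>c\<close> acts by \<open>c\<close> on the left factor and by the identity
  cell of its target arrow on the right one. Acting by \<open>c\<close> on both would not give a
  compatible pair: the right leg of the first result is moved along the target arrow of
  \<open>c\<close>, the left leg of the second along the source arrow.\<close>

definition tensor where
  "tensor M N = mk_module (sr M) (tg N) (tens_span M N)
     (\<lambda>c. span_cell (tens_span M N (dC c)) (tens_span M N (cC c))
        (fAr (sr M) (sC c)) (fAr (tg N) (tC c))
        (tens_lift M N (dC c) (\<lambda>m n. tens M N (cC c) (mce M c m)
           (mce N (ic (tC c)) n))))
     (\<lambda>x. span_cell (sc (fPr (sr M) x) (tens_span M N x)) (tens_span M N x)
        (idO (sr M) x) (idO (tg N) x)
        (\<lambda>z. let (a, t) = unpair pair z in tens_lift M N x (\<lambda>m n. tens M N x (la M x a m) n) t))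
     (\<lambda>x. span_cell (sc (tens_span M N x) (fPr (tg N) x)) (tens_span M N x)
        (idO (sr M) x) (idO (tg N) x)
        (\<lambda>z. let (t, b) = unpair pair z in tens_lift M N x (\<lambda>m n. tens M N x m (ra N x n b)) t))"

context
  fixes M N :: "('o, 'a, 'c, 'u) s_module"
  assumes M: "mx M" and N: "mx N" and MN: "tg M = sr N"
begin

lemma tens_span_simps:
  "lfoot (tens_span M N x) = fOb (sr M) x" "rfoot (tens_span M N x) = fOb (tg N) x"
  "m \<in> elt M x ==> n \<in> elt N x ==> rgt M x m = lft N x n ==>
     tens M N x m n \<in> apex (tens_span M N x)"
  "m \<in> elt M x ==> n \<in> elt N x ==> rgt M x m = lft N x n ==>
     lleg (tens_span M N x) (tens M N x m n) = lft M x m"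
  "m \<in> elt M x ==> n \<in> elt N x ==> rgt M x m = lft N x n ==>
     rleg (tens_span M N x) (tens M N x m n) = rgt N x n"
proof -
  have b: "balanced M N x p q (\<lambda>m n. lft M x m)" "balanced M N x p q (\<lambda>m n. rgt N x n)" for p q
    using M N MN by (auto simp: balanced_def)
  assume *: "m \<in> elt M x" "n \<in> elt N x" "rgt M x m = lft N x n"
  then have "tens M N x m n \<in> tens_set M N x" by (auto simp: tens_set_def tens_compat_def)
  then show "tens M N x m n \<in> apex (tens_span M N x)"
    "lleg (tens_span M N x) (tens M N x m n) = lft M x m"
    "rleg (tens_span M N x) (tens M N x m n) = rgt N x n"
    using tens_lift_tens[OF M N MN b(1) *] tens_lift_tens[OF M N MN b(2) *] by (simp_all add: tens_span_def)
qed (simp_all add: tens_span_def)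

lemma tens_span_cases:
  assumes "z \<in> apex (tens_span M N x)"
  obtains m n where "z = tens M N x m n" "m \<in> elt M x" "n \<in> elt N x"
    "rgt M x m = lft N x n"
  using assms by (auto simp: tens_span_def tens_set_def tens_compat_def)

lemma tens_span_spans: "tens_span M N x \<in> spans small"
proof -
  have "lleg (tens_span M N x) z \<in> fOb (sr M) x \<and> rleg (tens_span M N x) z \<in> fOb (tg N) x"
    if z: "z \<in> apex (tens_span M N x)" for z
    using z by (rule tens_span_cases) (use M N in \<open>simp add: tens_span_simps\<close>)
  moreover have "lleg (tens_span M N x) \<in> extensional (apex (tens_span M N x))"
    "rleg (tens_span M N x) \<in> extensional (apex (tens_span M N x))" "small (apex (tens_span M N x))"
    using tens_set_small[OF M N MN] by (simp_all add: tens_span_def)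
  moreover have "small (fOb (sr M) x)" "small (fOb (tg N) x)"
    using M N by simp_all
  ultimately show ?thesis
    unfolding spans_def mem_Collect_eq PiE_iff tens_span_simps(1,2) by blast
qed

text \<open>As \<open>c\<close> is its own external composite with the identity cell of its target
  arrow, applying it to \<open>ra M x m b\<close> applies that identity cell to \<open>b\<close>.
  The result is balanced over to \<open>N\<close>, where the same identity cell acts as a
  homomorphism.\<close>

lemma tens_balanced_cell:
  assumes c: "c \<in> Ce T"
  shows "balanced M N (dC c) p q
    (\<lambda>m n. tens M N (cC c) (mce M c m) (mce N (ic (tC c)) n))"
  unfolding balanced_def
proof (intro allI impI; elim conjE)
  fix m b n assume *: "m \<in> elt M (dC c)" "b \<in> fel (tg M) (dC c)"
    "n \<in> elt N (dC c)"
    "rgt M (dC c) m = flt (tg M) (dC c) b"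
    "frt (tg M) (dC c) b = lft N (dC c) n"
  have "mce M c (ra M (dC c) m b) =
      ra M (cC c) (mce M c m) (fce (tg M) (ic (tC c)) b)"
    using md_hcomp(2)[OF M refl refl c, of "ic (tC c)" m b] c * by simp
  then show "tens M N (cC c) (mce M c (ra M (dC c) m b)) (mce N (ic (tC c)) n) =
      tens M N (cC c) (mce M c m) (mce N (ic (tC c)) (la N (dC c) b n))"
    using * c M N MN by (simp add: tens_balance)
qed

text \<open>Well defined because the left and right actions on one module commute: the outer action
  on a factor does not see the element of the middle model that is being moved.\<close>

lemma tens_balanced_act:
  "a \<in> fel (sr M) x ==> frt (sr M) x a = p ==>
     balanced M N x p q (\<lambda>m n. tens M N x (la M x a m) n)"
  "c \<in> fel (tg N) x ==> q = flt (tg N) x c ==>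
     balanced M N x p q (\<lambda>m n. tens M N x m (ra N x n c))"
proof -
  assume a: "a \<in> fel (sr M) x" and p: "frt (sr M) x a = p"
  show "balanced M N x p q (\<lambda>m n. tens M N x (la M x a m) n)"
    unfolding balanced_def p[symmetric]
  proof (intro allI impI; elim conjE)
    fix m b n assume *: "lft M x m = frt (sr M) x a" "m \<in> elt M x"
      "b \<in> fel (tg M) x" "n \<in> elt N x"
      "rgt M x m = flt (tg M) x b" "frt (tg M) x b = lft N x n"
    have "tens M N x (ra M x (la M x a m) b) n = tens M N x (la M x a m) (la N x b n)"
      by (rule tens_balance[OF M N MN]) (use * a M N in simp_all)
    then show "tens M N x (la M x a (ra M x m b)) n = tens M N x (la M x a m) (la N x b n)"
      using * a M by simp
  qed
next
  assume c: "c \<in> fel (tg N) x" and q: "q = flt (tg N) x c"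
  show "balanced M N x p q (\<lambda>m n. tens M N x m (ra N x n c))"
    unfolding balanced_def q
  proof (intro allI impI; elim conjE)
    fix m b n assume *: "rgt N x n = flt (tg N) x c" "m \<in> elt M x"
      "b \<in> fel (tg M) x" "n \<in> elt N x"
      "rgt M x m = flt (tg M) x b" "frt (tg M) x b = lft N x n"
    have "tens M N x (ra M x m b) (ra N x n c) = tens M N x m (la N x b (ra N x n c))"
      by (rule tens_balance[OF M N MN]) (use * c M N in simp_all)
    then show "tens M N x (ra M x m b) (ra N x n c) = tens M N x m (ra N x (la N x b n) c)"
      using * c N MN by simp
  qed
qed

end

context
  fixes M N :: "('o, 'a, 'c, 'u) s_module"
  assumes M: "mx M" and N: "mx N" and MN: "tg M = sr N"
begin

lemma tensor_ends [simp]: "sr (tensor M N) = sr M" "tg (tensor M N) = tg N"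
  using M N by (simp_all add: tensor_def)

lemma tensor_Pr: "mod_Pr (tensor M N) x = tens_span M N x"
  by (simp add: tensor_def)

lemma tens_in [simp]:
  assumes "m \<in> elt M x" "n \<in> elt N x" "rgt M x m = lft N x n"
  shows "tens M N x m n \<in> elt (tensor M N) x"
    "lft (tensor M N) x (tens M N x m n) = lft M x m"
    "rgt (tensor M N) x (tens M N x m n) = rgt N x n"
  using assms tens_span_simps(3-5)[OF M N MN] by (simp_all add: tensor_Pr)

lemma tensor_cases:
  assumes "z \<in> elt (tensor M N) x"
  obtains m n where "z = tens M N x m n" "m \<in> elt M x" "n \<in> elt N x"
    "rgt M x m = lft N x n"
  using assms unfolding tensor_Pr by (rule tens_span_cases[OF M N MN])

lemma tensor_ce [simp]:
  assumes "c \<in> Ce T" "dC c = x" "m \<in> elt M x" "n \<in> elt N x"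
    "rgt M x m = lft N x n"
  shows "mce (tensor M N) c (tens M N x m n) =
    tens M N (cC c) (mce M c m) (mce N (ic (tC c)) n)"
  using assms tens_lift_tens[OF M N MN tens_balanced_cell[OF M N MN assms(1)], of m n] tens_in(1)[of m "dC c" n]
  by (auto simp: tensor_def)

lemma tensor_la [simp]:
  assumes "a \<in> fel (sr M) x" "m \<in> elt M x" "n \<in> elt N x"
    "frt (sr M) x a = lft M x m" "rgt M x m = lft N x n"
  shows "la (tensor M N) x a (tens M N x m n) = tens M N x (la M x a m) n"
  using assms tens_lift_tens[OF M N MN tens_balanced_act(1)[OF M N MN assms(1,4)], OF assms(2,3,5)]
    tens_span_simps(3-5)[OF M N MN assms(2,3,5)]
  by (simp add: tensor_def)

lemma tensor_ra [simp]:
  assumes "m \<in> elt M x" "n \<in> elt N x" "c \<in> fel (tg N) x"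
    "rgt M x m = lft N x n" "rgt N x n = flt (tg N) x c"
  shows "ra (tensor M N) x (tens M N x m n) c = tens M N x m (ra N x n c)"
  using assms tens_lift_tens[OF M N MN tens_balanced_act(2)[OF M N MN assms(3,5)], OF assms(1,2,4)]
    tens_span_simps(3-5)[OF M N MN assms(1,2,4)]
  by (simp add: tensor_def)

lemma tensor_mx [simp]: "mx (tensor M N)"
proof -
  let ?F = "sr M" and ?H = "tg N" and ?P = "tens_span M N"
  note [simp] = M N MN
  note sp [simp] = tens_span_simps[OF M N MN] tens_span_spans[OF M N MN]
  \<comment> \<open>The three families are given names so that they can be evaluated by rewriting at
    \<open>tens M N x m n\<close> only; unfolding them would expose the choice hidden in
    \<open>tens_lift\<close>.\<close>
  define C where "C = (\<lambda>c. span_cell (?P (dC c)) (?P (cC c)) (fAr ?F (sC c)) (fAr ?H (tC c))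
        (tens_lift M N (dC c) (\<lambda>m n. tens M N (cC c) (mce M c m)
           (mce N (ic (tC c)) n))))"
  define L where "L = (\<lambda>x. span_cell (sc (fPr ?F x) (?P x)) (?P x) (idO ?F x) (idO ?H x)
        (\<lambda>z. let (a, t) = unpair pair z in tens_lift M N x (\<lambda>m n. tens M N x (la M x a m) n) t))"
  define R where "R = (\<lambda>x. span_cell (sc (?P x) (fPr ?H x)) (?P x) (idO ?F x) (idO ?H x)
        (\<lambda>z. let (t, b) = unpair pair z in tens_lift M N x (\<lambda>m n. tens M N x m (ra N x n b)) t))"
  have eq: "tensor M N = mk_module ?F ?H ?P C L R"
    by (simp only: tensor_def C_def L_def R_def)
  have C_ev [simp]: "sm_map (C c) (tens M N x m n) =
      tens M N (cC c) (mce M c m) (mce N (ic (tC c)) n)"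
    if "c \<in> Ce T" "dC c = x" "m \<in> elt M x" "n \<in> elt N x"
      "rgt M x m = lft N x n" for c x m n
    using tensor_ce[OF that] that(1) by (simp add: eq)
  have L_ev [simp]: "sm_map (L x) (pair a (tens M N x m n)) = tens M N x (la M x a m) n"
    if "a \<in> fel ?F x" "m \<in> elt M x" "n \<in> elt N x"
      "frt ?F x a = lft M x m" "rgt M x m = lft N x n" for x a m n
    using tensor_la[OF that] by (simp add: eq)
  have R_ev [simp]: "sm_map (R x) (pair (tens M N x m n) c) = tens M N x m (ra N x n c)"
    if "m \<in> elt M x" "n \<in> elt N x" "c \<in> fel ?H x"
    "rgt M x m = lft N x n" "rgt N x n = flt ?H x c" for x m n c
    using tensor_ra[OF that] by (simp add: eq)
  have C_cell: "in_cell E (C c) (?P (dC c)) (?P (cC c)) (fAr ?F (sC c)) (fAr ?H (tC c))" if c: "c \<in> Ce T" for c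
  proof -
    have "sm_map (C c) z \<in> apex (?P (cC c)) \<and>
       lleg (?P (cC c)) (sm_map (C c) z) = far ?F (sC c) (lleg (?P (dC c)) z) \<and>
       rleg (?P (cC c)) (sm_map (C c) z) = far ?H (tC c) (rleg (?P (dC c)) z)"
      if "z \<in> apex (?P (dC c))" for z
      using that c by (elim tens_span_cases[OF M N MN]) simp
    moreover have "frame small (?P (dC c)) (?P (cC c)) (fAr ?F (sC c)) (fAr ?H (tC c))"
      using c by (simp add: frame_def)
    ultimately show ?thesis
      by (simp add: in_cell_iff) (simp add: C_def)
  qed
  have ids: "frame small (sc (fPr ?F x) (?P x)) (?P x) (idO ?F x) (idO ?H x)"
    "frame small (sc (?P x) (fPr ?H x)) (?P x) (idO ?F x) (idO ?H x)" for x
    by (simp_all add: frame_def span_comp_spans func_id_funcs)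
  have L_cell: "in_cell E (L x) (sc (fPr ?F x) (?P x)) (?P x) (idO ?F x) (idO ?H x)" for x
  proof -
    have "sm_map (L x) z \<in> apex (?P x) \<and>
        lleg (?P x) (sm_map (L x) z) = func_map (idO ?F x) (lleg (sc (fPr ?F x) (?P x)) z) \<and>
        rleg (?P x) (sm_map (L x) z) = func_map (idO ?H x) (rleg (sc (fPr ?F x) (?P x)) z)"
      if "z \<in> pullback pair (fPr ?F x) (?P x)" for z
    proof -
      from that obtain a t where "z = pair a t" "a \<in> fel ?F x" "t \<in> apex (?P x)" "frt ?F x a = lleg (?P x) t"
        by (auto simp: pullback_def)
      then show ?thesis by (elim tens_span_cases[OF M N MN]) simp
    qed
    then show ?thesis
      using ids(1)[of x] by (simp add: in_cell_iff) (simp add: L_def)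
  qed
  have R_cell: "in_cell E (R x) (sc (?P x) (fPr ?H x)) (?P x) (idO ?F x) (idO ?H x)" for x
  proof -
    have "sm_map (R x) z \<in> apex (?P x) \<and>
        lleg (?P x) (sm_map (R x) z) = func_map (idO ?F x) (lleg (sc (?P x) (fPr ?H x)) z) \<and>
        rleg (?P x) (sm_map (R x) z) = func_map (idO ?H x) (rleg (sc (?P x) (fPr ?H x)) z)"
      if "z \<in> pullback pair (?P x) (fPr ?H x)" for z
    proof -
      from that obtain a t where "z = pair t a" "a \<in> fel ?H x" "t \<in> apex (?P x)" "rleg (?P x) t = flt ?H x a"
        by (auto simp: pullback_def)
      then show ?thesis by (elim tens_span_cases[OF M N MN]) simp
    qed
    then show ?thesis
      using ids(2)[of x] by (simp add: in_cell_iff) (simp add: R_def)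
  qed
  show ?thesis
    unfolding eq
  proof (rule mk_module_mx, goal_cases)
    case (9 c d a z)
    note cd = hcomp_dom[OF 9(1-3)]
    from 9(5) show ?case
      by (rule tens_span_cases[OF M N MN])
        (use 9 cd md_hcomp(1)[OF M refl refl 9(1-3), of a] in simp)
  next
    case (10 c d z b)
    note cd = hcomp_dom[OF 10(1-3)]
    note nat = md_hcomp(2)[OF N refl refl] md_hcomp(1)[OF N refl refl]
    from 10(4) show ?case
    proof (rule tens_span_cases[OF M N MN])
      fix m n assume z: "z = tens M N (dC c) m n" "m \<in> elt M (dC c)" "n \<in> elt N (dC c)"
        "rgt M (dC c) m = lft N (dC c) n"
      let ?x = "dC c" and ?y = "cC c" and ?g = "ic (tC c)"
      let ?one = "uni (tg M) ?x (rgt M ?x m)"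
      have m: "mce M (hcomp T c d) m = ra M ?y (mce M c m) (fce (tg M) d ?one)"
        using md_hcomp(2)[OF M refl refl 10(1-3), of m ?one] z 10 cd by simp
      have n: "la N ?y (fce (sr N) d ?one) (mce N (ic (tC d)) n) = mce N d n"
        using md_whisker(1)[OF N refl refl 10(2), of n] z 10 cd by simp
      have nb: "mce N d (ra N ?x n b) = ra N ?y (mce N ?g n) (fce ?H d b)"
        using md_hcomp(2)[OF N refl refl, of "ic (sC d)" d n b] z 10 cd by simp
      have nb': "ra N ?y (mce N (ic (tC d)) n) (fce ?H (ic (tC d)) b) =
          mce N (ic (tC d)) (ra N ?x n b)"
        using z 10 cd by simp
      have n2: "la N ?y (fce (sr N) d ?one) (mce N (ic (tC d)) (ra N ?x n b)) =
          mce N d (ra N ?x n b)"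
        using md_whisker(1)[OF N refl refl 10(2), of "ra N ?x n b"] z 10 cd by simp
      \<comment> \<open>On the left side \<open>hcomp c d\<close> acts on \<open>m\<close>, while on
        the right side \<open>d\<close> acts on \<open>b\<close>. To transport \<open>d\<close>, its
        value at a unit is split off to the right of \<open>m\<close>, balanced across the tensor
        product and absorbed in \<open>N\<close>, where it turns the identity cell of the target of
        \<open>d\<close> into \<open>d\<close> itself.\<close>
      have "sm_map (C (hcomp T c d)) (sm_map (R ?x) (pair z b)) =
          tens M N ?y (ra M ?y (mce M c m) (fce (tg M) d ?one))
            (mce N (ic (tC d)) (ra N ?x n b))"
        using z 10 cd m by simp
      also have "... = tens M N ?y (mce M c m)
          (la N ?y (fce (tg M) d ?one) (mce N (ic (tC d)) (ra N ?x n b)))"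
        by (rule tens_balance[OF M N MN]) (use z 10 cd in simp_all)
      also have "... = tens M N ?y (mce M c m) (ra N ?y (mce N ?g n) (fce ?H d b))"
        using n2 nb by simp
      also have "... = sm_map (R ?y) (pair (sm_map (C c) z) (fce ?H d b))"
        using z 10 cd by simp
      finally show ?thesis .
    qed
  qed (use C_cell L_cell R_cell in \<open>auto elim!: tens_span_cases[OF M N MN] simp: idcell_acomp\<close>)
qed

end

section \<open>Identity modules and structure cells\<close>

definition hom_module where
  "hom_module F = mk_module F F (fPr F) (fCe F) (\<lambda>x. laxator F x x) (\<lambda>x. laxator F x x)"

context
  fixes F :: "('o, 'a, 'c, 'u) s_lax"
  assumes F: "lx F"
begin

lemma hom_module_simps [simp]: "sr (hom_module F) = F" "tg (hom_module F) = F"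
  "mod_Pr (hom_module F) x = fPr F x" "c \<in> Ce T ==> mod_Ce (hom_module F) c = fCe F c"
  "act_l (hom_module F) x x = laxator F x x" "act_r (hom_module F) x x = laxator F x x"
  using F by (simp_all add: hom_module_def)

lemma hom_module_mx [simp]: "mx (hom_module F)"
  unfolding hom_module_def
  by (rule mk_module_mx) (use F in \<open>auto simp: lx_ce lx_laxator lx_hcomp\<close>)

end

text \<open>Over identity transformations the factors indexed by an arrow are units, so the
  naturality law reduces to commuting with the action of identity cells.\<close>

lemma glob_modulation:
  assumes "mx M" "mx N" "sr M = F" "sr N = F" "tg M = G" "tg N = G"
    and "\<And>x m. m \<in> elt M x ==> g x m \<in> elt N x \<and>
      lft N x (g x m) = lft M x m \<and> rgt N x (g x m) = rgt M x m"
    and "\<And>x m b. m \<in> elt M x ==> b \<in> fel G x ==> rgt M x m = flt G x b ==>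
        g x (ra M x m b) = ra N x (g x m) b"
    and "\<And>x a m. a \<in> fel F x ==> m \<in> elt M x ==> frt F x a = lft M x m ==>
        g x (la M x a m) = la N x a (g x m)"
    and "\<And>f m. f \<in> Ar T ==> m \<in> elt M (dA f) ==>
        g (cA f) (mce M (ic f) m) = mce N (ic f) (g (dA f) m)"
  shows "mux (mk_modn M N (tid F) (tid G) g)"
proof (rule mk_modn_modulation)
  have FG: "lx F" "lx G" using assms(1,3,5) by auto
  note [simp] = assms FG
  have legs: "lft M x m \<in> fOb F x" "rgt M x m \<in> fOb G x" if "m \<in> elt M x" for x m
    using md_legs[OF assms(1,3,5) that] by auto
  show "g x m \<in> elt N x \<and>
      lft N x (g x m) = tob (tid F) x (lft M x m) \<and>
      rgt N x (g x m) = tob (tid G) x (rgt M x m)"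
    if "m \<in> elt M x" for x m
    using that legs[OF that] by simp
  show "la N (cA f) (tar (tid F) f (lft M (dA f) m))
          (g (cA f) (mce M (ic f) m)) =
        ra N (cA f) (mce N (ic f) (g (dA f) m))
          (tar (tid G) f (rgt M (dA f) m))"
    if "f \<in> Ar T" "m \<in> elt M (dA f)" for f m
    using that legs[OF that(2)] md_units[OF assms(2,4,6)] by simp
qed (use assms in auto)

definition cell_id where
  "cell_id M = mk_modn M M (tid (sr M)) (tid (tg M)) (\<lambda>x m. m)"

definition cell_comp where
  "cell_comp mu nu = mk_modn (odom mu) (ocod nu) (tcm (oleft mu) (oleft nu))
     (tcm (oright mu) (oright nu)) (\<lambda>x m. om nu x (om mu x m))"

definition hom_cell where
  "hom_cell al = mk_modn (hom_module (tdom al)) (hom_module (tcod al)) al al (\<lambda>x. tpr al x)"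

definition cell_tensor where
  "cell_tensor mu nu = mk_modn (tensor (odom mu) (odom nu)) (tensor (ocod mu) (ocod nu)) (oleft mu) (oright nu)
     (\<lambda>x. tens_lift (odom mu) (odom nu) x (\<lambda>m n. tens (ocod mu) (ocod nu) x (om mu x m) (om nu x n)))"

definition assoc_cell where
  "assoc_cell M N P = mk_modn (tensor (tensor M N) P) (tensor M (tensor N P))
     (tid (sr M)) (tid (tg P))
     (\<lambda>x. tens_lift (tensor M N) P x (\<lambda>t p. tens_lift M N x (\<lambda>m n. tens M (tensor N P) x m (tens N P x n p)) t))"

text \<open>\<open>cell_inverse\<close> asks for an inverse among the modulations. The inverse
  constraints are therefore given explicitly, here and in \<open>lunit_inv\<close> and
  \<open>runit_inv\<close>, and are shown to be modulations like the constraints themselves.\<close>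

definition assoc_inv where
  "assoc_inv M N P = mk_modn (tensor M (tensor N P)) (tensor (tensor M N) P)
     (tid (sr M)) (tid (tg P))
     (\<lambda>x. tens_lift M (tensor N P) x (\<lambda>m t. tens_lift N P x (\<lambda>n p. tens (tensor M N) P x (tens M N x m n) p) t))"

definition lunit_cell where
  "lunit_cell M = mk_modn (tensor (hom_module (sr M)) M) M
     (tid (sr M)) (tid (tg M))
     (\<lambda>x. tens_lift (hom_module (sr M)) M x (\<lambda>a m. la M x a m))"

definition lunit_inv where
  "lunit_inv M = mk_modn M (tensor (hom_module (sr M)) M)
     (tid (sr M)) (tid (tg M))
     (\<lambda>x m. tens (hom_module (sr M)) M x (uni (sr M) x (lft M x m)) m)"

definition runit_cell where
  "runit_cell M = mk_modn (tensor M (hom_module (tg M))) M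
     (tid (sr M)) (tid (tg M))
     (\<lambda>x. tens_lift M (hom_module (tg M)) x (\<lambda>m b. ra M x m b))"

definition runit_inv where
  "runit_inv M = mk_modn M (tensor M (hom_module (tg M)))
     (tid (sr M)) (tid (tg M))
     (\<lambda>x m. tens M (hom_module (tg M)) x m (uni (tg M) x (rgt M x m)))"

lemma cell_boundaries [simp]:
  "odom (cell_id M) = M" "ocod (cell_id M) = M" "oleft (cell_id M) = tid (sr M)"
  "oright (cell_id M) = tid (tg M)"
  "odom (cell_comp mu nu) = odom mu" "ocod (cell_comp mu nu) = ocod nu"
  "oleft (cell_comp mu nu) = tcm (oleft mu) (oleft nu)"
  "oright (cell_comp mu nu) = tcm (oright mu) (oright nu)"
  "odom (hom_cell al) = hom_module (tdom al)" "ocod (hom_cell al) = hom_module (tcod al)"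
  "oleft (hom_cell al) = al" "oright (hom_cell al) = al"
  "odom (cell_tensor mu nu) = tensor (odom mu) (odom nu)" "ocod (cell_tensor mu nu) = tensor (ocod mu) (ocod nu)"
  "oleft (cell_tensor mu nu) = oleft mu" "oright (cell_tensor mu nu) = oright nu"
  "odom (assoc_cell M N P) = tensor (tensor M N) P" "ocod (assoc_cell M N P) = tensor M (tensor N P)"
  "oleft (assoc_cell M N P) = tid (sr M)" "oright (assoc_cell M N P) = tid (tg P)"
  "odom (assoc_inv M N P) = tensor M (tensor N P)" "ocod (assoc_inv M N P) = tensor (tensor M N) P"
  "oleft (assoc_inv M N P) = tid (sr M)" "oright (assoc_inv M N P) = tid (tg P)"
  "odom (lunit_cell M) = tensor (hom_module (sr M)) M" "ocod (lunit_cell M) = M"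
  "oleft (lunit_cell M) = tid (sr M)" "oright (lunit_cell M) = tid (tg M)"
  "ocod (lunit_inv M) = tensor (hom_module (sr M)) M" "odom (lunit_inv M) = M"
  "oleft (lunit_inv M) = tid (sr M)" "oright (lunit_inv M) = tid (tg M)"
  "odom (runit_cell M) = tensor M (hom_module (tg M))" "ocod (runit_cell M) = M"
  "oleft (runit_cell M) = tid (sr M)" "oright (runit_cell M) = tid (tg M)"
  "ocod (runit_inv M) = tensor M (hom_module (tg M))" "odom (runit_inv M) = M"
  "oleft (runit_inv M) = tid (sr M)" "oright (runit_inv M) = tid (tg M)"
  by (simp_all add: cell_id_def cell_comp_def hom_cell_def cell_tensor_def assoc_cell_def assoc_inv_def
      lunit_cell_def lunit_inv_def runit_cell_def runit_inv_def)

lemma cell_id_om [simp]: "m \<in> elt M x ==> om (cell_id M) x m = m"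
  by (simp add: cell_id_def)

lemma cell_id_modulation [simp]: "mx M ==> mux (cell_id M)"
  unfolding cell_id_def by (rule glob_modulation) auto

lemma cell_comp_om [simp]: "m \<in> elt (odom mu) x ==> om (cell_comp mu nu) x m = om nu x (om mu x m)"
  by (simp add: cell_comp_def)

lemma cell_comp_modulation [simp]:
  assumes "mux mu" "mux nu" "ocod mu = odom nu"
  shows "mux (cell_comp mu nu)"
  unfolding cell_comp_def
proof (rule mk_modn_modulation, goal_cases)
  case (12 f m)
  note [simp] = assms
  let ?al = "oleft mu" and ?al' = "oleft nu" and ?be = "oright mu" and ?be' = "oright nu"
  let ?x = "dA f" and ?y = "cA f"
  let ?p = "lft (odom mu) ?x m" and ?q = "rgt (odom mu) ?x m"
  let ?A = "tar ?al' f (tob ?al ?x ?p)" and ?B = "tar ?be' f (tob ?be ?x ?q)"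
  let ?a = "tar ?al f ?p" and ?b = "tar ?be f ?q"
  let ?fm = "mce (odom mu) (ic f) m" and ?fn = "mce (odom nu) (ic f) (om mu ?x m)"
  \<comment> \<open>Equivariance of \<open>nu\<close> collects the factor from the left
    transformation of \<open>mu\<close> inside \<open>nu\<close>. There the law of \<open>mu\<close>
    applies, and the law of \<open>nu\<close> treats the factor that stayed outside.\<close>
  have "la (ocod nu) ?y (tar (tcm ?al ?al') f ?p) (om nu ?y (om mu ?y ?fm)) =
      la (ocod nu) ?y ?A (om nu ?y (la (odom nu) ?y ?a (om mu ?y ?fm)))"
    using 12 by simp
  also have "la (odom nu) ?y ?a (om mu ?y ?fm) = ra (odom nu) ?y ?fn ?b"
    using mu_laws(3)[OF assms(1) refl 12] by simp
  also have "la (ocod nu) ?y ?A (om nu ?y (ra (odom nu) ?y ?fn ?b)) =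
      ra (ocod nu) ?y (la (ocod nu) ?y ?A (om nu ?y ?fn)) (tpr ?be' ?y ?b)"
    using 12 by simp
  also have "la (ocod nu) ?y ?A (om nu ?y ?fn) = ra (ocod nu) ?y (mce (ocod nu) (ic f) (om nu ?x (om mu ?x m))) ?B"
    using mu_laws(3)[OF assms(2) refl 12(1), of "om mu ?x m"] 12 by simp
  finally show ?case
    using 12 by simp
qed (use assms in auto)

lemma hom_cell_om [simp]: "tx al ==> a \<in> fel (tdom al) x ==> om (hom_cell al) x a = tpr al x a"
  by (simp add: hom_cell_def)

lemma hom_cell_modulation [simp]: "tx al ==> mux (hom_cell al)"
  unfolding hom_cell_def by (rule mk_modn_modulation) (auto simp: tx_nat_arrow)

context
  fixes mu nu :: "('o, 'a, 'c, 'u) s_modn"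
  assumes mu: "mux mu" and nu: "mux nu" and eq: "oright mu = oleft nu"
begin

lemma hcomp_compat: "tg (odom mu) = sr (odom nu)" "tg (ocod mu) = sr (ocod nu)"
  using mu_simps(5-8)[OF mu] mu_simps(5-8)[OF nu] eq by auto

lemma cell_tensor_om [simp]:
  assumes "m \<in> elt (odom mu) x" "n \<in> elt (odom nu) x"
    "rgt (odom mu) x m = lft (odom nu) x n"
  shows "om (cell_tensor mu nu) x (tens (odom mu) (odom nu) x m n) = tens (ocod mu) (ocod nu) x (om mu x m) (om nu x n)"
proof -
  note [simp] = mu nu hcomp_compat eq
  have "balanced (odom mu) (odom nu) x p q (\<lambda>m n. tens (ocod mu) (ocod nu) x (om mu x m) (om nu x n))" for p q
    by (auto simp: balanced_def tens_balance)
  then show ?thesis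
    using assms by (simp add: cell_tensor_def tens_lift_tens)
qed

text \<open>The outer equivariance laws concern one factor each. Naturality along an arrow uses both
  cells, linked by the transformation that they share.\<close>

lemma cell_tensor_modulation [simp]: "mux (cell_tensor mu nu)"
proof -
  note [simp] = mu nu hcomp_compat
  have legs [simp]: "tob (oleft nu) x p = tob (oright mu) x p"
    "tpr (oleft nu) x a = tpr (oright mu) x a" "tar (oleft nu) f p = tar (oright mu) f p" for x p a f
    by (simp_all add: eq)
  have om_eq: "tens_lift (odom mu) (odom nu) x (\<lambda>m n. tens (ocod mu) (ocod nu) x (om mu x m) (om nu x n)) z = om (cell_tensor mu nu) x z"
    if "z \<in> elt (tensor (odom mu) (odom nu)) x" for x z
    using that by (simp add: cell_tensor_def)
  have tr: "rgt (ocod mu) x (om mu x m) = lft (ocod nu) x (om nu x n)"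
    if "m \<in> elt (odom mu) x" "n \<in> elt (odom nu) x" "rgt (odom mu) x m = lft (odom nu) x n" for x m n
    using that by simp
  show ?thesis
    unfolding cell_tensor_def
  proof (rule mk_modn_modulation, goal_cases)
    case (9 x z)
    then show ?case
      unfolding om_eq[OF 9] by (elim tensor_cases[OF _ _ hcomp_compat(1), rotated 2]) simp_all
  next
    case (10 x z b)
    then have "ra (tensor (odom mu) (odom nu)) x z b \<in> elt (tensor (odom mu) (odom nu)) x" by simp
    with 10 show ?case
      by (simp add: om_eq) (elim tensor_cases[OF _ _ hcomp_compat(1), rotated 2]; simp)
  next
    case (11 x a z)
    then have "la (tensor (odom mu) (odom nu)) x a z \<in> elt (tensor (odom mu) (odom nu)) x" by simp
    with 11 show ?case
      by (simp add: om_eq) (elim tensor_cases[OF _ _ hcomp_compat(1), rotated 2]; simp)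
  next
    case (12 f z)
    let ?x = "dA f" and ?y = "cA f" and ?M = "odom mu" and ?N = "odom nu" and ?M' = "ocod mu" and ?N' = "ocod nu"
    have c: "mce (tensor ?M ?N) (ic f) z \<in> elt (tensor ?M ?N) ?y"
      using 12 by simp
    obtain m n where z: "z = tens ?M ?N ?x m n" "m \<in> elt ?M ?x" "n \<in> elt ?N ?x"
        "rgt ?M ?x m = lft ?N ?x n"
      using tensor_cases[OF _ _ hcomp_compat(1) 12(2)] by auto
    let ?fm = "mce ?M (ic f) m" and ?fn = "mce ?N (ic f) n"
    let ?a = "tar (oleft mu) f (lft ?M ?x m)" and ?b = "tar (oright mu) f (rgt ?M ?x m)"
    let ?c = "tar (oright nu) f (rgt ?N ?x n)"
    note nat = mu_laws(3)[OF mu refl 12(1) z(2)] mu_laws(3)[OF nu refl 12(1) z(3), folded z(4), folded eq]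
    \<comment> \<open>The law of \<open>mu\<close> produces the component of the shared
      transformation as a right action on the first factor. Balancing turns it into a left action on
      the second factor, where the law of \<open>nu\<close> consumes it.\<close>
    have "tens ?M' ?N' ?y (la ?M' ?y ?a (om mu ?y ?fm)) (om nu ?y ?fn) =
        tens ?M' ?N' ?y (ra ?M' ?y (mce ?M' (ic f) (om mu ?x m)) ?b) (om nu ?y ?fn)"
      using nat by simp
    also have "... = tens ?M' ?N' ?y (mce ?M' (ic f) (om mu ?x m)) (la ?N' ?y ?b (om nu ?y ?fn))"
      by (rule tens_balance[OF _ _ hcomp_compat(2)]) (use z 12 in simp_all)
    also have "... = tens ?M' ?N' ?y (mce ?M' (ic f) (om mu ?x m)) (ra ?N' ?y (mce ?N' (ic f) (om nu ?x n)) ?c)"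
      using nat by simp
    finally show ?case
      unfolding om_eq[OF 12(2)] om_eq[OF c] using z 12 tr by simp
  qed simp_all
qed

end

context
  fixes M :: "('o, 'a, 'c, 'u) s_module"
  assumes M: "mx M"
begin

lemma lunit_om [simp]:
  assumes "a \<in> fel (sr M) x" "m \<in> elt M x" "frt (sr M) x a = lft M x m"
  shows "om (lunit_cell M) x (tens (hom_module (sr M)) M x a m) = la M x a m"
proof -
  have "balanced (hom_module (sr M)) M x p q (\<lambda>a m. la M x a m)" for p q
    using M by (auto simp: balanced_def)
  then show ?thesis
    using assms M by (simp add: lunit_cell_def tens_lift_tens)
qed

lemma runit_om [simp]:
  assumes "b \<in> fel (tg M) x" "m \<in> elt M x" "rgt M x m = flt (tg M) x b"
  shows "om (runit_cell M) x (tens M (hom_module (tg M)) x m b) = ra M x m b"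
proof -
  have "balanced M (hom_module (tg M)) x p q (\<lambda>m b. ra M x m b)" for p q
    using M by (auto simp: balanced_def)
  then show ?thesis
    using assms M by (simp add: runit_cell_def tens_lift_tens)
qed

lemma lunit_inv_om [simp]: "m \<in> elt M x ==> om (lunit_inv M) x m =
    tens (hom_module (sr M)) M x (uni (sr M) x (lft M x m)) m"
  by (simp add: lunit_inv_def)

lemma runit_inv_om [simp]: "m \<in> elt M x ==> om (runit_inv M) x m =
    tens M (hom_module (tg M)) x m (uni (tg M) x (rgt M x m))"
  by (simp add: runit_inv_def)

lemma hom_tens_cases:
  "z \<in> elt (tensor (hom_module (sr M)) M) x ==>
    (\<And>a m. z = tens (hom_module (sr M)) M x a m ==> a \<in> fel (sr M) x ==> m \<in> elt M x ==>
      frt (sr M) x a = lft M x m ==> thesis) ==> thesis"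
  "z \<in> elt (tensor M (hom_module (tg M))) x ==>
    (\<And>m b. z = tens M (hom_module (tg M)) x m b ==> m \<in> elt M x ==> b \<in> fel (tg M) x ==>
      rgt M x m = flt (tg M) x b ==> thesis) ==> thesis"
  using M by (auto elim!: tensor_cases[rotated 3])

lemma hom_tens_balance:
  "a \<in> fel (sr M) x ==> b \<in> fel (sr M) x ==> m \<in> elt M x ==>
     frt (sr M) x a = flt (sr M) x b ==> frt (sr M) x b = lft M x m ==>
     tens (hom_module (sr M)) M x (cmp (sr M) x a b) m = tens (hom_module (sr M)) M x a (la M x b m)"
  "m \<in> elt M x ==> a \<in> fel (tg M) x ==> b \<in> fel (tg M) x ==>
     rgt M x m = flt (tg M) x a ==> frt (tg M) x a = flt (tg M) x b ==>
     tens M (hom_module (tg M)) x (ra M x m a) b = tens M (hom_module (tg M)) x m (cmp (tg M) x a b)"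
  using M tens_balance[of "hom_module (sr M)" M a x b m] tens_balance[of M "hom_module (tg M)" m x a b]
  by simp_all

text \<open>What makes the unit constraints invertible: an element of the identity module can be
  moved onto its neighbour, leaving a unit behind.\<close>

lemma hom_tens_unit:
  "a \<in> fel (sr M) x ==> m \<in> elt M x ==> frt (sr M) x a = lft M x m ==>
     p = flt (sr M) x a ==>
     tens (hom_module (sr M)) M x (uni (sr M) x p) (la M x a m) = tens (hom_module (sr M)) M x a m"
  "m \<in> elt M x ==> b \<in> fel (tg M) x ==> rgt M x m = flt (tg M) x b ==>
     p = frt (tg M) x b ==>
     tens M (hom_module (tg M)) x (ra M x m b) (uni (tg M) x p) = tens M (hom_module (tg M)) x m b"
proof -
  let ?F = "sr M" and ?G = "tg M"
  assume h: "a \<in> fel ?F x" "m \<in> elt M x" "frt ?F x a = lft M x m"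
    "p = flt ?F x a"
  have "tens (hom_module ?F) M x (cmp ?F x (uni ?F x p) a) m =
      tens (hom_module ?F) M x (uni ?F x p) (la M x a m)"
    by (rule hom_tens_balance(1)) (use h M in simp_all)
  moreover have "cmp ?F x (uni ?F x p) a = a" using h M by simp
  ultimately show "tens (hom_module ?F) M x (uni ?F x p) (la M x a m) = tens (hom_module ?F) M x a m"
    by simp
next
  let ?F = "sr M" and ?G = "tg M"
  assume h: "m \<in> elt M x" "b \<in> fel ?G x" "rgt M x m = flt ?G x b"
    "p = frt ?G x b"
  have "tens M (hom_module ?G) x (ra M x m b) (uni ?G x p) =
      tens M (hom_module ?G) x m (cmp ?G x b (uni ?G x p))"
    by (rule hom_tens_balance(2)) (use h M in simp_all)
  moreover have "cmp ?G x b (uni ?G x p) = b" using h M by simp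
  ultimately show "tens M (hom_module ?G) x (ra M x m b) (uni ?G x p) = tens M (hom_module ?G) x m b"
    by simp
qed

lemma lunit_modulations [simp]: "mux (lunit_cell M)" "mux (lunit_inv M)"
proof -
  note [simp] = M
  let ?h = "\<lambda>x. tens_lift (hom_module (sr M)) M x (\<lambda>a m. la M x a m)"
  have h: "?h x z = om (lunit_cell M) x z" if "z \<in> elt (tensor (hom_module (sr M)) M) x" for x z
    using that by (simp add: lunit_cell_def)
  show "mux (lunit_cell M)"
    unfolding lunit_cell_def
  proof (rule glob_modulation, goal_cases)
    case (8 x z b)
    then have "ra (tensor (hom_module (sr M)) M) x z b \<in> elt (tensor (hom_module (sr M)) M) x" by simp
    with 8 show ?case by (simp add: h) (elim hom_tens_cases; simp)
  next
    case (9 x a z)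
    then have "la (tensor (hom_module (sr M)) M) x a z \<in> elt (tensor (hom_module (sr M)) M) x" by simp
    with 9 show ?case by (simp add: h) (elim hom_tens_cases; simp)
  next
    case (10 f z)
    then have "mce (tensor (hom_module (sr M)) M) (ic f) z \<in> elt (tensor (hom_module (sr M)) M) (cA f)" by simp
    with 10 show ?case by (simp add: h) (elim hom_tens_cases; simp)
  qed (simp_all add: h, elim hom_tens_cases, simp)
  show "mux (lunit_inv M)"
    unfolding lunit_inv_def
    by (rule glob_modulation) (simp_all add: hom_tens_unit)
qed

lemma runit_modulations [simp]: "mux (runit_cell M)" "mux (runit_inv M)"
proof -
  note [simp] = M
  let ?h = "\<lambda>x. tens_lift M (hom_module (tg M)) x (\<lambda>m b. ra M x m b)"
  have h: "?h x z = om (runit_cell M) x z" if "z \<in> elt (tensor M (hom_module (tg M))) x" for x z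
    using that by (simp add: runit_cell_def)
  show "mux (runit_cell M)"
    unfolding runit_cell_def
  proof (rule glob_modulation, goal_cases)
    case (8 x z b)
    then have "ra (tensor M (hom_module (tg M))) x z b \<in> elt (tensor M (hom_module (tg M))) x" by simp
    with 8 show ?case by (simp add: h) (elim hom_tens_cases; simp)
  next
    case (9 x a z)
    then have "la (tensor M (hom_module (tg M))) x a z \<in> elt (tensor M (hom_module (tg M))) x" by simp
    with 9 show ?case by (simp add: h) (elim hom_tens_cases; simp)
  next
    case (10 f z)
    then have "mce (tensor M (hom_module (tg M))) (ic f) z \<in> elt (tensor M (hom_module (tg M))) (cA f)" by simp
    with 10 show ?case by (simp add: h) (elim hom_tens_cases; simp)
  qed (simp_all add: h, elim hom_tens_cases, simp)
  show "mux (runit_inv M)"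
    unfolding runit_inv_def
    by (rule glob_modulation) (simp_all add: hom_tens_unit)
qed

end

context
  fixes M N P :: "('o, 'a, 'c, 'u) s_module"
  assumes M: "mx M" and N: "mx N" and P: "mx P"
    and MN: "tg M = sr N" and NP: "tg N = sr P"
begin

text \<open>The constraint is a lift inside a lift, so balancing is needed twice: over the model
  between \<open>M\<close> and \<open>N\<close> for a fixed \<open>p\<close>, and then over the
  model between \<open>tensor M N\<close> and \<open>P\<close>, where a class on the left is first
  replaced by a pair.\<close>

lemma assoc_om [simp]:
  assumes "m \<in> elt M x" "n \<in> elt N x" "p \<in> elt P x"
    "rgt M x m = lft N x n" "rgt N x n = lft P x p"
  shows "om (assoc_cell M N P) x (tens (tensor M N) P x (tens M N x m n) p) = tens M (tensor N P) x m (tens N P x n p)"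
proof -
  note [simp] = M N P MN NP
  let ?g = "\<lambda>p m n. tens M (tensor N P) x m (tens N P x n p)"
  have inner: "balanced M N x q r (?g p)" if "p \<in> elt P x" "r = lft P x p" for p q r
    using that by (auto simp: balanced_def tens_balance)
  have ev: "tens_lift M N x (?g p) (tens M N x m n) = ?g p m n"
    if "m \<in> elt M x" "n \<in> elt N x" "p \<in> elt P x"
      "rgt M x m = lft N x n" "rgt N x n = lft P x p" for m n p
    using that inner[OF that(3)] by (simp add: tens_lift_tens)
  have "balanced (tensor M N) P x q r (\<lambda>t p. tens_lift M N x (?g p) t)" for q r
    unfolding balanced_def
  proof (intro allI impI; elim conjE)
    fix t b p assume *: "t \<in> elt (tensor M N) x" "b \<in> fel (tg (tensor M N)) x" "p \<in> elt P x"
      "rgt (tensor M N) x t = flt (tg (tensor M N)) x b"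
      "frt (tg (tensor M N)) x b = lft P x p"
    obtain m n where "t = tens M N x m n" "m \<in> elt M x" "n \<in> elt N x"
        "rgt M x m = lft N x n"
      using tensor_cases[OF M N MN *(1)] .
    then show "tens_lift M N x (?g p) (ra (tensor M N) x t b) = tens_lift M N x (?g (la P x b p)) t"
      using * by (simp add: ev tens_balance)
  qed
  then show ?thesis
    using assms by (simp add: assoc_cell_def tens_lift_tens ev)
qed

lemma assoc_inv_om [simp]:
  assumes "m \<in> elt M x" "n \<in> elt N x" "p \<in> elt P x"
    "rgt M x m = lft N x n" "rgt N x n = lft P x p"
  shows "om (assoc_inv M N P) x (tens M (tensor N P) x m (tens N P x n p)) = tens (tensor M N) P x (tens M N x m n) p"
proof -
  note [simp] = M N P MN NP
  let ?g = "\<lambda>m n p. tens (tensor M N) P x (tens M N x m n) p"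
  have bal: "tens (tensor M N) P x (tens M N x m (ra N x n b)) p = tens (tensor M N) P x (tens M N x m n) (la P x b p)"
    if "m \<in> elt M x" "n \<in> elt N x" "b \<in> fel (tg N) x" "p \<in> elt P x"
      "rgt M x m = lft N x n" "rgt N x n = flt (tg N) x b"
      "frt (tg N) x b = lft P x p" for m n b p
    using tens_balance[of "tensor M N" P "tens M N x m n" x b p] that by simp
  have inner: "balanced N P x q r (?g m)" if "m \<in> elt M x" "rgt M x m = q" for m q r
    using that by (auto simp: balanced_def bal)
  have ev: "tens_lift N P x (?g m) (tens N P x n p) = ?g m n p"
    if "m \<in> elt M x" "n \<in> elt N x" "p \<in> elt P x"
      "rgt M x m = lft N x n" "rgt N x n = lft P x p" for m n p
    using that inner[OF that(1)] by (simp add: tens_lift_tens)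
  have "balanced M (tensor N P) x q r (\<lambda>m t. tens_lift N P x (?g m) t)" for q r
    unfolding balanced_def
  proof (intro allI impI; elim conjE)
    fix m b t assume *: "m \<in> elt M x" "b \<in> fel (tg M) x" "t \<in> elt (tensor N P) x"
      "rgt M x m = flt (tg M) x b"
      "frt (tg M) x b = lft (tensor N P) x t"
    obtain n p where "t = tens N P x n p" "n \<in> elt N x" "p \<in> elt P x"
        "rgt N x n = lft P x p"
      using tensor_cases[OF N P NP *(3)] .
    then show "tens_lift N P x (?g (ra M x m b)) t = tens_lift N P x (?g m) (la (tensor N P) x b t)"
      using * by (simp add: ev tens_balance)
  qed
  then show ?thesis
    using assms by (simp add: assoc_inv_def tens_lift_tens ev)
qed

lemma assoc_cases:
  "z \<in> elt (tensor (tensor M N) P) x ==>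
    (\<And>m n p. z = tens (tensor M N) P x (tens M N x m n) p ==> m \<in> elt M x ==> n \<in> elt N x ==>
      p \<in> elt P x ==> rgt M x m = lft N x n ==> rgt N x n = lft P x p ==>
      thesis) ==> thesis"
  "z \<in> elt (tensor M (tensor N P)) x ==>
    (\<And>m n p. z = tens M (tensor N P) x m (tens N P x n p) ==> m \<in> elt M x ==> n \<in> elt N x ==>
      p \<in> elt P x ==> rgt M x m = lft N x n ==> rgt N x n = lft P x p ==>
      thesis) ==> thesis"
proof -
  note [simp] = M N P MN NP
  show "z \<in> elt (tensor (tensor M N) P) x ==>
    (\<And>m n p. z = tens (tensor M N) P x (tens M N x m n) p ==> m \<in> elt M x ==> n \<in> elt N x ==>
      p \<in> elt P x ==> rgt M x m = lft N x n ==> rgt N x n = lft P x p ==>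
      thesis) ==> thesis"
  proof -
    assume z: "z \<in> elt (tensor (tensor M N) P) x"
      and t: "\<And>m n p. z = tens (tensor M N) P x (tens M N x m n) p ==> m \<in> elt M x ==> n \<in> elt N x ==>
      p \<in> elt P x ==> rgt M x m = lft N x n ==> rgt N x n = lft P x p ==>
      thesis"
    obtain t p where tp: "z = tens (tensor M N) P x t p" "t \<in> elt (tensor M N) x" "p \<in> elt P x"
      "rgt (tensor M N) x t = lft P x p"
      using tensor_cases[OF _ P _ z] by auto
    obtain m n where "t = tens M N x m n" "m \<in> elt M x" "n \<in> elt N x"
        "rgt M x m = lft N x n"
      using tensor_cases[OF M N MN tp(2)] .
    then show thesis using tp by (intro t) auto
  qed
  show "z \<in> elt (tensor M (tensor N P)) x ==>
    (\<And>m n p. z = tens M (tensor N P) x m (tens N P x n p) ==> m \<in> elt M x ==> n \<in> elt N x ==>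
      p \<in> elt P x ==> rgt M x m = lft N x n ==> rgt N x n = lft P x p ==>
      thesis) ==> thesis"
  proof -
    assume z: "z \<in> elt (tensor M (tensor N P)) x"
      and t: "\<And>m n p. z = tens M (tensor N P) x m (tens N P x n p) ==> m \<in> elt M x ==> n \<in> elt N x ==>
      p \<in> elt P x ==> rgt M x m = lft N x n ==> rgt N x n = lft P x p ==>
      thesis"
    obtain m t where tp: "z = tens M (tensor N P) x m t" "t \<in> elt (tensor N P) x" "m \<in> elt M x"
      "rgt M x m = lft (tensor N P) x t"
      by (rule tensor_cases[OF M _ _ z]) auto
    obtain n p where "t = tens N P x n p" "n \<in> elt N x" "p \<in> elt P x"
        "rgt N x n = lft P x p"
      using tensor_cases[OF N P NP tp(2)] .
    then show thesis using tp by (intro t) auto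
  qed
qed

lemma assoc_modulations [simp]: "mux (assoc_cell M N P)" "mux (assoc_inv M N P)"
proof -
  note [simp] = M N P MN NP
  let ?g = "\<lambda>x. tens_lift (tensor M N) P x (\<lambda>t p. tens_lift M N x (\<lambda>m n. tens M (tensor N P) x m (tens N P x n p)) t)"
  have g: "?g x z = om (assoc_cell M N P) x z" if "z \<in> elt (tensor (tensor M N) P) x" for x z
    using that by (simp add: assoc_cell_def)
  let ?h = "\<lambda>x. tens_lift M (tensor N P) x (\<lambda>m t. tens_lift N P x (\<lambda>n p. tens (tensor M N) P x (tens M N x m n) p) t)"
  have h: "?h x z = om (assoc_inv M N P) x z" if "z \<in> elt (tensor M (tensor N P)) x" for x z
    using that by (simp add: assoc_inv_def)
  show "mux (assoc_cell M N P)"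
    unfolding assoc_cell_def
  proof (rule glob_modulation, goal_cases)
    case (7 x z)
    then show ?case by (simp add: g) (elim assoc_cases; simp)
  next
    case (8 x z b)
    then have "ra (tensor (tensor M N) P) x z b \<in> elt (tensor (tensor M N) P) x" by simp
    with 8 show ?case by (simp add: g) (elim assoc_cases; simp)
  next
    case (9 x a z)
    then have "la (tensor (tensor M N) P) x a z \<in> elt (tensor (tensor M N) P) x" by simp
    with 9 show ?case by (simp add: g) (elim assoc_cases; simp)
  next
    case (10 f z)
    then have "mce (tensor (tensor M N) P) (ic f) z \<in> elt (tensor (tensor M N) P) (cA f)" by simp
    with 10 show ?case by (simp add: g) (elim assoc_cases; simp)
  qed simp_all
  show "mux (assoc_inv M N P)"
    unfolding assoc_inv_def
  proof (rule glob_modulation, goal_cases)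
    case (7 x z)
    then show ?case by (simp add: h) (elim assoc_cases; simp)
  next
    case (8 x z b)
    then have "ra (tensor M (tensor N P)) x z b \<in> elt (tensor M (tensor N P)) x" by simp
    with 8 show ?case by (simp add: h) (elim assoc_cases; simp)
  next
    case (9 x a z)
    then have "la (tensor M (tensor N P)) x a z \<in> elt (tensor M (tensor N P)) x" by simp
    with 9 show ?case by (simp add: h) (elim assoc_cases; simp)
  next
    case (10 f z)
    then have "mce (tensor M (tensor N P)) (ic f) z \<in> elt (tensor M (tensor N P)) (cA f)" by simp
    with 10 show ?case by (simp add: h) (elim assoc_cases; simp)
  qed simp_all
qed

end

section \<open>The double category of models\<close>

definition model_dbl where
  "model_dbl = \<lparr>Ob = {F. lx F}, Ar = {al. tx al}, Pr = {M. mx M}, Ce = {mu. mux mu},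
     adom = tdom, acod = tcod, aid = tid, acomp = tcm,
     psrc = sr, ptgt = tg, cdom = odom, ccod = ocod, cid = cell_id, ccomp = cell_comp,
     csrc = oleft, ctgt = oright, pid = hom_module, pcomp = tensor, idcell = hom_cell,
     hcomp = cell_tensor, assoc = assoc_cell, lunit = lunit_cell, runit = runit_cell\<rparr>"

lemma model_dbl_simps [simp]:
  "Ob model_dbl = {F. lx F}" "Ar model_dbl = {al. tx al}" "Pr model_dbl = {M. mx M}"
  "Ce model_dbl = {mu. mux mu}" "adom model_dbl = tdom" "acod model_dbl = tcod"
  "aid model_dbl = tid" "acomp model_dbl = tcm"
  "psrc model_dbl = sr" "ptgt model_dbl = tg" "cdom model_dbl = odom" "ccod model_dbl = ocod"
  "cid model_dbl = cell_id" "ccomp model_dbl = cell_comp" "csrc model_dbl = oleft" "ctgt model_dbl = oright"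
  "pid model_dbl = hom_module" "pcomp model_dbl = tensor" "idcell model_dbl = hom_cell"
  "hcomp model_dbl = cell_tensor" "assoc model_dbl = assoc_cell" "lunit model_dbl = lunit_cell"
  "runit model_dbl = runit_cell"
  by (simp_all add: model_dbl_def)

text \<open>The axioms of a double category become equations between elements. An element of a
  tensor product may be taken of the form \<open>tens m n\<close>, and there every structure cell is
  computed by a rewrite rule.\<close>

lemma mu_eqI:
  assumes "mux mu" "mux nu" "odom mu = odom nu" "ocod mu = ocod nu" "oleft mu = oleft nu" "oright mu = oright nu"
    "\<And>x m. m \<in> elt (odom nu) x ==> om mu x m = om nu x m"
  shows "mu = nu"
  using assms by (intro modn_eqI) (simp_all add: modulation_typed)

lemma trans_comp_ids [simp]:
  "lx F ==> tcm (tid F) (tid F) = tid F"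
  "tx al ==> tdom al = F ==> tcm (tid F) al = al"
  "tx al ==> tcod al = F ==> tcm al (tid F) = al"
  using trans_comp_id(1)[of "tid F"] trans_comp_id[of al] by auto

lemma cell_tensor_id:
  assumes "mx M" "mx N" "tg M = sr N"
  shows "cell_tensor (cell_id M) (cell_id N) = cell_id (tensor M N)"
proof (rule mu_eqI)
  note [simp] = assms
  show "om (cell_tensor (cell_id M) (cell_id N)) x z = om (cell_id (tensor M N)) x z"
    if z: "z \<in> elt (odom (cell_id (tensor M N))) x" for x z
    using z cell_tensor_om[of "cell_id M" "cell_id N"] by (auto elim!: tensor_cases[OF assms])
qed (use assms in simp_all)

lemma cell_interchange:
  assumes "mux c" "mux d" "mux c'" "mux d'"
    "oright c = oleft d" "oright c' = oleft d'" "ocod c = odom c'" "ocod d = odom d'"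
  shows "cell_comp (cell_tensor c d) (cell_tensor c' d') = cell_tensor (cell_comp c c') (cell_comp d d')"
proof (rule mu_eqI)
  note [simp] = assms
  note compat [simp] = hcomp_compat[OF assms(1,2,5)] hcomp_compat[OF assms(3,4,6)]
  note ev = cell_tensor_om[OF assms(1,2,5)] cell_tensor_om[OF assms(3,4,6)]
    cell_tensor_om[of "cell_comp c c'" "cell_comp d d'"]
  have legs: "rgt (odom c') x (om c x m) = lft (odom d') x (om d x n)"
    if "m \<in> elt (odom c) x" "n \<in> elt (odom d) x" "rgt (odom c) x m = lft (odom d) x n" for m n x
    using that by simp
  show "om (cell_comp (cell_tensor c d) (cell_tensor c' d')) x z = om (cell_tensor (cell_comp c c') (cell_comp d d')) x z"
    if z: "z \<in> elt (odom (cell_tensor (cell_comp c c') (cell_comp d d'))) x" for x z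
  proof -
    have z': "z \<in> elt (tensor (odom c) (odom d)) x" using z by simp
    obtain m n where "z = tens (odom c) (odom d) x m n" "m \<in> elt (odom c) x" "n \<in> elt (odom d) x"
      "rgt (odom c) x m = lft (odom d) x n"
      using tensor_cases[OF _ _ compat(1) z'] by auto
    with z' legs[of m x n] ev show ?thesis by simp
  qed
qed (use assms hcomp_compat[OF assms(1,2,5)] hcomp_compat[OF assms(3,4,6)] in simp_all)

lemma cell_inverseI:
  assumes "mux c" "mux d" "odom c = M" "ocod c = N" "odom d = N" "ocod d = M"
    "oleft c = tid F" "oright c = tid G" "oleft d = tid F" "oright d = tid G"
    "\<And>x m. m \<in> elt M x ==> om d x (om c x m) = m" "\<And>x m. m \<in> elt N x ==> om c x (om d x m) = m"
    "lx F" "lx G" "sr M = F" "sr N = F" "tg M = G" "tg N = G"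
  shows "globular model_dbl c M N \<and> (\<exists>d. cell_inverse model_dbl c d)"
proof
  have mx: "mx M" "mx N" using mu_simps(1,2)[OF assms(1)] assms by auto
  show "globular model_dbl c M N" using assms by (simp add: globular_def in_cell_def)
  have "cell_comp c d = cell_id M" "cell_comp d c = cell_id N"
    by (rule mu_eqI; use assms mx in simp)+
  then have "cell_inverse model_dbl c d" using assms by (simp add: cell_inverse_def)
  then show "\<exists>d. cell_inverse model_dbl c d" ..
qed

lemma assoc_natural:
  assumes c: "mux c" and d: "mux d" and e: "mux e"
    and cd: "oright c = oleft d" and de: "oright d = oleft e"
  shows "cell_comp (cell_tensor (cell_tensor c d) e) (assoc_cell (ocod c) (ocod d) (ocod e)) =
    cell_comp (assoc_cell (odom c) (odom d) (odom e)) (cell_tensor c (cell_tensor d e))"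
proof (rule mu_eqI)
  note [simp] = c d e cd de
  note compat = hcomp_compat[OF c d cd] hcomp_compat[OF d e de]
  note [simp] = compat
  note asm = assoc_modulations[OF mu_simps(1)[OF c] mu_simps(1)[OF d] mu_simps(1)[OF e] compat(1,3)]
    assoc_modulations[OF mu_simps(2)[OF c] mu_simps(2)[OF d] mu_simps(2)[OF e] compat(2,4)]
  have t: "mux (cell_tensor c d)" "mux (cell_tensor d e)"
    "mux (cell_tensor (cell_tensor c d) e)" "mux (cell_tensor c (cell_tensor d e))"
    by (simp_all del: compat)
  show "mux (cell_comp (cell_tensor (cell_tensor c d) e) (assoc_cell (ocod c) (ocod d) (ocod e)))"
    "mux (cell_comp (assoc_cell (odom c) (odom d) (odom e)) (cell_tensor c (cell_tensor d e)))"
    using t asm by (auto intro!: cell_comp_modulation)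
  have legs: "rgt (ocod c) x (om c x m) = lft (ocod d) x (om d x n)"
    if "m \<in> elt (odom c) x" "n \<in> elt (odom d) x" "rgt (odom c) x m = lft (odom d) x n" for m n x
    using that by simp
  have legs': "rgt (ocod d) x (om d x m) = lft (ocod e) x (om e x n)"
    if "m \<in> elt (odom d) x" "n \<in> elt (odom e) x" "rgt (odom d) x m = lft (odom e) x n" for m n x
    using that by simp
  note ev = cell_tensor_om[OF c d cd] cell_tensor_om[OF d e de] cell_tensor_om[of "cell_tensor c d" e]
    cell_tensor_om[of c "cell_tensor d e"]
  show "om (cell_comp (cell_tensor (cell_tensor c d) e) (assoc_cell (ocod c) (ocod d) (ocod e))) x z =
    om (cell_comp (assoc_cell (odom c) (odom d) (odom e)) (cell_tensor c (cell_tensor d e))) x z"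
    if z: "z \<in> elt (odom (cell_comp (assoc_cell (odom c) (odom d) (odom e)) (cell_tensor c (cell_tensor d e)))) x" for x z
  proof -
    have z': "z \<in> elt (tensor (tensor (odom c) (odom d)) (odom e)) x" using z by simp
    then show ?thesis
      by (rule assoc_cases(1)[OF mu_simps(1)[OF c] mu_simps(1)[OF d] mu_simps(1)[OF e] compat(1,3)])
        (use z' ev t legs legs' in simp)
  qed
qed (use assms hcomp_compat[OF c d cd] hcomp_compat[OF d e de] in simp_all)

lemma unit_natural:
  assumes c: "mux c"
  shows "cell_comp (cell_tensor (hom_cell (oleft c)) c) (lunit_cell (ocod c)) = cell_comp (lunit_cell (odom c)) c"
    "cell_comp (cell_tensor c (hom_cell (oright c))) (runit_cell (ocod c)) = cell_comp (runit_cell (odom c)) c"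
proof -
  note [simp] = c
  have t: "mux (cell_tensor (hom_cell (oleft c)) c)" "mux (cell_tensor c (hom_cell (oright c)))"
    by simp_all
  show "cell_comp (cell_tensor (hom_cell (oleft c)) c) (lunit_cell (ocod c)) = cell_comp (lunit_cell (odom c)) c"
  proof (rule mu_eqI)
    show "om (cell_comp (cell_tensor (hom_cell (oleft c)) c) (lunit_cell (ocod c))) x z = om (cell_comp (lunit_cell (odom c)) c) x z"
      if z: "z \<in> elt (odom (cell_comp (lunit_cell (odom c)) c)) x" for x z
    proof -
      have z': "z \<in> elt (tensor (hom_module (sr (odom c))) (odom c)) x" using z by simp
      then show ?thesis
        by (rule hom_tens_cases(1)[OF mu_simps(1)[OF c]])
          (use z' cell_tensor_om[of "hom_cell (oleft c)" c] in simp)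
    qed
  qed (use t in simp_all)
  show "cell_comp (cell_tensor c (hom_cell (oright c))) (runit_cell (ocod c)) = cell_comp (runit_cell (odom c)) c"
  proof (rule mu_eqI)
    show "om (cell_comp (cell_tensor c (hom_cell (oright c))) (runit_cell (ocod c))) x z = om (cell_comp (runit_cell (odom c)) c) x z"
      if z: "z \<in> elt (odom (cell_comp (runit_cell (odom c)) c)) x" for x z
    proof -
      have z': "z \<in> elt (tensor (odom c) (hom_module (tg (odom c)))) x" using z by simp
      then show ?thesis
        by (rule hom_tens_cases(2)[OF mu_simps(1)[OF c]])
          (use z' cell_tensor_om[of c "hom_cell (oright c)"] in simp)
    qed
  qed (use t in simp_all)
qed

lemma model_triangle:
  assumes M: "mx M" and N: "mx N" and MN: "tg M = sr N"
  shows "cell_comp (assoc_cell M (hom_module (tg M)) N) (cell_tensor (cell_id M) (lunit_cell N)) =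
    cell_tensor (runit_cell M) (cell_id N)"
proof (rule mu_eqI)
  note [simp] = M N MN
  let ?H = "hom_module (tg M)"
  show "om (cell_comp (assoc_cell M ?H N) (cell_tensor (cell_id M) (lunit_cell N))) x z =
      om (cell_tensor (runit_cell M) (cell_id N)) x z"
    if z: "z \<in> elt (odom (cell_tensor (runit_cell M) (cell_id N))) x" for x z
  proof -
    have z': "z \<in> elt (tensor (tensor M ?H) N) x" using z by simp
    show ?thesis
      by (rule assoc_cases(1)[OF _ _ _ _ _ z'])
        (use z' assoc_om[of M ?H N] cell_tensor_om[of "cell_id M" "lunit_cell N"] cell_tensor_om[of "runit_cell M" "cell_id N"]
          runit_om[OF M] lunit_om[OF N] in \<open>simp_all add: tens_balance\<close>)
  qed
qed (use assms in simp_all)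

lemma model_pentagon:
  assumes M: "mx M" and N: "mx N" and P: "mx P" and Q: "mx Q"
    and MN: "tg M = sr N" and NP: "tg N = sr P" and PQ: "tg P = sr Q"
  shows "cell_comp (cell_comp (cell_tensor (assoc_cell M N P) (cell_id Q)) (assoc_cell M (tensor N P) Q))
      (cell_tensor (cell_id M) (assoc_cell N P Q)) =
    cell_comp (assoc_cell (tensor M N) P Q) (assoc_cell M N (tensor P Q))"
proof (rule mu_eqI)
  note [simp] = M N P Q MN NP PQ
  show "om (cell_comp (cell_comp (cell_tensor (assoc_cell M N P) (cell_id Q)) (assoc_cell M (tensor N P) Q))
      (cell_tensor (cell_id M) (assoc_cell N P Q))) x z =
    om (cell_comp (assoc_cell (tensor M N) P Q) (assoc_cell M N (tensor P Q))) x z"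
    if z: "z \<in> elt (odom (cell_comp (assoc_cell (tensor M N) P Q) (assoc_cell M N (tensor P Q)))) x" for x z
  proof -
    have z': "z \<in> elt (tensor (tensor (tensor M N) P) Q) x" using z by simp
    obtain t p q where t: "z = tens (tensor (tensor M N) P) Q x (tens (tensor M N) P x t p) q"
      "t \<in> elt (tensor M N) x" "p \<in> elt P x" "q \<in> elt Q x"
      "rgt (tensor M N) x t = lft P x p" "rgt P x p = lft Q x q"
      by (rule assoc_cases(1)[OF _ P Q _ PQ z']) auto
    obtain m n where "t = tens M N x m n" "m \<in> elt M x" "n \<in> elt N x"
        "rgt M x m = lft N x n"
      using tensor_cases[OF M N MN t(2)] .
    then show ?thesis
      using z' t cell_tensor_om[of "assoc_cell M N P" "cell_id Q"] cell_tensor_om[of "cell_id M" "assoc_cell N P Q"]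
        assoc_om[of "tensor M N" P Q] assoc_om[of M N "tensor P Q"] assoc_om[of M "tensor N P" Q]
      by simp
  qed
qed (use assms in simp_all)

text \<open>The goals are numbered in the order of the axioms of the locale
  \<open>double_category\<close>. Those not singled out are conditions on boundaries.\<close>

lemma double_category_model_dbl: "double_category model_dbl"
proof (rule double_category.intro, goal_cases)
  case 1
  show ?case by (auto simp: category_def trans_comp_assoc)
next
  case 2
  show ?case unfolding category_def
    by (auto simp: trans_comp_assoc intro!: mu_eqI)
next
  case (15 m n)
  then show ?case by (simp add: cell_tensor_id)
next
  case (16 c d c' d')
  then show ?case by (simp add: cell_interchange)
next
  case (17 M N P)
  then have *: "mx M" "mx N" "mx P" "tg M = sr N" "tg N = sr P" by simp_all
  note [simp] = *
  have "globular model_dbl (assoc_cell M N P) (tensor (tensor M N) P) (tensor M (tensor N P)) \<and>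
      (\<exists>d. cell_inverse model_dbl (assoc_cell M N P) d)"
  proof (rule cell_inverseI[of _ "assoc_inv M N P" _ _ "sr M" "tg P"])
    show "om (assoc_inv M N P) x (om (assoc_cell M N P) x z) = z" if "z \<in> elt (tensor (tensor M N) P) x" for x z
      by (rule assoc_cases(1)[OF * that]) simp
    show "om (assoc_cell M N P) x (om (assoc_inv M N P) x z) = z" if "z \<in> elt (tensor M (tensor N P)) x" for x z
      by (rule assoc_cases(2)[OF * that]) simp
  qed simp_all
  then show ?case by simp
next
  case (18 M)
  then have *: "mx M" by simp
  note [simp] = *
  have "globular model_dbl (lunit_cell M) (tensor (hom_module (sr M)) M) M \<and>
      (\<exists>d. cell_inverse model_dbl (lunit_cell M) d)"
  proof (rule cell_inverseI[of _ "lunit_inv M" _ _ "sr M" "tg M"])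
    show "om (lunit_inv M) x (om (lunit_cell M) x z) = z" if "z \<in> elt (tensor (hom_module (sr M)) M) x" for x z
      by (rule hom_tens_cases(1)[OF * that]) (simp add: hom_tens_unit)
  qed simp_all
  then show ?case by simp
next
  case (19 M)
  then have *: "mx M" by simp
  note [simp] = *
  have "globular model_dbl (runit_cell M) (tensor M (hom_module (tg M))) M \<and>
      (\<exists>d. cell_inverse model_dbl (runit_cell M) d)"
  proof (rule cell_inverseI[of _ "runit_inv M" _ _ "sr M" "tg M"])
    show "om (runit_inv M) x (om (runit_cell M) x z) = z" if "z \<in> elt (tensor M (hom_module (tg M))) x" for x z
      by (rule hom_tens_cases(2)[OF * that]) (simp add: hom_tens_unit)
  qed simp_all
  then show ?case by simp
next
  case (20 c d e)
  then show ?case by (simp add: assoc_natural)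
next
  case (21 c)
  then show ?case by (simp add: unit_natural)
next
  case (22 c)
  then show ?case by (simp add: unit_natural)
next
  case (23 M N P Q)
  then show ?case by (simp add: model_pentagon)
next
  case (24 M N)
  then show ?case using model_triangle[of M N] by simp
next
  case (12 f g)
  then show ?case by (auto intro!: mu_eqI)
next
  case (11 F)
  then show ?case by (auto intro!: mu_eqI)
qed (simp_all add: in_cell_def)

end

section \<open>When two substitutions are equal\<close>

context span_universe
begin

lemma meval_Nil_iff: "meval [] p ess vs q \<longleftrightarrow> ess = [] \<and> vs = [] \<and> p = q"
  by (cases ess; cases vs) auto

lemma meval_Cons_iff: "meval ((ms, c) # cs) p ess vs q \<longleftrightarrow>
    (\<exists>es r ess' vs'. ess = es # ess' \<and> vs = sm_map c (enc p es) # vs' \<and> chain ms p es r \<and> meval cs r ess' vs' q)"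
  by (cases ess; cases vs) auto

lemma meval_append: "meval (cs @ ds) p ess vs q \<longleftrightarrow>
    (\<exists>ess1 ess2 vs1 vs2 r. ess = ess1 @ ess2 \<and> vs = vs1 @ vs2 \<and> meval cs p ess1 vs1 r \<and> meval ds r ess2 vs2 q)"
proof (induction cs arbitrary: p ess vs)
  case Nil
  then show ?case by (auto simp: meval_Nil_iff)
next
  case (Cons mc cs)
  obtain ms c where mc: "mc = (ms, c)" by force
  show ?case
  proof
    assume "meval ((mc # cs) @ ds) p ess vs q"
    then obtain es r ess' vs' where *: "ess = es # ess'" "vs = sm_map c (enc p es) # vs'" "chain ms p es r"
        "meval (cs @ ds) r ess' vs' q"
      by (auto simp: mc meval_Cons_iff)
    from *(4)[unfolded Cons.IH] obtain ess1 ess2 vs1 vs2 r'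
      where "ess' = ess1 @ ess2" "vs' = vs1 @ vs2" "meval cs r ess1 vs1 r'" "meval ds r' ess2 vs2 q"
      by blast
    with * show "\<exists>ess1 ess2 vs1 vs2 r. ess = ess1 @ ess2 \<and> vs = vs1 @ vs2 \<and> meval (mc # cs) p ess1 vs1 r \<and> meval ds r ess2 vs2 q"
      by (intro exI[of _ "es # ess1"] exI[of _ ess2] exI[of _ "sm_map c (enc p es) # vs1"] exI[of _ vs2] exI[of _ r'])
        (auto simp: mc)
  next
    assume "\<exists>ess1 ess2 vs1 vs2 r. ess = ess1 @ ess2 \<and> vs = vs1 @ vs2 \<and> meval (mc # cs) p ess1 vs1 r \<and> meval ds r ess2 vs2 q"
    then obtain ess1 ess2 vs1 vs2 r' where 1: "ess = ess1 @ ess2" "vs = vs1 @ vs2" "meval (mc # cs) p ess1 vs1 r'"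
      "meval ds r' ess2 vs2 q" by blast
    from 1(3) obtain es r ess' vs' where 2: "ess1 = es # ess'" "vs1 = sm_map c (enc p es) # vs'" "chain ms p es r"
        "meval cs r ess' vs' r'"
      unfolding mc meval_Cons_iff by blast
    have "meval (cs @ ds) r (ess' @ ess2) (vs' @ vs2) q"
      unfolding Cons.IH using 1(4) 2(4) by blast
    with 1 2 show "meval ((mc # cs) @ ds) p ess vs q"
      by (auto simp: mc)
  qed
qed

lemma meval_units_iff: "meval (units E ms) p ess vs q \<longleftrightarrow> ess = map (\<lambda>e. [e]) vs \<and> chain ms p vs q"
proof (induction ms arbitrary: p ess vs)
  case Nil
  then show ?case by (auto simp: units_def meval_Nil_iff chain_Nil_iff)
next
  case (Cons m ms)
  then show ?case by (auto simp: units_def meval_Cons_iff chain_Cons_iff chain_Nil_iff)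
qed

lemma mpath_units: "mpath (func_id A) (units E ms @ cs) \<longleftrightarrow> is_path E A ms \<and> mpath (func_id (path_end E A ms)) cs"
  if "small A" for A
  using that
proof (induction ms arbitrary: A)
  case Nil
  then show ?case by (auto simp: units_def)
next
  case (Cons m ms)
  have *: "cid E m \<in> span_maps small" if "m \<in> spans small"
    using in_cell_bd[OF in_cell_cid[OF that]] by simp
  have inj: "func_id A = func_id B \<longleftrightarrow> A = B" for A B :: "'u set"
    by (metis func_id_simps(1))
  show ?case
    using Cons.IH[of "rfoot m"] spans_feet[of m] * Cons.prems
    by (auto simp: units_def inj dest: is_path_start)
qed

lemma cpath_end_append: "cpath_end D f (cs @ ds) = cpath_end D (cpath_end D f cs) ds"
  by (induction cs arbitrary: f) auto

lemma cpath_end_units: "is_path E A ms ==> cpath_end E (func_id A) (map snd (units E ms)) = func_id (path_end E A ms)"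
  by (induction ms arbitrary: A) (auto simp: units_def)

lemma units_simps [simp]: "concat (map fst (units E ms)) = ms" "map sm_cod (map snd (units E ms)) = ms"
  "map (sm_cod \<circ> snd) (units E ms) = ms"
  by (induction ms) (auto simp: units_def)

text \<open>The equations in the definition of a multimodulation have substitutions on both sides.
  By \<open>msubst_elem\<close> both sides evaluate the same chain, cut in two ways, and the
  condition \<open>concat ess = concat ess'\<close> expresses just this.\<close>

lemma msubst_eq_iff:
  assumes cs: "mpath f cs" and ds: "mpath f' ds" and dom: "func_dom f = func_dom f'"
    and con: "concat (map fst cs) = concat (map fst ds)"
    and d: "in_cell E d (pcomps E (func_cod f) (map sm_cod (map snd cs))) n g h"
    and e: "in_cell E e (pcomps E (func_cod f') (map sm_cod (map snd ds))) n g' h'"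
    and l: "func_comp f g = func_comp f' g'"
    and r: "func_comp (cpath_end E f (map snd cs)) h = func_comp (cpath_end E f' (map snd ds)) h'"
  shows "msubst E f cs d = msubst E f' ds e \<longleftrightarrow>
    (\<forall>p ess vs q ess' vs'. p \<in> func_dom f \<and> meval cs p ess vs q \<and> meval ds p ess' vs' q \<and> concat ess = concat ess' -->
       sm_map d (enc (func_map f p) vs) = sm_map e (enc (func_map f' p) vs'))"
proof
  assume eq: "msubst E f cs d = msubst E f' ds e"
  show "\<forall>p ess vs q ess' vs'. p \<in> func_dom f \<and> meval cs p ess vs q \<and> meval ds p ess' vs' q \<and> concat ess = concat ess' -->
       sm_map d (enc (func_map f p) vs) = sm_map e (enc (func_map f' p) vs')"
  proof (intro allI impI, elim conjE)
    fix p ess vs q ess' vs' assume "p \<in> func_dom f" "meval cs p ess vs q" "meval ds p ess' vs' q" "concat ess = concat ess'"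
    then show "sm_map d (enc (func_map f p) vs) = sm_map e (enc (func_map f' p) vs')"
      using msubst_elem(1)[OF cs, of p ess vs q d] msubst_elem(1)[OF ds, of p ess' vs' q e] eq dom by simp
  qed
next
  assume *: "\<forall>p ess vs q ess' vs'. p \<in> func_dom f \<and> meval cs p ess vs q \<and> meval ds p ess' vs' q \<and> concat ess = concat ess' -->
       sm_map d (enc (func_map f p) vs) = sm_map e (enc (func_map f' p) vs')"
  show "msubst E f cs d = msubst E f' ds e"
  proof (rule in_cell_eqI[OF msubst_in_cell[OF cs d] msubst_in_cell[OF ds e, folded dom con l r]])
    fix z assume "z \<in> apex (pcomps E (func_dom f) (concat (map fst cs)))"
    moreover have "is_path E (func_dom f) (concat (map fst cs))" using mpath_props[OF cs] by simp
    ultimately obtain p es q where es: "p \<in> func_dom f" "chain (concat (map fst cs)) p es q" "z = enc p es"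
      using pcomps_cases by blast
    obtain ess vs where 1: "meval cs p ess vs q" "es = concat ess" using meval_split[OF es(2)] by blast
    obtain ess' vs' where 2: "meval ds p ess' vs' q" "es = concat ess'" using meval_split es(2) unfolding con by blast
    have "sm_map d (enc (func_map f p) vs) = sm_map e (enc (func_map f' p) vs')"
      using * es(1) 1 2 by blast
    then show "sm_map (msubst E f cs d) z = sm_map (msubst E f' ds e) z"
      using msubst_elem(1)[OF cs es(1) 1(1), of d] msubst_elem(1)[OF ds es(1)[unfolded dom] 2(1), of e] es 1 2 by simp
  qed
qed

end

context span_models
begin

text \<open>Composable proarrows of the theory are equal, so a path is constant. A multimodulation
  is thus determined by one cell for each object, indexed by the constant path of the right
  length.\<close>

lemma is_path_T: "is_path T x ms \<longleftrightarrow> ms = replicate (length ms) x"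
  by (induction ms arbitrary: x) auto

lemma is_path_replicate [simp]: "is_path T x (replicate k x)"
  by (simp add: is_path_T)

lemma pcomps_T [simp]: "pcomps T x (replicate k x) = x"
  by (induction k rule: induct_nat_012) auto

lemma pcomps_T' [simp]: "pcomps T x (x # replicate k x) = x"
  using pcomps_T[of x "Suc k"] by simp

lemma path_end_T [simp]: "path_end T x (replicate k x) = x"
  by (induction k) auto

abbreviation "prs Ms x \<equiv> map (\<lambda>M. mod_Pr M x) Ms"

lemma mods_Pr_replicate [simp]: "k = length Ms ==> mods_Pr Ms (replicate k x) = prs Ms x"
proof -
  assume k: "k = length Ms"
  show ?thesis unfolding k by (induction Ms) (auto simp: mods_Pr_def)
qed

lemma mod_path_append: "mpt F (Ms @ Ns) H \<longleftrightarrow> (\<exists>G. mpt F Ms G \<and> mpt G Ns H)"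
  by (induction Ms arbitrary: F) auto

lemma mod_path_end: "mpt F Ms G ==> lx F ==> lx G"
  by (induction Ms arbitrary: F) auto

lemma mod_path_is_path: "mpt F Ms G ==> lx F ==> is_path E (fOb F x) (prs Ms x) \<and> path_end E (fOb F x) (prs Ms x) = fOb G x"
  by (induction Ms arbitrary: F) auto

lemma chain_end_in:
  "mpt F Ms G ==> lx F ==> p \<in> fOb F x ==> chain (prs Ms x) p es q ==> q \<in> fOb G x"
proof (induction Ms arbitrary: F p es)
  case (Cons M Ms)
  then obtain e es' where "e \<in> elt M x" "chain (prs Ms x) (rgt M x e) es' q"
    by (auto simp: chain_Cons_iff)
  then show ?case using Cons.IH[of "tg M" "rgt M x e" es'] Cons.prems by auto
qed (auto simp: chain_Nil_iff)

definition acts where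
  "acts Ms f es = map2 (\<lambda>M. mce M (ic f)) Ms es"

lemma acts_simps [simp]: "acts [] f es = []" "acts (M # Ms) f (e # es) = mce M (ic f) e # acts Ms f es"
  by (simp_all add: acts_def)

lemma acts_chain:
  "mpt F Ms G ==> lx F ==> f \<in> Ar T ==> p \<in> fOb F (dA f) ==> chain (prs Ms (dA f)) p es q ==>
    chain (prs Ms (cA f)) (far F f p) (acts Ms f es) (far G f q)"
proof (induction Ms arbitrary: F p es)
  case (Cons M Ms)
  then obtain e es' where "es = e # es'" "e \<in> elt M (dA f)" "lft M (dA f) e = p"
      "chain (prs Ms (dA f)) (rgt M (dA f) e) es' q"
    by (auto simp: chain_Cons_iff)
  then show ?case using Cons by auto
qed (auto simp: chain_Nil_iff)

lemma acts_append: "length es = length Ms ==> acts (Ms @ Ns) f (es @ ds) = acts Ms f es @ acts Ns f ds"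
  by (simp add: acts_def)

section \<open>Multimodulations on elements\<close>

text \<open>A single move of inner equivariance, at any adjacent pair in a list of modules. As a
  relation on chains it turns that axiom into invariance, which extends to sequences of
  moves.\<close>

inductive istep where
  istep_here: "e \<in> elt M x ==> b \<in> fel (tg M) x ==> e' \<in> elt M' x ==>
     rgt M x e = flt (tg M) x b ==> frt (tg M) x b = lft M' x e' ==>
     istep x (M # M' # Ms) (ra M x e b # e' # es) (e # la M' x b e' # es)"
| istep_there: "istep x Ms es es' ==> istep x (M # Ms) (e # es) (e # es')"

lemma istep_chain: "istep x Ms es es' ==> mpt F Ms G ==> chain (prs Ms x) p es q ==> chain (prs Ms x) p es' q"
  by (induction x Ms es es' arbitrary: p F rule: istep.induct) auto

lemma istep_append: "istep x Ms es es' ==> length ds = length Ns ==> istep x (Ns @ Ms) (ds @ es) (ds @ es')"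
proof (induction Ns arbitrary: ds)
  case (Cons N Ns)
  then show ?case by (cases ds) (auto intro: istep_there)
qed auto

lemma istep_cases_append: "istep x Ms es es' ==> \<exists>Ms1 M M' Ms2 es1 e b e' es2. Ms = Ms1 @ M # M' # Ms2 \<and>
    length es1 = length Ms1 \<and> es = es1 @ ra M x e b # e' # es2 \<and> es' = es1 @ e # la M' x b e' # es2 \<and>
    e \<in> elt M x \<and> b \<in> fel (tg M) x \<and> e' \<in> elt M' x \<and>
     rgt M x e = flt (tg M) x b \<and> frt (tg M) x b = lft M' x e'"
proof (induction x Ms es es' rule: istep.induct)
  case (istep_here e M x b e' M' Ms es)
  then show ?case
    by (intro exI[of _ "[]"] exI[of _ M] exI[of _ M'] exI[of _ Ms] exI[of _ e] exI[of _ b] exI[of _ e'] exI[of _ es]) auto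
next
  case (istep_there x Ms es es' M e)
  then obtain Ms1 K M' Ms2 es1 k b e' es2 where *: "Ms = Ms1 @ K # M' # Ms2"
    "length es1 = length Ms1" "es = es1 @ ra K x k b # e' # es2" "es' = es1 @ k # la M' x b e' # es2"
    "k \<in> elt K x" "b \<in> fel (tg K) x" "e' \<in> elt M' x"
    "rgt K x k = flt (tg K) x b" "frt (tg K) x b = lft M' x e'"
    by blast
  show ?case
    by (rule exI[of _ "M # Ms1"], rule exI[of _ K], rule exI[of _ M'], rule exI[of _ Ms2], rule exI[of _ "e # es1"],
        rule exI[of _ k], rule exI[of _ b], rule exI[of _ e'], rule exI[of _ es2]) (simp add: *)
qed

abbreviation "mU mu x p es \<equiv> sm_map (mcell mu x (replicate (length (mdom mu)) x)) (enc p es)"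

definition mm_typed where
  "mm_typed mu \<longleftrightarrow> mpt (tdom (mleft mu)) (mdom mu) (tdom (mright mu)) \<and> mx (mcod mu) \<and> tx (mleft mu) \<and> tx (mright mu) \<and>
     tcod (mleft mu) = sr (mcod mu) \<and> tcod (mright mu) = tg (mcod mu) \<and>
     (\<forall>x ms. if is_path T x ms \<and> length ms = length (mdom mu)
        then in_cell E (mcell mu x ms) (pcomps E (fOb (tdom (mleft mu)) x) (mods_Pr (mdom mu) ms))
          (mod_Pr (mcod mu) (pcomps T x ms)) (tOb (mleft mu) x) (tOb (mright mu) (path_end T x ms))
        else mcell mu x ms = undefined)"

text \<open>Stated for an arbitrary family \<open>U\<close> of functions on chains rather than for
  the components of a multimodulation, so that new multimodulations can be obtained from functions
  on lists. As in \<open>modn_laws\<close>, naturality is required along arrows only, acting on all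
  entries by the identity cell.\<close>

definition mm_laws where
  "mm_laws Ms N al be U \<longleftrightarrow>
     (\<forall>x M Ms' a e es q. Ms = M # Ms' \<and> a \<in> fel (tdom al) x \<and>
        chain (prs Ms x) (frt (tdom al) x a) (e # es) q -->
        U x (flt (tdom al) x a) (la M x a e # es) =
          la N x (tpr al x a) (U x (frt (tdom al) x a) (e # es))) \<and>
     (\<forall>x M Ms' p es e b. Ms = Ms' @ [M] \<and> p \<in> fOb (tdom al) x \<and> b \<in> fel (tdom be) x \<and>
        chain (prs Ms x) p (es @ [e]) (flt (tdom be) x b) -->
        U x p (es @ [ra M x e b]) = ra N x (U x p (es @ [e])) (tpr be x b)) \<and>
     (\<forall>x es es' p q. istep x Ms es es' \<and> p \<in> fOb (tdom al) x \<and> chain (prs Ms x) p es q --> U x p es = U x p es') \<and>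
     (\<forall>x a. Ms = [] \<and> a \<in> fel (tdom al) x -->
        ra N x (U x (flt (tdom al) x a) []) (tpr be x a) =
        la N x (tpr al x a) (U x (frt (tdom al) x a) [])) \<and>
     (\<forall>f\<in>Ar T. \<forall>p\<in>fOb (tdom al) (dA f). \<forall>es q. chain (prs Ms (dA f)) p es q -->
        la N (cA f) (tar al f p) (U (cA f) (far (tdom al) f p) (acts Ms f es)) =
        ra N (cA f) (mce N (ic f) (U (dA f) p es)) (tar be f q))"

context
  fixes mu :: "('o, 'a, 'c, 'u) s_mmodn" and Ms N al be F G
  assumes typed: "mm_typed mu" and fields: "mdom mu = Ms" "mcod mu = N" "mleft mu = al" "mright mu = be"
    "tdom al = F" "tdom be = G"
begin

lemma mm_facts: "mpt F Ms G" "mx N" "tx al" "tx be" "tcod al = sr N" "tcod be = tg N" "lx F" "lx G"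
proof -
  show "mpt F Ms G" "mx N" "tx al" "tx be" "tcod al = sr N" "tcod be = tg N"
    using typed fields by (simp_all add: mm_typed_def)
  then show "lx F" "lx G" using tx_simps(1)[of al] tx_simps(1)[of be] fields by auto
qed

lemma mm_cell: "in_cell E (mcell mu x (replicate (length Ms) x)) (pcomps E (fOb F x) (prs Ms x)) (mod_Pr N x)
    (tOb al x) (tOb be x)"
  using typed fields unfolding mm_typed_def
  by (elim conjE) (drule spec[of _ x], drule spec[of _ "replicate (length Ms) x"], simp)

lemma mm_map:
  assumes "p \<in> fOb F x" "chain (prs Ms x) p es q"
  shows "mU mu x p es \<in> elt N x" "lft N x (mU mu x p es) = tob al x p"
    "rgt N x (mU mu x p es) = tob be x q"
  using in_cell_map[OF mm_cell, of "enc p es" x] enc_in_pcomps[OF conjunct1[OF mod_path_is_path[OF mm_facts(1,7)]] assms] fields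
  by simp_all

end

end

lemma chain_splitE:
  assumes "chain (ms @ ns) p (es @ ds) r" "length es = length ms"
  obtains q where "chain ms p es q" "chain ns q ds r"
  using chain_split[OF assms(1)] assms(2) chain_length by (metis append_eq_append_conv)

lemma chain_single_iff: "chain [m] p es q \<longleftrightarrow> (\<exists>e. es = [e] \<and> e \<in> apex m \<and> lleg m e = p \<and> rleg m e = q)"
  unfolding chain_Cons_iff chain_Nil_iff by blast

lemma chain_pair_iff: "chain [m, n] p es q \<longleftrightarrow> (\<exists>a b. es = [a, b] \<and> a \<in> apex m \<and> b \<in> apex n \<and>
    lleg m a = p \<and> rleg m a = lleg n b \<and> rleg n b = q)"
  unfolding chain_Cons_iff chain_Nil_iff by auto

lemma (in span_universe) meval_pair_iff: "meval [(ms, c), (ns, d)] p ess vs q \<longleftrightarrow>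
    (\<exists>es ds r. ess = [es, ds] \<and> vs = [sm_map c (enc p es), sm_map d (enc r ds)] \<and> chain ms p es r \<and> chain ns r ds q)"
  unfolding meval_Cons_iff meval_Nil_iff by blast

context span_models
begin

context
  fixes mu :: "('o, 'a, 'c, 'u) s_mmodn" and Ms N al be F G
  assumes typed: "mm_typed mu" and fields: "mdom mu = Ms" "mcod mu = N" "mleft mu = al" "mright mu = be"
    "tdom al = F" "tdom be = G"
begin

abbreviation (input) "uc x \<equiv> mcell mu x (replicate (length Ms) x)"

lemmas facts = mm_facts[OF typed fields]

lemma uc_bd [simp]: "sm_dom (uc x) = pcomps E (fOb F x) (prs Ms x)" "sm_cod (uc x) = mod_Pr N x"
  "sm_left (uc x) = tOb al x" "sm_right (uc x) = tOb be x" "uc x \<in> span_maps small"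
  using in_cell_bd[OF mm_cell[OF typed fields]] by simp_all

lemma cells_in_span_maps [simp]:
  "tx ga ==> tPr ga x \<in> span_maps small" "tx ga ==> f \<in> Ar T ==> tAr ga f \<in> span_maps small"
  "mx M ==> act_l M x x \<in> span_maps small" "mx M ==> act_r M x x \<in> span_maps small"
  "m \<in> spans small ==> cid E m \<in> span_maps small"
  using in_cell_bd[OF tt_pr_cell[OF trans_typed refl refl]] in_cell_bd[OF tt_ar_cell[OF trans_typed refl refl]]
    in_cell_bd[OF md_act(1)[OF _ refl refl]] in_cell_bd[OF md_act(2)[OF _ refl refl]]
    in_cell_bd[OF in_cell_cid] by blast+

lemma Ms_path [simp]: "is_path E (fOb F x) (prs Ms x)" "path_end E (fOb F x) (prs Ms x) = fOb G x"
  using mod_path_is_path[OF facts(1,7)] by auto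

lemma ab_id: "func_comp (tOb al x) (idO (sr N) x) = tOb al x" "func_comp (idO F x) (tOb al x) = tOb al x"
  "func_comp (tOb be x) (idO (tg N) x) = tOb be x" "func_comp (idO G x) (tOb be x) = tOb be x"
  using facts fields by (simp_all add: func_comp_id_left[of _ small] func_comp_id_right[of _ small])

text \<open>The chain starts with \<open>a\<close> and \<open>e\<close>. One side cuts off
  \<open>a\<close> alone and feeds it to the transformation; the other cuts off both and feeds them
  to the left action. The following equivalences arise in the same way from other pairs of
  cuttings.\<close>

lemma mm_left_iff:
  assumes Ms: "Ms = M # Ms'"
  shows "msubst E (tOb al x) [([fPr F x], tPr al x), (prs Ms x, uc x)] (act_l N x x) =
      msubst E (idO F x) (([fPr F x, mod_Pr M x], act_l M x x) # units E (prs Ms' x)) (uc x) \<longleftrightarrow>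
    (\<forall>a e es q. a \<in> fel F x \<and> chain (prs Ms x) (frt F x a) (e # es) q -->
        mU mu x (flt F x a) (la M x a e # es) = la N x (tpr al x a) (mU mu x (frt F x a) (e # es)))"
proof -
  note [simp] = facts fields
  have M: "mx M" "sr M = F" "mpt (tg M) Ms' G" using facts(1) Ms by auto
  note [simp] = M
  have path': "is_path E (fOb (tg M) x) (prs Ms' x)" "path_end E (fOb (tg M) x) (prs Ms' x) = fOb G x"
    using mod_path_is_path[OF M(3)] by auto
  have cs: "mpath (tOb al x) [([fPr F x], tPr al x), (prs Ms x, uc x)]" by simp
  have ds: "mpath (idO F x) (([fPr F x, mod_Pr M x], act_l M x x) # units E (prs Ms' x))"
    using mpath_units[of "fOb (tg M) x" "prs Ms' x" "[]"] path' by (simp add: func_id_funcs)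
  have d: "in_cell E (act_l N x x) (pcomps E (func_cod (tOb al x)) (map sm_cod (map snd [([fPr F x], tPr al x), (prs Ms x, uc x)])))
      (mod_Pr N x) (idO (sr N) x) (idO (tg N) x)"
    using md_act(1)[OF facts(2) refl refl, of x] by simp
  have e: "in_cell E (uc x) (pcomps E (func_cod (idO F x)) (map sm_cod (map snd (([fPr F x, mod_Pr M x], act_l M x x) # units E (prs Ms' x)))))
      (mod_Pr N x) (tOb al x) (tOb be x)"
    using mm_cell[OF typed fields, of x] by (simp add: Ms)
  have ce: "cpath_end E (idO F x) (map snd (([fPr F x, mod_Pr M x], act_l M x x) # units E (prs Ms' x))) = idO G x"
    using cpath_end_units[OF path'(1)] path'(2) by simp
  have dom: "func_dom (tOb al x) = func_dom (idO F x)" by simp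
  have con: "concat (map fst [([fPr F x], tPr al x), (prs Ms x, uc x)]) =
      concat (map fst (([fPr F x, mod_Pr M x], act_l M x x) # units E (prs Ms' x)))"
    by (simp add: Ms)
  have l: "func_comp (tOb al x) (idO (sr N) x) = func_comp (idO F x) (tOb al x)"
    by (simp add: ab_id)
  have r: "func_comp (cpath_end E (tOb al x) (map snd [([fPr F x], tPr al x), (prs Ms x, uc x)])) (idO (tg N) x) =
      func_comp (cpath_end E (idO F x) (map snd (([fPr F x, mod_Pr M x], act_l M x x) # units E (prs Ms' x)))) (tOb be x)"
    unfolding ce by (simp add: ab_id)
  show ?thesis
    unfolding msubst_eq_iff[OF cs ds dom con d e l r]
  proof ((intro iffI allI impI; elim conjE), goal_cases)
    case L: (1 a e es q)
    then have "meval [([fPr F x], tPr al x), (prs Ms x, uc x)] (flt F x a) [[a], e # es]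
        [tpr al x a, sm_map (uc x) (enc (frt F x a) (e # es))] q"
      by simp
    note 1 = this
    have 2: "meval (([fPr F x, mod_Pr M x], act_l M x x) # units E (prs Ms' x)) (flt F x a)
        ([a, e] # map (\<lambda>e. [e]) es) (la M x a e # es) q"
      using L(2,3) by (simp add: Ms meval_units_iff)
    show ?case
      using L(1)[rule_format, OF conjI[OF _ conjI[OF 1 conjI[OF 2]]]] L(2,3) by simp
  next
    case R: (2 p ess vs q ess' vs')
    from R(3) obtain a es where 1: "ess = [[a], es]" "vs = [tpr al x a, sm_map (uc x) (enc (frt F x a) es)]"
        "a \<in> fel F x" "flt F x a = p" "chain (prs Ms x) (frt F x a) es q"
      unfolding meval_pair_iff chain_single_iff by fastforce
    from R(4) obtain a' e' es' where 2: "ess' = [a', e'] # map (\<lambda>e. [e]) es'" "vs' = la M x a' e' # es'"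
      unfolding meval_Cons_iff meval_units_iff chain_pair_iff by fastforce
    have eq: "a' = a" "es = e' # es'" using R(5) 1 2 by simp_all
    have c: "chain (prs Ms x) (frt F x a) (e' # es') q" using 1(5) eq by simp
    show ?case
      using R(1)[rule_format, OF conjI[OF 1(3) c]] R(2) unfolding 1(2) 2(2) eq 1(4)[symmetric] by simp
  qed
qed

lemma mm_right_iff:
  assumes Ms: "Ms = Ms' @ [M]"
  shows "msubst E (tOb al x) [(prs Ms x, uc x), ([fPr G x], tPr be x)] (act_r N x x) =
      msubst E (idO F x) (units E (prs Ms' x) @ [([mod_Pr M x, fPr G x], act_r M x x)]) (uc x) \<longleftrightarrow>
    (\<forall>p es e b. p \<in> fOb F x \<and> b \<in> fel G x \<and> chain (prs Ms x) p (es @ [e]) (flt G x b) -->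
        mU mu x p (es @ [ra M x e b]) = ra N x (mU mu x p (es @ [e])) (tpr be x b))"
proof -
  note [simp] = facts fields
  have M: "mx M" "tg M = G" "mpt F Ms' (sr M)" using facts(1) Ms by (auto simp: mod_path_append)
  note [simp] = M
  have path': "is_path E (fOb F x) (prs Ms' x)" "path_end E (fOb F x) (prs Ms' x) = fOb (sr M) x"
    using mod_path_is_path[OF M(3) facts(7)] by auto
  have cs: "mpath (tOb al x) [(prs Ms x, uc x), ([fPr G x], tPr be x)]" by simp
  have ds: "mpath (idO F x) (units E (prs Ms' x) @ [([mod_Pr M x, fPr G x], act_r M x x)])"
    unfolding mpath_units[OF lx_ob[OF facts(7)]] path' using path'(1) by (simp add: func_id_funcs)
  have d: "in_cell E (act_r N x x) (pcomps E (func_cod (tOb al x)) (map sm_cod (map snd [(prs Ms x, uc x), ([fPr G x], tPr be x)])))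
      (mod_Pr N x) (idO (sr N) x) (idO (tg N) x)"
    using md_act(2)[OF facts(2) refl refl, of x] by simp
  have e: "in_cell E (uc x) (pcomps E (func_cod (idO F x)) (map sm_cod (map snd (units E (prs Ms' x) @ [([mod_Pr M x, fPr G x], act_r M x x)]))))
      (mod_Pr N x) (tOb al x) (tOb be x)"
    using mm_cell[OF typed fields, of x] by (simp add: Ms)
  have dom: "func_dom (tOb al x) = func_dom (idO F x)" by simp
  have con: "concat (map fst [(prs Ms x, uc x), ([fPr G x], tPr be x)]) =
      concat (map fst (units E (prs Ms' x) @ [([mod_Pr M x, fPr G x], act_r M x x)]))"
    by (simp add: Ms)
  have l: "func_comp (tOb al x) (idO (sr N) x) = func_comp (idO F x) (tOb al x)"
    by (simp add: ab_id)
  have r: "func_comp (cpath_end E (tOb al x) (map snd [(prs Ms x, uc x), ([fPr G x], tPr be x)])) (idO (tg N) x) =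
      func_comp (cpath_end E (idO F x) (map snd (units E (prs Ms' x) @ [([mod_Pr M x, fPr G x], act_r M x x)]))) (tOb be x)"
    by (simp add: cpath_end_append ab_id)
  show ?thesis
    unfolding msubst_eq_iff[OF cs ds dom con d e l r]
  proof ((intro iffI allI impI; elim conjE), goal_cases)
    case L: (1 p es e b)
    have "length es = length (prs Ms' x)" using chain_length[OF L(4)] by (simp add: Ms)
    then obtain r where r: "chain (prs Ms' x) p es r" "chain (prs [M] x) r [e] (flt G x b)"
      using L(4) by (auto simp: Ms elim!: chain_splitE[of _ "prs [M] x", simplified])
    have 1: "meval [(prs Ms x, uc x), ([fPr G x], tPr be x)] p [es @ [e], [b]]
        [sm_map (uc x) (enc p (es @ [e])), tpr be x b] (frt G x b)"
      using L by simp
    have 2: "meval (units E (prs Ms' x) @ [([mod_Pr M x, fPr G x], act_r M x x)]) p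
        (map (\<lambda>e. [e]) es @ [[e, b]]) (es @ [ra M x e b]) (frt G x b)"
      unfolding meval_units[OF r(1)] using r(2) L(3) by simp
    show ?case
      using L(1)[rule_format, OF conjI[OF _ conjI[OF 1 conjI[OF 2]]]] L(2-) by simp
  next
    case R: (2 p ess vs q ess' vs')
    from R(3) obtain es b where 1: "ess = [es, [b]]" "vs = [sm_map (uc x) (enc p es), tpr be x b]"
        "b \<in> fel G x" "chain (prs Ms x) p es (flt G x b)" "q = frt G x b"
      unfolding meval_pair_iff chain_single_iff by fastforce
    from R(4) obtain es' e' b' where 2: "ess' = map (\<lambda>e. [e]) es' @ [[e', b']]" "vs' = es' @ [ra M x e' b']"
      unfolding meval_append meval_Cons_iff meval_Nil_iff meval_units_iff chain_pair_iff by fastforce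
    have eq: "b' = b" "es = es' @ [e']" using R(5) 1 2 by simp_all
    have c: "chain (prs Ms x) p (es' @ [e']) (flt G x b)" using 1(4) eq by simp
    have p: "p \<in> fOb F x" using R(2) by simp
    show ?case
      using R(1)[rule_format, OF conjI[OF p conjI[OF 1(3) c]]] p unfolding 1(2) 2(2) eq by simp
  qed
qed

lemma mm_zero_iff:
  assumes Ms: "Ms = []"
  shows "msubst E (tOb al x) [([], mcell mu x []), ([fPr G x], tPr be x)] (act_r N x x) =
      msubst E (tOb al x) [([fPr F x], tPr al x), ([], mcell mu x [])] (act_l N x x) \<longleftrightarrow>
    (\<forall>a. a \<in> fel F x --> ra N x (mU mu x (flt F x a) []) (tpr be x a) =
        la N x (tpr al x a) (mU mu x (frt F x a) []))"
proof -
  note [simp] = facts fields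
  have FG: "G = F" using facts(1) Ms by simp
  have u: "mcell mu x [] = uc x" by (simp add: Ms)
  have ub [simp]: "sm_dom (mcell mu x []) = spO F x" "sm_cod (mcell mu x []) = mod_Pr N x"
    "sm_left (mcell mu x []) = tOb al x" "sm_right (mcell mu x []) = tOb be x" "mcell mu x [] \<in> span_maps small"
    unfolding u uc_bd using uc_bd(5)[of x] by (simp_all add: Ms)
  have cs: "mpath (tOb al x) [([], mcell mu x []), ([fPr G x], tPr be x)]" using FG by simp
  have ds: "mpath (tOb al x) [([fPr F x], tPr al x), ([], mcell mu x [])]" by simp
  have d: "in_cell E (act_r N x x) (pcomps E (func_cod (tOb al x)) (map sm_cod (map snd [([], mcell mu x []), ([fPr G x], tPr be x)])))
      (mod_Pr N x) (idO (sr N) x) (idO (tg N) x)"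
    using md_act(2)[OF facts(2) refl refl, of x] by simp
  have e: "in_cell E (act_l N x x) (pcomps E (func_cod (tOb al x)) (map sm_cod (map snd [([fPr F x], tPr al x), ([], mcell mu x [])])))
      (mod_Pr N x) (idO (sr N) x) (idO (tg N) x)"
    using md_act(1)[OF facts(2) refl refl, of x] by simp
  have con: "concat (map fst [([], mcell mu x []), ([fPr G x], tPr be x)]) = concat (map fst [([fPr F x], tPr al x), ([], mcell mu x [])])"
    by (simp add: FG)
  have r: "func_comp (cpath_end E (tOb al x) (map snd [([], mcell mu x []), ([fPr G x], tPr be x)])) (idO (tg N) x) =
      func_comp (cpath_end E (tOb al x) (map snd [([fPr F x], tPr al x), ([], mcell mu x [])])) (idO (tg N) x)"
    by simp
  show ?thesis
    unfolding msubst_eq_iff[OF cs ds refl con d e refl r]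
  proof ((intro iffI allI impI; (elim conjE)?), goal_cases)
    case L: (1 a)
    have 1: "meval [([], mcell mu x []), ([fPr G x], tPr be x)] (flt F x a) [[], [a]]
        [sm_map (mcell mu x []) (flt F x a), tpr be x a] (frt F x a)"
      and 2: "meval [([fPr F x], tPr al x), ([], mcell mu x [])] (flt F x a) [[a], []]
        [tpr al x a, sm_map (mcell mu x []) (frt F x a)] (frt F x a)"
      using L(2) by (simp_all add: FG)
    show ?case
      using L(1)[rule_format, OF conjI[OF _ conjI[OF 1 conjI[OF 2]]]] L(2) by (simp add: Ms)
  next
    case R: (2 p ess vs q ess' vs')
    from R(3) obtain a where 1: "ess = [[], [a]]" "vs = [sm_map (mcell mu x []) p, tpr be x a]"
        "a \<in> fel F x" "p = flt F x a"
      unfolding meval_pair_iff chain_single_iff chain_Nil_iff FG by fastforce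
    from R(4) obtain a' where 2: "ess' = [[a'], []]" "vs' = [tpr al x a', sm_map (mcell mu x []) (frt F x a')]"
      unfolding meval_pair_iff chain_single_iff chain_Nil_iff by fastforce
    have eq: "a' = a" using R(5) 1 2 by simp
    show ?case
      using R(1)[rule_format, OF 1(3)] R(2) unfolding 1(2,4) 2(2) eq by (simp add: Ms)
  qed
qed

lemma mm_inner_iff:
  assumes Ms: "Ms = Ms1 @ [M, M'] @ Ms2"
  shows "msubst E (idO F x) (units E (prs Ms1 x) @
           [([mod_Pr M x, fPr (tg M) x], act_r M x x), ([mod_Pr M' x], cid E (mod_Pr M' x))] @ units E (prs Ms2 x)) (uc x) =
      msubst E (idO F x) (units E (prs Ms1 x) @
           [([mod_Pr M x], cid E (mod_Pr M x)), ([fPr (sr M') x, mod_Pr M' x], act_l M' x x)] @ units E (prs Ms2 x)) (uc x) \<longleftrightarrow>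
    (\<forall>p es1 e b e' es2 q. p \<in> fOb F x \<and> length es1 = length Ms1 \<and> b \<in> fel (tg M) x \<and>
       e \<in> elt M x \<and> e' \<in> elt M' x \<and>
       rgt M x e = flt (tg M) x b \<and> frt (tg M) x b = lft M' x e' \<and>
       chain (prs Ms x) p (es1 @ ra M x e b # e' # es2) q -->
       mU mu x p (es1 @ ra M x e b # e' # es2) = mU mu x p (es1 @ e # la M' x b e' # es2))"
    (is "msubst E _ ?cs _ = msubst E _ ?ds _ \<longleftrightarrow> _")
proof -
  note [simp] = facts fields
  have M: "mx M" "mx M'" "sr M' = tg M" "mpt F Ms1 (sr M)" "mpt (tg M') Ms2 G"
    using facts(1) Ms by (auto simp: mod_path_append)
  note [simp] = M
  note p1 = mod_path_is_path[OF M(4) facts(7), of x, THEN conjunct1] mod_path_is_path[OF M(4) facts(7), of x, THEN conjunct2]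
  have p2: "is_path E (fOb (tg M') x) (prs Ms2 x)" "path_end E (fOb (tg M') x) (prs Ms2 x) = fOb G x"
    using mod_path_is_path[OF M(5)] by auto
  have cs: "mpath (idO F x) ?cs"
    unfolding mpath_units[OF lx_ob[OF facts(7)]] p1 using p1(1) p2 mpath_units[of "fOb (tg M') x" "prs Ms2 x" "[]"]
    by (simp add: func_id_funcs)
  have ds: "mpath (idO F x) ?ds"
    unfolding mpath_units[OF lx_ob[OF facts(7)]] p1 using p1(1) p2 mpath_units[of "fOb (tg M') x" "prs Ms2 x" "[]"]
    by (simp add: func_id_funcs)
  have d: "in_cell E (uc x) (pcomps E (func_cod (idO F x)) (map sm_cod (map snd ?cs))) (mod_Pr N x) (tOb al x) (tOb be x)"
    "in_cell E (uc x) (pcomps E (func_cod (idO F x)) (map sm_cod (map snd ?ds))) (mod_Pr N x) (tOb al x) (tOb be x)"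
    using mm_cell[OF typed fields, of x] by (simp_all add: Ms)
  have con: "concat (map fst ?cs) = concat (map fst ?ds)" by simp
  have r: "func_comp (cpath_end E (idO F x) (map snd ?cs)) (tOb be x) = func_comp (cpath_end E (idO F x) (map snd ?ds)) (tOb be x)"
    by (simp add: cpath_end_append)
  show ?thesis
    unfolding msubst_eq_iff[OF cs ds refl con d refl r]
  proof ((intro iffI allI impI; elim conjE), goal_cases)
    case L: (1 p es1 e b e' es2 q)
    have "chain (prs Ms1 x @ prs (M # M' # Ms2) x) p (es1 @ ra M x e b # e' # es2) q" "length es1 = length (prs Ms1 x)"
      using L(3,9) by (simp_all add: Ms)
    then obtain r where r: "chain (prs Ms1 x) p es1 r" "chain (prs (M # M' # Ms2) x) r (ra M x e b # e' # es2) q"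
      by (rule chain_splitE)
    have 1: "meval ?cs p (map (\<lambda>e. [e]) es1 @ [[e, b], [e']] @ map (\<lambda>e. [e]) es2) (es1 @ ra M x e b # e' # es2) q"
      unfolding meval_units[OF r(1)] using r(2) L(4-8) by (simp add: meval_units_iff)
    have 2: "meval ?ds p (map (\<lambda>e. [e]) es1 @ [[e], [b, e']] @ map (\<lambda>e. [e]) es2) (es1 @ e # la M' x b e' # es2) q"
      unfolding meval_units[OF r(1)] using r(2) L(4-8) by (simp add: meval_units_iff)
    show ?case
      using L(1)[rule_format, OF conjI[OF _ conjI[OF 1 conjI[OF 2]]]] L(2) by simp
  next
    case R: (2 p ess vs q ess' vs')
    from R(3) obtain es1 ess1 r t1 t2 r1 ess2 es2 where 0: "ess = map (\<lambda>e. [e]) es1 @ t1 # t2 # ess2"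
        "vs = es1 @ sm_map (act_r M x x) (enc r t1) # sm_map (cid E (mod_Pr M' x)) (enc r1 t2) # es2"
        "chain (prs Ms1 x) p es1 r" "chain [mod_Pr M x, fPr (tg M) x] r t1 r1"
        "\<exists>r2. chain [mod_Pr M' x] r1 t2 r2 \<and> ess2 = map (\<lambda>e. [e]) es2 \<and> chain (prs Ms2 x) r2 es2 q"
      unfolding append_Cons append_Nil meval_append meval_Cons_iff meval_units_iff by blast
    from 0(4) obtain e b where t1: "t1 = [e, b]" "lft M x e = r" "e \<in> elt M x"
        "b \<in> fel (tg M) x" "rgt M x e = flt (tg M) x b" "frt (tg M) x b = r1"
      unfolding chain_pair_iff by blast
    from 0(5) obtain e' where t2: "t2 = [e']" "lft M' x e' = r1" "e' \<in> elt M' x"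
        "ess2 = map (\<lambda>e. [e]) es2" "chain (prs Ms2 x) (rgt M' x e') es2 q"
      unfolding chain_single_iff by blast
    have t3: "frt (tg M) x b = lft M' x e'" using t1(6) t2(2) by simp
    note t = t1(1,3-5) t2(1,3-5) t3
    have 1: "ess = map (\<lambda>e. [e]) es1 @ [[e, b], [e']] @ map (\<lambda>e. [e]) es2"
        "vs = es1 @ ra M x e b # e' # es2"
      using 0(1,2) t by simp_all
    from R(4) obtain es1' r' t1' t2' r1' ess2' es2' where z': "ess' = map (\<lambda>e. [e]) es1' @ t1' # t2' # ess2'"
        "vs' = es1' @ sm_map (cid E (mod_Pr M x)) (enc r' t1') # sm_map (act_l M' x x) (enc r1' t2') # es2'"
        "chain (prs Ms1 x) p es1' r'" "chain [mod_Pr M x] r' t1' r1'"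
        "\<exists>r2. chain [fPr (sr M') x, mod_Pr M' x] r1' t2' r2 \<and> ess2' = map (\<lambda>e. [e]) es2' \<and> chain (prs Ms2 x) r2 es2' q"
      unfolding append_Cons append_Nil meval_append meval_Cons_iff meval_units_iff by blast
    from z'(4) obtain e1 where "t1' = [e1]" "e1 \<in> elt M x"
      unfolding chain_single_iff by blast
    moreover from z'(5) obtain b1 e1' where "t2' = [b1, e1']" "ess2' = map (\<lambda>e. [e]) es2'"
      unfolding chain_pair_iff by blast
    ultimately have t': "t1' = [e1]" "e1 \<in> elt M x" "t2' = [b1, e1']" "ess2' = map (\<lambda>e. [e]) es2'" by auto
    have 2: "ess' = map (\<lambda>e. [e]) es1' @ [[e1], [b1, e1']] @ map (\<lambda>e. [e]) es2'"
        "vs' = es1' @ e1 # la M' x b1 e1' # es2'"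
      using z'(1,2) t' by simp_all
    have len: "length es1 = length Ms1" "length es1' = length Ms1"
      using chain_length[OF 0(3)] chain_length[OF z'(3)] by simp_all
    \<comment> \<open>Both cuttings begin with as many singletons as there are modules in
      \<open>Ms1\<close>, so equality of the concatenations forces equality of all entries.\<close>
    have eq: "es1' = es1" "e1 = e" "b1 = b" "e1' = e'" "es2' = es2"
      using R(5) len unfolding 1(1) 2(1) by auto
    have "chain (prs Ms x) p (es1 @ ra M x e b # e' # es2) q"
      using chain_append[OF 0(3), of "prs (M # M' # Ms2) x"] t t1(2) by (simp add: Ms)
    then show ?case
      using R(1)[rule_format, of p es1 b e e' es2 q] R(2) t 1 len(1)
        \<open>chain (prs Ms x) p (es1 @ ra M x e b # e' # es2) q\<close> unfolding 2(2) eq by simp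
  qed
qed

end

lemma is_path_append_T: "is_path T x (ms @ ns) \<longleftrightarrow> is_path T x ms \<and> is_path T x ns"
  by (induction ms) auto

lemma is_path_T_eq: "is_path T x ms ==> length ms = k ==> ms = replicate k x"
  using is_path_T by auto

lemma cpath_T:
  "is_cpath T f cs ==> f \<in> Ar T \<and> is_path T (dA f) (map (dC) cs) \<and> is_path T (cA f) (map (cC) cs) \<and>
     cpath_end T f cs \<in> Ar T \<and> dA (cpath_end T f cs) = dA f \<and> cA (cpath_end T f cs) = cA f"
proof (induction cs arbitrary: f)
  case (Cons c cs)
  then have "is_cpath T (tC c) cs" "c \<in> Ce T" "sC c = f" by auto
  with Cons.IH[of "tC c"] show ?case by auto
qed auto

lemma hcomps_T:
  "is_cpath T f cs ==> in_cell T (hcomps T f cs) (dA f) (cA f) f (cpath_end T f cs)"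
proof (induction cs arbitrary: f rule: induct_list012)
  case 1
  then show ?case by (simp add: in_cell_def)
next
  case (2 c)
  then show ?case by (auto simp: in_cell_def)
next
  case (3 c d ds)
  then have *: "is_cpath T (tC c) (d # ds)" "c \<in> Ce T" "sC c = f" by auto
  from "3.IH"(2)[OF *(1)] * hc[of c "hcomps T (tC c) (d # ds)"] show ?case
    by (auto simp: in_cell_def)
qed

abbreviation "actc Ms cs es \<equiv> map2 sm_map (map2 mod_Ce Ms cs) es"

lemma mod_Ce_cpath:
  "mpt F Ms G ==> lx F ==> is_cpath T f cs ==> length cs = length Ms ==>
    is_cpath E (fAr F f) (map2 mod_Ce Ms cs) \<and> cpath_end E (fAr F f) (map2 mod_Ce Ms cs) = fAr G (cpath_end T f cs) \<and>
    map sm_dom (map2 mod_Ce Ms cs) = prs Ms (dA f) \<and> map sm_cod (map2 mod_Ce Ms cs) = prs Ms (cA f)"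
proof (induction Ms arbitrary: F f cs)
  case (Cons M Ms)
  then obtain c cs' where cs: "cs = c # cs'" "length cs' = length Ms" by (cases cs) auto
  have c: "c \<in> Ce T" "sC c = f" "is_cpath T (tC c) cs'" using Cons.prems(3) cs by auto
  have M: "mx M" "sr M = F" "mpt (tg M) Ms G" using Cons.prems by auto
  have "mod_Ce M c \<in> span_maps small" using in_cell_bd[OF md_ce[OF M(1) refl refl c(1)]] by simp
  then show ?case
    using Cons.IH[OF M(3) _ c(3) cs(2)] c M cs by auto
qed auto

context
  fixes mu :: "('o, 'a, 'c, 'u) s_mmodn" and Ms N al be F G
  assumes typed: "mm_typed mu" and fields: "mdom mu = Ms" "mcod mu = N" "mleft mu = al" "mright mu = be"
    "tdom al = F" "tdom be = G"
begin

abbreviation (input) "ucell x \<equiv> mcell mu x (replicate (length Ms) x)"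

lemmas mfacts = mm_facts[OF typed fields]
lemmas ucell_bd = uc_bd[OF typed fields]

text \<open>The component of a transformation at an arrow is a multicell with empty domain. It
  receives an empty piece of the chain and is evaluated at the end point \<open>p\<close> on one
  side and at \<open>q\<close> on the other.\<close>

lemma mm_nat_iff:
  assumes cs: "is_cpath T f cs" and len: "length cs = length Ms"
  defines "x \<equiv> dA f" and "w \<equiv> cA f" and "g \<equiv> cpath_end T f cs" and "h \<equiv> hcomps T f cs"
  shows "msubst E (func_comp (tOb al x) (fAr (tcod al) f))
      [([], tAr al f), (prs Ms x, ccomp E (hcomps E (fAr F f) (map2 mod_Ce Ms cs)) (ucell w))] (act_l N w w) =
    msubst E (func_comp (tOb al x) (fAr (tcod al) f))
      [(prs Ms x, ccomp E (ucell x) (mod_Ce N h)), ([], tAr be g)] (act_r N w w) \<longleftrightarrow>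
    (\<forall>p es q. p \<in> fOb F x \<and> chain (prs Ms x) p es q -->
       la N w (tar al f p) (mU mu w (far F f p) (actc Ms cs es)) =
       ra N w (mce N h (mU mu x p es)) (tar be g q))"
    (is "msubst E ?f ?cs _ = msubst E _ ?ds _ \<longleftrightarrow> _")
proof -
  note [simp] = mfacts fields ucell_bd
  have f: "f \<in> Ar T" "dA f = x" "cA f = w" "g \<in> Ar T" "dA g = x" "cA g = w"
    using cpath_T[OF cs] by (auto simp: x_def w_def g_def)
  note [simp] = f
  have h: "h \<in> Ce T" "dC h = x" "cC h = w" "sC h = f" "tC h = g"
    using hcomps_T[OF cs] by (auto simp: in_cell_def h_def g_def)
  note [simp] = h
  have hE: "is_cpath E (fAr F f) (map2 mod_Ce Ms cs)" "cpath_end E (fAr F f) (map2 mod_Ce Ms cs) = fAr G g"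
    "map sm_dom (map2 mod_Ce Ms cs) = prs Ms x" "map sm_cod (map2 mod_Ce Ms cs) = prs Ms w"
    using mod_Ce_cpath[OF mfacts(1,7) cs len] by (simp_all add: g_def)
  have H: "in_cell E (hcomps E (fAr F f) (map2 mod_Ce Ms cs)) (pcomps E (fOb F x) (prs Ms x)) (pcomps E (fOb F w) (prs Ms w)) (fAr F f) (fAr G g)"
    using hcomps_in_cell[OF hE(1)] hE by simp
  note Hb [simp] = in_cell_bd[OF H, THEN conjunct1] in_cell_bd[OF H, THEN conjunct2, THEN conjunct1]
  have Hu: "in_cell E (ccomp E (hcomps E (fAr F f) (map2 mod_Ce Ms cs)) (ucell w)) (pcomps E (fOb F x) (prs Ms x)) (mod_Pr N w)
      (func_comp (fAr F f) (tOb al w)) (func_comp (fAr G g) (tOb be w))"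
    by (rule in_cell_ccomp[OF H mm_cell[OF typed fields]])
  have uN: "in_cell E (ccomp E (ucell x) (mod_Ce N h)) (pcomps E (fOb F x) (prs Ms x)) (mod_Pr N w)
      (func_comp (tOb al x) (fAr (sr N) f)) (func_comp (tOb be x) (fAr (tg N) g))"
    using in_cell_ccomp[OF mm_cell[OF typed fields] md_ce[OF mfacts(2) refl refl h(1), unfolded h(2-5)]] .
  have path: "is_path E (fOb F x) (prs Ms x)" using mod_path_is_path[OF mfacts(1,7)] by simp
  have tAr: "tAr al f \<in> span_maps small" "tAr be g \<in> span_maps small"
    using in_cell_bd[OF tt_ar_cell[OF trans_typed[OF mfacts(3)] refl refl f(1)]]
      in_cell_bd[OF tt_ar_cell[OF trans_typed[OF mfacts(4)] refl refl f(4)]] by simp_all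
  note [simp] = tAr
  have cs': "mpath ?f ?cs"
    using in_cell_bd[OF Hu] path by (simp add: func_comp_funcs)
  have ds': "mpath ?f ?ds"
    using in_cell_bd[OF uN] path by (simp add: func_comp_funcs)
  have d: "in_cell E (act_l N w w) (pcomps E (func_cod ?f) (map sm_cod (map snd ?cs))) (mod_Pr N w)
      (idO (sr N) w) (idO (tg N) w)"
    using md_act(1)[OF mfacts(2) refl refl, of w] by simp
  have e: "in_cell E (act_r N w w) (pcomps E (func_cod ?f) (map sm_cod (map snd ?ds))) (mod_Pr N w)
      (idO (sr N) w) (idO (tg N) w)"
    using md_act(2)[OF mfacts(2) refl refl, of w] by simp
  have con: "concat (map fst ?cs) = concat (map fst ?ds)" by simp
  have r: "func_comp (cpath_end E ?f (map snd ?cs)) (idO (tg N) w) =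
      func_comp (cpath_end E ?f (map snd ?ds)) (idO (tg N) w)"
    using in_cell_bd[OF Hu] by simp
  have ev: "sm_map (ccomp E (hcomps E (fAr F f) (map2 mod_Ce Ms cs)) (ucell w)) (enc p es) =
      sm_map (ucell w) (enc (far F f p) (actc Ms cs es))"
    "sm_map (ccomp E (ucell x) (mod_Ce N h)) (enc p es) = mce N h (sm_map (ucell x) (enc p es))"
    if "p \<in> fOb F x" "chain (prs Ms x) p es q" for p es q
    using hcomps_elem[OF hE(1), of p es q] hE enc_in_pcomps[OF path that] that by simp_all
  show ?thesis
    unfolding msubst_eq_iff[OF cs' ds' refl con d e refl r]
  proof ((intro iffI allI impI; elim conjE), goal_cases)
    case L: (1 p es q)
    have 1: "meval ?cs p [[], es] [tar al f p, sm_map (ccomp E (hcomps E (fAr F f) (map2 mod_Ce Ms cs)) (ucell w)) (enc p es)] q"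
      using L(3) by simp
    have 2: "meval ?ds p [es, []] [sm_map (ccomp E (ucell x) (mod_Ce N h)) (enc p es), tar be g q] q"
      using L(3) by simp
    show ?case
      using L(1)[rule_format, OF conjI[OF _ conjI[OF 1 conjI[OF 2]]]] L(2) ev[OF L(2,3)] by simp
  next
    case R: (2 p ess vs q ess' vs')
    from R(3) obtain es where 1: "ess = [[], es]"
        "vs = [tar al f p, sm_map (ccomp E (hcomps E (fAr F f) (map2 mod_Ce Ms cs)) (ucell w)) (enc p es)]"
        "chain (prs Ms x) p es q"
      unfolding meval_pair_iff chain_Nil_iff by fastforce
    from R(4) obtain es' where 2: "ess' = [es', []]"
        "vs' = [sm_map (ccomp E (ucell x) (mod_Ce N h)) (enc p es'), tar be g q]"
      unfolding meval_pair_iff chain_Nil_iff by fastforce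
    have eq: "es' = es" using R(5) 1 2 by simp
    have p: "p \<in> fOb F x" using R(2) by simp
    show ?case
      using R(1)[rule_format, OF conjI[OF p 1(3)]] unfolding 1(2) 2(2) eq ev[OF p 1(3)] by simp
  qed
qed

text \<open>The factors produced by a path of cells are moved to the front of the list by inner equivariance.\<close>

lemma actc_isteps:
  "mpt K (M # Ks) G' ==> lx K ==> is_cpath T f cs ==> length cs = length (M # Ks) ==> p \<in> fOb K (dA f) ==>
    chain (prs (M # Ks) (dA f)) p (e # es) q ==>
    (istep (cA f) (M # Ks))\<^sup>*\<^sup>*
      (la M (cA f) (fce K (hcomps T f cs) (uni K (dA f) p))
         (mce M (ic (cpath_end T f cs)) e) # acts Ks (cpath_end T f cs) es)
      (actc (M # Ks) cs (e # es))"
proof (induction Ks arbitrary: K M f cs p e es)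
  case Nil
  then obtain c where cs: "cs = [c]" by (cases cs) auto
  with Nil have [simp]: "es = []" "c \<in> Ce T" "sC c = f" "mx M" "sr M = K" "lx K" "e \<in> elt M (dA f)"
    "lft M (dA f) e = p" "dC c = dA f" "cC c = cA f"
    by (auto simp: chain_Nil_iff)
  show ?case using md_whisker(1)[of M K _ c e] cs by simp
next
  case (Cons M' Ks)
  then obtain c d ds where cs: "cs = c # d # ds" by (cases cs; cases "tl cs") auto
  let ?x = "dA f" and ?w = "cA f" and ?g = "cpath_end T f cs" and ?h' = "hcomps T (tC c) (d # ds)"
  have c [simp]: "c \<in> Ce T" "sC c = f" and cs': "is_cpath T (tC c) (d # ds)" using Cons.prems cs by auto
  have M [simp]: "mx M" "sr M = K" "lx K" "mx M'" "sr M' = tg M" and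
    mp: "mpt (tg M) (M' # Ks) G'" using Cons.prems by auto
  have xw [simp]: "dC c = ?x" "cC c = ?w" using cell_boundary(3,4)[OF c(1)] c(2) by simp_all
  have ct [simp]: "dA (tC c) = ?x" "cA (tC c) = ?w" using cell_boundary(5,6)[OF c(1)] by simp_all
  obtain e' es' where es: "es = e' # es'" using Cons.prems by (auto simp: chain_Cons_iff)
  have e [simp]: "e \<in> elt M ?x" "lft M ?x e = p" "e' \<in> elt M' ?x" and
    ee: "rgt M ?x e = lft M' ?x e'" and
    ch: "chain (prs (M' # Ks) ?x) (rgt M ?x e) (e' # es') q"
    using Cons.prems es by auto
  have h' [simp]: "?h' \<in> Ce T" "dC ?h' = ?x" "cC ?h' = ?w" "sC ?h' = tC c" "tC ?h' = ?g"
    using hcomps_T[OF cs'] by (auto simp: in_cell_def cs)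
  have g [simp]: "?g \<in> Ar T" "dA ?g = ?x" "cA ?g = ?w" using cpath_T[OF Cons.prems(3)] by auto
  let ?one = "\<lambda>K p. uni K ?x p"
  let ?b = "fce (tg M) ?h' (?one (tg M) (rgt M ?x e))"
  have IH: "(istep ?w (M' # Ks))\<^sup>*\<^sup>* (la M' ?w ?b (mce M' (ic ?g) e') # acts Ks ?g es') (actc (M' # Ks) (d # ds) (e' # es'))"
    using Cons.IH[OF mp _ cs', of "rgt M ?x e" e' es'] ch Cons.prems(4) by (simp add: cs)
  have lift: "(istep ?w (M # M' # Ks))\<^sup>*\<^sup>* (k # ds) (k # ds')" if "(istep ?w (M' # Ks))\<^sup>*\<^sup>* ds ds'" for k ds ds'
    using that by (induction rule: rtranclp_induct) (auto intro: rtranclp.rtrancl_into_rtrancl istep_there)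
  have "istep ?w (M # M' # Ks) (ra M ?w (mce M c e) ?b # mce M' (ic ?g) e' # acts Ks ?g es')
      (mce M c e # la M' ?w ?b (mce M' (ic ?g) e') # acts Ks ?g es')"
    by (rule istep_here) (use ee in simp_all)
  \<comment> \<open>Both sides are the action on \<open>e\<close> of the external composite of the
    whole path of cells. On the left it is split into \<open>c\<close> on \<open>e\<close> and the
    remaining cells on a unit to its right; on the right it is whiskered into its value at a unit on
    the left and the identity cell of the last target arrow.\<close>
  moreover have "ra M ?w (mce M c e) ?b =
      la M ?w (fce K (hcomps T f cs) (?one K p)) (mce M (ic ?g) e)"
  proof -
    have hc: "hcomps T f cs = hcomp T c ?h'" by (simp add: cs)
    have "ra M ?w (mce M c e) ?b = mce M (hcomp T c ?h') (ra M ?x e (?one (tg M) (rgt M ?x e)))"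
      using md_hcomp(2)[OF M(1) refl refl c(1) h'(1), of e "?one (tg M) (rgt M ?x e)"] by simp
    also have "ra M ?x e (?one (tg M) (rgt M ?x e)) = e" by simp
    also have "mce M (hcomp T c ?h') e = la M ?w (fce K (hcomp T c ?h') (?one K p)) (mce M (ic ?g) e)"
      using md_whisker(1)[OF M(1,2) refl, of "hcomp T c ?h'" e] by simp
    finally show ?thesis unfolding hc .
  qed
  ultimately show ?case
    using lift[OF IH, of "mce M c e"] unfolding es by (simp add: cs converse_rtranclp_into_rtranclp)
qed

lemma isteps_invariant:
  assumes laws: "mm_laws Ms N al be U" and p: "p \<in> fOb F x" and ch: "chain (prs Ms x) p es q"
    and st: "(istep x Ms)\<^sup>*\<^sup>* es es'"
  shows "U x p es = U x p es' \<and> chain (prs Ms x) p es' q"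
  using st
proof (induction rule: rtranclp_induct)
  case (step ds ds')
  then show ?case
    using laws p istep_chain[OF step(2) mfacts(1)] fields unfolding mm_laws_def by metis
qed (use ch in simp)

text \<open>The version of \<open>mt_nat_cell\<close> for several arguments. Inner equivariance
  collects the effect of all cells in one element of the first model, acting in front; outer
  equivariance pulls it out and naturality of \<open>al\<close> exchanges it, leaving the law for
  the last target arrow. For no arguments the cell is already the identity cell of
  \<open>f\<close>.\<close>

lemma mm_nat_cell:
  assumes laws: "mm_laws Ms N al be (mU mu)" and cs: "is_cpath T f cs" and len: "length cs = length Ms"
  defines "x \<equiv> dA f" and "w \<equiv> cA f" and "g \<equiv> cpath_end T f cs" and "h \<equiv> hcomps T f cs"
  assumes p: "p \<in> fOb F x" and ch: "chain (prs Ms x) p es q"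
  shows "la N w (tar al f p) (mU mu w (far F f p) (actc Ms cs es)) =
       ra N w (mce N h (mU mu x p es)) (tar be g q)"
proof -
  note [simp] = mfacts fields ucell_bd
  have f: "f \<in> Ar T" "dA f = x" "cA f = w" "g \<in> Ar T" "dA g = x" "cA g = w"
    using cpath_T[OF cs] by (auto simp: x_def w_def g_def)
  have h: "h \<in> Ce T" "dC h = x" "cC h = w" "sC h = f" "tC h = g"
    using hcomps_T[OF cs] by (auto simp: in_cell_def h_def g_def x_def w_def)
  note [simp] = f h p
  have law_nat: "la N w (tar al k p) (mU mu w (far F k p) (acts Ms k es)) =
      ra N w (mce N (ic k) (mU mu x p es)) (tar be k q)"
    if "k \<in> Ar T" "dA k = x" "cA k = w" for k
    using laws[unfolded mm_laws_def, THEN conjunct2, THEN conjunct2, THEN conjunct2, THEN conjunct2, rule_format, OF that(1)]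
      that ch by simp
  show ?thesis
  proof (cases Ms)
    case Nil
    then have "cs = []" "es = []" using len ch chain_length[OF ch] by simp_all
    then show ?thesis
      using law_nat[of f] by (simp add: Nil g_def h_def)
  next
    case (Cons M Ks)
    then obtain e es' where es: "es = e # es'" using ch by (auto simp: chain_Cons_iff)
    have M [simp]: "mx M" "sr M = F" using mfacts(1) Cons by auto
    have e [simp]: "e \<in> elt M x" "lft M x e = p" using ch by (auto simp: es Cons)
    let ?one = "uni F x p"
    let ?a = "fce F h ?one"
    let ?H = "sr N"
    have st: "(istep w Ms)\<^sup>*\<^sup>* (la M w ?a (mce M (ic g) e) # acts Ks g es') (actc Ms cs es)"
      using actc_isteps[of F M Ks G f cs p e es' q] mfacts(1,7) cs len p ch
      unfolding Cons es h_def g_def x_def w_def by simp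
    have chg: "chain (prs Ms w) (far F g p) (mce M (ic g) e # acts Ks g es') (far G g q)"
      using acts_chain[OF mfacts(1,7) f(4), of p es q] ch by (simp add: Cons es)
    have ch1: "chain (prs Ms w) (far F f p) (la M w ?a (mce M (ic g) e) # acts Ks g es') (far G g q)"
      using chg by (simp add: Cons)
    have "mU mu w (far F f p) (actc Ms cs es) =
        mU mu w (far F f p) (la M w ?a (mce M (ic g) e) # acts Ks g es')"
      using isteps_invariant[OF laws _ ch1 st] by simp
    also have "... = la N w (tpr al w ?a) (mU mu w (far F g p) (acts Ms g es))"
      using laws[unfolded mm_laws_def, THEN conjunct1, rule_format, of M Ks ?a w "mce M (ic g) e" "acts Ks g es'"] chg
      by (simp add: Cons es)
    finally have 1: "mU mu w (far F f p) (actc Ms cs es) =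
        la N w (tpr al w ?a) (mU mu w (far F g p) (acts Ms g es))" .
    have chs: "chain (prs Ms w) (far F g p) (acts Ms g es) (far G g q)"
      using chg by (simp add: Cons es)
    note ug = mm_map[OF typed fields _ chs] and u = mm_map[OF typed fields p ch]
    have nat: "cmp ?H w (tar al f p) (tpr al w ?a) =
        cmp ?H w (fce ?H h (uni ?H x (tob al x p))) (tar al g p)"
      using tx_nat[OF mfacts(3) fields(5) mfacts(5) h(1), of ?one] by simp
    have q: "q \<in> fOb G x" using chain_end_in[OF mfacts(1,7) p ch] .
    have "la N w (tar al f p) (mU mu w (far F f p) (actc Ms cs es)) =
        la N w (cmp ?H w (tar al f p) (tpr al w ?a)) (mU mu w (far F g p) (acts Ms g es))"
      unfolding 1 using ug by simp
    also have "... = la N w (fce ?H h (uni ?H x (tob al x p)))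
        (la N w (tar al g p) (mU mu w (far F g p) (acts Ms g es)))"
      unfolding nat using ug by simp
    also have "... = ra N w (la N w (fce ?H h (uni ?H x (tob al x p)))
        (mce N (ic g) (mU mu x p es))) (tar be g q)"
      unfolding law_nat[OF f(4-6)] using u q by simp
    also have "la N w (fce ?H h (uni ?H x (tob al x p)))
        (mce N (ic g) (mU mu x p es)) = mce N h (mU mu x p es)"
      using md_whisker(1)[OF mfacts(2) refl refl h(1), of "mU mu x p es"] u by simp
    finally show ?thesis .
  qed
qed

end

section \<open>Elementwise form of the multimodulation axioms\<close>

lemma mods_Pr_Cons: "mods_Pr (M # Ms) (m # ms) = mod_Pr M m # mods_Pr Ms ms"
  by (simp add: mods_Pr_def)

text \<open>Since paths are constant, a quantifier over paths collapses to one over objects. The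
  predicate is left arbitrary so that the axiom can be rewritten as a whole;
  \<open>right_normal\<close> and \<open>inner_normal\<close> serve the other two positions.\<close>

lemma left_normal:
  "(\<forall>x m n ns M Ms'. Ms = M # Ms' \<and> is_path T x (m # n # ns) \<and> length ns = length Ms' --> P x m n ns M Ms') \<longleftrightarrow>
   (\<forall>x M Ms'. Ms = M # Ms' --> P x x x (replicate (length Ms') x) M Ms')" (is "?l \<longleftrightarrow> ?r")
proof
  assume ?l
  then show ?r by (intro allI impI) (simp del: split_paired_All)
next
  assume R: ?r
  show ?l
  proof (intro allI impI; elim conjE)
    fix x m n ns M Ms' assume a: "Ms = M # Ms'" "is_path T x (m # n # ns)" "length ns = length Ms'"
    then have "m = x" "n = x" "ns = replicate (length Ms') x" using is_path_T_eq[of x ns] by auto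
    then show "P x m n ns M Ms'" using R a(1) by blast
  qed
qed

lemma right_normal:
  "(\<forall>x ms m n M Ms'. Ms = Ms' @ [M] \<and> is_path T x (ms @ [m, n]) \<and> length ms = length Ms' --> P x ms m n M Ms') \<longleftrightarrow>
   (\<forall>x M Ms'. Ms = Ms' @ [M] --> P x (replicate (length Ms') x) x x M Ms')" (is "?l \<longleftrightarrow> ?r")
proof
  assume ?l
  then show ?r by (intro allI impI) (simp add: is_path_append_T)
next
  assume R: ?r
  show ?l
  proof (intro allI impI; elim conjE)
    fix x ms m n M Ms' assume a: "Ms = Ms' @ [M]" "is_path T x (ms @ [m, n])" "length ms = length Ms'"
    then have "m = x" "n = x" "ms = replicate (length Ms') x" using is_path_T_eq[of x ms] by (auto simp: is_path_append_T)
    then show "P x ms m n M Ms'" using R a(1) by blast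
  qed
qed

lemma inner_normal:
  "(\<forall>x ms l m n ns Ms1 M M' Ms2. Ms = Ms1 @ [M, M'] @ Ms2 \<and> is_path T x (ms @ [l, m, n] @ ns) \<and>
      length ms = length Ms1 \<and> length ns = length Ms2 --> P x ms l m n ns Ms1 M M' Ms2) \<longleftrightarrow>
   (\<forall>x Ms1 M M' Ms2. Ms = Ms1 @ [M, M'] @ Ms2 -->
      P x (replicate (length Ms1) x) x x x (replicate (length Ms2) x) Ms1 M M' Ms2)" (is "?l \<longleftrightarrow> ?r")
proof
  assume ?l
  then show ?r by (intro allI impI) (simp add: is_path_append_T)
next
  assume R: ?r
  show ?l
  proof (intro allI impI; elim conjE)
    fix x ms l m n ns Ms1 M M' Ms2
    assume a: "Ms = Ms1 @ [M, M'] @ Ms2" "is_path T x (ms @ [l, m, n] @ ns)" "length ms = length Ms1" "length ns = length Ms2"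
    then have "l = x" "m = x" "n = x" "ms = replicate (length Ms1) x" "ns = replicate (length Ms2) x"
      using is_path_T_eq[of x ms] is_path_T_eq[of x ns] by (auto simp: is_path_append_T)
    then show "P x ms l m n ns Ms1 M M' Ms2" using R a(1) by blast
  qed
qed

lemma replicate_join: "replicate a x @ x # x # replicate b x = replicate (a + Suc (Suc b)) x"
  by (simp only: replicate_add replicate_Suc append.simps)

text \<open>Repeating the identity cell of \<open>f\<close> gives a path of cells whose external
  composite is that cell again. This instance of the naturality axiom is the one recorded in
  \<open>mm_laws\<close>.\<close>

lemma is_cpath_replicate: "f \<in> Ar T ==> is_cpath T f (replicate k (ic f)) \<and> cpath_end T f (replicate k (ic f)) = f
    \<and> hcomps T f (replicate k (ic f)) = ic f"
  using hcomp_units(1)[of "ic f"] by (induction k rule: induct_nat_012) simp_all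

lemma actc_replicate: "length es = length Ms ==> actc Ms (replicate (length Ms) (ic f)) es = acts Ms f es"
  by (induction es Ms rule: list_induct2) auto

text \<open>\<open>C1\<close> to \<open>C5\<close> are the axioms and \<open>L1\<close> to
  \<open>L5\<close> their elementwise forms. The first four correspond one by one. The fifth does
  not: \<open>C5\<close> gives \<open>L5\<close> by specialization to identity cells, whereas the
  converse, by \<open>mm_nat_cell\<close>, uses the equivariance laws as well.\<close>

lemma multimodulation_iff:
  "mmx mu \<longleftrightarrow>
     mm_typed mu \<and> mm_laws (mdom mu) (mcod mu) (mleft mu) (mright mu) (\<lambda>x p es. mU mu x p es)"
proof (cases "mm_typed mu")
  case False
  have "mmx mu ==> mm_typed mu"
    unfolding multimodulation_def mm_typed_def Let_def by (elim conjE, intro conjI, assumption+)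
  with False show ?thesis by blast
next
  case typed: True
  define Ms N al be F G where d: "Ms = mdom mu" "N = mcod mu" "al = mleft mu" "be = mright mu" "F = tdom al" "G = tdom be"
  note fields = d[symmetric]
  note [simp] = mm_facts[OF typed fields] fields
  have cond: "mpt F Ms G \<and> mx N \<and> tx al \<and> tx be \<and> tcod al = sr N \<and> tcod be = tg N \<and>
     (\<forall>x ms. if is_path T x ms \<and> length ms = length Ms
        then in_cell E (mcell mu x ms) (pcomps E (fOb F x) (mods_Pr Ms ms)) (mod_Pr N (pcomps T x ms))
               (tOb al x) (tOb be (path_end T x ms))
        else mcell mu x ms = undefined)"
    using typed unfolding mm_typed_def fields by blast
  define C1 where "C1 \<longleftrightarrow> (\<forall>x m n ns M Ms'. Ms = M # Ms' \<and> is_path T x (m # n # ns) \<and> length ns = length Ms' -->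
        msubst E (tOb al x) [([fPr F m], tPr al m), (mods_Pr Ms (n # ns), mcell mu (ptgt T m) (n # ns))]
            (act_l N m (pcomps T (ptgt T m) (n # ns)))
          = msubst E (aid E (fOb F x)) (([fPr F m, mod_Pr M n], act_l M m n) # units E (mods_Pr Ms' ns))
            (mcell mu x (pcomp T m n # ns)))"
  define L1 where "L1 \<longleftrightarrow> (\<forall>x M Ms' a e es q. Ms = M # Ms' \<and> a \<in> fel F x \<and>
        chain (prs Ms x) (frt F x a) (e # es) q -->
        mU mu x (flt F x a) (la M x a e # es) =
          la N x (tpr al x a) (mU mu x (frt F x a) (e # es)))"
  have c1: "C1 \<longleftrightarrow> L1"
  proof -
    have *: "msubst E (tOb al x) [([fPr F x], tPr al x), (mods_Pr Ms (x # replicate (length Ms') x), mcell mu (ptgt T x) (x # replicate (length Ms') x))]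
            (act_l N x (pcomps T (ptgt T x) (x # replicate (length Ms') x)))
          = msubst E (aid E (fOb F x)) (([fPr F x, mod_Pr M x], act_l M x x) # units E (mods_Pr Ms' (replicate (length Ms') x)))
            (mcell mu x (pcomp T x x # replicate (length Ms') x)) \<longleftrightarrow>
        (\<forall>a e es q. a \<in> fel F x \<and> chain (prs Ms x) (frt F x a) (e # es) q -->
        mU mu x (flt F x a) (la M x a e # es) =
          la N x (tpr al x a) (mU mu x (frt F x a) (e # es)))"
      if Ms: "Ms = M # Ms'" for x M Ms'
      using mm_left_iff[OF typed fields Ms, of x] by (simp add: Ms mods_Pr_Cons)
    show ?thesis
      unfolding C1_def L1_def left_normal
    proof (intro iffI allI impI, goal_cases)
      case (1 x M Ms' a e es q)
      then have Ms: "Ms = M # Ms'" by blast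
      show ?case using *[OF Ms, of x, THEN iffD1, OF 1(1)[rule_format, OF Ms]] 1(2) by blast
    next
      case (2 x M Ms')
      then show ?case unfolding *[OF 2(2)] by blast
    qed
  qed
  define C2 where "C2 \<longleftrightarrow> (\<forall>x ms m n M Ms'. Ms = Ms' @ [M] \<and> is_path T x (ms @ [m, n]) \<and> length ms = length Ms' -->
        msubst E (tOb al x)
            [(mods_Pr Ms (ms @ [m]), mcell mu x (ms @ [m])), ([fPr G n], tPr be n)]
            (act_r N (pcomps T x (ms @ [m])) n)
          = msubst E (aid E (fOb F x))
            (units E (mods_Pr Ms' ms) @ [([mod_Pr M m, fPr G n], act_r M m n)])
            (mcell mu x (ms @ [pcomp T m n])))"
  define L2 where "L2 \<longleftrightarrow> (\<forall>x M Ms' p es e b. Ms = Ms' @ [M] \<and> p \<in> fOb F x \<and> b \<in> fel G x \<and>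
        chain (prs Ms x) p (es @ [e]) (flt G x b) -->
        mU mu x p (es @ [ra M x e b]) = ra N x (mU mu x p (es @ [e])) (tpr be x b))"
  have c2: "C2 \<longleftrightarrow> L2"
  proof -
    have *: "msubst E (tOb al x)
            [(mods_Pr Ms (replicate (length Ms') x @ [x]), mcell mu x (replicate (length Ms') x @ [x])), ([fPr G x], tPr be x)]
            (act_r N (pcomps T x (replicate (length Ms') x @ [x])) x)
          = msubst E (aid E (fOb F x))
            (units E (mods_Pr Ms' (replicate (length Ms') x)) @ [([mod_Pr M x, fPr G x], act_r M x x)])
            (mcell mu x (replicate (length Ms') x @ [pcomp T x x])) \<longleftrightarrow>
        (\<forall>p es e b. p \<in> fOb F x \<and> b \<in> fel G x \<and>
        chain (prs Ms x) p (es @ [e]) (flt G x b) -->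
        mU mu x p (es @ [ra M x e b]) = ra N x (mU mu x p (es @ [e])) (tpr be x b))"
      if Ms: "Ms = Ms' @ [M]" for x M Ms'
    proof -
      have r: "replicate (length Ms') x @ [x] = replicate (length Ms) x" using Ms by (simp add: replicate_append_same)
      show ?thesis using mm_right_iff[OF typed fields Ms, of x] by (simp del: map_append replicate_Suc add: r)
    qed
    show ?thesis
      unfolding C2_def L2_def right_normal
    proof (intro iffI allI impI, goal_cases)
      case (1 x M Ms' p es e b)
      then have Ms: "Ms = Ms' @ [M]" by blast
      show ?case using *[OF Ms, of x, THEN iffD1, OF 1(1)[rule_format, OF Ms]] 1(2) by blast
    next
      case (2 x M Ms')
      then show ?case unfolding *[OF 2(2)] by blast
    qed
  qed
  define C3 where "C3 \<longleftrightarrow> (\<forall>x ms l m n ns Ms1 M M' Ms2.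
        Ms = Ms1 @ [M, M'] @ Ms2 \<and> is_path T x (ms @ [l, m, n] @ ns) \<and>
        length ms = length Ms1 \<and> length ns = length Ms2 -->
        msubst E (aid E (fOb F x))
            (units E (mods_Pr Ms1 ms) @
             [([mod_Pr M l, fPr (tg M) m], act_r M l m), ([mod_Pr M' n], cid E (mod_Pr M' n))] @
             units E (mods_Pr Ms2 ns))
            (mcell mu x (ms @ [pcomp T l m, n] @ ns))
          = msubst E (aid E (fOb F x))
            (units E (mods_Pr Ms1 ms) @
             [([mod_Pr M l], cid E (mod_Pr M l)), ([fPr (sr M') m, mod_Pr M' n], act_l M' m n)] @
             units E (mods_Pr Ms2 ns))
            (mcell mu x (ms @ [l, pcomp T m n] @ ns)))"
  define L3 where "L3 \<longleftrightarrow> (\<forall>x es es' p q. istep x Ms es es' \<and> p \<in> fOb F x \<and> chain (prs Ms x) p es q --> mU mu x p es = mU mu x p es')"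
  have c3: "C3 \<longleftrightarrow> L3"
  proof -
    have *: "msubst E (aid E (fOb F x))
            (units E (mods_Pr Ms1 (replicate (length Ms1) x)) @
             [([mod_Pr M x, fPr (tg M) x], act_r M x x), ([mod_Pr M' x], cid E (mod_Pr M' x))] @
             units E (mods_Pr Ms2 (replicate (length Ms2) x)))
            (mcell mu x (replicate (length Ms1) x @ [pcomp T x x, x] @ replicate (length Ms2) x))
          = msubst E (aid E (fOb F x))
            (units E (mods_Pr Ms1 (replicate (length Ms1) x)) @
             [([mod_Pr M x], cid E (mod_Pr M x)), ([fPr (sr M') x, mod_Pr M' x], act_l M' x x)] @
             units E (mods_Pr Ms2 (replicate (length Ms2) x)))
            (mcell mu x (replicate (length Ms1) x @ [x, pcomp T x x] @ replicate (length Ms2) x)) \<longleftrightarrow>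
       (\<forall>p es1 e b e' es2 q. p \<in> fOb F x \<and> length es1 = length Ms1 \<and> b \<in> fel (tg M) x \<and>
         e \<in> elt M x \<and> e' \<in> elt M' x \<and>
         rgt M x e = flt (tg M) x b \<and> frt (tg M) x b = lft M' x e' \<and>
         chain (prs Ms x) p (es1 @ ra M x e b # e' # es2) q -->
         mU mu x p (es1 @ ra M x e b # e' # es2) = mU mu x p (es1 @ e # la M' x b e' # es2))"
      if Ms: "Ms = Ms1 @ [M, M'] @ Ms2" for x Ms1 M M' Ms2
    proof -
      have r: "replicate (length Ms1) x @ x # x # replicate (length Ms2) x = replicate (length Ms) x"
        by (simp add: Ms replicate_join)
      show ?thesis using mm_inner_iff[OF typed fields Ms, of x] by (simp del: map_append replicate_Suc add: r)
    qed
    show ?thesis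
      unfolding C3_def L3_def inner_normal
    proof (intro iffI allI impI, goal_cases)
      case (1 x es es' p q)
      then have st: "istep x Ms es es'" and p: "p \<in> fOb F x" "chain (prs Ms x) p es q" by blast+
      from istep_cases_append[OF st] obtain Ms1 M M' Ms2 es1 e b e' es2 where s: "Ms = Ms1 @ M # M' # Ms2"
        "length es1 = length Ms1" "es = es1 @ ra M x e b # e' # es2" "es' = es1 @ e # la M' x b e' # es2"
        "e \<in> elt M x" "b \<in> fel (tg M) x" "e' \<in> elt M' x"
        "rgt M x e = flt (tg M) x b" "frt (tg M) x b = lft M' x e'" by blast
      have s1: "Ms = Ms1 @ [M, M'] @ Ms2" using s(1) by simp
      show ?case using *[OF s1, of x, THEN iffD1, OF 1(1)[rule_format, OF s1], rule_format, of p es1 b e e' es2 q] s p by blast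
    next
      case (2 x Ms1 M M' Ms2)
      show ?case
        unfolding *[OF 2(2)]
      proof (intro allI impI; elim conjE)
        fix p es1 e b e' es2 q
        assume a: "p \<in> fOb F x" "length es1 = length Ms1" "b \<in> fel (tg M) x"
          "e \<in> elt M x" "e' \<in> elt M' x"
          "rgt M x e = flt (tg M) x b" "frt (tg M) x b = lft M' x e'"
          "chain (prs Ms x) p (es1 @ ra M x e b # e' # es2) q"
        have "istep x Ms (es1 @ ra M x e b # e' # es2) (es1 @ e # la M' x b e' # es2)"
          using istep_append[OF istep_here[OF a(4,3,5,6,7), of Ms2 es2] a(2)] 2(2) by simp
        then show "mU mu x p (es1 @ ra M x e b # e' # es2) = mU mu x p (es1 @ e # la M' x b e' # es2)"
          using 2(1) a(1,8) by blast
      qed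
    qed
  qed
  define C4 where "C4 \<longleftrightarrow> (Ms = [] --> (\<forall>m\<in>Pr T.
        msubst E (tOb al (psrc T m)) [([], mcell mu (psrc T m) []), ([fPr G m], tPr be m)] (act_r N (pid T (psrc T m)) m)
          = msubst E (tOb al (psrc T m)) [([fPr F m], tPr al m), ([], mcell mu (ptgt T m) [])] (act_l N m (pid T (ptgt T m)))))"
  define L4 where "L4 \<longleftrightarrow> (\<forall>x a. Ms = [] \<and> a \<in> fel F x -->
        ra N x (mU mu x (flt F x a) []) (tpr be x a) =
        la N x (tpr al x a) (mU mu x (frt F x a) []))"
  have c4: "C4 \<longleftrightarrow> L4"
  proof (cases "Ms = []")
    case True
    show ?thesis unfolding C4_def L4_def using mm_zero_iff[OF typed fields True] by (simp add: True)
  qed (simp add: C4_def L4_def)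
  have *: "msubst E (acomp E (tOb al (dA f)) (fAr (tcod al) f))
             [([], tAr al f),
              (mods_Pr Ms (map (dC) cs), ccomp E (hcomps E (fAr F f) (map2 mod_Ce Ms cs)) (mcell mu (cA f) (map (cC) cs)))]
             (act_l N (pid T (cA f)) (pcomps T (cA f) (map (cC) cs)))
           = msubst E (acomp E (tOb al (dA f)) (fAr (tcod al) f))
             [(mods_Pr Ms (map (dC) cs), ccomp E (mcell mu (dA f) (map (dC) cs)) (mod_Ce N (hcomps T f cs))),
              ([], tAr be (cpath_end T f cs))]
             (act_r N (pcomps T (cA f) (map (cC) cs)) (pid T (cA (cpath_end T f cs)))) \<longleftrightarrow>
       (\<forall>p es q. p \<in> fOb F (dA f) \<and> chain (prs Ms (dA f)) p es q -->
       la N (cA f) (tar al f p) (mU mu (cA f) (far F f p) (actc Ms cs es)) =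
       ra N (cA f) (mce N (hcomps T f cs) (mU mu (dA f) p es)) (tar be (cpath_end T f cs) q))"
      if cs: "is_cpath T f cs" "length cs = length Ms" for f cs
    proof -
      have c: "map (dC) cs = replicate (length Ms) (dA f)" "map (cC) cs = replicate (length Ms) (cA f)"
        using cpath_T[OF cs(1)] is_path_T_eq cs(2) by auto
      show ?thesis using mm_nat_iff[OF typed fields cs] cpath_T[OF cs(1)] by (simp add: c)
    qed
  define C5 where "C5 \<longleftrightarrow> (\<forall>f cs. is_cpath T f cs \<and> length cs = length Ms -->
         msubst E (acomp E (tOb al (dA f)) (fAr (tcod al) f))
             [([], tAr al f),
              (mods_Pr Ms (map (dC) cs), ccomp E (hcomps E (fAr F f) (map2 mod_Ce Ms cs)) (mcell mu (cA f) (map (cC) cs)))]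
             (act_l N (pid T (cA f)) (pcomps T (cA f) (map (cC) cs)))
           = msubst E (acomp E (tOb al (dA f)) (fAr (tcod al) f))
             [(mods_Pr Ms (map (dC) cs), ccomp E (mcell mu (dA f) (map (dC) cs)) (mod_Ce N (hcomps T f cs))),
              ([], tAr be (cpath_end T f cs))]
             (act_r N (pcomps T (cA f) (map (cC) cs)) (pid T (cA (cpath_end T f cs)))))"
  define L5 where "L5 \<longleftrightarrow> (\<forall>f\<in>Ar T. \<forall>p\<in>fOb F (dA f). \<forall>es q. chain (prs Ms (dA f)) p es q -->
        la N (cA f) (tar al f p) (mU mu (cA f) (far F f p) (acts Ms f es)) =
        ra N (cA f) (mce N (ic f) (mU mu (dA f) p es)) (tar be f q))"
  have c5: L5 if C5
    unfolding L5_def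
  proof (intro ballI allI impI)
    fix f p es q assume a: "f \<in> Ar T" "p \<in> fOb F (dA f)" "chain (prs Ms (dA f)) p es q"
    let ?cs = "replicate (length Ms) (ic f)"
    have cs: "is_cpath T f ?cs" "length ?cs = length Ms" using is_cpath_replicate[OF a(1)] by simp_all
    have "length es = length Ms" using chain_length[OF a(3)] by simp
    then show "la N (cA f) (tar al f p) (mU mu (cA f) (far F f p) (acts Ms f es)) =
        ra N (cA f) (mce N (ic f) (mU mu (dA f) p es)) (tar be f q)"
      using *[OF cs, THEN iffD1, OF that[unfolded C5_def, rule_format, OF conjI[OF cs]], rule_format, of p es q]
        a is_cpath_replicate[OF a(1), of "length Ms"]
      by (simp add: actc_replicate)
  qed
  have c5': C5 if laws: "mm_laws Ms N al be (\<lambda>x p es. mU mu x p es)"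
    unfolding C5_def
  proof ((intro allI impI; elim conjE), goal_cases)
    case (1 f cs)
    show ?case
      unfolding *[OF 1]
      using mm_nat_cell[OF typed fields laws 1] by blast
  qed
  have m: "mmx mu \<longleftrightarrow> (mpt F Ms G \<and> mx N \<and> tx al \<and> tx be \<and> tcod al = sr N \<and> tcod be = tg N \<and>
     (\<forall>x ms. if is_path T x ms \<and> length ms = length Ms
        then in_cell E (mcell mu x ms) (pcomps E (fOb F x) (mods_Pr Ms ms)) (mod_Pr N (pcomps T x ms))
               (tOb al x) (tOb be (path_end T x ms))
        else mcell mu x ms = undefined)) \<and> C1 \<and> C2 \<and> C3 \<and> C4 \<and> C5"
    unfolding multimodulation_def Let_def fields C1_def C2_def C3_def C4_def C5_def conj_assoc by (rule refl)
  have l: "mm_laws Ms N al be (\<lambda>x p es. mU mu x p es) \<longleftrightarrow> L1 \<and> L2 \<and> L3 \<and> L4 \<and> L5"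
    unfolding mm_laws_def fields L1_def L2_def L3_def L4_def L5_def by (rule refl)
  show ?thesis
    unfolding m using cond typed c1 c2 c3 c4 c5 c5' l unfolding fields by blast
qed

section \<open>Multimodulations from functions on chains\<close>

lemma mm_lawsD:
  assumes laws: "mm_laws Ms N al be U"
  shows "Ms = M # Ms' ==> a \<in> fel (tdom al) x ==> chain (prs Ms x) (frt (tdom al) x a) (e # es) q ==>
      U x (flt (tdom al) x a) (la M x a e # es) =
        la N x (tpr al x a) (U x (frt (tdom al) x a) (e # es))"
    "Ms = Ms' @ [M] ==> p \<in> fOb (tdom al) x ==> b \<in> fel (tdom be) x ==>
      chain (prs Ms x) p (es @ [e]) (flt (tdom be) x b) ==>
      U x p (es @ [ra M x e b]) = ra N x (U x p (es @ [e])) (tpr be x b)"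
    "istep x Ms es es' ==> p \<in> fOb (tdom al) x ==> chain (prs Ms x) p es q ==> U x p es = U x p es'"
    "Ms = [] ==> a \<in> fel (tdom al) x ==>
      ra N x (U x (flt (tdom al) x a) []) (tpr be x a) =
        la N x (tpr al x a) (U x (frt (tdom al) x a) [])"
    "f \<in> Ar T ==> p \<in> fOb (tdom al) (dA f) ==> chain (prs Ms (dA f)) p es q ==>
      la N (cA f) (tar al f p) (U (cA f) (far (tdom al) f p) (acts Ms f es)) =
        ra N (cA f) (mce N (ic f) (U (dA f) p es)) (tar be f q)"
proof -
  note l = laws[unfolded mm_laws_def]
  note r = l[THEN conjunct2] l[THEN conjunct2, THEN conjunct2] l[THEN conjunct2, THEN conjunct2, THEN conjunct2]
  note l1 = l[THEN conjunct1, rule_format, OF conjI[OF _ conjI]]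
  note l2 = r(1)[THEN conjunct1, rule_format, OF conjI[OF _ conjI[OF _ conjI]]]
  note l3 = r(2)[THEN conjunct1, rule_format, OF conjI[OF _ conjI]]
  note l4 = r(3)[THEN conjunct1, rule_format, OF conjI]
  note l5 = r(3)[THEN conjunct2, rule_format]
  show "Ms = M # Ms' ==> a \<in> fel (tdom al) x ==> chain (prs Ms x) (frt (tdom al) x a) (e # es) q ==>
      U x (flt (tdom al) x a) (la M x a e # es) =
        la N x (tpr al x a) (U x (frt (tdom al) x a) (e # es))" by (rule l1)
  show "Ms = Ms' @ [M] ==> p \<in> fOb (tdom al) x ==> b \<in> fel (tdom be) x ==>
      chain (prs Ms x) p (es @ [e]) (flt (tdom be) x b) ==>
      U x p (es @ [ra M x e b]) = ra N x (U x p (es @ [e])) (tpr be x b)" by (rule l2)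
  show "istep x Ms es es' ==> p \<in> fOb (tdom al) x ==> chain (prs Ms x) p es q ==> U x p es = U x p es'" by (rule l3)
  show "Ms = [] ==> a \<in> fel (tdom al) x ==>
      ra N x (U x (flt (tdom al) x a) []) (tpr be x a) =
        la N x (tpr al x a) (U x (frt (tdom al) x a) [])" by (rule l4)
  show "f \<in> Ar T ==> p \<in> fOb (tdom al) (dA f) ==> chain (prs Ms (dA f)) p es q ==>
      la N (cA f) (tar al f p) (U (cA f) (far (tdom al) f p) (acts Ms f es)) =
        ra N (cA f) (mce N (ic f) (U (dA f) p es)) (tar be f q)" by (rule l5)
qed

text \<open>Starting from a chain, each law evaluates the family at chains only, because actions,
  moves and arrows preserve the matching of legs. A family may thus be replaced by one that agrees
  with it on chains, which is all that \<open>mk_mmod_mU\<close> guarantees.\<close>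

lemma mm_laws_cong:
  assumes path: "mpt (tdom al) Ms (tdom be)" and F: "tx al" and G: "tx be"
    and eq: "\<And>x p es q. p \<in> fOb (tdom al) x ==> chain (prs Ms x) p es q ==> U x p es = V x p es"
    and laws: "mm_laws Ms N al be U"
  shows "mm_laws Ms N al be V"
proof -
  let ?F = "tdom al" and ?G = "tdom be"
  have [simp]: "lx ?F" "lx ?G" using F G by simp_all
  show ?thesis
    unfolding mm_laws_def
  proof ((intro conjI allI impI ballI; (elim conjE)?), goal_cases)
    case (1 x M Ms' a e es q)
    have M [simp]: "mx M" "sr M = ?F" using path 1(1) by auto
    have c: "chain (prs Ms x) (flt ?F x a) (la M x a e # es) q" using 1 by auto
    have "U x (flt ?F x a) (la M x a e # es) = la N x (tpr al x a) (U x (frt ?F x a) (e # es))"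
      using mm_lawsD(1)[OF laws 1] .
    moreover have "flt ?F x a \<in> fOb ?F x" "frt ?F x a \<in> fOb ?F x" using 1(2) by simp_all
    ultimately show ?case using eq[OF _ c] eq[OF _ 1(3)] by simp
  next
    case (2 x M Ms' p es e b)
    have M [simp]: "mx M" "tg M = ?G" using path 2(1) by (auto simp: mod_path_append)
    have len: "length es = length Ms'" using chain_length[OF 2(4)] 2(1) by simp
    have c': "chain (prs Ms' x @ [mod_Pr M x]) p (es @ [e]) (flt ?G x b)" using 2 by simp
    obtain r where r: "chain (prs Ms' x) p es r" "chain [mod_Pr M x] r [e] (flt ?G x b)"
      by (rule chain_splitE[OF c']) (use len in simp_all)
    have c: "chain (prs Ms x) p (es @ [ra M x e b]) (frt ?G x b)"
      using chain_append[OF r(1), of "[mod_Pr M x]" "[ra M x e b]" "frt ?G x b"] r(2) 2 by simp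
    have "U x p (es @ [ra M x e b]) = ra N x (U x p (es @ [e])) (tpr be x b)"
      using mm_lawsD(2)[OF laws 2] .
    then show ?case using eq[OF 2(2) c] eq[OF 2(2,4)] by simp
  next
    case (3 x es es' p q)
    have "U x p es = U x p es'" using mm_lawsD(3)[OF laws 3] .
    then show ?case using eq[OF 3(2,3)] eq[OF 3(2) istep_chain[OF 3(1) path 3(3)]] by simp
  next
    case (4 x a)
    have "ra N x (U x (flt ?F x a) []) (tpr be x a) = la N x (tpr al x a) (U x (frt ?F x a) [])"
      using mm_lawsD(4)[OF laws 4] .
    moreover have "flt ?F x a \<in> fOb ?F x" "frt ?F x a \<in> fOb ?F x" using 4(2) by simp_all
    ultimately show ?case using eq[of "flt ?F x a" x "[]"] eq[of "frt ?F x a" x "[]"] 4 by simp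
  next
    case (5 f p es q)
    have "la N (cA f) (tar al f p) (U (cA f) (far ?F f p) (acts Ms f es)) =
        ra N (cA f) (mce N (ic f) (U (dA f) p es)) (tar be f q)"
      using mm_lawsD(5)[OF laws 5] .
    moreover have "far ?F f p \<in> fOb ?F (cA f)" using 5 by simp
    ultimately show ?case using eq[OF 5(2,3)] eq[OF _ acts_chain[OF path _ 5(1,2,3)]] by simp
  qed
qed

text \<open>The cell has to be a function on encoded elements, while \<open>U\<close> takes a
  starting point and a list. These are recovered by choice, and \<open>enc_inject\<close> shows that
  there is nothing to choose.\<close>

definition mk_mmod where
  "mk_mmod Ms N al be U = \<lparr>mdom = Ms, mcod = N, mleft = al, mright = be,
     mcell = (\<lambda>x ms. if is_path T x ms \<and> length ms = length Ms
       then span_cell (pcomps E (fOb (tdom al) x) (prs Ms x)) (mod_Pr N x) (tOb al x) (tOb be x)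
         (\<lambda>z. let s = SOME s. fst s \<in> fOb (tdom al) x \<and> (\<exists>q. chain (prs Ms x) (fst s) (snd s) q) \<and> z = enc (fst s) (snd s)
           in U x (fst s) (snd s))
       else undefined)\<rparr>"

lemma mk_mmod_simps [simp]: "mdom (mk_mmod Ms N al be U) = Ms" "mcod (mk_mmod Ms N al be U) = N"
  "mleft (mk_mmod Ms N al be U) = al" "mright (mk_mmod Ms N al be U) = be"
  by (simp_all add: mk_mmod_def)

lemma mk_mmod_mU:
  assumes "mpt (tdom al) Ms (tdom be)" "tx al" "p \<in> fOb (tdom al) x" "chain (prs Ms x) p es q"
  shows "sm_map (mcell (mk_mmod Ms N al be U) x (replicate (length Ms) x)) (enc p es) = U x p es"
proof -
  let ?P = "\<lambda>s. fst s \<in> fOb (tdom al) x \<and> (\<exists>q. chain (prs Ms x) (fst s) (snd s) q) \<and> enc p es = enc (fst s) (snd s)"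
  have path: "is_path E (fOb (tdom al) x) (prs Ms x)"
    using mod_path_is_path[OF assms(1)] assms(2) by simp
  have "enc p es \<in> apex (pcomps E (fOb (tdom al) x) (prs Ms x))"
    using enc_in_pcomps[OF path assms(3,4)] by simp
  moreover have "(SOME s. ?P s) = (p, es)"
  proof (rule some_equality)
    show "?P (p, es)" using assms(3,4) by auto
    fix s assume "?P s"
    then obtain q' where "chain (prs Ms x) (fst s) (snd s) q'" "enc p es = enc (fst s) (snd s)" by blast
    from enc_inject[OF assms(4) this] show "s = (p, es)" by (simp add: prod_eq_iff)
  qed
  ultimately show ?thesis by (simp add: mk_mmod_def)
qed

lemma mk_mmod_multimodulation:
  assumes path: "mpt (tdom al) Ms (tdom be)" and N: "mx N" and al: "tx al" "tcod al = sr N"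
    and be: "tx be" "tcod be = tg N"
    and ty: "\<And>x p es q. p \<in> fOb (tdom al) x ==> chain (prs Ms x) p es q ==> U x p es \<in> elt N x \<and>
      lft N x (U x p es) = tob al x p \<and> rgt N x (U x p es) = tob be x q"
    and laws: "mm_laws Ms N al be U"
  shows "mmx (mk_mmod Ms N al be U)"
proof -
  let ?m = "mk_mmod Ms N al be U"
  note [simp] = N al be
  have isp: "is_path E (fOb (tdom al) x) (prs Ms x)" "path_end E (fOb (tdom al) x) (prs Ms x) = fOb (tdom be) x" for x
    using mod_path_is_path[OF path] by simp_all
  have cell: "in_cell E (mcell ?m x (replicate (length Ms) x)) (pcomps E (fOb (tdom al) x) (prs Ms x)) (mod_Pr N x)
      (tOb al x) (tOb be x)" for x
  proof -
    have f: "frame small (pcomps E (fOb (tdom al) x) (prs Ms x)) (mod_Pr N x) (tOb al x) (tOb be x)"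
      using pcomps_spans[OF isp(1)] by (simp add: frame_def isp(2))
    have "sm_map (mcell ?m x (replicate (length Ms) x)) z \<in> elt N x \<and>
        lft N x (sm_map (mcell ?m x (replicate (length Ms) x)) z) = tob al x (lleg (pcomps E (fOb (tdom al) x) (prs Ms x)) z) \<and>
        rgt N x (sm_map (mcell ?m x (replicate (length Ms) x)) z) = tob be x (rleg (pcomps E (fOb (tdom al) x) (prs Ms x)) z)"
      if z: "z \<in> apex (pcomps E (fOb (tdom al) x) (prs Ms x))" for z
    proof -
      obtain p es q where p: "p \<in> fOb (tdom al) x" "chain (prs Ms x) p es q" "z = enc p es"
        using pcomps_cases[OF isp(1) z] by blast
      show ?thesis
        using mk_mmod_mU[OF path al(1) p(1,2), of N U] ty[OF p(1,2)] enc_in_pcomps[OF isp(1) p(1,2)] p(3) by simp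
    qed
    then show ?thesis using f by (simp add: in_cell_iff) (simp add: mk_mmod_def)
  qed
  have typed: "mm_typed ?m"
    unfolding mm_typed_def
  proof (intro conjI allI, goal_cases)
    case (7 x ms)
    show ?case
    proof (cases "is_path T x ms \<and> length ms = length Ms")
      case True
      then have ms: "ms = replicate (length Ms) x" using is_path_T_eq by blast
      show ?thesis using cell[of x] by (simp add: ms)
    next
      case False
      then show ?thesis by (auto simp: mk_mmod_def)
    qed
  qed (use path in simp_all)
  have "mm_laws Ms N al be (\<lambda>x p es. mU ?m x p es)"
    by (rule mm_laws_cong[OF path _ _ _ laws]) (simp_all add: mk_mmod_mU[OF path])
  then show ?thesis unfolding multimodulation_iff using typed by simp
qed

lemmas mm_facts_self = mm_facts[where Ms = "mdom mu" and N = "mcod mu" and al = "mleft mu" and be = "mright mu" and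
    F = "tdom (mleft mu)" and G = "tdom (mright mu)" and mu = mu for mu, OF _ refl refl refl refl refl refl]

lemmas mm_cell_self = mm_cell[where Ms = "mdom mu" and N = "mcod mu" and al = "mleft mu" and be = "mright mu" and
    F = "tdom (mleft mu)" and G = "tdom (mright mu)" and mu = mu for mu, OF _ refl refl refl refl refl refl]

lemma mm_eqI:
  fixes mu nu :: "('o, 'a, 'c, 'u) s_mmodn"
  assumes typed: "mm_typed mu" "mm_typed nu"
    and eq: "mdom mu = mdom nu" "mcod mu = mcod nu" "mleft mu = mleft nu" "mright mu = mright nu"
    and U: "\<And>x p es q. p \<in> fOb (tdom (mleft nu)) x ==> chain (prs (mdom nu) x) p es q ==> mU mu x p es = mU nu x p es"
  shows "mu = nu"
proof -
  note f = mm_facts_self[OF typed(2)]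
  have "mcell mu x ms = mcell nu x ms" for x ms
  proof (cases "is_path T x ms \<and> length ms = length (mdom nu)")
    case True
    then have ms: "ms = replicate (length (mdom nu)) x" using is_path_T_eq by blast
    show ?thesis
      unfolding ms
    proof (rule in_cell_eqI[OF mm_cell_self[OF typed(1), unfolded eq] mm_cell_self[OF typed(2)]])
      fix z assume z: "z \<in> apex (pcomps E (fOb (tdom (mleft nu)) x) (prs (mdom nu) x))"
      have "is_path E (fOb (tdom (mleft nu)) x) (prs (mdom nu) x)" using mod_path_is_path[OF f(1,7)] by simp
      from pcomps_cases[OF this z] U eq(1)
      show "sm_map (mcell mu x (replicate (length (mdom nu)) x)) z = sm_map (mcell nu x (replicate (length (mdom nu)) x)) z"
        by auto
    qed
  next
    case False
    then have "mcell mu x ms = undefined" "mcell nu x ms = undefined"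
      using typed[unfolded mm_typed_def, THEN conjunct2, THEN conjunct2, THEN conjunct2, THEN conjunct2, THEN conjunct2,
          THEN conjunct2, rule_format, of x ms] eq(1) by auto
    then show ?thesis by simp
  qed
  then have "mcell mu = mcell nu" by blast
  with eq show ?thesis by (cases mu; cases nu) simp
qed

section \<open>Composition of multimodulations\<close>

lemma split_path_T: "split_path T ks x (replicate (sum_list ks) x) = map (\<lambda>k. (x, replicate k x)) ks"
  by (induction ks) (simp_all add: min_def)

abbreviation "mms x phs \<equiv> map (\<lambda>ph. (prs (mdom ph) x, mcell ph x (replicate (length (mdom ph)) x))) phs"

lemma mmod_comp_simps [simp]: "mdom (mcm al phs psi) = concat (map mdom phs)" "mcod (mcm al phs psi) = mcod psi"
  "mleft (mcm al phs psi) = tcm al (mleft psi)"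
  "mright (mcm al phs psi) = tcm (if phs = [] then al else mright (last phs)) (mright psi)"
  by (simp_all add: mmod_comp_def)

lemma mmod_comp_mcell:
  "mcell (mcm al phs psi) x (replicate (length (concat (map mdom phs))) x) =
     msubst E (tOb al x) (mms x phs) (mcell psi x (replicate (length phs) x))"
proof -
  have len: "length (concat (map mdom phs)) = sum_list (map (length \<circ> mdom) phs)"
    by (simp add: length_concat comp_def)
  have "map2 (\<lambda>ph (y, ns). (mods_Pr (mdom ph) ns, mcell ph y ns)) phs (map ((\<lambda>k. (x, replicate k x)) \<circ> (length \<circ> mdom)) phs) = mms x phs"
    by (induction phs) simp_all
  moreover have "map (\<lambda>(y, ns). pcomps T y ns) (map ((\<lambda>k. (x, replicate k x)) \<circ> (length \<circ> mdom)) phs) = replicate (length phs) x"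
    by (induction phs) simp_all
  ultimately show ?thesis
    unfolding mmod_comp_def by (simp add: len split_path_T Let_def del: map_map) (simp add: len)
qed

fun mmpath :: "('o, 'a, 'c, 'u) s_trans \<Rightarrow> ('o, 'a, 'c, 'u) s_mmodn list \<Rightarrow> ('o, 'a, 'c, 'u) s_trans \<Rightarrow> bool" where
  "mmpath al [] be \<longleftrightarrow> tx al \<and> al = be"
| "mmpath al (ph # phs) be \<longleftrightarrow> mm_typed ph \<and> mleft ph = al \<and> mmpath (mright ph) phs be"

lemma mmpath_props:
  "mmpath al phs be ==> tx al \<and> tx be \<and> mpt (tdom al) (concat (map mdom phs)) (tdom be) \<and>
     mpt (tcod al) (map mcod phs) (tcod be) \<and> mpath (tOb al x) (mms x phs) \<and>
     cpath_end E (tOb al x) (map snd (mms x phs)) = tOb be x \<and>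
     map sm_cod (map snd (mms x phs)) = prs (map mcod phs) x \<and> (if phs = [] then al else mright (last phs)) = be"
proof (induction phs arbitrary: al)
  case Nil
  then show ?case by auto
next
  case (Cons ph phs)
  then have ph: "mm_typed ph" "mleft ph = al" and IH: "mmpath (mright ph) phs be" by auto
  note f = mm_facts_self[OF ph(1), unfolded ph(2)] and b = in_cell_bd[OF mm_cell_self[OF ph(1), of x], unfolded ph(2)]
  have "is_path E (fOb (tdom al) x) (prs (mdom ph) x)" using mod_path_is_path[OF f(1,7)] by simp
  then show ?case
    using Cons.IH[OF IH] f b by (auto simp: mod_path_append)
qed

text \<open>For composites only typing is established. Equality of multimodulations, by
  \<open>mm_eqI\<close>, needs no more, and composites occur in the universal properties and in
  \<open>represents\<close> only as sides of equations.\<close>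

lemma mmod_comp_typed:
  assumes path: "mmpath al phs be" and typed: "mm_typed psi" and dom: "mdom psi = map mcod phs"
    and bd: "tcod al = tdom (mleft psi)" "tcod be = tdom (mright psi)"
  shows "mm_typed (mcm al phs psi)" "mright (mcm al phs psi) = tcm be (mright psi)"
proof -
  note P = mmpath_props[OF path]
  note f [simp] = mm_facts[OF typed dom refl refl refl bd[symmetric]]
  have [simp]: "tx al" "tx be" using P by auto
  have e: "(if phs = [] then al else mright (last phs)) = be" using P by auto
  then show r: "mright (mcm al phs psi) = tcm be (mright psi)" by simp
  have tOb: "tOb (tcm al' be') x = func_comp (tOb al' x) (tOb be' x)" for al' be' x
    by (simp add: trans_comp_def)
  have cell: "in_cell E (mcell (mcm al phs psi) x (replicate (length (concat (map mdom phs))) x))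
      (pcomps E (fOb (tdom al) x) (prs (concat (map mdom phs)) x)) (mod_Pr (mcod psi) x)
      (tOb (tcm al (mleft psi)) x) (tOb (tcm be (mright psi)) x)" for x
  proof -
    have mp: "mpath (tOb al x) (mms x phs)" "cpath_end E (tOb al x) (map snd (mms x phs)) = tOb be x"
      "map sm_cod (map snd (mms x phs)) = prs (map mcod phs) x"
      using P[of x] by blast+
    have c: "concat (map fst (mms x phs)) = prs (concat (map mdom phs)) x" by (induction phs) simp_all
    have d: "in_cell E (mcell psi x (replicate (length phs) x)) (pcomps E (func_cod (tOb al x)) (map sm_cod (map snd (mms x phs))))
        (mod_Pr (mcod psi) x) (tOb (mleft psi) x) (tOb (mright psi) x)"
      unfolding mp(3) using mm_cell[OF typed dom refl refl refl bd[symmetric], of x] bd by simp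
    have dm: "func_dom (tOb al x) = fOb (tdom al) x" by simp
    show ?thesis
      unfolding mmod_comp_mcell tOb using msubst_in_cell[OF mp(1) d] unfolding c mp(2) dm .
  qed
  show "mm_typed (mcm al phs psi)"
    unfolding mm_typed_def r
  proof (intro conjI allI, goal_cases)
    case (7 x ms)
    show ?case
    proof (cases "is_path T x ms \<and> length ms = length (concat (map mdom phs))")
      case True
      then have ms: "ms = replicate (length (concat (map mdom phs))) x" using is_path_T_eq by blast
      show ?thesis unfolding ms using cell[of x] bd by simp
    next
      case False
      then show ?thesis by (auto simp: mmod_comp_def)
    qed
  qed (use P bd in simp_all)
qed

lemma mmod_comp_mU:
  assumes path: "mmpath al phs be" and p: "p \<in> fOb (tdom al) x" and ev: "meval (mms x phs) p ess vs q"
  shows "sm_map (mcell (mcm al phs psi) x (replicate (length (concat (map mdom phs))) x)) (enc p (concat ess)) =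
      sm_map (mcell psi x (replicate (length phs) x)) (enc (tob al x p) vs)"
    and "chain (prs (map mcod phs) x) (tob al x p) vs (tob be x q)"
proof -
  note P = mmpath_props[OF path, of x]
  have mp: "mpath (tOb al x) (mms x phs)" "cpath_end E (tOb al x) (map snd (mms x phs)) = tOb be x"
      "map sm_cod (map snd (mms x phs)) = prs (map mcod phs) x" "tx al"
    using P by blast+
  have dm: "func_dom (tOb al x) = fOb (tdom al) x" using mp(4) by simp
  show "sm_map (mcell (mcm al phs psi) x (replicate (length (concat (map mdom phs))) x)) (enc p (concat ess)) =
      sm_map (mcell psi x (replicate (length phs) x)) (enc (tob al x p) vs)"
    unfolding mmod_comp_mcell using msubst_elem(1)[OF mp(1) p[folded dm] ev] .
  show "chain (prs (map mcod phs) x) (tob al x p) vs (tob be x q)"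
    using msubst_elem(2)[OF mp(1) p[folded dm] ev] unfolding mp(2,3) .
qed

lemma mmod_id_simps [simp]: "mdom (mmi M) = [M]" "mcod (mmi M) = M"
  "mleft (mmi M) = tid (sr M)" "mright (mmi M) = tid (tg M)"
  "mcell (mmi M) x [x] = cid E (mod_Pr M x)"
  by (simp_all add: mmod_id_def)

lemma unary_simps [simp]: "mdom (unary T mu) = [odom mu]" "mcod (unary T mu) = ocod mu"
  "mleft (unary T mu) = oleft mu" "mright (unary T mu) = oright mu" "mcell (unary T mu) x [x] = ocell mu x"
  by (simp_all add: unary_def)

lemma unary_typed: "mm_typed (unary T mu) \<longleftrightarrow> modn_typed mu"
proof -
  have path: "is_path T x ms \<and> length ms = Suc 0 \<longleftrightarrow> ms = [x]" for x ms
    using is_path_T_eq[of x ms 1] by auto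
  show ?thesis
    unfolding mm_typed_def modn_typed_def
    by (auto simp: path mods_Pr_def unary_def)
qed

lemma istep_single [simp]: "\<not> istep x [M] es es'"
  by (auto elim: istep.cases)

text \<open>With one module in the list there is no adjacent pair and the list is not empty, so
  inner equivariance and the law for no arguments are vacuous. The other three laws are those of a
  modulation.\<close>

lemma unary_laws:
  assumes U: "\<And>x p m. U x p [m] = g x m" and "tdom al = sr M" "tdom be = tg M" "mx M"
  shows "mm_laws [M] N al be U \<longleftrightarrow> modn_laws M N al be g" (is "?L \<longleftrightarrow> ?R")
proof
  assume L: ?L
  note [simp] = assms
  show ?R
    unfolding modn_laws_def
  proof ((intro conjI allI impI ballI; (elim conjE)?), goal_cases)
    case (1 x m b)
    have "U x (lft M x m) ([] @ [ra M x m b]) = ra N x (U x (lft M x m) ([] @ [m])) (tpr be x b)"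
      by (rule mm_lawsD(2)[OF L]) (use 1 in simp_all)
    then show ?case by simp
  next
    case (2 x a m)
    then show ?case using mm_lawsD(1)[OF L refl, of a x m "[]" "rgt M x m"] by simp
  next
    case (3 f m)
    then show ?case
      using mm_lawsD(5)[OF L, of f "lft M (dA f) m" "[m]" "rgt M (dA f) m"] by simp
  qed
next
  assume R: ?R
  note [simp] = assms
  show ?L
    unfolding mm_laws_def
  proof ((intro conjI allI impI ballI; (elim conjE)?), goal_cases)
    case (1 x K Ms' a e es q)
    then have "K = M" "Ms' = []" "es = []" "e \<in> elt M x" "lft M x e = frt (sr M) x a"
      by (auto simp: chain_Nil_iff)
    then show ?case using R 1 unfolding modn_laws_def by simp
  next
    case (2 x K Ms' p es e b)
    then have "K = M" "Ms' = []" by auto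
    moreover have "es = []" using chain_length[OF 2(4)] by simp
    moreover have "e \<in> elt M x" "rgt M x e = flt (tg M) x b"
      using 2(4) \<open>es = []\<close> by auto
    ultimately show ?case using R 2 unfolding modn_laws_def by simp
  next
    case (5 f p es q)
    then obtain m where "es = [m]" "m \<in> elt M (dA f)" "lft M (dA f) m = p" "rgt M (dA f) m = q"
      by (auto simp: chain_single_iff)
    then show ?case using R 5 unfolding modn_laws_def by auto
  qed auto
qed

lemma unary_iff: "mmx (unary T mu) \<longleftrightarrow> mux mu"
proof -
  have "mm_laws [odom mu] (ocod mu) (oleft mu) (oright mu) (\<lambda>x p es. mU (unary T mu) x p es) \<longleftrightarrow>
      modn_laws (odom mu) (ocod mu) (oleft mu) (oright mu) (om mu)" if "modn_typed mu"
    by (rule unary_laws) (use mt_facts[OF that refl refl refl refl] in simp_all)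
  then show ?thesis
    unfolding multimodulation_iff modulation_iff unary_typed by auto
qed

lemma unary_bij: "bij_betw (unary T) {mu. mux mu} {ph. mmx ph \<and> length (mdom ph) = 1}"
  unfolding bij_betw_def
proof
  show "inj_on (unary T) {mu. mux mu}"
  proof (rule inj_onI)
    fix mu nu assume eq: "unary T mu = unary T nu"
    have "ocell mu x = ocell nu x" for x
      using arg_cong[OF eq, of "\<lambda>ph. mcell ph x [x]"] by simp
    then have "ocell mu = ocell nu" by blast
    moreover have "odom mu = odom nu" "ocod mu = ocod nu" "oleft mu = oleft nu" "oright mu = oright nu"
      using arg_cong[OF eq, of mdom] arg_cong[OF eq, of mcod] arg_cong[OF eq, of mleft] arg_cong[OF eq, of mright] by simp_all
    ultimately show "mu = nu" by (cases mu; cases nu) simp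
  qed
  show "unary T ` {mu. mux mu} = {ph. mmx ph \<and> length (mdom ph) = 1}"
  proof (intro equalityI subsetI)
    fix ph assume "ph \<in> {ph. mmx ph \<and> length (mdom ph) = 1}"
    then have ph: "mmx ph" "length (mdom ph) = 1" by auto
    then obtain M where M: "mdom ph = [M]" by (cases "mdom ph") auto
    define mu where "mu = \<lparr>odom = M, ocod = mcod ph, oleft = mleft ph, oright = mright ph, ocell = (\<lambda>x. mcell ph x [x])\<rparr>"
    have path: "is_path T x ms \<and> length ms = Suc 0 \<longleftrightarrow> ms = [x]" for x ms
      using is_path_T_eq[of x ms 1] by auto
    have typed: "mm_typed ph" using ph(1) multimodulation_iff by blast
    have "mcell ph x ms = mcell (unary T mu) x ms" for x ms
    proof (cases "ms = [x]")
      case False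
      then have "mcell ph x ms = undefined"
        using typed[unfolded mm_typed_def, THEN conjunct2, THEN conjunct2, THEN conjunct2, THEN conjunct2, THEN conjunct2,
          THEN conjunct2, rule_format, of x ms] path[of x ms] M by auto
      then show ?thesis using False path[of x ms] by (auto simp: unary_def)
    qed (simp add: mu_def)
    then have "mcell ph = mcell (unary T mu)" by blast
    then have eq: "unary T mu = ph"
      using M by (cases ph) (simp add: unary_def mu_def)
    then have "mux mu" using ph(1) unary_iff by metis
    then show "ph \<in> unary T ` {mu. mux mu}" using eq by blast
  qed (auto simp: unary_iff)
qed

lemma mod_path_unique: "mpt F Ms G ==> mpt F Ms G' ==> G = G'"
  by (induction Ms arbitrary: F) auto

lemma lax_vdbl_sel: "VOb (lax_vdbl T E) = {F. lx F}" "VAr (lax_vdbl T E) = {al. tx al}" "VPr (lax_vdbl T E) = {M. mx M}"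
  "VCe (lax_vdbl T E) = {mu. mmx mu}" "vpsrc (lax_vdbl T E) = sr" "vptgt (lax_vdbl T E) = tg"
  "vcdom (lax_vdbl T E) = mdom" "vccod (lax_vdbl T E) = mcod" "vcsrc (lax_vdbl T E) = mleft" "vctgt (lax_vdbl T E) = mright"
  "vadom (lax_vdbl T E) = tdom" "vacod (lax_vdbl T E) = tcod" "vaid (lax_vdbl T E) = tid"
  "vacomp (lax_vdbl T E) = tcm" "vcid (lax_vdbl T E) = mmi" "vccomp (lax_vdbl T E) = mcm"
  by (simp_all add: lax_vdbl_def)

lemma vpath_iff: "vpath (lax_vdbl T E) F Ms G \<longleftrightarrow> lx F \<and> mpt F Ms G"
proof (induction Ms arbitrary: F)
  case (Cons M Ms)
  have "mx M ==> lx (sr M)" "mx M ==> lx (tg M)" by simp_all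
  then show ?case unfolding vpath.simps mod_path.simps Cons.IH lax_vdbl_sel mem_Collect_eq by blast
qed (simp add: lax_vdbl_sel)

lemma mmod_id_unary: "mx M ==> mmi M = unary T (cell_id M)"
proof -
  assume M: "mx M"
  have t: "tOb (tid F) x = idO F x" for F x by (simp add: trans_id_def)
  have "cid E (mod_Pr M x) = ocell (cell_id M) x" for x
  proof (rule in_cell_eqI)
    show "in_cell E (cid E (mod_Pr M x)) (mod_Pr M x) (mod_Pr M x) (tOb (tid (sr M)) x) (tOb (tid (tg M)) x)"
      using in_cell_cid[of "mod_Pr M x"] M by (simp add: t)
    show "in_cell E (ocell (cell_id M) x) (mod_Pr M x) (mod_Pr M x) (tOb (tid (sr M)) x) (tOb (tid (tg M)) x)"
      using mt_cell[OF modulation_typed[OF cell_id_modulation[OF M]], of M M] by simp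
    show "sm_map (cid E (mod_Pr M x)) m = om (cell_id M) x m" if "m \<in> elt M x" for m
      using that M by simp
  qed
  then show ?thesis
    by (auto simp: mmod_id_def unary_def fun_eq_iff)
qed

lemma mmod_id_typed [simp]: "mx M ==> mm_typed (mmi M)"
  by (simp add: mmod_id_unary unary_typed modulation_typed)

text \<open>Identity multimodulations in front of a path do not disturb it, as their boundaries are
  identity transformations. This provides the padded paths that occur in the definition of
  \<open>opcartesian\<close>.\<close>

lemma whisker_path:
  "mpt F ks G ==> lx F ==> mmpath (tid G) phs be ==>
    mmpath (tid F) (map (mmi) ks @ phs) be"
  by (induction ks arbitrary: F) auto

lemma meval_ids: "meval (mms x (map (mmi) ks)) p ess vs q \<longleftrightarrow> ess = map (\<lambda>e. [e]) vs \<and> chain (prs ks x) p vs q"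
proof -
  have "mms x (map (mmi) ks) = units E (prs ks x)"
    by (induction ks) (simp_all add: units_def)
  then show ?thesis by (simp only: meval_units_iff)
qed

section \<open>Opcartesian multimodulations\<close>

text \<open>A multimodulation stripped of its record: a family of functions on chains with correct
  values and laws. Extensions along opcartesian cells are constructed in this form and wrapped by
  \<open>mk_mmod\<close> afterwards.\<close>

definition mm_ok where
  "mm_ok Ms N al be U \<longleftrightarrow> mpt (tdom al) Ms (tdom be) \<and> mx N \<and> tx al \<and> tx be \<and>
     tcod al = sr N \<and> tcod be = tg N \<and>
     (\<forall>x p es q. p \<in> fOb (tdom al) x \<and> chain (prs Ms x) p es q --> U x p es \<in> elt N x \<and>
        lft N x (U x p es) = tob al x p \<and> rgt N x (U x p es) = tob be x q) \<and>
     mm_laws Ms N al be U"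

lemma multimodulation_ok:
  "mmx mu ==> mm_ok (mdom mu) (mcod mu) (mleft mu) (mright mu) (\<lambda>x p es. mU mu x p es)"
proof -
  assume "mmx mu"
  then have *: "mm_typed mu" "mm_laws (mdom mu) (mcod mu) (mleft mu) (mright mu) (\<lambda>x p es. mU mu x p es)"
    using multimodulation_iff by blast+
  show ?thesis
    unfolding mm_ok_def using mm_facts_self[OF *(1)] mm_map[OF *(1) refl refl refl refl refl refl] *(2)
    by blast
qed

lemma mm_ok_multimodulation:
  assumes ok: "mm_ok Ms N al be U"
  shows "mmx (mk_mmod Ms N al be U)"
    and "p \<in> fOb (tdom al) x ==> chain (prs Ms x) p es q ==>
      sm_map (mcell (mk_mmod Ms N al be U) x (replicate (length Ms) x)) (enc p es) = U x p es"
proof -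
  show "mmx (mk_mmod Ms N al be U)"
    using ok unfolding mm_ok_def by (elim conjE) (rule mk_mmod_multimodulation; blast)
  show "p \<in> fOb (tdom al) x ==> chain (prs Ms x) p es q ==>
      sm_map (mcell (mk_mmod Ms N al be U) x (replicate (length Ms) x)) (enc p es) = U x p es"
    using ok mk_mmod_mU unfolding mm_ok_def by blast
qed

context
  fixes ph :: "('o, 'a, 'c, 'u) s_mmodn" and P
  assumes phi: "mm_typed ph" "mcod ph = P" "mleft ph = tid (sr P)" "mright ph = tid (tg P)"
begin

lemma phi_facts: "mx P" "mpt (sr P) (mdom ph) (tg P)"
  using mm_facts_self[OF phi(1)] phi by simp_all

lemma phi_map:
  assumes "r \<in> fOb (sr P) x" "chain (prs (mdom ph) x) r ds s"
  shows "mU ph x r ds \<in> elt P x" "lft P x (mU ph x r ds) = r" "rgt P x (mU ph x r ds) = s"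
proof -
  have [simp]: "lx (sr P)" "lx (tg P)" using phi_facts by simp_all
  have "s \<in> fOb (tg P) x" using chain_end_in[OF phi_facts(2) _ assms] by simp
  then show "mU ph x r ds \<in> elt P x" "lft P x (mU ph x r ds) = r" "rgt P x (mU ph x r ds) = s"
    using mm_map[OF phi(1) refl phi(2-4) refl refl, of r x ds s] assms by simp_all
qed

context
  fixes ks ls F G
  assumes ks: "mpt F ks (sr P)" and ls: "mpt (tg P) ls G" and F: "lx F"
begin

text \<open>Precomposition with \<open>ph\<close>, padded by identities, contracts a segment
  \<open>ds\<close> of the chain to the single entry that \<open>ph\<close> assigns to it and leaves
  the rest of the list alone.\<close>

lemma comp_whisker:
  assumes chi: "mm_typed ch" "mdom ch = ks @ [P] @ ls" "tdom (mleft ch) = F"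
  defines "C \<equiv> mcm (tid F) (map (mmi) ks @ [ph] @ map (mmi) ls) ch"
  shows "mm_typed C" "mdom C = ks @ mdom ph @ ls" "mcod C = mcod ch" "mleft C = mleft ch" "mright C = mright ch"
    "[|p \<in> fOb F x; chain (prs ks x) p es1 r; chain (prs (mdom ph) x) r ds s; chain (prs ls x) s es2 q|] ==>
      mU C x p (es1 @ ds @ es2) = mU ch x p (es1 @ mU ph x r ds # es2)"
proof -
  let ?phs = "map (mmi) ks @ [ph] @ map (mmi) ls"
  have G: "lx G" using mod_path_end[OF ls] phi_facts(1) by simp
  have path: "mmpath (tid F) ?phs (tid G)"
  proof (rule whisker_path[OF ks F])
    have "mmpath (tid (tg P)) (map (mmi) ls @ []) (tid G)"
      by (rule whisker_path[OF ls]) (use phi_facts(1) G in simp_all)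
    then show "mmpath (tid (sr P)) ([ph] @ map (mmi) ls) (tid G)"
      using phi by simp
  qed
  have "map mcod (map (mmi) Ms) = Ms" "concat (map mdom (map (mmi) Ms)) = Ms" for Ms
    by (induction Ms) simp_all
  note dm = this this[unfolded map_map comp_def]
  have cod: "mdom ch = map mcod ?phs" using chi(2) phi(2) by (simp only: map_append dm list.map)
  have "mpt F (ks @ [P] @ ls) (tdom (mright ch))" using mm_facts_self(1)[OF chi(1)] chi by simp
  moreover have "mpt F (ks @ [P] @ ls) G" using ks ls phi_facts(1) by (auto simp: mod_path_append)
  ultimately have G': "tdom (mright ch) = G" by (rule mod_path_unique)
  have bd: "tcod (tid F) = tdom (mleft ch)" "tcod (tid G) = tdom (mright ch)" using F G G' chi by simp_all
  note ct = mmod_comp_typed[OF path chi(1) cod bd]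
  have t: "tx (mleft ch)" "tx (mright ch)" using mm_facts_self(3,4)[OF chi(1)] .
  show "mm_typed C" unfolding C_def by (rule ct(1))
  show dC: "mdom C = ks @ mdom ph @ ls" unfolding C_def mmod_comp_simps by (simp only: map_append concat_append dm list.map concat.simps append_Nil append_Nil2)
  show "mcod C = mcod ch" "mleft C = mleft ch" unfolding C_def using t chi by simp_all
  show "mright C = mright ch" unfolding C_def ct(2) using t G' by simp
  assume p: "p \<in> fOb F x" and ch: "chain (prs ks x) p es1 r" "chain (prs (mdom ph) x) r ds s" "chain (prs ls x) s es2 q"
  have "meval (mms x ([ph] @ map (mmi) ls)) r (ds # map (\<lambda>e. [e]) es2) (mU ph x r ds # es2) q"
    using ch(2) meval_ids[of x ls s "map (\<lambda>e. [e]) es2" es2 q, THEN iffD2, OF conjI[OF refl ch(3)]]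
    unfolding list.map append_Cons append_Nil meval_Cons_iff by blast
  with meval_ids[of x ks p "map (\<lambda>e. [e]) es1" es1 r, THEN iffD2, OF conjI[OF refl ch(1)]]
  have ev: "meval (mms x ?phs) p (map (\<lambda>e. [e]) es1 @ ds # map (\<lambda>e. [e]) es2) (es1 @ mU ph x r ds # es2) q"
    unfolding map_append[of _ "map (mmi) ks"] meval_append by blast
  have cc: "concat (map (\<lambda>e. [e]) es1 @ ds # map (\<lambda>e. [e]) es2) = es1 @ ds @ es2"
    by simp
  have len: "length (concat (map mdom ?phs)) = length (mdom C)" "length ?phs = length (mdom ch)"
    unfolding dC chi(2) by (simp_all only: map_append concat_append dm list.map concat.simps append_Nil append_Nil2 length_append length_map list.size)
  show "mU C x p (es1 @ ds @ es2) = mU ch x p (es1 @ mU ph x r ds # es2)"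
    using mmod_comp_mU(1)[OF path _ ev, of ch] p F unfolding cc len C_def[symmetric] by simp
qed

end

text \<open>The universal property in terms of lists. Uniqueness is asked between families that
  satisfy the laws: the values of \<open>ph\<close> need not exhaust the elements of
  \<open>P\<close>. For the unit cell they are only the unit elements, and the laws must carry the
  agreement to all others.\<close>

lemma opcartesian_I:
  assumes m: "mmx ph"
    and ex: "\<And>ks ls F G N al be U. mpt F ks (sr P) ==> mpt (tg P) ls G ==> lx F ==>
      tdom al = F ==> tdom be = G ==> mm_ok (ks @ mdom ph @ ls) N al be U ==>
      \<exists>V. mm_ok (ks @ [P] @ ls) N al be V \<and> (\<forall>x p es1 r ds s es2 q. p \<in> fOb F x \<and> chain (prs ks x) p es1 r \<and>
        chain (prs (mdom ph) x) r ds s \<and> chain (prs ls x) s es2 q --> V x p (es1 @ mU ph x r ds # es2) = U x p (es1 @ ds @ es2))"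
    and un: "\<And>ks ls F G N al be V V' x p es q. mpt F ks (sr P) ==> mpt (tg P) ls G ==> lx F ==>
      tdom al = F ==> tdom be = G ==> mm_ok (ks @ [P] @ ls) N al be V ==> mm_ok (ks @ [P] @ ls) N al be V' ==>
      (\<And>p es1 r ds s es2 q. p \<in> fOb F x ==> chain (prs ks x) p es1 r ==> chain (prs (mdom ph) x) r ds s ==> chain (prs ls x) s es2 q ==>
        V x p (es1 @ mU ph x r ds # es2) = V' x p (es1 @ mU ph x r ds # es2)) ==>
      p \<in> fOb F x ==> chain (prs (ks @ [P] @ ls) x) p es q ==> V x p es = V' x p es"
  shows "opcartesian (lax_vdbl T E) ph"
proof -
  show ?thesis
    unfolding opcartesian_def Let_def lax_vdbl_sel vpath_iff mem_Collect_eq phi(2)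
  proof ((intro conjI allI impI; (elim conjE)?), goal_cases)
    case (4 F G ks ls psi)
    then have ks: "mpt F ks (sr P)" and ls: "mpt (tg P) ls G" and F: "lx F"
      and psi: "mmx psi" and dom: "mdom psi = ks @ mdom ph @ ls" "tdom (mleft psi) = F" by blast+
    have ty: "mm_typed psi" using psi multimodulation_iff by blast
    have mp: "mpt F (ks @ mdom ph @ ls) (tdom (mright psi))" using mm_facts_self(1)[OF ty] dom by simp
    have mp': "mpt F (ks @ mdom ph @ ls) G" using ks ls phi_facts(2) by (auto simp: mod_path_append)
    note G = mod_path_unique[OF mp mp']
    note ok = multimodulation_ok[OF psi, unfolded dom(1)]
    obtain V where V: "mm_ok (ks @ [P] @ ls) (mcod psi) (mleft psi) (mright psi) V"
      and VU: "\<And>x p es1 r ds s es2 q. p \<in> fOb F x ==> chain (prs ks x) p es1 r ==> chain (prs (mdom ph) x) r ds s ==> chain (prs ls x) s es2 q ==>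
        V x p (es1 @ mU ph x r ds # es2) = sm_map (mcell psi x (replicate (length (ks @ mdom ph @ ls)) x)) (enc p (es1 @ ds @ es2))"
      using ex[OF ks ls F dom(2) G ok] by blast
    have chain3: "chain (prs (ks @ [P] @ ls) x) p (es1 @ mU ph x r ds # es2) q"
      if "p \<in> fOb F x" "chain (prs ks x) p es1 r" "chain (prs (mdom ph) x) r ds s" "chain (prs ls x) s es2 q" for x p es1 r ds s es2 q
    proof -
      have "r \<in> fOb (sr P) x" using chain_end_in[OF ks F that(1,2)] .
      then show ?thesis using phi_map[OF _ that(3)] that chain_append[OF that(2)] by simp
    qed
    define ch where "ch = mk_mmod (ks @ [P] @ ls) (mcod psi) (mleft psi) (mright psi) V"
    note ok' = mm_ok_multimodulation[OF V]
    have chi: "mmx ch" "mdom ch = ks @ [P] @ ls" "mcod ch = mcod psi" "mleft ch = mleft psi" "mright ch = mright psi"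
      unfolding ch_def using ok'(1) by simp_all
    have chiU: "mU ch x p es = V x p es" if "p \<in> fOb F x" "chain (prs (ks @ [P] @ ls) x) p es q" for x p es q
      unfolding ch_def mk_mmod_simps using ok'(2) that dom(2) by blast
    let ?C = "mcm (tid F) (map (mmi) ks @ [ph] @ map (mmi) ls)"
    \<comment> \<open>Being a factorization of \<open>psi\<close> means having prescribed values at
      the chains that contain a value of \<open>ph\<close>. One direction shows that the constructed
      \<open>ch\<close> is a factorization, the other that any second one agrees with it
      there.\<close>
    have eqI: "?C ch' = psi \<longleftrightarrow> (\<forall>x p es1 r ds s es2 q. p \<in> fOb F x \<and> chain (prs ks x) p es1 r \<and> chain (prs (mdom ph) x) r ds s \<and> chain (prs ls x) s es2 q -->
        mU ch' x p (es1 @ mU ph x r ds # es2) = mU psi x p (es1 @ ds @ es2))"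
      if c: "mmx ch'" "mdom ch' = ks @ [P] @ ls" "mcod ch' = mcod psi" "mleft ch' = mleft psi" "mright ch' = mright psi" for ch'
    proof -
      have ty': "mm_typed ch'" using c(1) multimodulation_iff by blast
      have l: "tdom (mleft ch') = F" using c dom by simp
      note w = comp_whisker[OF ks ls F ty' c(2) l]
      show ?thesis
      proof
        assume C: "?C ch' = psi"
        show "\<forall>x p es1 r ds s es2 q. p \<in> fOb F x \<and> chain (prs ks x) p es1 r \<and> chain (prs (mdom ph) x) r ds s \<and> chain (prs ls x) s es2 q -->
          mU ch' x p (es1 @ mU ph x r ds # es2) = mU psi x p (es1 @ ds @ es2)"
          using w(6) unfolding C by metis
      next
        assume R: "\<forall>x p es1 r ds s es2 q. p \<in> fOb F x \<and> chain (prs ks x) p es1 r \<and> chain (prs (mdom ph) x) r ds s \<and> chain (prs ls x) s es2 q -->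
          mU ch' x p (es1 @ mU ph x r ds # es2) = mU psi x p (es1 @ ds @ es2)"
        show "?C ch' = psi"
        proof (rule mm_eqI[OF w(1) ty], goal_cases)
          case (5 x p es q)
          have ch: "chain (prs ks x @ prs (mdom ph) x @ prs ls x) p es q" using 5(2) dom by simp
          obtain es1 es' r where 1: "es = es1 @ es'" "chain (prs ks x) p es1 r" "chain (prs (mdom ph) x @ prs ls x) r es' q"
            using chain_split[OF ch] by blast
          obtain ds es2 s where 2: "es' = ds @ es2" "chain (prs (mdom ph) x) r ds s" "chain (prs ls x) s es2 q"
            using chain_split[OF 1(3)] by blast
          have p: "p \<in> fOb F x" using 5(1) dom by simp
          show ?case
            using w(6)[OF p 1(2) 2(2,3)] R[rule_format, OF conjI[OF p conjI[OF 1(2) conjI[OF 2(2,3)]]]]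
            unfolding 1(1) 2(1) by simp
        qed (use w c dom in simp_all)
      qed
    qed
    show ?case
    proof (rule ex1I[of _ ch], goal_cases)
      case 1
      have "?C ch = psi"
        unfolding eqI[OF chi]
      proof ((intro allI impI; elim conjE), goal_cases)
        case (1 x p es1 r ds s es2 q)
        show ?case using chiU[OF 1(1) chain3[OF 1]] VU[OF 1] dom(1) by simp
      qed
      with chi show ?case by blast
    next
      case (2 ch')
      then have c: "mmx ch'" "mdom ch' = ks @ [P] @ ls" "mcod ch' = mcod psi" "mleft ch' = mleft psi" "mright ch' = mright psi"
        and C: "?C ch' = psi" by blast+
      note ok2 = multimodulation_ok[OF c(1), unfolded c(2-5)]
      note agree = eqI[OF c, THEN iffD1, OF C, unfolded c(2) dom(1)]
      have ty': "mm_typed ch'" "mm_typed ch" using c(1) chi(1) multimodulation_iff by blast+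
      show ?case
      proof (rule mm_eqI[OF ty'], goal_cases)
        case (5 x p es q)
        have p: "p \<in> fOb F x" and ch: "chain (prs (ks @ [P] @ ls) x) p es q" using 5 chi dom by simp_all
        have "sm_map (mcell ch' x (replicate (length (ks @ [P] @ ls)) x)) (enc p es) = V x p es"
        proof (rule un[OF ks ls F dom(2) G ok2 V _ p ch], goal_cases)
          case (1 p es1 r ds s es2 q)
          show ?case
            using agree[rule_format, OF conjI[OF 1(1) conjI[OF 1(2) conjI[OF 1(3,4)]]]] VU[OF 1] by (simp only:)
        qed
        then show ?case using chiU[OF p ch] c(2) chi(2) by simp
      qed (use c chi in simp_all)
    qed
  qed (use m phi in simp_all)
qed

end

lemma mm_okD:
  assumes "mm_ok Ms N al be U"
  shows "mpt (tdom al) Ms (tdom be)" "mx N" "tx al" "tx be" "tcod al = sr N" "tcod be = tg N"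
    "[|p \<in> fOb (tdom al) x; chain (prs Ms x) p es q|] ==> U x p es \<in> elt N x"
    "[|p \<in> fOb (tdom al) x; chain (prs Ms x) p es q|] ==> lft N x (U x p es) = tob al x p"
    "[|p \<in> fOb (tdom al) x; chain (prs Ms x) p es q|] ==> rgt N x (U x p es) = tob be x q"
    "mm_laws Ms N al be U"
  using assms unfolding mm_ok_def by blast+

lemma chain_mid:
  assumes "chain (prs (ks @ [P] @ ls) x) p zs q"
  obtains es1 z es2 where "zs = es1 @ z # es2" "chain (prs ks x) p es1 (lft P x z)" "z \<in> elt P x"
    "chain (prs ls x) (rgt P x z) es2 q"
proof -
  have "chain (prs ks x @ (mod_Pr P x # prs ls x)) p zs q" using assms by simp
  from chain_split[OF this] obtain es1 ds r where 1: "zs = es1 @ ds" "chain (prs ks x) p es1 r" "chain (mod_Pr P x # prs ls x) r ds q"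
    by blast
  from 1(3) obtain z es2 where "ds = z # es2" "z \<in> elt P x" "lft P x z = r" "chain (prs ls x) (rgt P x z) es2 q"
    unfolding chain_Cons_iff by blast
  with 1 show thesis using that by blast
qed

section \<open>The cell into the tensor product is opcartesian\<close>

context
  fixes M N :: "('o, 'a, 'c, 'u) s_module"
  assumes M: "mx M" and N: "mx N" and MN: "tg M = sr N"
begin

abbreviation (input) "MN \<equiv> tensor M N"

definition tens_mm where
  "tens_mm = mk_mmod [M, N] (tensor M N) (tid (sr M)) (tid (tg N))
     (\<lambda>x p es. tens M N x (hd es) (hd (tl es)))"

lemma istep_pair: "istep x [M, N] es es' ==> length es = 2 ==> \<exists>e b e'. es = [ra M x e b, e'] \<and> es' = [e, la N x b e'] \<and>
    e \<in> elt M x \<and> b \<in> fel (tg M) x \<and> e' \<in> elt N x \<and>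
    rgt M x e = flt (tg M) x b \<and> frt (tg M) x b = lft N x e'"
  by (erule istep.cases) (fastforce elim: istep.cases)+

lemma tens_mm_ok: "mm_ok [M, N] (tensor M N) (tid (sr M)) (tid (tg N))
    (\<lambda>x p es. tens M N x (hd es) (hd (tl es)))"
proof -
  note [simp] = M N MN
  have [simp]: "lx (sr M)" "lx (tg N)" by simp_all
  show ?thesis
    unfolding mm_ok_def mm_laws_def
  proof ((intro conjI allI impI ballI; (elim conjE)?), goal_cases)
    case (10 x K Ms' a e es q)
    then have "K = M" "Ms' = [N]" by auto
    with 10(2,3) show ?case by (auto simp: chain_Cons_iff)
  next
    case (11 x K Ms' p es e b)
    then have K: "K = N" "Ms' = [M]" by (auto simp: Cons_eq_append_conv)
    obtain e0 where es: "es = [e0]" using chain_length[OF 11(4)] by (cases es) auto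
    show ?case using 11 by (simp add: K es)
  next
    case (12 x es es' p q)
    have "length es = 2" using chain_length[OF 12(3)] by simp
    from istep_pair[OF 12(1) this] show ?case by (elim exE conjE) (simp add: tens_balance)
  next
    case (14 f p es q)
    then obtain m n where "es = [m, n]" "m \<in> elt M (dA f)" "n \<in> elt N (dA f)"
      "lft M (dA f) m = p" "rgt M (dA f) m = lft N (dA f) n" "rgt N (dA f) n = q"
      by (auto simp: chain_pair_iff)
    then show ?case using 14(1) by (auto simp del: legs)
  qed (auto simp: chain_pair_iff)
qed

lemma tens_mm_multimodulation: "mmx tens_mm"
  unfolding tens_mm_def by (rule mm_ok_multimodulation(1)[OF tens_mm_ok])

lemma tens_mm_simps: "mdom tens_mm = [M, N]" "mcod tens_mm = tensor M N"
  "mleft tens_mm = tid (sr M)" "mright tens_mm = tid (tg N)"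
  by (simp_all add: tens_mm_def)

lemma tens_mm_mU:
  assumes "m \<in> elt M x" "n \<in> elt N x" "rgt M x m = lft N x n" "lft M x m = p"
  shows "mU tens_mm x p [m, n] = tens M N x m n"
proof -
  have "sm_map (mcell tens_mm x (replicate (length [M, N]) x)) (enc p [m, n]) = tens M N x (hd [m, n]) (hd (tl [m, n]))"
    unfolding tens_mm_def by (rule mm_ok_multimodulation(2)[OF tens_mm_ok]) (use assms M in \<open>auto simp: chain_pair_iff\<close>)
  then show ?thesis by (simp add: tens_mm_simps)
qed

lemma chain_tens:
  assumes "chain (prs (ks @ [MN] @ ls) x) p zs q"
  obtains es1 m n es2 where "zs = es1 @ tens M N x m n # es2" "chain (prs ks x) p es1 (lft M x m)"
    "m \<in> elt M x" "n \<in> elt N x" "rgt M x m = lft N x n"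
    "chain (prs ls x) (rgt N x n) es2 q"
proof -
  obtain es1 z es2 where z: "zs = es1 @ z # es2" "chain (prs ks x) p es1 (lft MN x z)" "z \<in> elt MN x"
    "chain (prs ls x) (rgt MN x z) es2 q" using chain_mid[OF assms] .
  obtain m n where "z = tens M N x m n" "m \<in> elt M x" "n \<in> elt N x"
    "rgt M x m = lft N x n" using tensor_cases[OF M N MN z(3)] .
  with z M N MN show thesis by (intro that) simp_all
qed

text \<open>A move in a list containing a tensor product lifts to one move in the expanded list,
  provided that the representatives before and after are chosen together. From the right a neighbour
  interacts with the second component, from the left with the first; moves elsewhere keep the
  representative.\<close>

lemma istep_tens:
  assumes "istep x (ks @ [MN] @ ls) zs zs'" "chain (prs (ks @ [MN] @ ls) x) p zs q"
    "mpt F ks (sr M)" "mpt (tg N) ls G"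
  shows "\<exists>es1 m n es2 es1' m' n' es2'. zs = es1 @ tens M N x m n # es2 \<and> zs' = es1' @ tens M N x m' n' # es2' \<and>
    length es1 = length ks \<and> length es1' = length ks \<and> m \<in> elt M x \<and> n \<in> elt N x \<and>
    rgt M x m = lft N x n \<and> m' \<in> elt M x \<and> n' \<in> elt N x \<and>
    rgt M x m' = lft N x n' \<and> istep x (ks @ [M, N] @ ls) (es1 @ m # n # es2) (es1' @ m' # n' # es2')"
  using assms
proof (induction ks arbitrary: zs zs' p F)
  case Nil
  note [simp] = M N MN
  have st: "istep x (MN # ls) zs zs'" using Nil by simp
  from Nil(2) obtain m n es where z: "zs = tens M N x m n # es" "m \<in> elt M x" "n \<in> elt N x"
      "rgt M x m = lft N x n"
    by (rule chain_tens) (auto simp: chain_Nil_iff)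
  from st show ?case
  proof (cases rule: istep.cases)
    case (istep_here e b e' L ls' es')
    note * = istep_here
    from tensor_cases[OF M N MN *(4)] obtain m' n' where e: "e = tens M N x m' n'" "m' \<in> elt M x" "n' \<in> elt N x"
        "rgt M x m' = lft N x n'" .
    have b: "b \<in> fel (tg N) x" "rgt N x n' = flt (tg N) x b" using * e by simp_all
    have "istep x (M # N # L # ls') (m' # ra N x n' b # e' # es') (m' # n' # la L x b e' # es')"
      by (intro istep_there istep.istep_here) (use * e b in simp_all)
    then show ?thesis
      using * e b
      by (intro exI[of _ "[]"] exI[of _ m'] exI[of _ "ra N x n' b"] exI[of _ "e' # es'"] exI[of _ n'] exI[of _ "la L x b e' # es'"]) simp
  next
    case (istep_there es' es'' e)
    then show ?thesis using z
      by (intro exI[of _ "[]"] exI[of _ m] exI[of _ n] exI[of _ "es'"] exI[of _ "es''"]) (auto intro!: istep.istep_there)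
  qed
next
  case (Cons K ks)
  note [simp] = M N MN
  have K [simp]: "mx K" "sr K = F" and mp: "mpt (tg K) ks (sr M)" using Cons.prems(3) by auto
  obtain k ds where zs: "zs = k # ds" "chain (prs (ks @ [MN] @ ls) x) (rgt K x k) ds q"
    using Cons.prems(2) by (auto simp: chain_Cons_iff)
  from chain_tens[OF zs(2)] obtain es1 m n es2 where z: "ds = es1 @ tens M N x m n # es2" "chain (prs ks x) (rgt K x k) es1 (lft M x m)"
    "m \<in> elt M x" "n \<in> elt N x" "rgt M x m = lft N x n" .
  have len: "length es1 = length ks" using chain_length[OF z(2)] by simp
  have "istep x (K # (ks @ [MN] @ ls)) (k # ds) zs'" using Cons.prems(1) zs(1) by simp
  then show ?case
  proof (cases rule: istep.cases)
    case (istep_here e b e' M' Ms' es')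
    show ?thesis
    proof (cases ks)
      case Nil
      then have MM: "M' = MN" "Ms' = ls" "es1 = []" "e' = tens M N x m n" "es' = es2" using istep_here z len by auto
      have b: "b \<in> fel (sr M) x" "frt (sr M) x b = lft M x m"
        using istep_here MM z mp Nil by auto
      have "istep x (K # M # N # ls) (ra K x e b # m # n # es2) (e # la M x b m # n # es2)"
        by (rule istep.istep_here) (use istep_here z b mp Nil in auto)
      then show ?thesis
        using istep_here MM z b zs(1) Nil
        by (intro exI[of _ "[k]"] exI[of _ m] exI[of _ n] exI[of _ es2] exI[of _ "[e]"] exI[of _ "la M x b m"]) simp
    next
      case (Cons K' ks')
      then obtain e1 es1' where es1: "es1 = e1 # es1'" using len by (cases es1) auto
      have "istep x (K # K' # (ks' @ [M, N] @ ls)) (ra K x e b # e1 # (es1' @ m # n # es2)) (e # la K' x b e1 # (es1' @ m # n # es2))"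
        by (rule istep.istep_here) (use istep_here es1 z Cons in auto)
      then show ?thesis
        using istep_here z zs(1) es1 len Cons
        by (intro exI[of _ "k # es1"] exI[of _ m] exI[of _ n] exI[of _ es2] exI[of _ "e # la K' x b e1 # es1'"]) auto
    qed
  next
    case (istep_there ds' )
    have st: "istep x (ks @ [MN] @ ls) ds ds'" using istep_there by simp
    have zs': "zs' = k # ds'" using istep_there by simp
    from Cons.IH[OF st zs(2) mp Cons.prems(4)] obtain ds1 m1 n1 ds2 ds1' m1' n1' ds2' where
      I: "ds = ds1 @ tens M N x m1 n1 # ds2" "ds' = ds1' @ tens M N x m1' n1' # ds2'"
        "length ds1 = length ks" "length ds1' = length ks" "m1 \<in> elt M x" "n1 \<in> elt N x"
        "rgt M x m1 = lft N x n1" "m1' \<in> elt M x" "n1' \<in> elt N x"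
        "rgt M x m1' = lft N x n1'"
      and J: "istep x (ks @ [M, N] @ ls) (ds1 @ m1 # n1 # ds2) (ds1' @ m1' # n1' # ds2')" by blast
    from istep.istep_there[OF J, of K k] show ?thesis
      unfolding zs(1) zs' I(1,2) using I(3-10)
      by (intro exI[of _ "k # ds1"] exI[of _ m1] exI[of _ n1] exI[of _ ds2] exI[of _ "k # ds1'"] exI[of _ m1'] exI[of _ n1'] exI[of _ ds2'])
        simp
  qed
qed

text \<open>Replaces the entry at position \<open>k\<close> by the two components of a
  representative before applying \<open>U\<close>. Only the fibre of pairs whose outer legs fit the
  rest of the list matters, which is why \<open>balanced\<close> carries the legs as
  parameters.\<close>

definition tens_ext where
  "tens_ext k U x p zs = tens_lift M N x (\<lambda>m n. U x p (take k zs @ m # n # drop (Suc k) zs)) (zs ! k)"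

context
  fixes ks ls F G R al be U
  assumes ks: "mpt F ks (sr M)" and ls: "mpt (tg N) ls G" and F: "lx F"
    and al: "tdom al = F" and be: "tdom be = G" and ok: "mm_ok (ks @ [M, N] @ ls) R al be U"
begin

abbreviation (input) "V \<equiv> tens_ext (length ks) U"

lemma chain_expand:
  "chain (prs ks x) p es1 (lft M x m) ==> m \<in> elt M x ==> n \<in> elt N x ==>
    rgt M x m = lft N x n ==> chain (prs ls x) (rgt N x n) es2 q ==>
    chain (prs (ks @ [M, N] @ ls) x) p (es1 @ m # n # es2) q"
  using chain_append[of "prs ks x" p es1 "lft M x m"] by simp

lemma tens_ext_tens:
  assumes p: "p \<in> fOb F x" and c: "chain (prs ks x) p es1 (lft M x m)" "m \<in> elt M x" "n \<in> elt N x"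
    "rgt M x m = lft N x n" "chain (prs ls x) (rgt N x n) es2 q"
  shows "V x p (es1 @ tens M N x m n # es2) = U x p (es1 @ m # n # es2)"
proof -
  have len: "length es1 = length ks" using chain_length[OF c(1)] by simp
  have "balanced M N x (lft M x m) (rgt N x n) (\<lambda>m n. U x p (es1 @ m # n # es2))"
    unfolding balanced_def
  proof (intro allI impI; elim conjE)
    note [simp] = M N MN
    fix m' b n' assume a: "lft M x m' = lft M x m" "rgt N x n' = rgt N x n" "m' \<in> elt M x"
      "b \<in> fel (tg M) x" "n' \<in> elt N x" "rgt M x m' = flt (tg M) x b"
      "frt (tg M) x b = lft N x n'"
    have st: "istep x (ks @ [M, N] @ ls) (es1 @ ra M x m' b # n' # es2) (es1 @ m' # la N x b n' # es2)"
      using istep_append[OF istep_here[OF a(3-7), of ls es2] len] by simp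
    have ch: "chain (prs (ks @ [M, N] @ ls) x) p (es1 @ ra M x m' b # n' # es2) q"
      by (rule chain_expand) (use c a in simp_all)
    show "U x p (es1 @ ra M x m' b # n' # es2) = U x p (es1 @ m' # la N x b n' # es2)"
      by (rule mm_lawsD(3)[OF mm_okD(10)[OF ok] st _ ch]) (use al p in simp)
  qed
  from tens_lift_tens[OF M N MN this c(2-4)] show ?thesis
    by (simp add: tens_ext_def len[symmetric])
qed

text \<open>Each law for the extension is the same law for \<open>U\<close> at the expanded list.
  The tensor product itself is touched by an outer law only if it stands at that end of the list;
  then the action falls on its outer component. Otherwise the acted entry is a neighbour and the
  pair is carried along.\<close>

lemma tens_ext_ok: "mm_ok (ks @ [MN] @ ls) R al be V"
  unfolding mm_ok_def mm_laws_def
proof ((intro conjI allI impI ballI; (elim conjE)?), goal_cases)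
  note [simp] = M N MN al be F
  note U = mm_okD[OF ok]
  note laws = mm_lawsD[OF U(10)]
  {
    case 1
    show ?case using ks ls by (auto simp: mod_path_append)
  next
    case 2 show ?case by (rule U(2))
  next
    case 3 show ?case by (rule U(3))
  next
    case 4 show ?case by (rule U(4))
  next
    case 5 show ?case by (rule U(5))
  next
    case 6 show ?case by (rule U(6))
  next
    case (7 x p es q)
    from 7(2) show ?case
      by (rule chain_tens) (use 7(1) U(7)[OF _ chain_expand] in \<open>simp add: tens_ext_tens\<close>)
  next
    case (8 x p es q)
    from 8(2) show ?case
      by (rule chain_tens) (use 8(1) U(8)[OF _ chain_expand] in \<open>simp add: tens_ext_tens\<close>)
  next
    case (9 x p es q)
    from 9(2) show ?case
      by (rule chain_tens) (use 9(1) U(9)[OF _ chain_expand] in \<open>simp add: tens_ext_tens\<close>)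
  next
    case (10 x K Ms' a e es q)
    from 10(3) obtain es1 m n es2 where z: "e # es = es1 @ tens M N x m n # es2" "chain (prs ks x) (frt (tdom al) x a) es1 (lft M x m)"
      "m \<in> elt M x" "n \<in> elt N x" "rgt M x m = lft N x n"
      "chain (prs ls x) (rgt N x n) es2 q" by (rule chain_tens)
    have a [simp]: "a \<in> fel F x" using 10(2) by simp
    note ch = chain_expand[OF z(2-6)]
    show ?case
    proof (cases ks)
      case Nil
      then have FM: "sr M = F" and s: "es1 = []" "e = tens M N x m n" "es = es2" "K = MN" "frt F x a = lft M x m"
        using ks z 10(1) by (auto simp: chain_Nil_iff)
      have v: "V x (flt F x a) ([] @ tens M N x (la M x a m) n # es2) = U x (flt F x a) ([] @ la M x a m # n # es2)"
        by (rule tens_ext_tens) (use s z FM Nil in simp_all)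
      have v': "V x (frt F x a) ([] @ tens M N x m n # es2) = U x (frt F x a) ([] @ m # n # es2)"
        by (rule tens_ext_tens) (use s z FM Nil in simp_all)
      have t: "la MN x a (tens M N x m n) = tens M N x (la M x a m) n"
        using s z FM by simp
      have "U x (flt (tdom al) x a) (la M x a m # n # es2) =
          la R x (tpr al x a) (U x (frt (tdom al) x a) (m # n # es2))"
        by (rule laws(1)[OF _ 10(2), where q = q]) (use ch s(1) Nil in simp_all)
      then show ?thesis
        using v v' unfolding s(2-4) t al append_Nil by (simp only:)
    next
      case (Cons K' ks')
      then obtain es1' where s: "es1 = e # es1'" "es = es1' @ tens M N x m n # es2" "K' = K"
        using z(1,2) 10(1) by (auto simp: chain_Cons_iff)
      have K [simp]: "mx K" "sr K = F" using ks Cons s by auto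
      have c: "e \<in> elt K x" "lft K x e = frt F x a" "chain (prs ks' x) (rgt K x e) es1' (lft M x m)"
        using z(2) Cons s by simp_all
      have v: "V x (flt F x a) ((la K x a e # es1') @ tens M N x m n # es2) = U x (flt F x a) ((la K x a e # es1') @ m # n # es2)"
        by (rule tens_ext_tens) (use s z c Cons in simp_all)
      have v': "V x (frt F x a) ((e # es1') @ tens M N x m n # es2) = U x (frt F x a) ((e # es1') @ m # n # es2)"
        by (rule tens_ext_tens) (use s z c Cons in simp_all)
      have "U x (flt (tdom al) x a) (la K x a e # es1' @ m # n # es2) =
          la R x (tpr al x a) (U x (frt (tdom al) x a) (e # es1' @ m # n # es2))"
        by (rule laws(1)[OF _ 10(2), where q = q]) (use ch s(1,3) Cons in simp_all)
      then show ?thesis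
        using v v' unfolding s(2) al append_Cons by (simp only:)
    qed
  next
    case (11 x K Ms' p es e b)
    from 11(4) obtain es1 m n es2 where z: "es @ [e] = es1 @ tens M N x m n # es2" "chain (prs ks x) p es1 (lft M x m)"
      "m \<in> elt M x" "n \<in> elt N x" "rgt M x m = lft N x n"
      "chain (prs ls x) (rgt N x n) es2 (flt (tdom be) x b)" by (rule chain_tens)
    have b [simp]: "b \<in> fel G x" "p \<in> fOb F x" using 11(2,3) by simp_all
    note ch = chain_expand[OF z(2-6)]
    show ?case
    proof (cases ls rule: rev_cases)
      case Nil
      then have es2: "es2 = []" using z(6) by (simp add: chain_Nil_iff)
      then have FM: "tg N = G" and s: "es = es1" "e = tens M N x m n" "K = MN" "flt G x b = rgt N x n"
        using ls z 11(1) Nil by (auto simp: chain_Nil_iff)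
      have v: "V x p (es1 @ tens M N x m (ra N x n b) # []) = U x p (es1 @ m # ra N x n b # [])"
        by (rule tens_ext_tens) (use s z FM Nil in simp_all)
      have v': "V x p (es1 @ tens M N x m n # []) = U x p (es1 @ m # n # [])"
        by (rule tens_ext_tens) (use s z FM Nil in simp_all)
      have t: "ra MN x (tens M N x m n) b = tens M N x m (ra N x n b)"
        using s z FM by simp
      have "U x p ((es1 @ [m]) @ [ra N x n b]) = ra R x (U x p ((es1 @ [m]) @ [n])) (tpr be x b)"
        by (rule laws(2)[OF _ 11(2,3)]) (use ch s(4) Nil es2 in simp_all)
      then show ?thesis
        using v v' unfolding s(1-3) t append_assoc append_Cons append_Nil by (simp only:)
    next
      case (snoc ls' L)
      have K: "K = L" using 11(1) snoc by simp
      have L [simp]: "mx L" "tg L = G" using ls snoc by (auto simp: mod_path_append)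
      have "es2 \<noteq> []" using chain_length[OF z(6)] snoc by auto
      then obtain es2' where s: "es2 = es2' @ [e]" "es = es1 @ tens M N x m n # es2'"
        using z(1) by (cases es2 rule: rev_cases) auto
      have c': "chain (prs ls' x @ [mod_Pr L x]) (rgt N x n) (es2' @ [e]) (flt G x b)" using z(6) s snoc by simp
      have len': "length es2' = length (prs ls' x)" using chain_length[OF z(6)] s(1) snoc by simp
      obtain r where c: "chain (prs ls' x) (rgt N x n) es2' r" "chain [mod_Pr L x] r [e] (flt G x b)"
        using chain_splitE[OF c' len'] by blast
      have c2: "chain (prs ls x) (rgt N x n) (es2' @ [ra L x e b]) (frt G x b)"
        using chain_append[OF c(1), of "[mod_Pr L x]" "[ra L x e b]"] c(2) snoc by simp
      have v: "V x p (es1 @ tens M N x m n # (es2' @ [ra L x e b])) = U x p (es1 @ m # n # (es2' @ [ra L x e b]))"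
        by (rule tens_ext_tens[OF _ z(2-5) c2]) simp
      have v': "V x p (es1 @ tens M N x m n # (es2' @ [e])) = U x p (es1 @ m # n # (es2' @ [e]))"
        by (rule tens_ext_tens[OF _ z(2-5)]) (use z(6) s in simp_all)
      have "U x p ((es1 @ m # n # es2') @ [ra L x e b]) = ra R x (U x p ((es1 @ m # n # es2') @ [e])) (tpr be x b)"
        by (rule laws(2)[OF _ 11(2,3)]) (use ch s(1) snoc in simp_all)
      then show ?thesis
        using v v' unfolding s(2) K append_assoc append_Cons append_Nil by (simp only:)
    qed
  next
    case (12 x es es' p q)
    have mp: "mpt F (ks @ [MN] @ ls) G" using ks ls by (auto simp: mod_path_append)
    from istep_tens[OF 12(1,3) ks ls] obtain es1 m n es2 es1' m' n' es2' where
      s: "es = es1 @ tens M N x m n # es2" "es' = es1' @ tens M N x m' n' # es2'"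
      "length es1 = length ks" "length es1' = length ks" "m \<in> elt M x" "n \<in> elt N x"
      "rgt M x m = lft N x n" "m' \<in> elt M x" "n' \<in> elt N x"
      "rgt M x m' = lft N x n'" and
      st: "istep x (ks @ [M, N] @ ls) (es1 @ m # n # es2) (es1' @ m' # n' # es2')" by blast
    have p: "p \<in> fOb F x" using 12(2) by simp
    have split: "chain (prs ks x) p ds1 (lft M x k) \<and> chain (prs ls x) (rgt N x l) ds2 q"
      if "chain (prs (ks @ [MN] @ ls) x) p (ds1 @ tens M N x k l # ds2) q" "length ds1 = length ks"
        "k \<in> elt M x" "l \<in> elt N x" "rgt M x k = lft N x l" for ds1 k l ds2
    proof -
      have "chain (prs ks x @ (mod_Pr MN x # prs ls x)) p (ds1 @ tens M N x k l # ds2) q" using that(1) by simp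
      then show ?thesis
        by (rule chain_splitE) (use that in auto)
    qed
    have c: "chain (prs (ks @ [MN] @ ls) x) p (es1 @ tens M N x m n # es2) q" using 12(3) s by simp
    have c': "chain (prs (ks @ [MN] @ ls) x) p (es1' @ tens M N x m' n' # es2') q"
      using istep_chain[OF 12(1) mp 12(3)] s by simp
    note sp = split[OF c s(3,5-7)] split[OF c' s(4,8-10)]
    have "V x p (es1 @ tens M N x m n # es2) = U x p (es1 @ m # n # es2)"
      by (rule tens_ext_tens[OF p]) (use sp s in blast)+
    moreover have "V x p (es1' @ tens M N x m' n' # es2') = U x p (es1' @ m' # n' # es2')"
      by (rule tens_ext_tens[OF p]) (use sp s in blast)+
    \<comment> \<open>The move between the contracted lists has been lifted to one between these
      expansions, so inner equivariance of \<open>U\<close> applies once.\<close>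
    moreover have "U x p (es1 @ m # n # es2) = U x p (es1' @ m' # n' # es2')"
      by (rule laws(3)[OF st _ chain_expand[OF conjunct1[OF sp(1)] s(5-7) conjunct2[OF sp(1)]]]) (use p in simp)
    ultimately show ?case unfolding s(1,2) by simp
  next
    case (13 x a)
    then show ?case by simp
  next
    case (14 f p es q)
    let ?x = "dA f" and ?w = "cA f"
    from 14(3) obtain es1 m n es2 where z: "es = es1 @ tens M N ?x m n # es2" "chain (prs ks ?x) p es1 (lft M ?x m)"
      "m \<in> elt M ?x" "n \<in> elt N ?x" "rgt M ?x m = lft N ?x n"
      "chain (prs ls ?x) (rgt N ?x n) es2 q" by (rule chain_tens)
    have p: "p \<in> fOb F ?x" and f [simp]: "f \<in> Ar T" using 14 by simp_all
    have len: "length es1 = length ks" using chain_length[OF z(2)] by simp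
    let ?m = "mce M (ic f) m" and ?n = "mce N (ic f) n"
    have r: "rgt N ?x n \<in> fOb (tg N) ?x" using z by simp
    have lN: "lx (tg N)" by simp
    have a: "acts (ks @ [MN] @ ls) f es = acts ks f es1 @ tens M N ?w ?m ?n # acts ls f es2"
      "acts (ks @ [M, N] @ ls) f (es1 @ m # n # es2) = acts ks f es1 @ ?m # ?n # acts ls f es2"
      using z len by (simp_all add: acts_append)
    have v: "V ?w (far F f p) (acts ks f es1 @ tens M N ?w ?m ?n # acts ls f es2) =
        U ?w (far F f p) (acts ks f es1 @ ?m # ?n # acts ls f es2)"
      by (rule tens_ext_tens) (use p z acts_chain[OF ks F f p z(2)] acts_chain[OF ls lN f r z(6)] in simp_all)
    have v': "V ?x p (es1 @ tens M N ?x m n # es2) = U ?x p (es1 @ m # n # es2)"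
      by (rule tens_ext_tens[OF p z(2-6)])
    show ?case
      using laws(5)[OF f 14(2) chain_expand[OF z(2-6)]] v v' unfolding a a(1)[unfolded z(1)] z(1) al by (simp only:)
  }
qed

end

lemma tens_mm_opcartesian: "opcartesian (lax_vdbl T E) tens_mm"
proof (rule opcartesian_I[where P = MN], goal_cases)
  case 1 show ?case using tens_mm_multimodulation multimodulation_iff by blast
next
  case 2 show ?case by (rule tens_mm_simps)
next
  case 3 show ?case using M N MN by (simp add: tens_mm_simps)
next
  case 4 show ?case using M N MN by (simp add: tens_mm_simps)
next
  case 5 show ?case by (rule tens_mm_multimodulation)
next
  case (6 ks ls F G R al be U)
  have ks: "mpt F ks (sr M)" and ls: "mpt (tg N) ls G" using 6 M N MN by simp_all
  have ok: "mm_ok (ks @ [M, N] @ ls) R al be U" using 6(6) by (simp add: tens_mm_simps)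
  have "tens_ext (length ks) U x p (es1 @ mU tens_mm x r ds # es2) = U x p (es1 @ ds @ es2)"
    if "p \<in> fOb F x" "chain (prs ks x) p es1 r" "chain (prs (mdom tens_mm) x) r ds s" "chain (prs ls x) s es2 q" for x p es1 r ds s es2 q
  proof -
    from that(3) obtain m n where d: "ds = [m, n]" "m \<in> elt M x" "n \<in> elt N x" "lft M x m = r"
      "rgt M x m = lft N x n" "rgt N x n = s"
      by (auto simp: tens_mm_simps chain_pair_iff)
    show ?thesis
      using tens_ext_tens[OF ks ls 6(3-5) ok that(1), of es1 m n es2 q] that d tens_mm_mU[OF d(2,3,5,4)] by simp
  qed
  then show ?case using tens_ext_ok[OF ks ls 6(3-5) ok] by blast
next
  case (7 ks ls F G R al be V V' x p es q)
  from 7(10) show ?case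
  proof (rule chain_tens)
    fix es1 m n es2
    assume a: "es = es1 @ tens M N x m n # es2" "chain (prs ks x) p es1 (lft M x m)"
    "m \<in> elt M x" "n \<in> elt N x" "rgt M x m = lft N x n"
    "chain (prs ls x) (rgt N x n) es2 q"
    have d: "chain (prs (mdom tens_mm) x) (lft M x m) [m, n] (rgt N x n)" using a by (simp add: tens_mm_simps)
    show ?thesis
      using 7(8)[OF 7(9) a(2) d a(6)] unfolding tens_mm_mU[OF a(3-5) refl] a(1) .
  qed
qed

end

section \<open>The cell into the identity module is opcartesian\<close>

fun contract_r where
  "contract_r K x 0 es = ra K x (hd es) (hd (tl es)) # tl (tl es)"
| "contract_r K x (Suc k) es = hd es # contract_r K x k (tl es)"

text \<open>The mirror image of \<open>contract_r\<close>. That function lets an element of the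
  model act on the entry at position \<open>k\<close> to its left; this one serves the case where
  the identity module is first in the list, and acts on the entry to the right.\<close>

definition contract_l where
  "contract_l L x es = la L x (hd es) (hd (tl es)) # tl (tl es)"

lemma contract_r_append: "length es = k ==> contract_r K x k (es @ e # a # ds) = es @ ra K x e a # ds"
  by (induction k arbitrary: es) (auto simp: length_Suc_conv)

lemma contract_l_Cons [simp]: "contract_l L x (a # e # es) = la L x a e # es"
  by (simp add: contract_l_def)

context
  fixes F :: "('o, 'a, 'c, 'u) s_lax"
  assumes F: "lx F"
begin

abbreviation (input) "H \<equiv> hom_module F"

definition unit_mm where
  "unit_mm = mk_mmod [] (hom_module F) (tid F) (tid F) (\<lambda>x p es. uni F x p)"

lemma unit_mm_ok: "mm_ok [] (hom_module F) (tid F) (tid F) (\<lambda>x p es. uni F x p)"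
proof -
  note [simp] = F
  have no: "\<not> istep x [] es es'" for x :: 'o and es es' by (auto elim: istep.cases)
  show ?thesis
    unfolding mm_ok_def mm_laws_def
    by ((intro conjI allI impI ballI; (elim conjE)?)) (auto simp: no chain_Nil_iff lx_units)
qed

lemma unit_mm_simps: "mdom unit_mm = []" "mcod unit_mm = hom_module F"
  "mleft unit_mm = tid F" "mright unit_mm = tid F"
  by (simp_all add: unit_mm_def)

lemma unit_mm_multimodulation: "mmx unit_mm"
  unfolding unit_mm_def by (rule mm_ok_multimodulation(1)[OF unit_mm_ok])

lemma unit_mm_mU: "p \<in> fOb F x ==> mU unit_mm x p [] = uni F x p"
proof -
  assume p: "p \<in> fOb F x"
  have "sm_map (mcell unit_mm x (replicate (length ([] :: ('o, 'a, 'c, 'u) s_module list)) x)) (enc p []) =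
      uni F x p"
    unfolding unit_mm_def by (rule mm_ok_multimodulation(2)[OF unit_mm_ok]) (use p F in simp_all)
  then show ?thesis by (simp add: unit_mm_simps)
qed

lemma chain_r:
  assumes "chain (prs (ks @ [K, H] @ ls) x) p zs q"
  obtains es1 e a es2 where "zs = es1 @ e # a # es2" "length es1 = length ks" "chain (prs ks x) p es1 (lft K x e)"
    "e \<in> elt K x" "a \<in> fel F x" "rgt K x e = flt F x a"
    "chain (prs ls x) (frt F x a) es2 q"
proof -
  have "chain (prs (ks @ [K] @ (H # ls)) x) p zs q" using assms by simp
  from chain_mid[OF this] obtain es1 e es' where 1: "zs = es1 @ e # es'" "chain (prs ks x) p es1 (lft K x e)"
    "e \<in> elt K x" "chain (prs (H # ls) x) (rgt K x e) es' q" .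
  from 1(4) obtain a es2 where 2: "es' = a # es2" "a \<in> fel F x" "flt F x a = rgt K x e"
    "chain (prs ls x) (frt F x a) es2 q" using F by (auto simp: chain_Cons_iff)
  show thesis
    by (rule that[of es1 e a es2]) (use 1 2 chain_length[OF 1(2)] in simp_all)
qed

text \<open>Contraction turns a move between \<open>K\<close> and the identity module into an
  equality, by associativity of the right action. A move between the identity module and its right
  neighbour becomes a move between \<open>K\<close> and that neighbour, and the remaining moves
  survive as moves.\<close>

lemma istep_r:
  assumes "istep x (ks @ [K, H] @ ls) zs zs'" "chain (prs (ks @ [K, H] @ ls) x) p zs q"
    "mpt F0 (ks @ [K]) F" "mpt F ls G"
  shows "contract_r K x (length ks) zs = contract_r K x (length ks) zs' \<or>
    istep x (ks @ [K] @ ls) (contract_r K x (length ks) zs) (contract_r K x (length ks) zs')"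
  using assms
proof (induction ks arbitrary: zs zs' p F0)
  case Nil
  have K [simp]: "mx K" "tg K = F" "lx F" using Nil F by auto
  have "istep x (K # H # ls) zs zs'" using Nil by simp
  then show ?case
  proof (cases rule: istep.cases)
    case (istep_here e b e' es')
    then show ?thesis by simp
  next
    case (istep_there ds ds' e)
    have ch: "e \<in> elt K x" "chain (prs (H # ls) x) (rgt K x e) ds q" using Nil.prems(2) istep_there by auto
    have "istep x (H # ls) ds ds'" using istep_there by simp
    then show ?thesis
    proof (cases rule: istep.cases)
      case (istep_here a b e' L ls' es')
      have r: "rgt K x e = flt F x a" using ch(2) istep_here by simp
      have ab: "a \<in> fel F x" "b \<in> fel F x" "e' \<in> elt L x" "frt F x a = flt F x b" "frt F x b = lft L x e'"
        using istep_here by simp_all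
      have "istep x (K # L # ls') (ra K x (ra K x e a) b # e' # es') (ra K x e a # la L x b e' # es')"
        by (rule istep.istep_here) (use ab r ch in simp_all)
      then show ?thesis using istep_there(1,2) istep_here(1-3) ab(1,2,4) r ch(1) by simp
    next
      case (istep_there es es' a)
      then show ?thesis using \<open>zs = e # ds\<close> \<open>zs' = e # ds'\<close> by (simp add: istep.istep_there)
    qed
  qed
next
  case (Cons K1 ks)
  have K1 [simp]: "mx K1" "sr K1 = F0" and mp: "mpt (tg K1) (ks @ [K]) F" using Cons.prems(3) by auto
  have K [simp]: "mx K" "tg K = F" "lx F" using mp F by (auto simp: mod_path_append)
  obtain k ds where zs: "zs = k # ds" and ch: "chain (prs (ks @ [K, H] @ ls) x) (rgt K1 x k) ds q"
    using Cons.prems(2) by (auto simp: chain_Cons_iff)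
  have "istep x (K1 # (ks @ [K, H] @ ls)) (k # ds) zs'" using Cons.prems(1) zs(1) by simp
  then show ?case
  proof (cases rule: istep.cases)
    case (istep_here e b e' M' Ms' es')
    note h = istep_here
    from chain_r[OF ch] obtain es1 e1 a es2 where c: "ds = es1 @ e1 # a # es2" "length es1 = length ks"
      "e1 \<in> elt K x" "a \<in> fel F x" "rgt K x e1 = flt F x a" .
    show ?thesis
    proof (cases ks)
      case Nil
      then have s: "M' = K" "e' = e1" "es' = a # es2" using h c by auto
      have sK: "tg K1 = sr K" using mp Nil by simp
      have b: "b \<in> fel (sr K) x" "rgt K1 x e = flt (sr K) x b" "frt (sr K) x b = lft K x e1"
        using h(6,8,9) unfolding s sK by simp_all
      have "istep x (K1 # K # ls) (ra K1 x e b # ra K x e1 a # es2) (e # la K x b (ra K x e1 a) # es2)"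
        by (rule istep.istep_here) (use h(5) b c sK in simp_all)
      then show ?thesis using h(2-4) zs s Nil c b by simp
    next
      case (Cons K2 ks2)
      then obtain d es1' where es1: "es1 = d # es1'" using c(2) by (cases es1) auto
      have s: "M' = K2" "e' = d" "es' = es1' @ e1 # a # es2" "length es1' = length ks2" using h c es1 Cons by auto
      have "istep x (K1 # K2 # (ks2 @ [K] @ ls)) (ra K1 x e b # d # (es1' @ ra K x e1 a # es2)) (e # la K2 x b d # (es1' @ ra K x e1 a # es2))"
        by (rule istep.istep_here) (use h(5-9) s in simp_all)
      then show ?thesis using h(2-4) zs s Cons by (simp add: contract_r_append)
    qed
  next
    case (istep_there ds')
    have st: "istep x (ks @ [K, H] @ ls) ds ds'" and zs': "zs' = k # ds'" using istep_there by simp_all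
    from Cons.IH[OF st ch mp Cons.prems(4)] show ?thesis
      unfolding zs zs' by (auto intro: istep.istep_there)
  qed
qed

lemma istep_l:
  assumes "istep x (H # L # ls) zs zs'" "chain (prs (H # L # ls) x) p zs q" "mx L" "sr L = F"
  shows "contract_l L x zs = contract_l L x zs' \<or> istep x (L # ls) (contract_l L x zs) (contract_l L x zs')"
  using assms(1)
proof (cases rule: istep.cases)
  case (istep_here e b e' es')
  then show ?thesis using assms(3,4) F by simp
next
  case (istep_there ds ds' a)
  note [simp] = assms(3,4) F
  have a: "a \<in> fel F x" and ch: "chain (prs (L # ls) x) (frt F x a) ds q" using assms(2) istep_there by auto
  have "istep x (L # ls) ds ds'" using istep_there by simp
  then show ?thesis
  proof (cases rule: istep.cases)
    case (istep_here e b e' L' ls' es')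
    note h = istep_here
    have r: "frt F x a = lft L x e" using ch h by simp
    have "istep x (L # L' # ls') (ra L x (la L x a e) b # e' # es') (la L x a e # la L' x b e' # es')"
      by (rule istep.istep_here) (use h(4-8) a r in simp_all)
    then show ?thesis using istep_there(1,2) h(1-8) a r by simp
  next
    case (istep_there es es' e)
    then show ?thesis using \<open>zs = a # ds\<close> \<open>zs' = a # ds'\<close> by (simp add: istep.istep_there)
  qed
qed

text \<open>The extension sees the entry of the identity module only through its action on the entry
  of \<open>K\<close>. Its laws are laws of \<open>U\<close> at the contracted list, because the
  right action on \<open>K\<close> is associative, commutes with the left action and is respected by
  identity cells.\<close>

lemma unit_ext_r_ok:
  assumes ks: "mpt (tdom al) (ks @ [K]) F" and ls: "mpt F ls (tdom be)" and
    ok: "mm_ok (ks @ [K] @ ls) R al be U"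
  shows "mm_ok (ks @ [K, H] @ ls) R al be (\<lambda>x p es. U x p (contract_r K x (length ks) es))"
  unfolding mm_ok_def mm_laws_def
proof ((intro conjI allI impI ballI; (elim conjE)?), goal_cases)
  note U = mm_okD[OF ok]
  note laws = mm_lawsD[OF U(10)]
  have K [simp]: "mx K" "tg K = F" "lx F" "tx al" "tx be" "mx R" "tcod al = sr R" "tcod be = tg R"
    and mp: "mpt (tdom al) ks (sr K)"
    using ks F U by (auto simp: mod_path_append)
  have ch: "chain (prs (ks @ [K] @ ls) x) p (es1 @ ra K x e a # es2) q"
    if "chain (prs ks x) p es1 (lft K x e)" "e \<in> elt K x" "a \<in> fel F x"
      "rgt K x e = flt F x a" "chain (prs ls x) (frt F x a) es2 q" for x p es1 e a es2 q
    using chain_append[OF that(1), of "prs ([K] @ ls) x" "ra K x e a # es2" q] that by simp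
  {
    case 1
    show ?case using mp ls F by (auto simp: mod_path_append)
  next
    case 2 show ?case by simp
  next
    case 3 show ?case by simp
  next
    case 4 show ?case by simp
  next
    case 5 show ?case by simp
  next
    case 6 show ?case by simp
  next
    case (7 x p es q)
    from chain_r[OF 7(2)] obtain es1 e a es2 where z: "es = es1 @ e # a # es2" "length es1 = length ks"
      "chain (prs ks x) p es1 (lft K x e)" "e \<in> elt K x" "a \<in> fel F x" "rgt K x e = flt F x a"
      "chain (prs ls x) (frt F x a) es2 q" .
    show ?case unfolding z(1) contract_r_append[OF z(2)] by (rule U(7)[OF 7(1) ch[OF z(3-7)]])
  next
    case (8 x p es q)
    from chain_r[OF 8(2)] obtain es1 e a es2 where z: "es = es1 @ e # a # es2" "length es1 = length ks"
      "chain (prs ks x) p es1 (lft K x e)" "e \<in> elt K x" "a \<in> fel F x" "rgt K x e = flt F x a"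
      "chain (prs ls x) (frt F x a) es2 q" .
    show ?case unfolding z(1) contract_r_append[OF z(2)] by (rule U(8)[OF 8(1) ch[OF z(3-7)]])
  next
    case (9 x p es q)
    from chain_r[OF 9(2)] obtain es1 e a es2 where z: "es = es1 @ e # a # es2" "length es1 = length ks"
      "chain (prs ks x) p es1 (lft K x e)" "e \<in> elt K x" "a \<in> fel F x" "rgt K x e = flt F x a"
      "chain (prs ls x) (frt F x a) es2 q" .
    show ?case unfolding z(1) contract_r_append[OF z(2)] by (rule U(9)[OF 9(1) ch[OF z(3-7)]])
  next
    case (10 x M Ms' b e0 es q)
    from chain_r[OF 10(3)] obtain es1 e a es2 where z: "e0 # es = es1 @ e # a # es2" "length es1 = length ks"
      "chain (prs ks x) (frt (tdom al) x b) es1 (lft K x e)" "e \<in> elt K x" "a \<in> fel F x" "rgt K x e = flt F x a"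
      "chain (prs ls x) (frt F x a) es2 q" .
    note c = ch[OF z(3-7)]
    show ?case
    proof (cases ks)
      case Nil
      have s: "es1 = []" "M = K" "e0 = e" "es = a # es2" using z(1,2) 10(1) Nil by auto
      have r: "sr K = tdom al" "frt (tdom al) x b = lft K x e" using mp z(3) Nil s by (auto simp: chain_Nil_iff)
      have "U x (flt (tdom al) x b) (la K x b (ra K x e a) # es2) =
          la R x (tpr al x b) (U x (frt (tdom al) x b) (ra K x e a # es2))"
        by (rule laws(1)[OF _ 10(2), where q = q]) (use c s Nil in simp_all)
      then show ?thesis using r 10(2) z(4-6) Nil s by simp
    next
      case (Cons M0 ks')
      then obtain es1' where s: "es1 = e0 # es1'" "es = es1' @ e # a # es2" "M0 = M" "length es1' = length ks'"
        using z(1,2) 10(1) by (cases es1) auto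
      have "U x (flt (tdom al) x b) (la M x b e0 # es1' @ ra K x e a # es2) =
          la R x (tpr al x b) (U x (frt (tdom al) x b) (e0 # es1' @ ra K x e a # es2))"
        by (rule laws(1)[OF _ 10(2), where q = q]) (use c s Cons in simp_all)
      then show ?thesis using s Cons by (simp add: contract_r_append)
    qed
  next
    case (11 x M Ms' p es e0 b)
    from chain_r[OF 11(4)] obtain es1 e a es2 where z: "es @ [e0] = es1 @ e # a # es2" "length es1 = length ks"
      "chain (prs ks x) p es1 (lft K x e)" "e \<in> elt K x" "a \<in> fel F x" "rgt K x e = flt F x a"
      "chain (prs ls x) (frt F x a) es2 (flt (tdom be) x b)" .
    note c = ch[OF z(3-7)]
    show ?case
    proof (cases ls rule: rev_cases)
      case Nil
      have es2: "es2 = []" "frt F x a = flt (tdom be) x b" using z(7) Nil by (simp_all add: chain_Nil_iff)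
      have s: "es = es1 @ [e]" "e0 = a" "M = H" and FM: "tdom be = F" using z(1) es2 ls 11(1) Nil by auto
      \<comment> \<open>When the identity module is last, \<open>b\<close> acts on its entry by
        composition in \<open>F\<close>. Associativity turns this into a second action on the entry
        of \<open>K\<close>, which is the last one after contraction.\<close>
      have "U x p (es1 @ [ra K x (ra K x e a) b]) = ra R x (U x p (es1 @ [ra K x e a])) (tpr be x b)"
        by (rule laws(2)[OF _ 11(2,3)]) (use c es2 Nil in simp_all)
      moreover have "contract_r K x (length ks) (es1 @ e # cmp F x a b # []) = es1 @ [ra K x (ra K x e a) b]"
        "contract_r K x (length ks) (es1 @ e # a # []) = es1 @ [ra K x e a]"
        using contract_r_append[OF z(2)] z(4-6) 11(3) es2 FM by simp_all
      ultimately show ?thesis unfolding s using F by simp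
    next
      case (snoc ls' L)
      have Ms: "M = L" using 11(1) snoc by simp
      have "es2 \<noteq> []" using chain_length[OF z(7)] snoc by auto
      then obtain es2' where s: "es2 = es2' @ [e0]" "es = es1 @ e # a # es2'"
        using z(1) by (cases es2 rule: rev_cases) auto
      have "U x p ((es1 @ ra K x e a # es2') @ [ra L x e0 b]) = ra R x (U x p ((es1 @ ra K x e a # es2') @ [e0])) (tpr be x b)"
        by (rule laws(2)[OF _ 11(2,3)]) (use c s(1) snoc in simp_all)
      then show ?thesis unfolding s(2) Ms by (simp add: contract_r_append[OF z(2)])
    qed
  next
    case (12 x es es' p q)
    have mpH: "mpt (tdom al) (ks @ [K, H] @ ls) (tdom be)" using mp ls F by (auto simp: mod_path_append)
    from chain_r[OF 12(3)] obtain es1 e a es2 where z: "es = es1 @ e # a # es2" "length es1 = length ks"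
      "chain (prs ks x) p es1 (lft K x e)" "e \<in> elt K x" "a \<in> fel F x" "rgt K x e = flt F x a"
      "chain (prs ls x) (frt F x a) es2 q" .
    have c: "chain (prs (ks @ [K] @ ls) x) p (contract_r K x (length ks) es) q"
      unfolding z(1) contract_r_append[OF z(2)] by (rule ch[OF z(3-7)])
    from istep_r[OF 12(1,3) ks ls] show ?case
    proof
      assume "contract_r K x (length ks) es = contract_r K x (length ks) es'"
      then show ?case by (simp only:)
    next
      assume "istep x (ks @ [K] @ ls) (contract_r K x (length ks) es) (contract_r K x (length ks) es')"
      then show ?case by (rule laws(3)[OF _ 12(2) c])
    qed
  next
    case (13 x a)
    then show ?case by simp
  next
    case (14 f p es q)
    let ?x = "dA f" and ?w = "cA f"
    from chain_r[OF 14(3)] obtain es1 e a es2 where z: "es = es1 @ e # a # es2" "length es1 = length ks"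
      "chain (prs ks ?x) p es1 (lft K ?x e)" "e \<in> elt K ?x" "a \<in> fel F ?x" "rgt K ?x e = flt F ?x a"
      "chain (prs ls ?x) (frt F ?x a) es2 q" .
    note f [simp] = 14(1)
    have len: "length (acts ks f es1) = length ks" using z(2) by (simp add: acts_def)
    have m: "mce K (ic f) (ra K ?x e a) = ra K ?w (mce K (ic f) e) (fce F (ic f) a)"
      using md_hcomp(2)[OF K(1) refl refl, of "ic f" "ic f" e a] z(4-6) hcomp_units(1)[of "ic f"] by simp
    have a1: "acts (ks @ [K, H] @ ls) f es = acts ks f es1 @ mce K (ic f) e # fce F (ic f) a # acts ls f es2"
      and a2: "acts (ks @ [K] @ ls) f (es1 @ ra K ?x e a # es2) = acts ks f es1 @ ra K ?w (mce K (ic f) e) (fce F (ic f) a) # acts ls f es2"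
      using z(2) m F by (simp_all add: acts_append z(1))
    show ?case
      using laws(5)[OF f 14(2) ch[OF z(3-7)]] unfolding z(1) a1[unfolded z(1)] a2 contract_r_append[OF z(2)] contract_r_append[OF len] .
  }
qed

lemma unit_ext_l_ok:
  assumes al: "tdom al = F" and L: "mx L" "sr L = F" and ls: "mpt (tg L) ls (tdom be)" and
    ok: "mm_ok (L # ls) R al be U"
  shows "mm_ok (H # L # ls) R al be (\<lambda>x p es. U x p (contract_l L x es))"
  unfolding mm_ok_def mm_laws_def al
proof ((intro conjI allI impI ballI; (elim conjE)?), goal_cases)
  note U = mm_okD[OF ok, unfolded al]
  note laws = mm_lawsD[OF mm_okD(10)[OF ok], unfolded al]
  note [simp] = L F U(2-6) al
  have split: "\<exists>a e es2. es = a # e # es2 \<and> a \<in> fel F x \<and> e \<in> elt L x \<and> flt F x a = p \<and>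
      frt F x a = lft L x e \<and> chain (prs ls x) (rgt L x e) es2 q \<and>
      chain (prs (L # ls) x) p (la L x a e # es2) q"
    if c: "chain (prs (H # L # ls) x) p es q" for x p es q
  proof -
    from c obtain a e es2 where "es = a # e # es2" "a \<in> fel F x" "e \<in> elt L x" "flt F x a = p"
      "lft L x e = frt F x a" "chain (prs ls x) (rgt L x e) es2 q"
      by (auto simp: chain_Cons_iff)
    then show ?thesis by (intro exI[of _ a] exI[of _ e] exI[of _ es2]) simp
  qed
  {
    case 1
    show ?case using ls by simp
  next
    case 2 show ?case by simp
  next
    case 3 show ?case by simp
  next
    case 4 show ?case by simp
  next
    case 5 show ?case by simp
  next
    case 6 show ?case by simp
  next
    case (7 x p es q)
    from split[OF 7(2)] U(7)[OF 7(1)] show ?case by (elim exE conjE) (simp only: contract_l_Cons)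
  next
    case (8 x p es q)
    from split[OF 8(2)] U(8)[OF 8(1)] show ?case by (elim exE conjE) (simp only: contract_l_Cons)
  next
    case (9 x p es q)
    from split[OF 9(2)] U(9)[OF 9(1)] show ?case by (elim exE conjE) (simp only: contract_l_Cons)
  next
    case (10 x M Ms' b e0 es q)
    from split[OF 10(3)] obtain a e es2 where z: "e0 # es = a # e # es2" "a \<in> fel F x" "e \<in> elt L x" "flt F x a = frt F x b"
      "frt F x a = lft L x e" "chain (prs (L # ls) x) (frt F x b) (la L x a e # es2) q" by blast
    have s: "M = H" "e0 = a" "es = e # es2" using 10(1) z(1) by auto
    have "U x (flt F x b) (la L x b (la L x a e) # es2) = la R x (tpr al x b) (U x (frt F x b) (la L x a e # es2))"
      by (rule laws(1)[OF refl 10(2) z(6)])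
    moreover have "la L x b (la L x a e) = la L x (cmp F x b a) e" using 10(2) z by simp
    ultimately show ?case unfolding s by simp
  next
    case (11 x M Ms' p es e0 b)
    from split[OF 11(4)] obtain a e es2 where z: "es @ [e0] = a # e # es2" "a \<in> fel F x" "e \<in> elt L x" "flt F x a = p"
      "frt F x a = lft L x e" "chain (prs ls x) (rgt L x e) es2 (flt (tdom be) x b)"
      "chain (prs (L # ls) x) p (la L x a e # es2) (flt (tdom be) x b)" by blast
    show ?case
    proof (cases es2 rule: rev_cases)
      case Nil
      then have "ls = []" using chain_length[OF z(6)] by simp
      then have r: "tg L = tdom be" "rgt L x e = flt (tdom be) x b" and s: "M = L" "es = [a]" "e0 = e"
        using ls z(1,6) Nil 11(1) by (auto simp: chain_Nil_iff)
      have "U x p ([] @ [ra L x (la L x a e) b]) = ra R x (U x p ([] @ [la L x a e])) (tpr be x b)"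
        by (rule laws(2)[OF _ 11(2,3)]) (use z(7) Nil \<open>ls = []\<close> in simp_all)
      moreover have "ra L x (la L x a e) b = la L x a (ra L x e b)" using z r 11(3) by simp
      ultimately show ?thesis unfolding s by simp
    next
      case (snoc es2' e1)
      then have s: "e1 = e0" "es = a # e # es2'" using z(1) by auto
      have "ls \<noteq> []" using chain_length[OF z(6)] snoc by auto
      then obtain ls' where ls': "ls = ls' @ [M]" using 11(1) by (cases ls rule: rev_cases) auto
      have "U x p ((la L x a e # es2') @ [ra M x e0 b]) = ra R x (U x p ((la L x a e # es2') @ [e0])) (tpr be x b)"
        by (rule laws(2)[OF _ 11(2,3), where Ms' = "L # ls'"]) (use z(7) s snoc ls' in simp_all)
      then show ?thesis unfolding s by simp
    qed
  next
    case (12 x es es' p q)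
    from split[OF 12(3)] have c: "chain (prs (L # ls) x) p (contract_l L x es) q" by (elim exE conjE) (simp only: contract_l_Cons)
    from istep_l[OF 12(1,3) L] show ?case
    proof
      assume "contract_l L x es = contract_l L x es'"
      then show ?case by (simp only:)
    next
      assume "istep x (L # ls) (contract_l L x es) (contract_l L x es')"
      then show ?case by (rule laws(3)[OF _ 12(2) c])
    qed
  next
    case (13 x a)
    then show ?case by simp
  next
    case (14 f p es q)
    let ?x = "dA f" and ?w = "cA f"
    from split[OF 14(3)] obtain a e es2 where z: "es = a # e # es2" "a \<in> fel F ?x" "e \<in> elt L ?x"
      "frt F ?x a = lft L ?x e" "chain (prs (L # ls) ?x) p (la L ?x a e # es2) q" by blast
    note f [simp] = 14(1)
    have "mce L (ic f) (la L ?x a e) = la L ?w (fce F (ic f) a) (mce L (ic f) e)"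
      using md_hcomp(1)[OF L(1) refl refl, of "ic f" "ic f" a e] z(2-4) hcomp_units(1)[of "ic f"] by simp
    then show ?case using laws(5)[OF f 14(2) z(5)] unfolding z(1) by simp
  }
qed

text \<open>Here the identity module is alone and has no neighbour. Its entry acts instead on the
  value of \<open>U\<close>, through \<open>al\<close> from the left; the law for no arguments says
  that acting through \<open>be\<close> from the right would give the same.\<close>

lemma unit_ext_ok:
  assumes al: "tdom al = F" and be: "tdom be = F" and ok: "mm_ok [] R al be U"
  shows "mm_ok [H] R al be (\<lambda>x p es. la R x (tpr al x (hd es)) (U x (frt F x (hd es)) []))"
  unfolding mm_ok_def mm_laws_def al be
proof ((intro conjI allI impI ballI; (elim conjE)?), goal_cases)
  note U = mm_okD[OF ok, unfolded al be]
  note laws = mm_lawsD[OF mm_okD(10)[OF ok], unfolded al be]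
  note [simp] = F U(2-6) al be
  have u [simp]: "U x p [] \<in> elt R x" "lft R x (U x p []) = tob al x p"
    "rgt R x (U x p []) = tob be x p" if "p \<in> fOb F x" for x p
    using U(7-9)[of p x "[]" p] that by simp_all
  {
    case (10 x M Ms' b e es q)
    then have "M = H" "es = []" "e \<in> fel F x" "flt F x e = frt F x b" by (auto simp: chain_Cons_iff chain_Nil_iff)
    with 10(2) show ?case by simp
  next
    case (11 x M Ms' p es e b)
    have es: "es = []" using chain_length[OF 11(4)] by simp
    then have M: "M = H" "e \<in> fel F x" "frt F x e = flt F x b" "flt F x e = p"
      using 11(1,4) by (auto simp: chain_Cons_iff chain_Nil_iff)
    have "la R x (tpr al x (cmp F x e b)) (U x (frt F x b) []) =
        la R x (tpr al x e) (la R x (tpr al x b) (U x (frt F x b) []))"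
      using M 11(3) by simp
    \<comment> \<open>The law for no arguments converts the left action through \<open>al\<close>
      into a right action through \<open>be\<close>, as right equivariance demands.\<close>
    also have "la R x (tpr al x b) (U x (frt F x b) []) = ra R x (U x (flt F x b) []) (tpr be x b)"
      using laws(4)[OF refl 11(3)] by simp
    also have "la R x (tpr al x e) (ra R x (U x (flt F x b) []) (tpr be x b)) =
        ra R x (la R x (tpr al x e) (U x (flt F x b) [])) (tpr be x b)"
      using M 11(3) by simp
    finally show ?case using M 11(3) es by simp
  next
    case (14 f p es q)
    then obtain a where a: "es = [a]" "a \<in> fel F (dA f)" "flt F (dA f) a = p" "frt F (dA f) a = q"
      by (auto simp: chain_single_iff)
    let ?x = "dA f" and ?w = "cA f" and ?S = "sr R"
    note [simp] = 14(1) a(2)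
    have q: "q \<in> fOb F ?x" using a by auto
    let ?u = "U ?w (far F f q) []"
    \<comment> \<open>Naturality of \<open>al\<close> at the entry \<open>a\<close> moves the
      component at \<open>f\<close> from the left end of \<open>a\<close> to its right end, where
      the law of \<open>U\<close> along \<open>f\<close> can be used.\<close>
    have nat: "cmp ?S ?w (tar al f p) (tpr al ?w (fce F (ic f) a)) =
        cmp ?S ?w (fce ?S (ic f) (tpr al ?x a)) (tar al f q)"
      using tx_nat_arrow[OF U(3) al U(5) 14(1), of a] a by simp
    have l5: "la R ?w (tar al f q) ?u = ra R ?w (mce R (ic f) (U ?x q [])) (tar be f q)"
      using laws(5)[OF 14(1) q, of "[]" q] by simp
    have md: "mce R (ic f) (la R ?x (tpr al ?x a) (U ?x q [])) =
        la R ?w (fce ?S (ic f) (tpr al ?x a)) (mce R (ic f) (U ?x q []))"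
      using md_hcomp(1)[OF U(2) refl refl, of "ic f" "ic f" "tpr al ?x a" "U ?x q []"] a q
        hcomp_units(1)[of "ic f"] by simp
    have "la R ?w (tar al f p) (la R ?w (tpr al ?w (fce F (ic f) a)) ?u) =
        la R ?w (cmp ?S ?w (tar al f p) (tpr al ?w (fce F (ic f) a))) ?u"
      using a q by auto
    also have "... = la R ?w (fce ?S (ic f) (tpr al ?x a)) (la R ?w (tar al f q) ?u)"
      unfolding nat using a q by auto
    also have "... = ra R ?w (la R ?w (fce ?S (ic f) (tpr al ?x a)) (mce R (ic f) (U ?x q []))) (tar be f q)"
      unfolding l5 using a q by auto
    finally show ?case using a q unfolding md[symmetric] by auto
  }
qed (auto simp: F al be mm_okD[OF ok] chain_single_iff mm_okD(7-9)[OF ok, unfolded al be, where es = "[]"] chain_Nil_iff)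

lemma unit_mm_opcartesian: "opcartesian (lax_vdbl T E) unit_mm"
proof (rule opcartesian_I[where P = H], goal_cases)
  case 1 show ?case using unit_mm_multimodulation multimodulation_iff by blast
next
  case 2 show ?case by (rule unit_mm_simps)
next
  case 3 show ?case using F by (simp add: unit_mm_simps)
next
  case 4 show ?case using F by (simp add: unit_mm_simps)
next
  case 5 show ?case by (rule unit_mm_multimodulation)
next
  case (6 ks ls F0 G R al be U)
  have ks: "mpt F0 ks F" and ls: "mpt F ls G" using 6(1,2) F by simp_all
  have ok: "mm_ok (ks @ ls) R al be U" using 6(6) by (simp add: unit_mm_simps)
  note U = mm_okD[OF ok, unfolded 6(4,5)]
  note [simp] = F
  \<comment> \<open>The values of \<open>unit_mm\<close> are the units of \<open>F\<close>, so an
    extension is correct if inserting a unit does not change its value. Which extension to take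
    depends on the presence of a neighbour: left if possible, else right, else none.\<close>
  have red: "(\<exists>V. mm_ok (ks @ [H] @ ls) R al be V \<and> (\<forall>x p es1 r ds s es2 q. p \<in> fOb F0 x \<and> chain (prs ks x) p es1 r \<and>
        chain (prs (mdom unit_mm) x) r ds s \<and> chain (prs ls x) s es2 q --> V x p (es1 @ mU unit_mm x r ds # es2) = U x p (es1 @ ds @ es2)))"
    if V: "mm_ok (ks @ [H] @ ls) R al be V"
      "\<And>x p es1 r es2 q. p \<in> fOb F0 x ==> r \<in> fOb F x ==> chain (prs ks x) p es1 r ==> chain (prs ls x) r es2 q ==>
        V x p (es1 @ uni F x r # es2) = U x p (es1 @ es2)" for V
  proof (rule exI[of _ V], rule conjI[OF V(1)], intro allI impI, elim conjE)
    fix x p es1 r ds s es2 q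
    assume a: "p \<in> fOb F0 x" "chain (prs ks x) p es1 r" "chain (prs (mdom unit_mm) x) r ds s" "chain (prs ls x) s es2 q"
    have d: "ds = []" "s = r" using a(3) by (simp_all add: unit_mm_simps chain_Nil_iff)
    have r: "r \<in> fOb F x" using chain_end_in[OF ks 6(3) a(1,2)] .
    show "V x p (es1 @ mU unit_mm x r ds # es2) = U x p (es1 @ ds @ es2)"
      using V(2)[OF a(1) r a(2) a(4)[unfolded d]] unit_mm_mU[OF r] unfolding d by simp
  qed
  show ?case
  proof (cases ks rule: rev_cases)
    case (snoc ks' K)
    have K: "mx K" "tg K = F" using ks snoc by (auto simp: mod_path_append)
    note [simp] = K
    show ?thesis
    proof (rule red[of "\<lambda>x p es. U x p (contract_r K x (length ks') es)"], goal_cases)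
      case 1
      show ?case using unit_ext_r_ok[of al ks' K ls be R U] ks ls ok 6(4,5) snoc by simp
    next
      case (2 x p es1 r es2 q)
      have c: "chain (prs ks' x @ [mod_Pr K x]) p es1 r" using 2(3) snoc by simp
      from chain_split[OF this] obtain es1' e where e: "es1 = es1' @ [e]" "chain (prs ks' x) p es1' (lft K x e)"
        "e \<in> elt K x" "rgt K x e = r" by (auto simp: chain_single_iff)
      have len: "length es1' = length ks'" using chain_length[OF e(2)] by simp
      show ?case using contract_r_append[OF len, of K x e "uni F x r" es2] e by simp
    qed
  next
    case Nil
    then have F0: "F0 = F" using ks by simp
    show ?thesis
    proof (cases ls)
      case (Cons L ls')
      have L: "mx L" "sr L = F" "mpt (tg L) ls' G" using ls Cons by auto
      note [simp] = L
      show ?thesis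
      proof (rule red[of "\<lambda>x p es. U x p (contract_l L x es)"], goal_cases)
        case 1
        show ?case using unit_ext_l_ok[of al L ls' be R U] L ok 6(4,5) F0 Nil Cons by simp
      next
        case (2 x p es1 r es2 q)
        then have "es1 = []" "p = r" using Nil by (auto simp: chain_Nil_iff)
        moreover obtain e es2' where "es2 = e # es2'" "e \<in> elt L x" "lft L x e = r"
          using 2(4) Cons by (auto simp: chain_Cons_iff)
        ultimately show ?case by simp
      qed
    next
      case Nil2: Nil
      then have G: "G = F" using ls by simp
      show ?thesis
      proof (rule red[of "\<lambda>x p es. la R x (tpr al x (hd es)) (U x (frt F x (hd es)) [])"], goal_cases)
        case 1
        show ?case using unit_ext_ok[of al be R U] ok 6(4,5) F0 G Nil Nil2 by simp
      next
        case (2 x p es1 r es2 q)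
        have a: "tdom al = F" "tdom be = F" using 6(4,5) F0 G by simp_all
        have s: "es1 = []" "es2 = []" "p = r" using 2 Nil Nil2 by (auto simp: chain_Nil_iff)
        have "U x r [] \<in> elt R x" "lft R x (U x r []) = tob al x r"
          using U(7,8)[of r x "[]" r] 2(2) F0 Nil Nil2 by simp_all
        then show ?case using s a 2(2) U(2-6) by simp
      qed
    qed
  qed
next
  case (7 ks ls F0 G R al be V V' x p es q)
  have ks: "mpt F0 ks F" and ls: "mpt F ls G" using 7(1,2) F by simp_all
  note [simp] = F
  note lV = mm_lawsD[OF mm_okD(10)[OF 7(6)], unfolded 7(4,5)] and lV' = mm_lawsD[OF mm_okD(10)[OF 7(7)], unfolded 7(4,5)]
  have agree: "V x p (es1 @ uni F x r # es2) = V' x p (es1 @ uni F x r # es2)"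
    if "p \<in> fOb F0 x" "chain (prs ks x) p es1 r" "chain (prs ls x) r es2 q" for p es1 r es2 q
  proof -
    have r: "r \<in> fOb F x" using chain_end_in[OF ks 7(3) that(1,2)] .
    have "chain (prs (mdom unit_mm) x) r [] r" by (simp add: unit_mm_simps)
    from 7(8)[OF that(1,2) this that(3)] show ?thesis unfolding unit_mm_mU[OF r] .
  qed
  show ?case
  proof (cases ks rule: rev_cases)
    case (snoc ks' K)
    have K: "mx K" "tg K = F" using ks snoc by (auto simp: mod_path_append)
    note [simp] = K
    have "chain (prs (ks' @ [K, H] @ ls) x) p es q" using 7(10) snoc by simp
    from chain_r[OF this] obtain es1 e a es2 where z: "es = es1 @ e # a # es2" "length es1 = length ks'"
      "chain (prs ks' x) p es1 (lft K x e)" "e \<in> elt K x" "a \<in> fel F x" "rgt K x e = flt F x a"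
      "chain (prs ls x) (frt F x a) es2 q" .
    let ?u = "uni F x (frt F x a)"
    \<comment> \<open>The entry \<open>a\<close> is the composite of \<open>a\<close> with the unit
      at its right end. Moving \<open>a\<close> onto the entry of \<open>K\<close> leaves that unit
      in its place, and there the two families agree by hypothesis.\<close>
    have "istep x (K # H # ls) (ra K x e a # ?u # es2) (e # la H x a ?u # es2)"
      by (rule istep_here) (use z in simp_all)
    then have st: "istep x (ks @ [H] @ ls) (es1 @ ra K x e a # ?u # es2) es"
      using istep_append[of x "K # H # ls" _ _ es1 ks'] z snoc by simp
    have c1: "chain (prs ks x) p (es1 @ [ra K x e a]) (frt F x a)"
      using chain_append[OF z(3), of "[mod_Pr K x]" "[ra K x e a]"] z snoc by simp
    have c: "chain (prs (ks @ [H] @ ls) x) p (es1 @ ra K x e a # ?u # es2) q"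
      using chain_append[OF c1, of "prs (H # ls) x" "?u # es2" q] z by simp
    show ?thesis
      using lV(3)[OF st 7(9) c] lV'(3)[OF st 7(9) c] agree[OF 7(9) c1 z(7)] by simp
  next
    case Nil
    then have F0: "F0 = F" using ks by simp
    show ?thesis
    proof (cases ls)
      case (Cons L ls')
      have L: "mx L" "sr L = F" using ls Cons by auto
      note [simp] = L
      from 7(10) obtain a e es2 where z: "es = a # e # es2" "a \<in> fel F x" "e \<in> elt L x" "flt F x a = p"
        "lft L x e = frt F x a" "chain (prs ls' x) (rgt L x e) es2 q"
        using Nil Cons by (auto simp: chain_Cons_iff)
      let ?u = "uni F x p"
      have p: "p \<in> fOb F x" using 7(9) F0 by simp
      \<comment> \<open>The mirror image: \<open>a\<close> is a composite that begins with a unit,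
        and the move carries \<open>a\<close> onto the right neighbour.\<close>
      have "istep x (H # L # ls') (ra H x ?u a # e # es2) (?u # la L x a e # es2)"
        by (rule istep_here) (use z p in simp_all)
      then have st: "istep x (ks @ [H] @ ls) es (?u # la L x a e # es2)" using z Nil Cons p by simp
      have c: "chain (prs ls x) p (la L x a e # es2) q" using z Cons by simp
      show ?thesis
        using lV(3)[OF st 7(9,10)] lV'(3)[OF st 7(9,10)] agree[OF 7(9) _ c, of "[]"] Nil by simp
    next
      case Nil2: Nil
      from 7(10) obtain a where z: "es = [a]" "a \<in> fel F x" "flt F x a = p"
        using Nil Nil2 by (auto simp: chain_single_iff)
      let ?q = "frt F x a" and ?u = "uni F x (frt F x a)"
      have q: "?q \<in> fOb F0 x" using z F0 by simp
      have Ms: "ks @ [H] @ ls = H # []" using Nil Nil2 by simp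
      have a0: "a \<in> fel F0 x" using z F0 by simp
      have c: "chain (prs (ks @ [H] @ ls) x) (frt F0 x a) [?u] ?q" using z q F0 Nil Nil2 by simp
      \<comment> \<open>With no neighbour, outer left equivariance takes the place of a move:
        \<open>a\<close> is the result of \<open>a\<close> acting on a unit of the identity module,
        and it can be pulled out of either family.\<close>
      have "W x (flt F0 x a) [la H x a ?u] = la R x (tpr al x a) (W x (frt F0 x a) [?u])"
        if "W = V \<or> W = V'" for W
        using that lV(1)[OF Ms a0 c] lV'(1)[OF Ms a0 c] by blast
      moreover have "V x ?q [?u] = V' x ?q [?u]" using agree[OF q, of "[]" ?q "[]" ?q] Nil Nil2 by simp
      moreover have "la H x a ?u = a" using z by simp
      ultimately show ?thesis using z F0 by metis
    qed
  qed
qed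

end

section \<open>The opcartesian cells determine the structure of the double category\<close>

lemma comp_mU:
  assumes "mmpath al phs be" "mdom psi = map mcod phs" "p \<in> fOb (tdom al) x" "meval (mms x phs) p ess vs q" "concat ess = es"
  shows "mU (mcm al phs psi) x p es = mU psi x (tob al x p) vs"
  using mmod_comp_mU(1)[OF assms(1,3,4), of psi] assms(2,5) by simp

lemma unary_mmpath [simp]: "mux c ==> mm_typed (unary T c)"
  by (simp add: unary_typed modulation_typed)

lemma tens_mm_typed [simp]: "mx M ==> mx N ==> tg M = sr N ==> mm_typed (tens_mm M N)"
  using tens_mm_multimodulation multimodulation_iff by blast

lemma unit_mm_typed [simp]: "lx F ==> mm_typed (unit_mm F)"
  using unit_mm_multimodulation multimodulation_iff by blast

lemma mm_bd [simp]: "mx M ==> mx N ==> tg M = sr N ==> mdom (tens_mm M N) = [M, N]"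
  "mx M ==> mx N ==> tg M = sr N ==> mcod (tens_mm M N) = tensor M N"
  "mx M ==> mx N ==> tg M = sr N ==> mleft (tens_mm M N) = tid (sr M)"
  "mx M ==> mx N ==> tg M = sr N ==> mright (tens_mm M N) = tid (tg N)"
  "lx F ==> mdom (unit_mm F) = []" "lx F ==> mcod (unit_mm F) = hom_module F"
  "lx F ==> mleft (unit_mm F) = tid F" "lx F ==> mright (unit_mm F) = tid F"
  using tens_mm_simps unit_mm_simps by blast+

lemma unary_comp:
  assumes "mux c" "mux d" "ocod c = odom d"
  shows "unary T (cell_comp c d) = mcm (oleft c) [unary T c] (unary T d)"
proof (rule mm_eqI, goal_cases)
  note [simp] = assms
  have path: "mmpath (oleft c) [unary T c] (oright c)" by simp
  {
    case 2
    show ?case by (rule mmod_comp_typed(1)[OF path]) simp_all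
  next
    case (7 x p es q)
    then obtain m where m: "es = [m]" "m \<in> elt (odom c) x" "lft (odom c) x m = p"
      by (auto simp: chain_single_iff)
    have p: "p \<in> fOb (tdom (oleft c)) x" using m by auto
    have "meval (mms x [unary T c]) p [[m]] [om c x m] (rgt (odom c) x m)" using m by simp
    from comp_mU[OF path _ p this, of "unary T d" es] m show ?case by simp
  }
qed (use assms in simp_all)

text \<open>Each composite is evaluated at a list by exhibiting its cutting as an instance of
  \<open>meval\<close>. Both sides here arrive at the class of the pair of images; the equations for
  units and constraints are treated in the same manner.\<close>

lemma tens_comp:
  assumes c: "mux c" and d: "mux d" and cd: "oright c = oleft d"
  shows "mcm (tid (sr (odom c))) [tens_mm (odom c) (odom d)] (unary T (cell_tensor c d)) =
    mcm (oleft c) [unary T c, unary T d] (tens_mm (ocod c) (ocod d))"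
proof (rule mm_eqI, goal_cases)
  note [simp] = c d cd hcomp_compat[OF c d cd]
  let ?F = "sr (odom c)"
  have path: "mmpath (tid ?F) [tens_mm (odom c) (odom d)] (tid (tg (odom d)))" by simp
  have path': "mmpath (oleft c) [unary T c, unary T d] (oright d)" by simp
  {
    case 1
    show ?case by (rule mmod_comp_typed(1)[OF path]) simp_all
  next
    case 2
    show ?case by (rule mmod_comp_typed(1)[OF path']) simp_all
  next
    case 3 show ?case by simp
  next
    case 4 show ?case by simp
  next
    case 5 show ?case by simp
  next
    case 6 show ?case by simp
  next
    case (7 x p es q)
    then obtain m n where m: "es = [m, n]" "m \<in> elt (odom c) x" "n \<in> elt (odom d) x" "lft (odom c) x m = p"
        "rgt (odom c) x m = lft (odom d) x n"
      by (auto simp: chain_pair_iff)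
    have p: "p \<in> fOb ?F x" using m by auto
    have t: "mU (tens_mm (odom c) (odom d)) x p [m, n] = tens (odom c) (odom d) x m n"
      by (rule tens_mm_mU) (use m in simp_all)
    have e1: "meval (mms x [tens_mm (odom c) (odom d)]) p [[m, n]] [tens (odom c) (odom d) x m n] (rgt (odom d) x n)"
      using m t by simp
    have e2: "meval (mms x [unary T c, unary T d]) p [[m], [n]] [om c x m, om d x n] (rgt (odom d) x n)"
      using m by simp
    have l: "mU (mcm (tid ?F) [tens_mm (odom c) (odom d)] (unary T (cell_tensor c d))) x p es =
        tens (ocod c) (ocod d) x (om c x m) (om d x n)"
      using comp_mU[OF path _ _ e1, of "unary T (cell_tensor c d)" es] p m cell_tensor_om[OF c d cd m(2,3,5)] by simp
    have t': "mU (tens_mm (ocod c) (ocod d)) x (tob (oleft c) x p) [om c x m, om d x n] =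
        tens (ocod c) (ocod d) x (om c x m) (om d x n)"
      by (rule tens_mm_mU) (use m in simp_all)
    show ?case
      unfolding l using comp_mU[OF path' _ _ e2, of "tens_mm (ocod c) (ocod d)" es] p m t' by simp
  }
qed

lemma unit_comp:
  assumes f: "tx f"
  shows "mcm (tid (tdom f)) [unit_mm (tdom f)] (unary T (hom_cell f)) =
    mcm f [] (unit_mm (tcod f))"
proof (rule mm_eqI, goal_cases)
  note [simp] = f
  have path: "mmpath (tid (tdom f)) [unit_mm (tdom f)] (tid (tdom f))" by simp
  have path': "mmpath f [] f" by simp
  {
    case 1
    show ?case by (rule mmod_comp_typed(1)[OF path]) simp_all
  next
    case 2
    show ?case by (rule mmod_comp_typed(1)[OF path']) simp_all
  next
    case 3 show ?case by simp
  next
    case 4 show ?case by simp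
  next
    case 5 show ?case by simp
  next
    case 6 show ?case by simp
  next
    case (7 x p es q)
    then have es: "es = []" and p: "p \<in> fOb (tdom f) x" by (auto simp: chain_Nil_iff)
    have t: "mU (unit_mm (tdom f)) x p [] = uni (tdom f) x p" by (rule unit_mm_mU) (use p in simp_all)
    have e1: "meval (mms x [unit_mm (tdom f)]) p [[]] [uni (tdom f) x p] p"
      using t by simp
    have e2: "meval (mms x []) p [] [] p" by simp
    have t': "mU (unit_mm (tcod f)) x (tob f x p) [] = uni (tcod f) x (tob f x p)"
      by (rule unit_mm_mU) (use p in simp_all)
    show ?case
      using comp_mU[OF path _ _ e1, of "unary T (hom_cell f)" es] comp_mU[OF path' _ _ e2, of "unit_mm (tcod f)" es] p es t' by simp
  }
qed

text \<open>Both sides send a list of three elements to its class bracketed to the right: one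
  directly, the other by forming the class bracketed to the left and applying the
  constraint.\<close>

lemma assoc_comp:
  assumes M: "mx M" and N: "mx N" and P: "mx P" and MN: "tg M = sr N" and NP: "tg N = sr P"
  defines "i \<equiv> tid (sr M)"
  shows "mcm i [mcm i [tens_mm M N, mmi P] (tens_mm (tensor M N) P)] (unary T (assoc_cell M N P)) =
    mcm i [mmi M, tens_mm N P] (tens_mm M (tensor N P))"
proof (rule mm_eqI, goal_cases)
  note [simp] = M N P MN NP i_def
  let ?X = "mcm i [tens_mm M N, mmi P] (tens_mm (tensor M N) P)"
  let ?j = "tid (tg P)"
  have pX: "mmpath i [tens_mm M N, mmi P] ?j" by simp
  have X: "mm_typed ?X" by (rule mmod_comp_typed(1)[OF pX]) simp_all
  \<comment> \<open>The inner composite is evaluated first and then enters the outer one as a single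
    multicell in three arguments. Its boundary is recorded so that it need not be unfolded
    there.\<close>
  have Xbd: "mdom ?X = [M, N, P]" "mcod ?X = tensor (tensor M N) P" "mleft ?X = i" "mright ?X = ?j" by simp_all
  have path: "mmpath i [?X] ?j" unfolding mmpath.simps Xbd using X by simp
  have path': "mmpath i [mmi M, tens_mm N P] ?j" by simp
  {
    case 1
    show ?case by (rule mmod_comp_typed(1)[OF path]) simp_all
  next
    case 2
    show ?case by (rule mmod_comp_typed(1)[OF path']) simp_all
  next
    case 3 show ?case by simp
  next
    case 4 show ?case by simp
  next
    case 5 show ?case by simp
  next
    case 6 show ?case by simp
  next
    case (7 x p es q)
    then obtain m n k where m: "es = [m, n, k]" "m \<in> elt M x" "n \<in> elt N x" "k \<in> elt P x" "lft M x m = p"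
        "rgt M x m = lft N x n" "rgt N x n = lft P x k"
      by (auto simp: chain_Cons_iff chain_Nil_iff)
    have p: "p \<in> fOb (sr M) x" using m by auto
    have t1: "mU (tens_mm M N) x p [m, n] = tens M N x m n" by (rule tens_mm_mU) (use m in simp_all)
    have t2: "mU (tens_mm (tensor M N) P) x p [tens M N x m n, k] = tens (tensor M N) P x (tens M N x m n) k"
      by (rule tens_mm_mU) (use m in simp_all)
    have t3: "mU (tens_mm N P) x (rgt M x m) [n, k] = tens N P x n k" by (rule tens_mm_mU) (use m in simp_all)
    have t4: "mU (tens_mm M (tensor N P)) x p [m, tens N P x n k] = tens M (tensor N P) x m (tens N P x n k)"
      by (rule tens_mm_mU) (use m in simp_all)
    have e1: "meval (mms x [tens_mm M N, mmi P]) p [[m, n], [k]] [tens M N x m n, k] (rgt P x k)"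
      using m t1 by simp
    have u1: "mU ?X x p es = tens (tensor M N) P x (tens M N x m n) k"
      using comp_mU[OF pX _ _ e1, of "tens_mm (tensor M N) P" es] p m(1) t2 by simp
    have e2: "meval (mms x [?X]) p [es] [tens (tensor M N) P x (tens M N x m n) k] (rgt P x k)"
      unfolding list.map Xbd meval_Cons_iff meval_Nil_iff using u1[unfolded Xbd] m by simp
    have e3: "meval (mms x [mmi M, tens_mm N P]) p [[m], [n, k]] [m, tens N P x n k] (rgt P x k)"
      using m t3 by simp
    have l: "mU (mcm i [?X] (unary T (assoc_cell M N P))) x p es = tens M (tensor N P) x m (tens N P x n k)"
      using comp_mU[OF path _ _ e2, of "unary T (assoc_cell M N P)" es] p m by simp
    show ?case
      unfolding l using comp_mU[OF path' _ _ e3, of "tens_mm M (tensor N P)" es] p m(1) t4 by simp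
  }
qed

lemma lunit_comp:
  assumes M: "mx M"
  defines "i \<equiv> tid (sr M)"
  shows "mcm i [mcm i [unit_mm (sr M), mmi M] (tens_mm (hom_module (sr M)) M)]
      (unary T (lunit_cell M)) = mmi M"
proof (rule mm_eqI, goal_cases)
  note [simp] = M i_def
  let ?F = "sr M" and ?H = "hom_module (sr M)"
  let ?X = "mcm i [unit_mm ?F, mmi M] (tens_mm ?H M)"
  let ?j = "tid (tg M)"
  have pX: "mmpath i [unit_mm ?F, mmi M] ?j" by simp
  have X: "mm_typed ?X" by (rule mmod_comp_typed(1)[OF pX]) simp_all
  have Xbd: "mdom ?X = [M]" "mcod ?X = tensor ?H M" "mleft ?X = i" "mright ?X = ?j" by simp_all
  have path: "mmpath i [?X] ?j" unfolding mmpath.simps Xbd using X by simp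
  {
    case 1
    show ?case by (rule mmod_comp_typed(1)[OF path]) simp_all
  next
    case 2 show ?case by simp
  next
    case 3 show ?case by simp
  next
    case 4 show ?case by simp
  next
    case 5 show ?case by simp
  next
    case 6 show ?case by simp
  next
    case (7 x p es q)
    then obtain m where m: "es = [m]" "m \<in> elt M x" "lft M x m = p"
      by (auto simp: chain_single_iff)
    have p: "p \<in> fOb ?F x" using m by auto
    let ?u = "uni ?F x p"
    have t1: "mU (unit_mm ?F) x p [] = ?u" by (rule unit_mm_mU) (use p in simp_all)
    have t2: "mU (tens_mm ?H M) x p [?u, m] = tens ?H M x ?u m" by (rule tens_mm_mU) (use m p in simp_all)
    \<comment> \<open>The unit cell takes the empty piece at the start of the list and contributes
      the unit over the left leg of \<open>m\<close>; the constraint then lets this unit act on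
      \<open>m\<close>, which is the identity.\<close>
    have e1: "meval (mms x [unit_mm ?F, mmi M]) p [[], [m]] [?u, m] (rgt M x m)"
      using m t1 by simp
    have u1: "mU ?X x p es = tens ?H M x ?u m"
      using comp_mU[OF pX _ _ e1, of "tens_mm ?H M" es] p m(1) t2 by simp
    have e2: "meval (mms x [?X]) p [es] [tens ?H M x ?u m] (rgt M x m)"
      unfolding list.map Xbd meval_Cons_iff meval_Nil_iff using u1[unfolded Xbd] m by simp
    show ?case
      using comp_mU[OF path _ _ e2, of "unary T (lunit_cell M)" es] p m by simp
  }
qed

lemma runit_comp:
  assumes M: "mx M"
  defines "i \<equiv> tid (sr M)"
  shows "mcm i [mcm i [mmi M, unit_mm (tg M)] (tens_mm M (hom_module (tg M)))]
      (unary T (runit_cell M)) = mmi M"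
proof (rule mm_eqI, goal_cases)
  note [simp] = M i_def
  let ?F = "sr M" and ?G = "tg M" and ?H = "hom_module (tg M)"
  let ?X = "mcm i [mmi M, unit_mm ?G] (tens_mm M ?H)"
  let ?j = "tid (tg M)"
  have pX: "mmpath i [mmi M, unit_mm ?G] ?j" by simp
  have X: "mm_typed ?X" by (rule mmod_comp_typed(1)[OF pX]) simp_all
  have Xbd: "mdom ?X = [M]" "mcod ?X = tensor M ?H" "mleft ?X = i" "mright ?X = ?j" by simp_all
  have path: "mmpath i [?X] ?j" unfolding mmpath.simps Xbd using X by simp
  {
    case 1
    show ?case by (rule mmod_comp_typed(1)[OF path]) simp_all
  next
    case 2 show ?case by simp
  next
    case 3 show ?case by simp
  next
    case 4 show ?case by simp
  next
    case 5 show ?case by simp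
  next
    case 6 show ?case by simp
  next
    case (7 x p es q)
    then obtain m where m: "es = [m]" "m \<in> elt M x" "lft M x m = p"
      by (auto simp: chain_single_iff)
    have p: "p \<in> fOb ?F x" using m by auto
    have r: "rgt M x m \<in> fOb ?G x" using m by simp
    let ?u = "uni ?G x (rgt M x m)"
    have t1: "mU (unit_mm ?G) x (rgt M x m) [] = ?u" by (rule unit_mm_mU) (use r in simp_all)
    have t2: "mU (tens_mm M ?H) x p [m, ?u] = tens M ?H x m ?u" by (rule tens_mm_mU) (use m r in simp_all)
    have e1: "meval (mms x [mmi M, unit_mm ?G]) p [[m], []] [m, ?u] (rgt M x m)"
      using m t1 by simp
    have u1: "mU ?X x p es = tens M ?H x m ?u"
      using comp_mU[OF pX _ _ e1, of "tens_mm M ?H" es] p m(1) t2 by simp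
    have e2: "meval (mms x [?X]) p [es] [tens M ?H x m ?u] (rgt M x m)"
      unfolding list.map Xbd meval_Cons_iff meval_Nil_iff using u1[unfolded Xbd] m by simp
    show ?case
      using comp_mU[OF path _ _ e2, of "unary T (runit_cell M)" es] p m r by simp
  }
qed

lemma represents_model_dbl: "represents model_dbl (lax_vdbl T E) (unary T)"
  unfolding represents_def model_dbl_simps lax_vdbl_sel Let_def mem_Collect_eq
proof (intro conjI exI[of _ tens_mm] exI[of _ unit_mm] ballI impI; (unfold mem_Collect_eq)?, (elim conjE)?, goal_cases)
qed (simp_all add: unary_bij[unfolded One_nat_def] mmod_id_unary[symmetric] unary_comp tens_mm_opcartesian unit_mm_opcartesian tens_comp unit_comp
    assoc_comp lunit_comp runit_comp)

lemma double_category_of_models_model_dbl: "double_category_of_models T E model_dbl"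
  unfolding double_category_of_models_def
  using double_category_model_dbl represents_model_dbl by simp

end

lemma double_category_of_models_exists:
  assumes "set_universe small pair" "simple_theory T"
  shows "\<exists>X. double_category_of_models T (Span small pair) X"
  using span_models.double_category_of_models_model_dbl[OF span_models.intro[OF span_universe.intro[OF assms(1)] assms(2)]]
  by blast

theorem corollary10p5:
  fixes small :: "'u set \<Rightarrow> bool" and pair :: "'u \<Rightarrow> 'u \<Rightarrow> 'u"
  assumes "set_universe small pair"
  shows "(\<exists>X. double_category_of_models theory_of_categories (Span small pair) X) \<and>
         (\<exists>X. double_category_of_models theory_of_functors (Span small pair) X) \<and>
         (\<exists>X. double_category_of_models theory_of_transformations (Span small pair) X) \<and>
         (\<exists>X. double_category_of_models theory_of_adjunctions (Span small pair) X) \<and>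
         (\<exists>X. double_category_of_models theory_of_monads (Span small pair) X) \<and>
         (\<exists>X. double_category_of_models theory_of_Frobenius_monads (Span small pair) X)"
  unfolding theory_of_categories_def theory_of_functors_def
  by (intro conjI double_category_of_models_exists[OF assms] simple_theory_order simple_theory_transformations
      simple_theory_adjunctions simple_theory_monads simple_theory_Frobenius_monads)

end
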